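(* Let $\Bbbk$ be a commutative unital ring, $\delta\in\Bbbk$, and $0\le n\le k$. The ideal $X(n)$ of $\mathsf{PTL}_k(\delta)$ is isomorphic (as a $\Bbbk$-algebra) to the matrix algebra $$\mathrm{Mat}_{\binom kn}\big(\mathsf{TL}_n(\delta-1)\big)\cong \mathrm{Mat}_{\binom kn}(\Bbbk)\otimes\mathsf{TL}_n(\delta-1).$$ Furthermore, every $X(n)$-module is isomorphic to one of the form $Q_n\otimes N$, where $N$ is a $\mathsf{TL}_n(\delta-1)$-module.
   Context: Let $[k]=\{1,\dots,k\}$, $[k]'=\{1',\dots,k'\}$. A partial Brauer $k$-diagram is a set partition of $[k]\sqcup[k]'$ into blocks of size at most $2$, drawn with top row $1,\dots,k$ and bottom row $1',\dots,k'$; blocks of size $2$ are edges, singletons are isolated vertices. An edge is a cup if both endpoints are in $[k]$, a cap if both are in $[k]'$; cups and caps are horizontal, other edges vertical. A Motzkin $k$-diagram is a partial Brauer $k$-diagram that can be drawn in the rectangle without crossings. Product: place $d_1$ above $d_2$, identify $i'$ of $d_1$ with $i$ of $d_2$ (middle row), let $d_1\circ d_2$ record connectivity of the outer rows. $\mathsf M_k(\delta)$ is the unital associative $\Bbbk$-algebra free on the Motzkin $k$-diagrams with $d_1d_2=\delta^{N_1}d_1\circ d_2$, where $N_1$ is the number of closed loops in the middle row (interior paths contribute factor $1$). $p_j$ is the diagram with $j,j'$ isolated and vertical edges $\{i,i'\}$, $i\ne j$. For a Motzkin diagram $d$, $\bar d=\sum_{d'\le d}(-1)^{\beta(d)-\beta(d')}d'$,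 where $\beta$ is the number of blocks and $d'\le d$ means $d'$ is obtained from $d$ by removing zero or more edges; $\tilde d=\prod_i(1-p_i)\,d\,\prod_j(1-p_j)$, with $i$ (resp. $j$) running over the $i\in[k]$ (resp. $j$ with $j'\in[k]'$) that are endpoints of horizontal edges of $d$. A Motzkin diagram is balanced if it has as many cups as caps; $\mathcal D(k)$ is the set of balanced Motzkin $k$-diagrams and $\mathcal D_n(k)$ the subset of those with exactly $n$ edges. $\mathsf{PTL}_k(\delta)\subseteq\mathsf M_k(\delta)$ is the subalgebra spanned by $\{\tilde d\mid d\in\mathcal D(k)\}$; $\{\bar d\mid d\in\mathcal D(k)\}$ is also a $\Bbbk$-basis. $X(n)$ is the $\Bbbk$-span of $\{\bar d\mid d\in\mathcal D_n(k)\}$, a two-sided ideal of $\mathsf{PTL}_k(\delta)$ (an algebra with its own identity element; modules are unital). $\mathsf{TL}_n(\delta)$ is the Temperley--Lieb algebra: free on the planar $n$-diagrams all of whose blocks have exactly two elements, with $d_1d_2=\delta^{N_1}d_1\circ d_2$; $\mathsf{TL}_0(\delta)=\Bbbk$. $Q_n$ is the free $\Bbbk$-module on the set of all $n$-element subsets of $[k]$, and $\mathrm{End}_\Bbbk(Q_n)$ is identified with $\mathrm{Mat}_{\binom kn}(\Bbbk)$ via this basis. $\otimes=\otimes_\Bbbk$. The action on $Q_n\otimes N$ is via $X(n)\cong\mathrm{End}_\Bbbk(Q_n)\otimes\mathsf{TL}_n(\delta-1)$, with $(f\otimes t)(A\otimes v)=f(A)\otimes tv$. *)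

theory Defs
  imports "HOL-Algebra.QuotRing" "HOL-Algebra.Module" "HOL-Library.Disjoint_Sets"
begin

section \<open>Diagrams\<close>

text \<open>A vertex is a row together with a position: the vertex \<open>i\<close> of a diagram is \<open>(Upper, i)\<close>
  and the vertex \<open>i'\<close> is \<open>(Lower, i)\<close>. The row \<open>Middle\<close> only occurs when two diagrams are
  stacked.\<close>

datatype row = Upper | Middle | Lower

type_synonym vertex = "row \<times> nat"
type_synonym diagram = "vertex set set"

definition partial_brauer :: "nat \<Rightarrow> diagram set" where
  "partial_brauer k = {d. partition_on ({Upper, Lower} \<times> {1..k}) d \<and> (\<forall>b\<in>d. card b \<le> 2)}"

definition edges :: "diagram \<Rightarrow> diagram" where
  "edges d = {b \<in> d. card b = 2}"

definition cups :: "diagram \<Rightarrow> diagram" where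
  "cups d = {b \<in> edges d. b \<subseteq> {Upper} \<times> UNIV}"

definition caps :: "diagram \<Rightarrow> diagram" where
  "caps d = {b \<in> edges d. b \<subseteq> {Lower} \<times> UNIV}"

text \<open>Position on the boundary of the rectangle, read in the order \<open>1, \<dots>, k, k', \<dots>, 1'\<close>.
  All vertices lie on the boundary, so a diagram can be drawn in the rectangle without crossings
  iff no two of its edges have interleaved endpoints in this order.\<close>

definition boundary_pos :: "nat \<Rightarrow> vertex \<Rightarrow> nat" where
  "boundary_pos k v = (if fst v = Upper then snd v else 2 * k + 1 - snd v)"

definition noncrossing :: "nat \<Rightarrow> diagram \<Rightarrow> bool" where
  "noncrossing k d \<longleftrightarrow>
    (\<forall>b\<in>d. \<forall>b'\<in>d. \<not> (\<exists>x\<in>b. \<exists>y\<in>b'. \<exists>z\<in>b. \<exists>w\<in>b'.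
       boundary_pos k x < boundary_pos k y \<and> boundary_pos k y < boundary_pos k z \<and>
       boundary_pos k z < boundary_pos k w))"

definition motzkin :: "nat \<Rightarrow> diagram set" where
  "motzkin k = {d \<in> partial_brauer k. noncrossing k d}"

definition tl_diagrams :: "nat \<Rightarrow> diagram set" where
  "tl_diagrams n = {d \<in> motzkin n. \<forall>b\<in>d. card b = 2}"

definition balanced :: "nat \<Rightarrow> diagram set" where
  "balanced k = {d \<in> motzkin k. card (cups d) = card (caps d)}"

definition balanced_edges :: "nat \<Rightarrow> nat \<Rightarrow> diagram set" where
  "balanced_edges k n = {d \<in> balanced k. card (edges d) = n}"

definition id_diagram :: "nat \<Rightarrow> diagram" where
  "id_diagram k = (\<lambda>i. {(Upper, i), (Lower, i)}) ` {1..k}"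

definition p_diagram :: "nat \<Rightarrow> nat \<Rightarrow> diagram" where
  "p_diagram k j =
    (\<lambda>i. {(Upper, i), (Lower, i)}) ` ({1..k} - {j}) \<union> {{(Upper, j)}, {(Lower, j)}}"

text \<open>\<open>below d' d\<close> is \<open>d' \<le> d\<close>: the edges in \<open>E\<close> are removed from \<open>d\<close>, their endpoints
  becoming isolated vertices.\<close>

definition below :: "diagram \<Rightarrow> diagram \<Rightarrow> bool" where
  "below d' d \<longleftrightarrow> (\<exists>E \<subseteq> edges d. d' = (d - E) \<union> (\<lambda>v. {v}) ` \<Union>E)"

subsection \<open>Stacking\<close>

definition relabel_rows :: "(row \<Rightarrow> row) \<Rightarrow> diagram \<Rightarrow> diagram" where
  "relabel_rows g d = (\<lambda>b. map_prod g id ` b) ` d"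

definition stacked :: "diagram \<Rightarrow> diagram \<Rightarrow> diagram" where
  "stacked d\<^sub>1 d\<^sub>2 =
    relabel_rows (id(Lower := Middle)) d\<^sub>1 \<union> relabel_rows (id(Upper := Middle)) d\<^sub>2"

text \<open>Connected components of the stacked graph, as sets of vertices.\<close>

definition components :: "diagram \<Rightarrow> diagram \<Rightarrow> vertex set set" where
  "components d\<^sub>1 d\<^sub>2 = \<Union>(stacked d\<^sub>1 d\<^sub>2) // (\<Union>b\<in>stacked d\<^sub>1 d\<^sub>2. b \<times> b)\<^sup>+"

definition diag_comp :: "diagram \<Rightarrow> diagram \<Rightarrow> diagram" where
  "diag_comp d\<^sub>1 d\<^sub>2 = (\<lambda>C. C - {Middle} \<times> UNIV) ` components d\<^sub>1 d\<^sub>2 - {{}}"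

text \<open>A component inside the middle row is either a closed loop or an interior path (possibly a
  single vertex); the endpoints of an interior path are isolated vertices of \<open>d\<^sub>1\<close> or \<open>d\<^sub>2\<close>,
  whereas no vertex of a closed loop is isolated in either diagram.\<close>

definition num_loops :: "diagram \<Rightarrow> diagram \<Rightarrow> nat" where
  "num_loops d\<^sub>1 d\<^sub>2 = card {C \<in> components d\<^sub>1 d\<^sub>2.
     C \<subseteq> {Middle} \<times> UNIV \<and> (\<forall>b\<in>stacked d\<^sub>1 d\<^sub>2. b \<subseteq> C \<longrightarrow> card b = 2)}"

section \<open>Modules and algebras over a commutative ring\<close>

text \<open>Algebras over \<open>K\<close> are kept in \<^typ>\<open>('a, 'b) module\<close> records; the locale \<^locale>\<open>algebra\<close> of
  the library is restricted to commutative algebras. In records that are used only as modules the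
  fields \<open>mult\<close> and \<open>one\<close> are left undefined.\<close>

definition alg_iso ::
    "('a, 'c) ring_scheme \<Rightarrow> ('a, 'x) module \<Rightarrow> ('a, 'y) module \<Rightarrow> ('x \<Rightarrow> 'y) set" where
  "alg_iso K A B = {h \<in> ring_iso A B.
     \<forall>c\<in>carrier K. \<forall>a\<in>carrier A. h (c \<odot>\<^bsub>A\<^esub> a) = c \<odot>\<^bsub>B\<^esub> h a}"

definition alg_isomorphic ::
    "('a, 'c) ring_scheme \<Rightarrow> ('a, 'x) module \<Rightarrow> ('a, 'y) module \<Rightarrow> bool" where
  "alg_isomorphic K A B \<longleftrightarrow> alg_iso K A B \<noteq> {}"

text \<open>Unital left modules over a possibly noncommutative ring.\<close>

locale left_module = abelian_group M
  for R :: "('r, 'c) ring_scheme" and M :: "('r, 'm) module" +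
  assumes smult_closed:
      "\<lbrakk>a \<in> carrier R; x \<in> carrier M\<rbrakk> \<Longrightarrow> a \<odot>\<^bsub>M\<^esub> x \<in> carrier M"
    and smult_l_distr:
      "\<lbrakk>a \<in> carrier R; b \<in> carrier R; x \<in> carrier M\<rbrakk> \<Longrightarrow>
       (a \<oplus>\<^bsub>R\<^esub> b) \<odot>\<^bsub>M\<^esub> x = a \<odot>\<^bsub>M\<^esub> x \<oplus>\<^bsub>M\<^esub> b \<odot>\<^bsub>M\<^esub> x"
    and smult_r_distr:
      "\<lbrakk>a \<in> carrier R; x \<in> carrier M; y \<in> carrier M\<rbrakk> \<Longrightarrow>
       a \<odot>\<^bsub>M\<^esub> (x \<oplus>\<^bsub>M\<^esub> y) = a \<odot>\<^bsub>M\<^esub> x \<oplus>\<^bsub>M\<^esub> a \<odot>\<^bsub>M\<^esub> y"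
    and smult_assoc:
      "\<lbrakk>a \<in> carrier R; b \<in> carrier R; x \<in> carrier M\<rbrakk> \<Longrightarrow>
       (a \<otimes>\<^bsub>R\<^esub> b) \<odot>\<^bsub>M\<^esub> x = a \<odot>\<^bsub>M\<^esub> (b \<odot>\<^bsub>M\<^esub> x)"
    and smult_one:
      "x \<in> carrier M \<Longrightarrow> \<one>\<^bsub>R\<^esub> \<odot>\<^bsub>M\<^esub> x = x"

definition left_module_iso ::
    "('r, 'c) ring_scheme \<Rightarrow> ('r, 'x) module \<Rightarrow> ('r, 'y) module \<Rightarrow> ('x \<Rightarrow> 'y) set" where
  "left_module_iso R V W = {h. bij_betw h (carrier V) (carrier W) \<and>
     (\<forall>x\<in>carrier V. \<forall>y\<in>carrier V. h (x \<oplus>\<^bsub>V\<^esub> y) = h x \<oplus>\<^bsub>W\<^esub> h y) \<and>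
     (\<forall>r\<in>carrier R. \<forall>x\<in>carrier V. h (r \<odot>\<^bsub>V\<^esub> x) = r \<odot>\<^bsub>W\<^esub> h x)}"

definition left_module_isomorphic ::
    "('r, 'c) ring_scheme \<Rightarrow> ('r, 'x) module \<Rightarrow> ('r, 'y) module \<Rightarrow> bool" where
  "left_module_isomorphic R V W \<longleftrightarrow> left_module_iso R V W \<noteq> {}"

text \<open>A unital module over the \<open>K\<close>-algebra \<open>A\<close>, viewed as a \<open>K\<close>-module.\<close>

definition restrict_scalars ::
    "('a, 'x) module \<Rightarrow> ('x, 'm) module \<Rightarrow> ('a, 'm) module" where
  "restrict_scalars A N = \<lparr>carrier = carrier N, monoid.mult = undefined, one = undefined,
     zero = \<zero>\<^bsub>N\<^esub>, add = add N, smult = (\<lambda>c v. (c \<odot>\<^bsub>A\<^esub> \<one>\<^bsub>A\<^esub>) \<odot>\<^bsub>N\<^esub> v)\<rparr>"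

definition span_in ::
    "('a, 'c) ring_scheme \<Rightarrow> ('a, 'x) module \<Rightarrow> 'x set \<Rightarrow> 'x set" where
  "span_in K M S = \<Inter>{H. submodule H K M \<and> S \<subseteq> H}"

definition free_module :: "('a, 'c) ring_scheme \<Rightarrow> 's set \<Rightarrow> ('a, 's \<Rightarrow> 'a) module" where
  "free_module K S = \<lparr>
     carrier = {f \<in> S \<rightarrow>\<^sub>E carrier K. finite {s \<in> S. f s \<noteq> \<zero>\<^bsub>K\<^esub>}},
     monoid.mult = undefined, one = undefined,
     zero = (\<lambda>s\<in>S. \<zero>\<^bsub>K\<^esub>),
     add = (\<lambda>f g. \<lambda>s\<in>S. f s \<oplus>\<^bsub>K\<^esub> g s),
     smult = (\<lambda>c f. \<lambda>s\<in>S. c \<otimes>\<^bsub>K\<^esub> f s)\<rparr>"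

definition basis_elt :: "('a, 'c) ring_scheme \<Rightarrow> 's set \<Rightarrow> 's \<Rightarrow> ('s \<Rightarrow> 'a)" where
  "basis_elt K S s = (\<lambda>t\<in>S. if t = s then \<one>\<^bsub>K\<^esub> else \<zero>\<^bsub>K\<^esub>)"

text \<open>The commutative ring \<open>K\<close> as an algebra over itself.\<close>

definition self_alg :: "('a, 'c) ring_scheme \<Rightarrow> ('a, 'a) module" where
  "self_alg K = \<lparr>carrier = carrier K, monoid.mult = monoid.mult K, one = \<one>\<^bsub>K\<^esub>, zero = \<zero>\<^bsub>K\<^esub>, add = add K,
     smult = monoid.mult K\<rparr>"

definition mat_alg :: "nat \<Rightarrow> ('a, 'x) module \<Rightarrow> ('a, nat \<times> nat \<Rightarrow> 'x) module" where
  "mat_alg m A = \<lparr>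
     carrier = {..<m} \<times> {..<m} \<rightarrow>\<^sub>E carrier A,
     monoid.mult = (\<lambda>f g. \<lambda>(i, j)\<in>{..<m} \<times> {..<m}. \<Oplus>\<^bsub>A\<^esub>l\<in>{..<m}. f (i, l) \<otimes>\<^bsub>A\<^esub> g (l, j)),
     one = (\<lambda>(i, j)\<in>{..<m} \<times> {..<m}. if i = j then \<one>\<^bsub>A\<^esub> else \<zero>\<^bsub>A\<^esub>),
     zero = (\<lambda>_\<in>{..<m} \<times> {..<m}. \<zero>\<^bsub>A\<^esub>),
     add = (\<lambda>f g. \<lambda>p\<in>{..<m} \<times> {..<m}. f p \<oplus>\<^bsub>A\<^esub> g p),
     smult = (\<lambda>c f. \<lambda>p\<in>{..<m} \<times> {..<m}. c \<odot>\<^bsub>A\<^esub> f p)\<rparr>"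

definition end_alg :: "('a, 'c) ring_scheme \<Rightarrow> ('a, 'x) module \<Rightarrow> ('a, 'x \<Rightarrow> 'x) module" where
  "end_alg K M = \<lparr>
     carrier = {f \<in> carrier M \<rightarrow>\<^sub>E carrier M.
       (\<forall>x\<in>carrier M. \<forall>y\<in>carrier M. f (x \<oplus>\<^bsub>M\<^esub> y) = f x \<oplus>\<^bsub>M\<^esub> f y) \<and>
       (\<forall>c\<in>carrier K. \<forall>x\<in>carrier M. f (c \<odot>\<^bsub>M\<^esub> x) = c \<odot>\<^bsub>M\<^esub> f x)},
     monoid.mult = (\<lambda>f g. compose (carrier M) f g),
     one = (\<lambda>x\<in>carrier M. x),
     zero = (\<lambda>_\<in>carrier M. \<zero>\<^bsub>M\<^esub>),
     add = (\<lambda>f g. \<lambda>x\<in>carrier M. f x \<oplus>\<^bsub>M\<^esub> g x),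
     smult = (\<lambda>c f. \<lambda>x\<in>carrier M. c \<odot>\<^bsub>M\<^esub> f x)\<rparr>"

subsection \<open>Tensor products over \<open>K\<close>\<close>

text \<open>The free module on \<open>carrier A \<times> carrier B\<close> modulo the submodule generated by the
  bilinearity relations.\<close>

definition tensor_free ::
    "('a, 'c) ring_scheme \<Rightarrow> ('a, 'x) module \<Rightarrow> ('a, 'y) module \<Rightarrow> ('a, 'x \<times> 'y \<Rightarrow> 'a) module" where
  "tensor_free K A B = free_module K (carrier A \<times> carrier B)"

definition tensor_rel ::
    "('a, 'c) ring_scheme \<Rightarrow> ('a, 'x) module \<Rightarrow> ('a, 'y) module \<Rightarrow> ('x \<times> 'y \<Rightarrow> 'a) set" where
  "tensor_rel K A B =
    (let F = tensor_free K A B;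
         e = (\<lambda>a b. basis_elt K (carrier A \<times> carrier B) (a, b))
     in span_in K F
       ({e (a \<oplus>\<^bsub>A\<^esub> a') b \<ominus>\<^bsub>F\<^esub> (e a b \<oplus>\<^bsub>F\<^esub> e a' b) | a a' b.
           a \<in> carrier A \<and> a' \<in> carrier A \<and> b \<in> carrier B} \<union>
        {e a (b \<oplus>\<^bsub>B\<^esub> b') \<ominus>\<^bsub>F\<^esub> (e a b \<oplus>\<^bsub>F\<^esub> e a b') | a b b'.
           a \<in> carrier A \<and> b \<in> carrier B \<and> b' \<in> carrier B} \<union>
        {e (c \<odot>\<^bsub>A\<^esub> a) b \<ominus>\<^bsub>F\<^esub> (c \<odot>\<^bsub>F\<^esub> e a b) | c a b.
           c \<in> carrier K \<and> a \<in> carrier A \<and> b \<in> carrier B} \<union>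
        {e a (c \<odot>\<^bsub>B\<^esub> b) \<ominus>\<^bsub>F\<^esub> (c \<odot>\<^bsub>F\<^esub> e a b) | c a b.
           c \<in> carrier K \<and> a \<in> carrier A \<and> b \<in> carrier B}))"

definition tensor_module ::
    "('a, 'c) ring_scheme \<Rightarrow> ('a, 'x) module \<Rightarrow> ('a, 'y) module
      \<Rightarrow> ('a, ('x \<times> 'y \<Rightarrow> 'a) set) module" where
  "tensor_module K A B =
    (let F = tensor_free K A B; I = tensor_rel K A B
     in \<lparr>carrier = a_rcosets\<^bsub>F\<^esub> I, monoid.mult = undefined, one = undefined,
         zero = I,
         add = set_add F,
         smult = (\<lambda>c z. \<Union>f\<in>z. I +>\<^bsub>F\<^esub> (c \<odot>\<^bsub>F\<^esub> f))\<rparr>)"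

definition pure_tensor ::
    "('a, 'c) ring_scheme \<Rightarrow> ('a, 'x) module \<Rightarrow> ('a, 'y) module
      \<Rightarrow> 'x \<Rightarrow> 'y \<Rightarrow> ('x \<times> 'y \<Rightarrow> 'a) set" where
  "pure_tensor K A B a b =
    tensor_rel K A B +>\<^bsub>tensor_free K A B\<^esub> basis_elt K (carrier A \<times> carrier B) (a, b)"

text \<open>The linear map on the tensor product of \<open>A\<close> and \<open>B\<close> induced by a bilinear map \<open>\<beta>\<close> into
  \<open>C\<close>. It is evaluated on representatives; for bilinear \<open>\<beta>\<close> all representatives of a coset give
  the same value, which \<^const>\<open>the_elem\<close> picks out.\<close>

definition tensor_lift ::
    "('a, 'c) ring_scheme \<Rightarrow> ('a, 'x) module \<Rightarrow> ('a, 'y) module \<Rightarrow> ('a, 'z) module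
      \<Rightarrow> ('x \<Rightarrow> 'y \<Rightarrow> 'z) \<Rightarrow> ('x \<times> 'y \<Rightarrow> 'a) set \<Rightarrow> 'z" where
  "tensor_lift K A B C \<beta> z =
    the_elem ((\<lambda>f. \<Oplus>\<^bsub>C\<^esub>p\<in>{p \<in> carrier A \<times> carrier B. f p \<noteq> \<zero>\<^bsub>K\<^esub>}.
                 f p \<odot>\<^bsub>C\<^esub> \<beta> (fst p) (snd p)) ` z)"

text \<open>Multiplication: \<open>(a \<otimes> b)(a' \<otimes> b') = aa' \<otimes> bb'\<close>.\<close>

definition tensor_alg ::
    "('a, 'c) ring_scheme \<Rightarrow> ('a, 'x) module \<Rightarrow> ('a, 'y) module
      \<Rightarrow> ('a, ('x \<times> 'y \<Rightarrow> 'a) set) module" where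
  "tensor_alg K A B =
    (let T = tensor_module K A B
     in T\<lparr>monoid.mult := (\<lambda>z w.
            tensor_lift K A B T (\<lambda>a b.
              tensor_lift K A B T (\<lambda>a' b'. pure_tensor K A B (a \<otimes>\<^bsub>A\<^esub> a') (b \<otimes>\<^bsub>B\<^esub> b')) w) z),
          one := pure_tensor K A B \<one>\<^bsub>A\<^esub> \<one>\<^bsub>B\<^esub>\<rparr>)"

text \<open>For a \<open>K\<close>-module \<open>Q\<close>, a \<open>K\<close>-algebra \<open>A\<close> and an \<open>A\<close>-module \<open>N\<close>, the tensor product
  of \<open>Q\<close> and \<open>N\<close> with the action of \<open>End(Q) \<otimes> A\<close> given by
  \<open>(f \<otimes> t)(q \<otimes> v) = f(q) \<otimes> tv\<close>, pulled back along a map \<open>\<phi>\<close> from another ring to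
  \<open>End(Q) \<otimes> A\<close>.\<close>

definition tensor_action ::
    "('a, 'c) ring_scheme \<Rightarrow> ('a, 'q) module \<Rightarrow> ('a, 'x) module \<Rightarrow> ('x, 'm) module
      \<Rightarrow> (('q \<Rightarrow> 'q) \<times> 'x \<Rightarrow> 'a) set \<Rightarrow> ('q \<times> 'm \<Rightarrow> 'a) set \<Rightarrow> ('q \<times> 'm \<Rightarrow> 'a) set" where
  "tensor_action K Q A N z w =
    (let N' = restrict_scalars A N; T = tensor_module K Q N'
     in tensor_lift K (end_alg K Q) A T (\<lambda>f t.
          tensor_lift K Q N' T (\<lambda>q v. pure_tensor K Q N' (f q) (t \<odot>\<^bsub>N\<^esub> v)) w) z)"

definition tensor_left_module ::
    "('a, 'c) ring_scheme \<Rightarrow> ('a, 'q) module \<Rightarrow> ('a, 'x) module \<Rightarrow> ('x, 'm) module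
      \<Rightarrow> ('r \<Rightarrow> (('q \<Rightarrow> 'q) \<times> 'x \<Rightarrow> 'a) set) \<Rightarrow> ('r, ('q \<times> 'm \<Rightarrow> 'a) set) module" where
  "tensor_left_module K Q A N \<phi> =
    (let T = tensor_module K Q (restrict_scalars A N)
     in \<lparr>carrier = carrier T, monoid.mult = undefined, one = undefined, zero = \<zero>\<^bsub>T\<^esub>, add = add T,
         smult = (\<lambda>x w. tensor_action K Q A N (\<phi> x) w)\<rparr>)"

section \<open>Diagram algebras\<close>

definition diagram_alg ::
    "('a, 'c) ring_scheme \<Rightarrow> 'a \<Rightarrow> diagram set \<Rightarrow> diagram \<Rightarrow> ('a, diagram \<Rightarrow> 'a) module" where
  "diagram_alg K \<delta> D u = (free_module K D)
     \<lparr>monoid.mult := (\<lambda>f g. \<lambda>d\<in>D. \<Oplus>\<^bsub>K\<^esub>p\<in>{p \<in> D \<times> D. diag_comp (fst p) (snd p) = d}.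
               (\<delta> [^]\<^bsub>K\<^esub> num_loops (fst p) (snd p)) \<otimes>\<^bsub>K\<^esub> (f (fst p) \<otimes>\<^bsub>K\<^esub> g (snd p))),
      one := basis_elt K D u\<rparr>"

definition motzkin_alg ::
    "('a, 'c) ring_scheme \<Rightarrow> 'a \<Rightarrow> nat \<Rightarrow> ('a, diagram \<Rightarrow> 'a) module" where
  "motzkin_alg K \<delta> k = diagram_alg K \<delta> (motzkin k) (id_diagram k)"

definition TL_alg ::
    "('a, 'c) ring_scheme \<Rightarrow> 'a \<Rightarrow> nat \<Rightarrow> ('a, diagram \<Rightarrow> 'a) module" where
  "TL_alg K \<delta> n = diagram_alg K \<delta> (tl_diagrams n) (id_diagram n)"

text \<open>The product of the commuting elements \<open>1 - p\<^sub>i\<close> for \<open>i \<in> I\<close>, taken in increasing order.\<close>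

definition prod_one_minus_p ::
    "('a, 'c) ring_scheme \<Rightarrow> 'a \<Rightarrow> nat \<Rightarrow> nat set \<Rightarrow> (diagram \<Rightarrow> 'a)" where
  "prod_one_minus_p K \<delta> k I =
    (let M = motzkin_alg K \<delta> k
     in foldr (\<lambda>i x. (\<one>\<^bsub>M\<^esub> \<ominus>\<^bsub>M\<^esub> basis_elt K (motzkin k) (p_diagram k i)) \<otimes>\<^bsub>M\<^esub> x)
          (sorted_list_of_set I) \<one>\<^bsub>M\<^esub>)"

definition tilde_elt ::
    "('a, 'c) ring_scheme \<Rightarrow> 'a \<Rightarrow> nat \<Rightarrow> diagram \<Rightarrow> (diagram \<Rightarrow> 'a)" where
  "tilde_elt K \<delta> k d =
    (let M = motzkin_alg K \<delta> k
     in prod_one_minus_p K \<delta> k {i. (Upper, i) \<in> \<Union>(cups d)}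
        \<otimes>\<^bsub>M\<^esub> basis_elt K (motzkin k) d
        \<otimes>\<^bsub>M\<^esub> prod_one_minus_p K \<delta> k {j. (Lower, j) \<in> \<Union>(caps d)})"

text \<open>Coefficientwise definition of \<open>\<Sum>d'\<le>d. (-1)\<^bsup>\<beta>(d) - \<beta>(d')\<^esup> d'\<close>. Since \<open>\<beta>(d') \<ge> \<beta>(d)\<close>
  for \<open>d' \<le> d\<close>, the exponent is negated to make it a natural number.\<close>

definition bar_elt ::
    "('a, 'c) ring_scheme \<Rightarrow> nat \<Rightarrow> diagram \<Rightarrow> (diagram \<Rightarrow> 'a)" where
  "bar_elt K k d = (\<lambda>d'\<in>motzkin k.
     if below d' d then (\<ominus>\<^bsub>K\<^esub> \<one>\<^bsub>K\<^esub>) [^]\<^bsub>K\<^esub> (card d' - card d) else \<zero>\<^bsub>K\<^esub>)"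

definition PTL_alg ::
    "('a, 'c) ring_scheme \<Rightarrow> 'a \<Rightarrow> nat \<Rightarrow> ('a, diagram \<Rightarrow> 'a) module" where
  "PTL_alg K \<delta> k = (motzkin_alg K \<delta> k)
     \<lparr>carrier := span_in K (motzkin_alg K \<delta> k) (tilde_elt K \<delta> k ` balanced k)\<rparr>"

text \<open>The ideal \<open>X(n)\<close> is an algebra with the operations of \<open>PTL\<^sub>k(\<delta>)\<close> but with its own
  identity element.\<close>

definition X_carrier ::
    "('a, 'c) ring_scheme \<Rightarrow> 'a \<Rightarrow> nat \<Rightarrow> nat \<Rightarrow> (diagram \<Rightarrow> 'a) set" where
  "X_carrier K \<delta> k n = span_in K (motzkin_alg K \<delta> k) (bar_elt K k ` balanced_edges k n)"

definition X_alg ::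
    "('a, 'c) ring_scheme \<Rightarrow> 'a \<Rightarrow> nat \<Rightarrow> nat \<Rightarrow> ('a, diagram \<Rightarrow> 'a) module" where
  "X_alg K \<delta> k n = (PTL_alg K \<delta> k)
     \<lparr>carrier := X_carrier K \<delta> k n,
      one := (THE u. u \<in> X_carrier K \<delta> k n \<and>
        (\<forall>x\<in>X_carrier K \<delta> k n. u \<otimes>\<^bsub>PTL_alg K \<delta> k\<^esub> x = x \<and> x \<otimes>\<^bsub>PTL_alg K \<delta> k\<^esub> u = x))\<rparr>"

definition Q_module :: "('a, 'c) ring_scheme \<Rightarrow> nat \<Rightarrow> nat \<Rightarrow> ('a, nat set \<Rightarrow> 'a) module" where
  "Q_module K k n = free_module K {A. A \<subseteq> {1..k} \<and> card A = n}"

end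

theory Submission
  imports Defs "HOL-Library.Infinite_Set"
begin

text \<open>Replacing every edge \<open>e\<close> of a diagram \<open>d\<close> by the difference of \<open>e\<close> and two isolated vertices
  gives \<open>bar d\<close>. In a product of two barred diagrams a middle vertex that is matched in one factor
  and isolated in the other makes all terms cancel in pairs. If there is no such vertex, every
  component of the stacked graph that contains an edge is a path between two outer vertices or a
  closed loop. Summing over the sets of removed edges inside one component gives an edge minus two
  isolated vertices for a path and \<open>\<delta> - 1\<close> for a loop, so the product is the bar of the composite
  times a power of \<open>\<delta> - 1\<close>, one factor for each loop.

  A balanced diagram with \<open>n\<close> edges is a pair of \<open>n\<close>-subsets, the matched upper and lower vertices,
  together with a planar matching between them. Hence barred diagrams multiply like matrix units
  with coefficients in the Temperley-Lieb algebra of parameter \<open>\<delta> - 1\<close>. That planarity survives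
  composition follows by counting crossings modulo 2.

  The statement on modules is Morita theory for a matrix algebra: the module \<open>N\<close> is the image of
  the idempotent that corresponds to \<open>E\<^sub>0\<^sub>0 \<otimes> 1\<close>.\<close>

section \<open>Abelian groups and bilinear maps\<close>

text \<open>Why a whole component collapses: the nonempty subsets of a finite nonempty set of edges
  have signs adding up to -1, so all the ways of breaking a component count together as one broken
  component with sign -1. Only the set of broken components matters. The obstacle is to know what is
  left of a broken component. No path is traced for this; a count of degrees shows that a component
  of a stack has at most two outer vertices, and at most one if it contains a vertex isolated in a
  layer. A broken component therefore sheds its outer vertices as singletons.

  Balancedness enters by counting endpoints: it means that each row has as many matched vertices as
  there are edges, so rows and columns of the matrices are indexed by subsets of the same size.

  Tensor products are sets of cosets in a free module, and maps out of them are values of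
  \<open>the_elem\<close>. Computations with them are reduced to pure tensors by additivity. The
  module statement concerns an arbitrary isomorphism \<open>\<phi>\<close>, so its proof uses the
  ideal only through the inverse of \<open>\<phi>\<close>.\<close>

lemma (in abelian_group_hom) hom_finsum:
  "f \<in> A \<rightarrow> carrier G \<Longrightarrow> h (\<Oplus>\<^bsub>G\<^esub>i\<in>A. f i) = (\<Oplus>\<^bsub>H\<^esub>i\<in>A. h (f i))"
proof (induction A rule: infinite_finite_induct)
  case (insert x A)
  have 1: "f \<in> A \<rightarrow> carrier G" "f x \<in> carrier G" using insert.prems by auto
  have 2: "(\<lambda>i. h (f i)) \<in> A \<rightarrow> carrier H" "h (f x) \<in> carrier H" using 1 by (auto simp: Pi_iff)
  show ?case
    using insert 1 2 by (simp add: G.finsum_insert H.finsum_insert)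
qed auto

lemma add_homI:
  assumes "abelian_group G" "abelian_group H"
    and "\<And>x. x \<in> carrier G \<Longrightarrow> h x \<in> carrier H"
    and "\<And>x y. \<lbrakk>x \<in> carrier G; y \<in> carrier G\<rbrakk> \<Longrightarrow> h (x \<oplus>\<^bsub>G\<^esub> y) = h x \<oplus>\<^bsub>H\<^esub> h y"
  shows "abelian_group_hom G H h"
proof -
  interpret G: abelian_group G by fact
  interpret H: abelian_group H by fact
  show ?thesis
    by (rule abelian_group_homI)
      (auto intro!: group_hom.intro G.a_group H.a_group
        simp: group_hom_axioms_def hom_def assms(3,4) G.abelian_group_axioms H.abelian_group_axioms)
qed

lemma (in abelian_monoid) finsum_times:
  assumes "finite A" "finite B" "\<And>i j. i \<in> A \<Longrightarrow> j \<in> B \<Longrightarrow> f (i, j) \<in> carrier G"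
  shows "(\<Oplus>p\<in>A \<times> B. f p) = (\<Oplus>i\<in>A. \<Oplus>j\<in>B. f (i, j))"
  using assms(1,3)
proof (induction A rule: finite_induct)
  case empty
  then show ?case by simp
next
  case (insert x A)
  have e: "insert x A \<times> B = Pair x ` B \<union> A \<times> B" by auto
  have "(\<Oplus>p\<in>insert x A \<times> B. f p) = (\<Oplus>p\<in>Pair x ` B. f p) \<oplus> (\<Oplus>p\<in>A \<times> B. f p)"
    unfolding e using insert assms(2) by (intro finsum_Un_disjoint) auto
  also have "(\<Oplus>p\<in>Pair x ` B. f p) = (\<Oplus>j\<in>B. f (x, j))"
    using insert.prems by (intro finsum_reindex) (auto simp: inj_on_def)
  also have "(\<Oplus>p\<in>A \<times> B. f p) = (\<Oplus>i\<in>A. \<Oplus>j\<in>B. f (i, j))"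
    using insert by auto
  also have "(\<Oplus>j\<in>B. f (x, j)) \<oplus> (\<Oplus>i\<in>A. \<Oplus>j\<in>B. f (i, j)) = (\<Oplus>i\<in>insert x A. \<Oplus>j\<in>B. f (i, j))"
    using insert by (intro finsum_insert[symmetric]) (auto intro!: finsum_closed)
  finally show ?case .
qed

lemma (in abelian_monoid) finsum_single:
  assumes "finite A" "i \<in> A" "f i \<in> carrier G" "\<And>j. \<lbrakk>j \<in> A; j \<noteq> i\<rbrakk> \<Longrightarrow> f j = \<zero>"
  shows "(\<Oplus>j\<in>A. f j) = f i"
proof -
  have "(\<Oplus>j\<in>A. f j) = (\<Oplus>j\<in>A. if i = j then f i else \<zero>)"
    using assms by (intro finsum_cong') auto
  also have "\<dots> = f i" using finsum_singleton[of i A "\<lambda>_. f i"] assms by auto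
  finally show ?thesis .
qed

text \<open>Sums of generators, without scalars or negatives. The generating sets in use are closed
  under scalar multiplication, so nothing is lost, and two additive maps can be compared on
  generators without any linearity.\<close>

inductive_set add_span :: "('x, 'z) ring_scheme \<Rightarrow> 'x set \<Rightarrow> 'x set" for G S where
  add_span_zero: "\<zero>\<^bsub>G\<^esub> \<in> add_span G S"
| add_span_gen: "s \<in> S \<Longrightarrow> s \<in> add_span G S"
| add_span_add: "\<lbrakk>x \<in> add_span G S; y \<in> add_span G S\<rbrakk> \<Longrightarrow> x \<oplus>\<^bsub>G\<^esub> y \<in> add_span G S"

lemma (in abelian_group) add_span_carrier:
  assumes "S \<subseteq> carrier G"
  shows "x \<in> add_span G S \<Longrightarrow> x \<in> carrier G"
  by (induction rule: add_span.induct) (use assms in auto)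

lemma (in abelian_group) add_span_finsum:
  "\<lbrakk>finite A; f \<in> A \<rightarrow> carrier G; \<And>i. i \<in> A \<Longrightarrow> f i \<in> add_span G S\<rbrakk> \<Longrightarrow> (\<Oplus>i\<in>A. f i) \<in> add_span G S"
proof (induction A rule: finite_induct)
  case empty
  then show ?case by (simp add: add_span_zero)
next
  case (insert x A)
  then have "(\<Oplus>i\<in>insert x A. f i) = f x \<oplus> (\<Oplus>i\<in>A. f i)" by (intro finsum_insert) auto
  then show ?case using insert by (auto intro!: add_span_add)
qed

lemma add_homs_eq:
  assumes "abelian_group_hom G H h" "abelian_group_hom G H h'" "S \<subseteq> carrier G"
    and "\<And>s. s \<in> S \<Longrightarrow> h s = h' s" and "x \<in> add_span G S"
  shows "h x = h' x"
proof -
  interpret h: abelian_group_hom G H h by fact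
  interpret h': abelian_group_hom G H h' by fact
  show ?thesis using assms(5)
  proof (induction rule: add_span.induct)
    case (add_span_add x y)
    then show ?case using h.G.add_span_carrier[OF assms(3)] by simp
  qed (simp_all add: assms(4))
qed

text \<open>Distributivity is all that comparing two products on additive generators takes. Matrix
  algebras, tensor algebras and the ideal \<open>X(n)\<close> all enter through this locale.\<close>

locale biadditive_ring = abelian_group G for G (structure) +
  assumes mult_closed: "\<lbrakk>x \<in> carrier G; y \<in> carrier G\<rbrakk> \<Longrightarrow> x \<otimes> y \<in> carrier G"
    and mult_l_distr: "\<lbrakk>x \<in> carrier G; y \<in> carrier G; z \<in> carrier G\<rbrakk> \<Longrightarrow>
      (x \<oplus> y) \<otimes> z = x \<otimes> z \<oplus> y \<otimes> z"
    and mult_r_distr: "\<lbrakk>x \<in> carrier G; y \<in> carrier G; z \<in> carrier G\<rbrakk> \<Longrightarrow>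
      z \<otimes> (x \<oplus> y) = z \<otimes> x \<oplus> z \<otimes> y"
begin

lemma hom_mult_left: "y \<in> carrier G \<Longrightarrow> abelian_group_hom G G (\<lambda>x. x \<otimes> y)"
  by (rule add_homI) (auto simp: mult_closed mult_l_distr abelian_group_axioms)

lemma hom_mult_right: "x \<in> carrier G \<Longrightarrow> abelian_group_hom G G (\<lambda>y. x \<otimes> y)"
  by (rule add_homI) (auto simp: mult_closed mult_r_distr abelian_group_axioms)

lemma mult_zero_left: "y \<in> carrier G \<Longrightarrow> \<zero> \<otimes> y = \<zero>"
  using abelian_group_hom.hom_zero[OF hom_mult_left] by simp

lemma mult_zero_right: "x \<in> carrier G \<Longrightarrow> x \<otimes> \<zero> = \<zero>"
  using abelian_group_hom.hom_zero[OF hom_mult_right] by simp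

end

text \<open>Additivity is used twice: with a generator on the left, both sides are additive in the
  right factor; with the right factor then arbitrary, both sides are additive in the left
  one.\<close>

lemma mult_hom_on_gens:
  assumes "biadditive_ring G" "biadditive_ring H" "abelian_group_hom G H h" "S \<subseteq> carrier G"
    and gen: "\<And>s t. \<lbrakk>s \<in> S; t \<in> S\<rbrakk> \<Longrightarrow> h (s \<otimes>\<^bsub>G\<^esub> t) = h s \<otimes>\<^bsub>H\<^esub> h t"
    and "x \<in> add_span G S" "y \<in> add_span G S"
  shows "h (x \<otimes>\<^bsub>G\<^esub> y) = h x \<otimes>\<^bsub>H\<^esub> h y"
proof -
  interpret G: biadditive_ring G by fact
  interpret H: biadditive_ring H by fact
  interpret h: abelian_group_hom G H h by fact
  have 1: "h (s \<otimes>\<^bsub>G\<^esub> y) = h s \<otimes>\<^bsub>H\<^esub> h y" if "s \<in> S" "y \<in> add_span G S" for s y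
    by (rule add_homs_eq[where G=G and H=H and S=S and h="\<lambda>y. h (s \<otimes>\<^bsub>G\<^esub> y)" and h'="\<lambda>y. h s \<otimes>\<^bsub>H\<^esub> h y"])
      (use that assms(4) in \<open>auto intro!: add_homI G.abelian_group_axioms H.abelian_group_axioms
        simp: G.mult_closed H.mult_closed G.mult_r_distr H.mult_r_distr gen subset_iff\<close>)
  have y: "y \<in> carrier G" using G.add_span_carrier assms(4,7) by auto
  show ?thesis
    by (rule add_homs_eq[where G=G and H=H and S=S and h="\<lambda>x. h (x \<otimes>\<^bsub>G\<^esub> y)" and h'="\<lambda>x. h x \<otimes>\<^bsub>H\<^esub> h y"])
      (use y assms in \<open>auto intro!: add_homI G.abelian_group_axioms H.abelian_group_axioms
        simp: G.mult_closed H.mult_closed G.mult_l_distr H.mult_l_distr 1\<close>)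
qed

locale bilinear_alg = module K A for K :: "('a, 'c) ring_scheme" and A :: "('a, 'x) module" +
  assumes alg_mult_closed: "\<lbrakk>x \<in> carrier A; y \<in> carrier A\<rbrakk> \<Longrightarrow> x \<otimes>\<^bsub>A\<^esub> y \<in> carrier A"
    and alg_l_distr: "\<lbrakk>x \<in> carrier A; y \<in> carrier A; z \<in> carrier A\<rbrakk> \<Longrightarrow>
      (x \<oplus>\<^bsub>A\<^esub> y) \<otimes>\<^bsub>A\<^esub> z = x \<otimes>\<^bsub>A\<^esub> z \<oplus>\<^bsub>A\<^esub> y \<otimes>\<^bsub>A\<^esub> z"
    and alg_r_distr: "\<lbrakk>x \<in> carrier A; y \<in> carrier A; z \<in> carrier A\<rbrakk> \<Longrightarrow>
      z \<otimes>\<^bsub>A\<^esub> (x \<oplus>\<^bsub>A\<^esub> y) = z \<otimes>\<^bsub>A\<^esub> x \<oplus>\<^bsub>A\<^esub> z \<otimes>\<^bsub>A\<^esub> y"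
    and alg_smult_left: "\<lbrakk>c \<in> carrier K; x \<in> carrier A; y \<in> carrier A\<rbrakk> \<Longrightarrow>
      (c \<odot>\<^bsub>A\<^esub> x) \<otimes>\<^bsub>A\<^esub> y = c \<odot>\<^bsub>A\<^esub> (x \<otimes>\<^bsub>A\<^esub> y)"
    and alg_smult_right: "\<lbrakk>c \<in> carrier K; x \<in> carrier A; y \<in> carrier A\<rbrakk> \<Longrightarrow>
      x \<otimes>\<^bsub>A\<^esub> (c \<odot>\<^bsub>A\<^esub> y) = c \<odot>\<^bsub>A\<^esub> (x \<otimes>\<^bsub>A\<^esub> y)"

lemma (in bilinear_alg) biadditive_ring: "biadditive_ring A"
  by unfold_locales (auto simp: alg_mult_closed alg_l_distr alg_r_distr)

locale unital_alg = bilinear_alg +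
  assumes alg_one_closed: "\<one>\<^bsub>A\<^esub> \<in> carrier A"
    and alg_l_one: "x \<in> carrier A \<Longrightarrow> \<one>\<^bsub>A\<^esub> \<otimes>\<^bsub>A\<^esub> x = x"
    and alg_r_one: "x \<in> carrier A \<Longrightarrow> x \<otimes>\<^bsub>A\<^esub> \<one>\<^bsub>A\<^esub> = x"

definition bilin ::
    "('a, 'c) ring_scheme \<Rightarrow> ('a, 'x) module \<Rightarrow> ('a, 'y) module \<Rightarrow> ('a, 'z) module
      \<Rightarrow> ('x \<Rightarrow> 'y \<Rightarrow> 'z) \<Rightarrow> bool" where
  "bilin K A B C \<beta> \<longleftrightarrow>
     (\<forall>a\<in>carrier A. \<forall>b\<in>carrier B. \<beta> a b \<in> carrier C) \<and>
     (\<forall>a\<in>carrier A. \<forall>a'\<in>carrier A. \<forall>b\<in>carrier B. \<beta> (a \<oplus>\<^bsub>A\<^esub> a') b = \<beta> a b \<oplus>\<^bsub>C\<^esub> \<beta> a' b) \<and>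
     (\<forall>a\<in>carrier A. \<forall>b\<in>carrier B. \<forall>b'\<in>carrier B. \<beta> a (b \<oplus>\<^bsub>B\<^esub> b') = \<beta> a b \<oplus>\<^bsub>C\<^esub> \<beta> a b') \<and>
     (\<forall>c\<in>carrier K. \<forall>a\<in>carrier A. \<forall>b\<in>carrier B. \<beta> (c \<odot>\<^bsub>A\<^esub> a) b = c \<odot>\<^bsub>C\<^esub> \<beta> a b) \<and>
     (\<forall>c\<in>carrier K. \<forall>a\<in>carrier A. \<forall>b\<in>carrier B. \<beta> a (c \<odot>\<^bsub>B\<^esub> b) = c \<odot>\<^bsub>C\<^esub> \<beta> a b)"

section \<open>Free modules\<close>

lemma free_module_simps:
  "carrier (free_module K S) = {f \<in> S \<rightarrow>\<^sub>E carrier K. finite {s \<in> S. f s \<noteq> \<zero>\<^bsub>K\<^esub>}}"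
  "\<zero>\<^bsub>free_module K S\<^esub> = (\<lambda>s\<in>S. \<zero>\<^bsub>K\<^esub>)"
  "f \<oplus>\<^bsub>free_module K S\<^esub> g = (\<lambda>s\<in>S. f s \<oplus>\<^bsub>K\<^esub> g s)"
  "c \<odot>\<^bsub>free_module K S\<^esub> f = (\<lambda>s\<in>S. c \<otimes>\<^bsub>K\<^esub> f s)"
  by (simp_all add: free_module_def)

lemma free_module_apply:
  assumes "s \<in> S"
  shows "\<zero>\<^bsub>free_module K S\<^esub> s = \<zero>\<^bsub>K\<^esub>"
    and "(f \<oplus>\<^bsub>free_module K S\<^esub> g) s = f s \<oplus>\<^bsub>K\<^esub> g s"
    and "(c \<odot>\<^bsub>free_module K S\<^esub> f) s = c \<otimes>\<^bsub>K\<^esub> f s"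
    and "basis_elt K S t s = (if s = t then \<one>\<^bsub>K\<^esub> else \<zero>\<^bsub>K\<^esub>)"
  using assms by (simp_all add: free_module_def basis_elt_def)

lemma (in cring) free_module_add_closed:
  assumes "f \<in> carrier (free_module R S)" "g \<in> carrier (free_module R S)"
  shows "f \<oplus>\<^bsub>free_module R S\<^esub> g \<in> carrier (free_module R S)"
proof -
  have "{s \<in> S. f s \<oplus> g s \<noteq> \<zero>} \<subseteq> {s \<in> S. f s \<noteq> \<zero>} \<union> {s \<in> S. g s \<noteq> \<zero>}" by auto
  then have "finite {s \<in> S. f s \<oplus> g s \<noteq> \<zero>}"
    using assms by (auto simp: free_module_simps elim: finite_subset)
  moreover have "{s \<in> S. (\<lambda>s\<in>S. f s \<oplus> g s) s \<noteq> \<zero>} = {s \<in> S. f s \<oplus> g s \<noteq> \<zero>}" by auto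
  ultimately show ?thesis using assms by (auto simp: free_module_simps)
qed

lemma (in cring) free_module_smult_closed:
  assumes "c \<in> carrier R" "f \<in> carrier (free_module R S)"
  shows "c \<odot>\<^bsub>free_module R S\<^esub> f \<in> carrier (free_module R S)"
proof -
  have "{s \<in> S. c \<otimes> f s \<noteq> \<zero>} \<subseteq> {s \<in> S. f s \<noteq> \<zero>}" using assms by auto
  then have "finite {s \<in> S. c \<otimes> f s \<noteq> \<zero>}"
    using assms by (auto simp: free_module_simps elim: finite_subset)
  moreover have "{s \<in> S. (\<lambda>s\<in>S. c \<otimes> f s) s \<noteq> \<zero>} = {s \<in> S. c \<otimes> f s \<noteq> \<zero>}" by auto
  ultimately show ?thesis using assms by (auto simp: free_module_simps)
qed

lemma (in cring) free_module_mem: "\<lbrakk>f \<in> carrier (free_module R S); s \<in> S\<rbrakk> \<Longrightarrow> f s \<in> carrier R"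
  by (auto simp: free_module_simps)

lemma free_module_eqI:
  "\<lbrakk>f \<in> carrier (free_module R S); g \<in> carrier (free_module R S); \<And>s. s \<in> S \<Longrightarrow> f s = g s\<rbrakk> \<Longrightarrow> f = g"
  by (rule PiE_ext[of _ S "\<lambda>_. carrier R"]) (auto simp: free_module_simps)

lemma (in cring) free_module_zero_closed: "\<zero>\<^bsub>free_module R S\<^esub> \<in> carrier (free_module R S)"
  by (auto simp: free_module_simps restrict_def)

lemma (in cring) free_module_abelian_group: "abelian_group (free_module R S)"
proof (rule abelian_groupI)
  fix f assume f: "f \<in> carrier (free_module R S)"
  \<comment> \<open>The additive inverse is taken to be the multiple by -1, whose finite support is
    already known.\<close>
  have m1: "\<ominus> \<one> \<odot>\<^bsub>free_module R S\<^esub> f \<in> carrier (free_module R S)"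
    using f by (intro free_module_smult_closed) auto
  show "\<exists>g\<in>carrier (free_module R S). g \<oplus>\<^bsub>free_module R S\<^esub> f = \<zero>\<^bsub>free_module R S\<^esub>"
  proof (rule bexI[OF _ m1])
    have "\<ominus> \<one> \<otimes> f s \<oplus> f s = \<zero>" if "s \<in> S" for s
      using free_module_mem[OF f that] by (simp add: l_minus l_neg)
    then show "(\<ominus> \<one> \<odot>\<^bsub>free_module R S\<^esub> f) \<oplus>\<^bsub>free_module R S\<^esub> f = \<zero>\<^bsub>free_module R S\<^esub>"
      by (auto simp: free_module_simps(2-4))
  qed
  show "\<zero>\<^bsub>free_module R S\<^esub> \<oplus>\<^bsub>free_module R S\<^esub> f = f"
    by (rule free_module_eqI[of _ R S])
      (simp_all add: f free_module_add_closed free_module_zero_closed free_module_apply free_module_mem[OF f])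
next
  fix f g h assume "f \<in> carrier (free_module R S)" "g \<in> carrier (free_module R S)" "h \<in> carrier (free_module R S)"
  note m = this[THEN free_module_mem]
  show "f \<oplus>\<^bsub>free_module R S\<^esub> g \<oplus>\<^bsub>free_module R S\<^esub> h = f \<oplus>\<^bsub>free_module R S\<^esub> (g \<oplus>\<^bsub>free_module R S\<^esub> h)"
    unfolding free_module_simps(3) by (rule restrict_ext) (simp add: m a_assoc)
next
  fix f g assume "f \<in> carrier (free_module R S)" "g \<in> carrier (free_module R S)"
  note m = this[THEN free_module_mem]
  show "f \<oplus>\<^bsub>free_module R S\<^esub> g = g \<oplus>\<^bsub>free_module R S\<^esub> f"
    unfolding free_module_simps(3) by (rule restrict_ext) (simp add: m a_comm)
qed (simp_all add: free_module_add_closed free_module_zero_closed)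

lemma (in cring) free_module_module: "module R (free_module R S)"
proof (rule moduleI)
  fix a b f g assume ab: "a \<in> carrier R" "b \<in> carrier R"
    and fg: "f \<in> carrier (free_module R S)" "g \<in> carrier (free_module R S)"
  note m = fg[THEN free_module_mem]
  show "(a \<oplus> b) \<odot>\<^bsub>free_module R S\<^esub> f = a \<odot>\<^bsub>free_module R S\<^esub> f \<oplus>\<^bsub>free_module R S\<^esub> b \<odot>\<^bsub>free_module R S\<^esub> f"
    unfolding free_module_simps(3,4) by (rule restrict_ext) (simp add: m ab l_distr)
  show "a \<odot>\<^bsub>free_module R S\<^esub> (f \<oplus>\<^bsub>free_module R S\<^esub> g) = a \<odot>\<^bsub>free_module R S\<^esub> f \<oplus>\<^bsub>free_module R S\<^esub> a \<odot>\<^bsub>free_module R S\<^esub> g"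
    unfolding free_module_simps(3,4) by (rule restrict_ext) (simp add: m ab r_distr)
  show "(a \<otimes> b) \<odot>\<^bsub>free_module R S\<^esub> f = a \<odot>\<^bsub>free_module R S\<^esub> (b \<odot>\<^bsub>free_module R S\<^esub> f)"
    unfolding free_module_simps(3,4) by (rule restrict_ext) (simp add: m ab m_assoc)
next
  fix f assume fg: "f \<in> carrier (free_module R S)"
  note m = fg[THEN free_module_mem]
  show "\<one> \<odot>\<^bsub>free_module R S\<^esub> f = f"
    by (rule free_module_eqI[of _ R S])
      (simp_all add: fg free_module_smult_closed free_module_apply m)
qed (simp_all add: free_module_smult_closed free_module_abelian_group is_cring)

lemma (in cring) free_module_eval_hom: "s \<in> S \<Longrightarrow> abelian_group_hom (free_module R S) R (\<lambda>f. f s)"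
  by (rule add_homI) (auto intro: free_module_abelian_group free_module_mem abelian_group_axioms simp: free_module_simps(3))

lemma (in cring) free_module_finsum_apply:
  "\<lbrakk>s \<in> S; f \<in> A \<rightarrow> carrier (free_module R S)\<rbrakk> \<Longrightarrow>
    (\<Oplus>\<^bsub>free_module R S\<^esub>i\<in>A. f i) s = (\<Oplus>i\<in>A. f i s)"
  by (rule abelian_group_hom.hom_finsum[OF free_module_eval_hom])

lemma (in cring) basis_elt_carrier: "basis_elt R S s \<in> carrier (free_module R S)"
proof -
  have "{t \<in> S. basis_elt R S s t \<noteq> \<zero>} \<subseteq> {s}" by (auto simp: basis_elt_def)
  then have "finite {t \<in> S. basis_elt R S s t \<noteq> \<zero>}" by (rule finite_subset) auto
  then show ?thesis by (auto simp: free_module_simps basis_elt_def)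
qed

text \<open>\<open>P\<close> may be any finite set containing the support, so that the same
  expansion serves for the support itself and for the whole of a finite basis.\<close>

lemma (in cring) free_module_expand:
  assumes f: "f \<in> carrier (free_module R S)" and P: "finite P" "P \<subseteq> S" "{s \<in> S. f s \<noteq> \<zero>} \<subseteq> P"
  shows "f = (\<Oplus>\<^bsub>free_module R S\<^esub>s\<in>P. f s \<odot>\<^bsub>free_module R S\<^esub> basis_elt R S s)"
proof -
  interpret F: module R "free_module R S" by (rule free_module_module)
  have m: "f s \<odot>\<^bsub>free_module R S\<^esub> basis_elt R S s \<in> carrier (free_module R S)" if "s \<in> P" for s
    using that P f by (intro free_module_smult_closed basis_elt_carrier free_module_mem[of f S]) auto
  show ?thesis
  proof (rule free_module_eqI[OF f])
    fix t assume t: "t \<in> S"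
    have "(\<Oplus>\<^bsub>free_module R S\<^esub>s\<in>P. f s \<odot>\<^bsub>free_module R S\<^esub> basis_elt R S s) t
      = (\<Oplus>s\<in>P. (f s \<odot>\<^bsub>free_module R S\<^esub> basis_elt R S s) t)"
      using m t by (intro free_module_finsum_apply) auto
    also have "\<dots> = (\<Oplus>s\<in>P. if t = s then f s else \<zero>)"
      using t f P by (intro finsum_cong') (auto simp: free_module_apply free_module_mem[OF f] subset_iff)
    also have "\<dots> = f t"
    proof (cases "t \<in> P")
      case True
      then show ?thesis using P f by (subst finsum_singleton) (auto intro: free_module_mem)
    next
      case False
      then have "(\<Oplus>s\<in>P. if t = s then f s else \<zero>) = (\<Oplus>s\<in>P. \<zero>)"
        by (intro finsum_cong') auto
      moreover have "f t = \<zero>" using False t P by auto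
      ultimately show ?thesis by (simp add: finsum_zero)
    qed
    finally show "f t = (\<Oplus>\<^bsub>free_module R S\<^esub>s\<in>P. f s \<odot>\<^bsub>free_module R S\<^esub> basis_elt R S s) t" ..
  qed (use m in \<open>auto intro!: F.finsum_closed\<close>)
qed

lemma (in cring) free_module_add_span:
  assumes "f \<in> carrier (free_module R S)"
  shows "f \<in> add_span (free_module R S) {c \<odot>\<^bsub>free_module R S\<^esub> basis_elt R S s | c s. c \<in> carrier R \<and> s \<in> S}"
    (is "_ \<in> add_span ?F ?G")
proof -
  interpret F: module R ?F by (rule free_module_module)
  have "(\<Oplus>\<^bsub>?F\<^esub>s\<in>{s \<in> S. f s \<noteq> \<zero>}. f s \<odot>\<^bsub>?F\<^esub> basis_elt R S s) \<in> add_span ?F ?G"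
  proof (intro F.add_span_finsum add_span_gen)
    show "finite {s \<in> S. f s \<noteq> \<zero>}" using assms by (simp add: free_module_simps)
  next
    show "(\<lambda>s. f s \<odot>\<^bsub>?F\<^esub> basis_elt R S s) \<in> {s \<in> S. f s \<noteq> \<zero>} \<rightarrow> carrier ?F"
      using free_module_mem[OF assms] by (auto simp: basis_elt_carrier)
  next
    fix s assume "s \<in> {s \<in> S. f s \<noteq> \<zero>}"
    then show "f s \<odot>\<^bsub>?F\<^esub> basis_elt R S s \<in> ?G" using free_module_mem[OF assms] by blast
  qed
  then show ?thesis
    using free_module_expand[OF assms, of "{s \<in> S. f s \<noteq> \<zero>}"] assms by (simp add: free_module_simps)
qed

text \<open>The linear extension of a map on the basis. It is the sum inside
  \<open>tensor_lift\<close>, evaluated on one representative.\<close>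

definition free_lift :: "('a, 'c) ring_scheme \<Rightarrow> 's set \<Rightarrow> ('a, 'z, 'm) module_scheme \<Rightarrow> ('s \<Rightarrow> 'z) \<Rightarrow> ('s \<Rightarrow> 'a) \<Rightarrow> 'z" where
  "free_lift K S C \<beta> f = (\<Oplus>\<^bsub>C\<^esub>p\<in>{p \<in> S. f p \<noteq> \<zero>\<^bsub>K\<^esub>}. f p \<odot>\<^bsub>C\<^esub> \<beta> p)"

lemma (in module) smult_zero_left: "x \<in> carrier M \<Longrightarrow> \<zero> \<odot>\<^bsub>M\<^esub> x = \<zero>\<^bsub>M\<^esub>"
  using smult_l_null by simp

context module
begin

context
  fixes S :: "'s set" and \<beta> assumes b: "\<And>s. s \<in> S \<Longrightarrow> \<beta> s \<in> carrier M"
begin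

text \<open>Passing to a sum or a multiple changes the support. Summing over a common finite
  superset makes additivity and homogeneity termwise statements.\<close>

lemma free_lift_superset:
  assumes f: "f \<in> carrier (free_module R S)" and P: "finite P" "P \<subseteq> S" "{s \<in> S. f s \<noteq> \<zero>} \<subseteq> P"
  shows "free_lift R S M \<beta> f = (\<Oplus>\<^bsub>M\<^esub>p\<in>P. f p \<odot>\<^bsub>M\<^esub> \<beta> p)"
  unfolding free_lift_def
  by (rule M.add.finprod_mono_neutral_cong_left) (use P f b in \<open>auto simp: R.free_module_mem subset_iff smult_zero_left\<close>)

lemma free_lift_closed: "f \<in> carrier (free_module R S) \<Longrightarrow> free_lift R S M \<beta> f \<in> carrier M"
  unfolding free_lift_def by (rule M.finsum_closed) (use b in \<open>auto simp: R.free_module_mem\<close>)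

lemma free_lift_add:
  assumes f: "f \<in> carrier (free_module R S)" and g: "g \<in> carrier (free_module R S)"
  shows "free_lift R S M \<beta> (f \<oplus>\<^bsub>free_module R S\<^esub> g) = free_lift R S M \<beta> f \<oplus>\<^bsub>M\<^esub> free_lift R S M \<beta> g"
proof -
  let ?P = "{s \<in> S. f s \<noteq> \<zero>} \<union> {s \<in> S. g s \<noteq> \<zero>}"
  have P: "finite ?P" "?P \<subseteq> S" using f g by (auto simp: free_module_simps)
  have "free_lift R S M \<beta> (f \<oplus>\<^bsub>free_module R S\<^esub> g)
      = (\<Oplus>\<^bsub>M\<^esub>p\<in>?P. (f \<oplus>\<^bsub>free_module R S\<^esub> g) p \<odot>\<^bsub>M\<^esub> \<beta> p)"
    by (rule free_lift_superset) (use P f g in \<open>auto intro: R.free_module_add_closed simp: free_module_apply\<close>)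
  also have "\<dots> = (\<Oplus>\<^bsub>M\<^esub>p\<in>?P. f p \<odot>\<^bsub>M\<^esub> \<beta> p \<oplus>\<^bsub>M\<^esub> g p \<odot>\<^bsub>M\<^esub> \<beta> p)"
    by (rule M.finsum_cong')
      (use P f g b in \<open>auto simp: free_module_apply R.free_module_mem smult_l_distr\<close>)
  also have "\<dots> = (\<Oplus>\<^bsub>M\<^esub>p\<in>?P. f p \<odot>\<^bsub>M\<^esub> \<beta> p) \<oplus>\<^bsub>M\<^esub> (\<Oplus>\<^bsub>M\<^esub>p\<in>?P. g p \<odot>\<^bsub>M\<^esub> \<beta> p)"
    by (rule M.finsum_addf) (use P f g b in \<open>auto simp: R.free_module_mem\<close>)
  also have "\<dots> = free_lift R S M \<beta> f \<oplus>\<^bsub>M\<^esub> free_lift R S M \<beta> g"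
    using free_lift_superset[OF f P] free_lift_superset[OF g P] by auto
  finally show ?thesis .
qed

lemma free_lift_smult:
  assumes f: "f \<in> carrier (free_module R S)" and c: "c \<in> carrier R"
  shows "free_lift R S M \<beta> (c \<odot>\<^bsub>free_module R S\<^esub> f) = c \<odot>\<^bsub>M\<^esub> free_lift R S M \<beta> f"
proof -
  let ?P = "{s \<in> S. f s \<noteq> \<zero>}"
  have P: "finite ?P" "?P \<subseteq> S" using f by (auto simp: free_module_simps)
  have "free_lift R S M \<beta> (c \<odot>\<^bsub>free_module R S\<^esub> f)
      = (\<Oplus>\<^bsub>M\<^esub>p\<in>?P. (c \<odot>\<^bsub>free_module R S\<^esub> f) p \<odot>\<^bsub>M\<^esub> \<beta> p)"
    by (rule free_lift_superset) (use P f c in \<open>auto intro: R.free_module_smult_closed simp: free_module_apply\<close>)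
  also have "\<dots> = (\<Oplus>\<^bsub>M\<^esub>p\<in>?P. c \<odot>\<^bsub>M\<^esub> (f p \<odot>\<^bsub>M\<^esub> \<beta> p))"
    by (rule M.finsum_cong')
      (use P f b c in \<open>auto simp: free_module_apply R.free_module_mem smult_assoc1\<close>)
  also have "\<dots> = c \<odot>\<^bsub>M\<^esub> (\<Oplus>\<^bsub>M\<^esub>p\<in>?P. f p \<odot>\<^bsub>M\<^esub> \<beta> p)"
    by (rule finsum_smult_ldistr[symmetric]) (use P f b c in \<open>auto simp: R.free_module_mem\<close>)
  finally show ?thesis by (simp add: free_lift_def)
qed

lemma free_lift_basis:
  assumes s: "s \<in> S" shows "free_lift R S M \<beta> (basis_elt R S s) = \<beta> s"
proof -
  have "free_lift R S M \<beta> (basis_elt R S s) = (\<Oplus>\<^bsub>M\<^esub>p\<in>{s}. basis_elt R S s p \<odot>\<^bsub>M\<^esub> \<beta> p)"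
    by (rule free_lift_superset) (use s in \<open>auto simp: R.basis_elt_carrier free_module_apply split: if_splits\<close>)
  also have "\<dots> = \<beta> s" using s b by (simp add: free_module_apply)
  finally show ?thesis .
qed

end

end

section \<open>Tensor products\<close>

lemma span_in_submodule:
  assumes "module R M"
  assumes "S \<subseteq> carrier M" shows "submodule (span_in R M S) R M"
proof -
  interpret module R M by fact
  have c: "submodule (carrier M) R M" by (rule submoduleI) auto
  have sub: "span_in R M S \<subseteq> carrier M" using c assms by (auto simp: span_in_def)
  show ?thesis
    by (rule submoduleI[OF sub])
      (auto simp: span_in_def submoduleE(3-5) intro: subgroup.one_closed[OF submodule.axioms(1), simplified])
qed

lemma span_in_subset: "S \<subseteq> span_in K M S"
  by (auto simp: span_in_def)

lemma span_in_least: "\<lbrakk>submodule H K M; S \<subseteq> H\<rbrakk> \<Longrightarrow> span_in K M S \<subseteq> H"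
  by (auto simp: span_in_def)


locale tensor_context = A: module K A + B: module K B
  for K :: "('a, 'c) ring_scheme" and A :: "('a, 'x) module" and B :: "('a, 'y) module"
begin

abbreviation "F \<equiv> tensor_free K A B"
abbreviation "I \<equiv> tensor_rel K A B"
abbreviation "T \<equiv> tensor_module K A B"
abbreviation "S \<equiv> carrier A \<times> carrier B"
abbreviation "e a b \<equiv> basis_elt K S (a, b)"
abbreviation "pure \<equiv> pure_tensor K A B"
abbreviation "coset f \<equiv> I +>\<^bsub>F\<^esub> f"

definition rels where
  "rels = {e (a \<oplus>\<^bsub>A\<^esub> a') b \<ominus>\<^bsub>F\<^esub> (e a b \<oplus>\<^bsub>F\<^esub> e a' b) | a a' b.
           a \<in> carrier A \<and> a' \<in> carrier A \<and> b \<in> carrier B} \<union>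
        {e a (b \<oplus>\<^bsub>B\<^esub> b') \<ominus>\<^bsub>F\<^esub> (e a b \<oplus>\<^bsub>F\<^esub> e a b') | a b b'.
           a \<in> carrier A \<and> b \<in> carrier B \<and> b' \<in> carrier B} \<union>
        {e (c \<odot>\<^bsub>A\<^esub> a) b \<ominus>\<^bsub>F\<^esub> (c \<odot>\<^bsub>F\<^esub> e a b) | c a b.
           c \<in> carrier K \<and> a \<in> carrier A \<and> b \<in> carrier B} \<union>
        {e a (c \<odot>\<^bsub>B\<^esub> b) \<ominus>\<^bsub>F\<^esub> (c \<odot>\<^bsub>F\<^esub> e a b) | c a b.
           c \<in> carrier K \<and> a \<in> carrier A \<and> b \<in> carrier B}"

lemma tensor_rel_eq: "I = span_in K F rels"
  by (simp add: tensor_rel_def rels_def Let_def)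

lemma F_module: "module K F"
  unfolding tensor_free_def by (rule A.R.free_module_module)

sublocale F: module K F by (rule F_module)

lemma e_carrier [simp]: "basis_elt K S p \<in> carrier F"
  by (simp add: tensor_free_def A.R.basis_elt_carrier)

lemma rels_carrier: "rels \<subseteq> carrier F"
  by (auto simp: rels_def)

lemma I_submodule: "submodule I K F"
  unfolding tensor_rel_eq by (rule span_in_submodule[OF F_module rels_carrier])

sublocale I: abelian_subgroup I F
  by (rule abelian_subgroupI3)
    (auto intro: additive_subgroupI submodule.axioms(1)[OF I_submodule] F.abelian_group_axioms)

lemma coset_eq_iff: "\<lbrakk>f \<in> carrier F; g \<in> carrier F\<rbrakk> \<Longrightarrow> coset f = coset g \<longleftrightarrow> f \<ominus>\<^bsub>F\<^esub> g \<in> I"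
  using I.a_rcos_module[of g f] I.a_repr_independence'[of f g] I.a_rcos_self[of f]
  by (auto simp: F.minus_eq)

lemma mem_coset_iff: "f \<in> carrier F \<Longrightarrow> g \<in> coset f \<longleftrightarrow> g \<in> carrier F \<and> coset g = coset f"
  using I.a_repr_independence'[of g f] I.a_rcos_self[of g] I.a_elemrcos_carrier[of f g] by auto

lemma T_simps:
  "carrier T = coset ` carrier F" "\<zero>\<^bsub>T\<^esub> = I" "add T = set_add F"
  "c \<odot>\<^bsub>T\<^esub> z = (\<Union>f\<in>z. coset (c \<odot>\<^bsub>F\<^esub> f))"
  by (auto simp: tensor_module_def Let_def A_RCOSETS_def')

lemma T_add: "\<lbrakk>f \<in> carrier F; g \<in> carrier F\<rbrakk> \<Longrightarrow> coset f \<oplus>\<^bsub>T\<^esub> coset g = coset (f \<oplus>\<^bsub>F\<^esub> g)"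
  by (simp add: T_simps I.a_rcos_sum)

lemma T_zero: "\<zero>\<^bsub>T\<^esub> = coset \<zero>\<^bsub>F\<^esub>"
  by (simp add: T_simps I.a_rcos_const)

text \<open>The definition takes a union over all representatives. They all give the same coset
  because the relations form a submodule, so that a difference in \<open>I\<close> stays in
  \<open>I\<close> after scaling.\<close>

lemma T_smult:
  assumes c: "c \<in> carrier K" and f: "f \<in> carrier F"
  shows "c \<odot>\<^bsub>T\<^esub> coset f = coset (c \<odot>\<^bsub>F\<^esub> f)"
proof -
  have "coset (c \<odot>\<^bsub>F\<^esub> g) = coset (c \<odot>\<^bsub>F\<^esub> f)" if "g \<in> coset f" for g
  proof -
    have g: "g \<in> carrier F" "g \<ominus>\<^bsub>F\<^esub> f \<in> I" using that f by (auto simp: mem_coset_iff coset_eq_iff)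
    have "c \<odot>\<^bsub>F\<^esub> (g \<ominus>\<^bsub>F\<^esub> f) \<in> I" using g c I_submodule by (auto intro: submodule.smult_closed)
    moreover have "c \<odot>\<^bsub>F\<^esub> (g \<ominus>\<^bsub>F\<^esub> f) = c \<odot>\<^bsub>F\<^esub> g \<ominus>\<^bsub>F\<^esub> c \<odot>\<^bsub>F\<^esub> f"
      using c f g by (simp add: F.minus_eq F.smult_r_distr F.smult_r_minus)
    ultimately show ?thesis using c f g by (simp add: coset_eq_iff)
  qed
  moreover have "f \<in> coset f" using f by (simp add: mem_coset_iff)
  ultimately show ?thesis unfolding T_simps by blast
qed

lemma T_abelian_group: "abelian_group T"
proof (rule abelian_groupI)
  fix x assume "x \<in> carrier T"
  then obtain f where f: "f \<in> carrier F" "x = coset f" by (auto simp: T_simps)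
  then have "coset (\<ominus>\<^bsub>F\<^esub> f) \<in> carrier T" "coset (\<ominus>\<^bsub>F\<^esub> f) \<oplus>\<^bsub>T\<^esub> x = \<zero>\<^bsub>T\<^esub>"
    by (auto simp: T_simps(1) T_add T_zero F.l_neg)
  then show "\<exists>y\<in>carrier T. y \<oplus>\<^bsub>T\<^esub> x = \<zero>\<^bsub>T\<^esub>" by blast
qed (auto simp: T_simps(1) T_add T_zero F.a_ac)

lemma T_module: "module K T"
proof (rule moduleI)
  fix c d x y assume cd: "c \<in> carrier K" "d \<in> carrier K" and "x \<in> carrier T" "y \<in> carrier T"
  then obtain f g where fg: "f \<in> carrier F" "g \<in> carrier F" "x = coset f" "y = coset g"
    by (auto simp: T_simps(1))
  show "(c \<oplus>\<^bsub>K\<^esub> d) \<odot>\<^bsub>T\<^esub> x = c \<odot>\<^bsub>T\<^esub> x \<oplus>\<^bsub>T\<^esub> d \<odot>\<^bsub>T\<^esub> x"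
    using cd fg by (simp add: T_smult T_add F.smult_l_distr)
  show "c \<odot>\<^bsub>T\<^esub> (x \<oplus>\<^bsub>T\<^esub> y) = c \<odot>\<^bsub>T\<^esub> x \<oplus>\<^bsub>T\<^esub> c \<odot>\<^bsub>T\<^esub> y"
    using cd fg by (simp add: T_smult T_add F.smult_r_distr)
  show "(c \<otimes>\<^bsub>K\<^esub> d) \<odot>\<^bsub>T\<^esub> x = c \<odot>\<^bsub>T\<^esub> (d \<odot>\<^bsub>T\<^esub> x)"
    using cd fg by (simp add: T_smult F.smult_assoc1)
next
  fix c x assume c: "c \<in> carrier K" and "x \<in> carrier T"
  then obtain f where f: "f \<in> carrier F" "x = coset f" by (auto simp: T_simps(1))
  show "c \<odot>\<^bsub>T\<^esub> x \<in> carrier T" using c f by (simp add: T_smult) (simp add: T_simps(1))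
next
  fix x assume "x \<in> carrier T"
  then obtain f where f: "f \<in> carrier F" "x = coset f" by (auto simp: T_simps(1))
  then show "\<one>\<^bsub>K\<^esub> \<odot>\<^bsub>T\<^esub> x = x" by (simp add: T_smult)
qed (auto simp: T_abelian_group A.R.is_cring)

sublocale T: module K T by (rule T_module)

lemma pure_coset: "pure a b = coset (e a b)"
  by (simp add: pure_tensor_def)

lemma rels_in_I:
  "\<lbrakk>a \<in> carrier A; a' \<in> carrier A; b \<in> carrier B\<rbrakk> \<Longrightarrow>
    e (a \<oplus>\<^bsub>A\<^esub> a') b \<ominus>\<^bsub>F\<^esub> (e a b \<oplus>\<^bsub>F\<^esub> e a' b) \<in> I"
  "\<lbrakk>a \<in> carrier A; b \<in> carrier B; b' \<in> carrier B\<rbrakk> \<Longrightarrow>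
    e a (b \<oplus>\<^bsub>B\<^esub> b') \<ominus>\<^bsub>F\<^esub> (e a b \<oplus>\<^bsub>F\<^esub> e a b') \<in> I"
  "\<lbrakk>c \<in> carrier K; a \<in> carrier A; b \<in> carrier B\<rbrakk> \<Longrightarrow>
    e (c \<odot>\<^bsub>A\<^esub> a) b \<ominus>\<^bsub>F\<^esub> (c \<odot>\<^bsub>F\<^esub> e a b) \<in> I"
  "\<lbrakk>c \<in> carrier K; a \<in> carrier A; b \<in> carrier B\<rbrakk> \<Longrightarrow>
    e a (c \<odot>\<^bsub>B\<^esub> b) \<ominus>\<^bsub>F\<^esub> (c \<odot>\<^bsub>F\<^esub> e a b) \<in> I"
  by (rule span_in_subset[of rels K F, folded tensor_rel_eq, THEN subsetD], unfold rels_def, blast)+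

lemma pure_bilin: "bilin K A B T pure"
  unfolding bilin_def
  by (intro conjI ballI)
    (simp_all add: pure_coset T_add T_smult coset_eq_iff rels_in_I T_simps(1))

lemma pure_closed [simp]: "\<lbrakk>a \<in> carrier A; b \<in> carrier B\<rbrakk> \<Longrightarrow> pure a b \<in> carrier T"
  using pure_bilin by (auto simp: bilin_def)

text \<open>A scalar multiple of a basis element of the free module becomes a pure tensor, the
  scalar being absorbed by the left factor. Hence pure tensors generate additively, and
  \<open>T_homs_eq\<close> applies to maps that are merely additive.\<close>

lemma T_add_span:
  assumes "z \<in> carrier T"
  shows "z \<in> add_span T {pure a b | a b. a \<in> carrier A \<and> b \<in> carrier B}" (is "_ \<in> add_span T ?G")
proof -
  obtain f where f: "f \<in> carrier F" "z = coset f" using assms by (auto simp: T_simps(1))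
  let ?H = "{c \<odot>\<^bsub>F\<^esub> basis_elt K S s | c s. c \<in> carrier K \<and> s \<in> S}"
  have "f \<in> add_span F ?H"
    using f A.R.free_module_add_span[of f S] by (simp add: tensor_free_def)
  then have "coset f \<in> add_span T ?G \<and> f \<in> carrier F"
  proof (induction rule: add_span.induct)
    case add_span_zero
    then show ?case using add_span.add_span_zero[of T ?G] by (simp add: T_zero)
  next
    case (add_span_gen s)
    then obtain c a b where s: "s = c \<odot>\<^bsub>F\<^esub> e a b" "c \<in> carrier K" "a \<in> carrier A" "b \<in> carrier B" by auto
    then have "coset s = pure (c \<odot>\<^bsub>A\<^esub> a) b"
      using pure_bilin by (simp add: bilin_def T_smult[symmetric] pure_coset)
    then show ?case using s by (auto intro!: add_span.add_span_gen)
  next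
    case (add_span_add x y)
    then show ?case by (auto simp: T_add[symmetric] intro: add_span.add_span_add)
  qed
  then show ?thesis using f by simp
qed

lemma T_homs_eq:
  assumes "abelian_group_hom T H h" "abelian_group_hom T H h'"
    and "\<And>a b. \<lbrakk>a \<in> carrier A; b \<in> carrier B\<rbrakk> \<Longrightarrow> h (pure a b) = h' (pure a b)" and "z \<in> carrier T"
  shows "h z = h' z"
  by (rule add_homs_eq[OF assms(1,2), of "{pure a b | a b. a \<in> carrier A \<and> b \<in> carrier B}"])
    (use assms(3,4) T_add_span in auto)

context
  fixes C :: "('a, 'z) module" and \<beta> :: "'x \<Rightarrow> 'y \<Rightarrow> 'z"
  assumes C: "module K C" and \<beta>: "bilin K A B C \<beta>"
begin

interpretation C: module K C by (rule C)

text \<open>The kernel of the linear extension is a submodule, and bilinearity of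
  \<open>\<beta>\<close> puts all relations into it. The extension is therefore constant on cosets
  and \<open>the_elem\<close> is applied to a singleton.\<close>

lemma tensor_lift_coset:
  assumes f: "f \<in> carrier F"
  shows "tensor_lift K A B C \<beta> (coset f) = free_lift K S C (\<lambda>p. \<beta> (fst p) (snd p)) f"
proof -
  let ?b = "\<lambda>p. \<beta> (fst p) (snd p)" and ?l = "free_lift K S C (\<lambda>p. \<beta> (fst p) (snd p))"
  have b: "\<And>s. s \<in> S \<Longrightarrow> ?b s \<in> carrier C" using \<beta> by (auto simp: bilin_def)
  have lc: "?l f \<in> carrier C" if "f \<in> carrier F" for f
    using that C.free_lift_closed[of S ?b f] b by (simp add: tensor_free_def)
  have la: "?l (f \<oplus>\<^bsub>F\<^esub> g) = ?l f \<oplus>\<^bsub>C\<^esub> ?l g" if "f \<in> carrier F" "g \<in> carrier F" for f g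
    using that C.free_lift_add[of S ?b f g] b by (simp add: tensor_free_def)
  have ls: "?l (c \<odot>\<^bsub>F\<^esub> f) = c \<odot>\<^bsub>C\<^esub> ?l f" if "f \<in> carrier F" "c \<in> carrier K" for f c
    using that C.free_lift_smult[of S ?b f c] b by (simp add: tensor_free_def)
  have le: "?l (e x y) = \<beta> x y" if "x \<in> carrier A" "y \<in> carrier B" for x y
    using that C.free_lift_basis[of S ?b "(x, y)"] b by simp
  interpret l: abelian_group_hom F C ?l
    by (rule add_homI) (auto simp: lc la F.abelian_group_axioms C.abelian_group_axioms)
  have lm: "?l (f \<ominus>\<^bsub>F\<^esub> g) = ?l f \<ominus>\<^bsub>C\<^esub> ?l g" if "f \<in> carrier F" "g \<in> carrier F" for f g
    using that by (simp add: F.minus_eq C.minus_eq)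
  have "submodule {f \<in> carrier F. ?l f = \<zero>\<^bsub>C\<^esub>} K F"
    by (rule F.submoduleI) (auto simp: ls)
  moreover have "rels \<subseteq> {f \<in> carrier F. ?l f = \<zero>\<^bsub>C\<^esub>}"
    using \<beta> by (auto simp: rels_def lm ls le bilin_def) (auto simp: C.minus_eq C.r_neg)
  ultimately have I0: "I \<subseteq> {f \<in> carrier F. ?l f = \<zero>\<^bsub>C\<^esub>}"
    unfolding tensor_rel_eq by (rule span_in_least)
  have "?l g = ?l f" if "g \<in> coset f" for g
  proof -
    have g: "g \<in> carrier F" "g \<ominus>\<^bsub>F\<^esub> f \<in> I" using that f by (auto simp: mem_coset_iff coset_eq_iff)
    then have "?l g \<ominus>\<^bsub>C\<^esub> ?l f = \<zero>\<^bsub>C\<^esub>" using I0 f lm by auto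
    moreover have "?l g = (?l g \<ominus>\<^bsub>C\<^esub> ?l f) \<oplus>\<^bsub>C\<^esub> ?l f"
      using f g lc by (simp add: C.minus_eq C.a_assoc C.l_neg)
    ultimately show ?thesis using f lc by simp
  qed
  moreover have "f \<in> coset f" using f by (simp add: mem_coset_iff)
  ultimately have "?l ` coset f = {?l f}" by blast
  then have "the_elem (?l ` coset f) = ?l f" by simp
  then show ?thesis by (simp add: tensor_lift_def free_lift_def)
qed

lemma \<beta>_closed: "p \<in> S \<Longrightarrow> \<beta> (fst p) (snd p) \<in> carrier C"
  using \<beta> by (auto simp: bilin_def)

lemma tensor_lift_pure: "\<lbrakk>a \<in> carrier A; b \<in> carrier B\<rbrakk> \<Longrightarrow> tensor_lift K A B C \<beta> (pure a b) = \<beta> a b"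
  using C.free_lift_basis[of S "\<lambda>p. \<beta> (fst p) (snd p)" "(a, b)"] \<beta>_closed
  by (simp add: pure_coset tensor_lift_coset)

lemma tensor_lift_closed: "z \<in> carrier T \<Longrightarrow> tensor_lift K A B C \<beta> z \<in> carrier C"
  using C.free_lift_closed[of S "\<lambda>p. \<beta> (fst p) (snd p)"] \<beta>_closed
  by (auto simp: T_simps(1) tensor_lift_coset) (simp add: tensor_free_def)

lemma tensor_lift_add:
  "\<lbrakk>z \<in> carrier T; w \<in> carrier T\<rbrakk> \<Longrightarrow>
    tensor_lift K A B C \<beta> (z \<oplus>\<^bsub>T\<^esub> w) = tensor_lift K A B C \<beta> z \<oplus>\<^bsub>C\<^esub> tensor_lift K A B C \<beta> w"
  using C.free_lift_add[of S "\<lambda>p. \<beta> (fst p) (snd p)"] \<beta>_closed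
  by (auto simp: T_simps(1) T_add tensor_lift_coset) (simp add: tensor_free_def)

lemma tensor_lift_hom: "abelian_group_hom T C (tensor_lift K A B C \<beta>)"
  by (rule add_homI) (auto simp: tensor_lift_closed tensor_lift_add T_abelian_group C.abelian_group_axioms)

end

end

text \<open>Treats together the product of a tensor algebra and its action on a tensor module: both
  are nested lifts, the inner one with the arguments of the outer one as parameters.\<close>

locale multilinear4 = X: tensor_context K A B + Y: tensor_context K C D + Z: module K Z
  for K :: "('a, 'c) ring_scheme" and A :: "('a, 'x) module" and B :: "('a, 'y) module"
    and C :: "('a, 'u) module" and D :: "('a, 'v) module" and Z :: "('a, 'z) module" +
  fixes \<gamma> :: "'x \<Rightarrow> 'y \<Rightarrow> 'u \<Rightarrow> 'v \<Rightarrow> 'z"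
  assumes bilin_left: "\<lbrakk>c \<in> carrier C; d \<in> carrier D\<rbrakk> \<Longrightarrow> bilin K A B Z (\<lambda>a b. \<gamma> a b c d)"
    and bilin_right: "\<lbrakk>a \<in> carrier A; b \<in> carrier B\<rbrakk> \<Longrightarrow> bilin K C D Z (\<gamma> a b)"
begin

definition inner where "inner w a b = tensor_lift K C D Z (\<gamma> a b) w"

definition double_lift where "double_lift z w = tensor_lift K A B Z (inner w) z"

lemma inner_hom: "\<lbrakk>a \<in> carrier A; b \<in> carrier B\<rbrakk> \<Longrightarrow> abelian_group_hom Y.T Z (\<lambda>w. inner w a b)"
  unfolding inner_def using Y.tensor_lift_hom[OF Z.module_axioms bilin_right] by simp

lemma inner_closed: "\<lbrakk>a \<in> carrier A; b \<in> carrier B; w \<in> carrier Y.T\<rbrakk> \<Longrightarrow> inner w a b \<in> carrier Z"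
  unfolding inner_def by (simp add: Y.tensor_lift_closed[OF Z.module_axioms bilin_right])

lemma inner_add: "\<lbrakk>a \<in> carrier A; b \<in> carrier B; w \<in> carrier Y.T; w' \<in> carrier Y.T\<rbrakk> \<Longrightarrow>
    inner (w \<oplus>\<^bsub>Y.T\<^esub> w') a b = inner w a b \<oplus>\<^bsub>Z\<^esub> inner w' a b"
  unfolding inner_def by (simp add: Y.tensor_lift_add[OF Z.module_axioms bilin_right])

lemma inner_pure: "\<lbrakk>a \<in> carrier A; b \<in> carrier B; c \<in> carrier C; d \<in> carrier D\<rbrakk> \<Longrightarrow>
    inner (Y.pure c d) a b = \<gamma> a b c d"
  unfolding inner_def by (simp add: Y.tensor_lift_pure[OF Z.module_axioms bilin_right])

lemma hom_sum:
  assumes "abelian_group_hom Y.T Z h" "abelian_group_hom Y.T Z h'"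
  shows "abelian_group_hom Y.T Z (\<lambda>w. h w \<oplus>\<^bsub>Z\<^esub> h' w)"
proof -
  interpret h: abelian_group_hom Y.T Z h by fact
  interpret h': abelian_group_hom Y.T Z h' by fact
  show ?thesis by (rule add_homI) (auto simp: Y.T_abelian_group Z.abelian_group_axioms Z.a_ac)
qed

lemma hom_scale:
  assumes "abelian_group_hom Y.T Z h" "c \<in> carrier K"
  shows "abelian_group_hom Y.T Z (\<lambda>w. c \<odot>\<^bsub>Z\<^esub> h w)"
proof -
  interpret h: abelian_group_hom Y.T Z h by fact
  show ?thesis by (rule add_homI) (auto simp: Y.T_abelian_group Z.abelian_group_axioms assms Z.smult_r_distr)
qed

text \<open>For fixed arguments of the outer map each law is an equation between additive functions
  of \<open>w\<close>. It can be tested at pure tensors, where it becomes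
  \<open>bilin_left\<close>.\<close>

lemma inner_bilin: assumes w: "w \<in> carrier Y.T" shows "bilin K A B Z (inner w)"
  unfolding bilin_def
proof (intro conjI ballI)
  fix a b assume "a \<in> carrier A" "b \<in> carrier B" then show "inner w a b \<in> carrier Z" using w by (rule inner_closed)
next
  fix a a' b assume x: "a \<in> carrier A" "a' \<in> carrier A" "b \<in> carrier B"
  then show "inner w (a \<oplus>\<^bsub>A\<^esub> a') b = inner w a b \<oplus>\<^bsub>Z\<^esub> inner w a' b"
    by (intro Y.T_homs_eq[OF inner_hom hom_sum[OF inner_hom inner_hom] _ w])
      (use bilin_left in \<open>auto simp: inner_pure bilin_def\<close>)
next
  fix a b b' assume x: "a \<in> carrier A" "b \<in> carrier B" "b' \<in> carrier B"
  then show "inner w a (b \<oplus>\<^bsub>B\<^esub> b') = inner w a b \<oplus>\<^bsub>Z\<^esub> inner w a b'"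
    by (intro Y.T_homs_eq[OF inner_hom hom_sum[OF inner_hom inner_hom] _ w])
      (use bilin_left in \<open>auto simp: inner_pure bilin_def\<close>)
next
  fix c a b assume x: "c \<in> carrier K" "a \<in> carrier A" "b \<in> carrier B"
  then show "inner w (c \<odot>\<^bsub>A\<^esub> a) b = c \<odot>\<^bsub>Z\<^esub> inner w a b" "inner w a (c \<odot>\<^bsub>B\<^esub> b) = c \<odot>\<^bsub>Z\<^esub> inner w a b"
    by (intro Y.T_homs_eq[OF inner_hom hom_scale[OF inner_hom] _ w];
        use bilin_left in \<open>auto simp: inner_pure bilin_def\<close>)+
qed

lemma double_lift_closed: "\<lbrakk>z \<in> carrier X.T; w \<in> carrier Y.T\<rbrakk> \<Longrightarrow> double_lift z w \<in> carrier Z"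
  unfolding double_lift_def by (rule X.tensor_lift_closed[OF Z.module_axioms inner_bilin])

lemma double_lift_add_left: "\<lbrakk>z \<in> carrier X.T; z' \<in> carrier X.T; w \<in> carrier Y.T\<rbrakk> \<Longrightarrow>
    double_lift (z \<oplus>\<^bsub>X.T\<^esub> z') w = double_lift z w \<oplus>\<^bsub>Z\<^esub> double_lift z' w"
  unfolding double_lift_def by (rule X.tensor_lift_add[OF Z.module_axioms inner_bilin])

lemma double_lift_pure: "\<lbrakk>a \<in> carrier A; b \<in> carrier B; c \<in> carrier C; d \<in> carrier D\<rbrakk> \<Longrightarrow>
    double_lift (X.pure a b) (Y.pure c d) = \<gamma> a b c d"
  unfolding double_lift_def by (subst X.tensor_lift_pure[OF Z.module_axioms inner_bilin]) (auto simp: inner_pure)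

lemma double_lift_pure_left: "\<lbrakk>a \<in> carrier A; b \<in> carrier B; w \<in> carrier Y.T\<rbrakk> \<Longrightarrow>
    double_lift (X.pure a b) w = inner w a b"
  unfolding double_lift_def by (rule X.tensor_lift_pure[OF Z.module_axioms inner_bilin])

lemma double_lift_hom_left:
  "w \<in> carrier Y.T \<Longrightarrow> abelian_group_hom X.T Z (\<lambda>z. double_lift z w)"
  by (rule add_homI) (auto simp: double_lift_closed double_lift_add_left X.T_abelian_group Z.abelian_group_axioms)

text \<open>By construction the double lift is additive in its first argument only. Both sides being
  additive in \<open>z\<close>, it is enough to take \<open>z\<close> pure, and there the claim is
  additivity of the inner lift.\<close>

lemma double_lift_add_right:
  assumes "z \<in> carrier X.T" "w \<in> carrier Y.T" "w' \<in> carrier Y.T"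
  shows "double_lift z (w \<oplus>\<^bsub>Y.T\<^esub> w') = double_lift z w \<oplus>\<^bsub>Z\<^esub> double_lift z w'"
proof -
  interpret h: abelian_group_hom X.T Z "\<lambda>z. double_lift z w" by (rule double_lift_hom_left) fact
  interpret h': abelian_group_hom X.T Z "\<lambda>z. double_lift z w'" by (rule double_lift_hom_left) fact
  have "abelian_group_hom X.T Z (\<lambda>z. double_lift z w \<oplus>\<^bsub>Z\<^esub> double_lift z w')"
    by (rule add_homI) (auto simp: X.T_abelian_group Z.abelian_group_axioms Z.a_ac)
  then show ?thesis
    by (intro X.T_homs_eq[OF double_lift_hom_left _ _ assms(1)])
      (use assms in \<open>auto simp: double_lift_pure_left inner_add\<close>)
qed

lemma double_lift_hom_right:
  "z \<in> carrier X.T \<Longrightarrow> abelian_group_hom Y.T Z (double_lift z)"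
  by (rule add_homI) (auto simp: double_lift_closed double_lift_add_right Y.T_abelian_group Z.abelian_group_axioms)

end

section \<open>Finite bases\<close>

text \<open>The coordinates are part of the data: \<open>co_q\<close> and \<open>co_expand\<close>
  say that they form the dual basis of \<open>q\<close>. Having them as functions makes them
  available for defining bilinear maps.\<close>

locale fin_basis = module K A for K :: "('a, 'c) ring_scheme" and A :: "('a, 'x) module" +
  fixes J :: "'j set" and q :: "'j \<Rightarrow> 'x" and co :: "'x \<Rightarrow> 'j \<Rightarrow> 'a"
  assumes fin: "finite J"
    and q_closed: "i \<in> J \<Longrightarrow> q i \<in> carrier A"
    and co_closed: "\<lbrakk>a \<in> carrier A; i \<in> J\<rbrakk> \<Longrightarrow> co a i \<in> carrier K"
    and co_add: "\<lbrakk>a \<in> carrier A; b \<in> carrier A; i \<in> J\<rbrakk> \<Longrightarrow> co (a \<oplus>\<^bsub>A\<^esub> b) i = co a i \<oplus>\<^bsub>K\<^esub> co b i"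
    and co_smult: "\<lbrakk>c \<in> carrier K; a \<in> carrier A; i \<in> J\<rbrakk> \<Longrightarrow> co (c \<odot>\<^bsub>A\<^esub> a) i = c \<otimes>\<^bsub>K\<^esub> co a i"
    and co_q: "\<lbrakk>i \<in> J; j \<in> J\<rbrakk> \<Longrightarrow> co (q i) j = (if i = j then \<one>\<^bsub>K\<^esub> else \<zero>\<^bsub>K\<^esub>)"
    and co_expand: "a \<in> carrier A \<Longrightarrow> (\<Oplus>\<^bsub>A\<^esub>i\<in>J. co a i \<odot>\<^bsub>A\<^esub> q i) = a"

lemma (in fin_basis) co_hom: "i \<in> J \<Longrightarrow> abelian_group_hom A K (\<lambda>a. co a i)"
  by (rule add_homI) (auto simp: co_closed co_add M.abelian_group_axioms R.abelian_group_axioms)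

lemma (in fin_basis) co_zero: "i \<in> J \<Longrightarrow> co \<zero>\<^bsub>A\<^esub> i = \<zero>\<^bsub>K\<^esub>"
  using abelian_group_hom.hom_zero[OF co_hom] .

locale fin_basis_tensor = fin_basis K A J q co + tensor_context K A B
  for K :: "('a, 'c) ring_scheme" and A :: "('a, 'x) module"
    and J :: "'j set" and q :: "'j \<Rightarrow> 'x" and co :: "'x \<Rightarrow> 'j \<Rightarrow> 'a" and B :: "('a, 'y) module"
begin

text \<open>A basis of the left factor splits the tensor product into copies of \<open>B\<close>,
  one for each index; this is the projection onto the copy with index \<open>j\<close>.\<close>

definition coord where "coord j = tensor_lift K A B B (\<lambda>a b. co a j \<odot>\<^bsub>B\<^esub> b)"

lemma coord_bilin: "j \<in> J \<Longrightarrow> bilin K A B B (\<lambda>a b. co a j \<odot>\<^bsub>B\<^esub> b)"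
  by (auto simp: bilin_def co_closed co_add co_smult B.smult_l_distr B.smult_r_distr
      B.smult_assoc1[symmetric] R.m_comm)

lemma coord_hom: "j \<in> J \<Longrightarrow> abelian_group_hom T B (coord j)"
  unfolding coord_def by (rule tensor_lift_hom[OF B.module_axioms coord_bilin])

lemma coord_pure: "\<lbrakk>j \<in> J; a \<in> carrier A; b \<in> carrier B\<rbrakk> \<Longrightarrow> coord j (pure a b) = co a j \<odot>\<^bsub>B\<^esub> b"
  unfolding coord_def by (rule tensor_lift_pure[OF B.module_axioms coord_bilin])

lemma coord_closed: "\<lbrakk>j \<in> J; z \<in> carrier T\<rbrakk> \<Longrightarrow> coord j z \<in> carrier B"
  unfolding coord_def by (rule tensor_lift_closed[OF B.module_axioms coord_bilin])

lemma pure_hom_left: "b \<in> carrier B \<Longrightarrow> abelian_group_hom A T (\<lambda>a. pure a b)"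
  by (rule add_homI) (use pure_bilin in \<open>auto simp: bilin_def M.abelian_group_axioms T_abelian_group\<close>)

lemma pure_hom_right: "a \<in> carrier A \<Longrightarrow> abelian_group_hom B T (\<lambda>b. pure a b)"
  by (rule add_homI) (use pure_bilin in \<open>auto simp: bilin_def B.abelian_group_axioms T_abelian_group\<close>)

lemma coord_sum:
  assumes b: "\<And>i. i \<in> J \<Longrightarrow> b i \<in> carrier B" and j: "j \<in> J"
  shows "coord j (\<Oplus>\<^bsub>T\<^esub>i\<in>J. pure (q i) (b i)) = b j"
proof -
  have "coord j (\<Oplus>\<^bsub>T\<^esub>i\<in>J. pure (q i) (b i)) = (\<Oplus>\<^bsub>B\<^esub>i\<in>J. coord j (pure (q i) (b i)))"
    using b by (intro abelian_group_hom.hom_finsum[OF coord_hom[OF j]]) (auto simp: q_closed)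
  also have "\<dots> = coord j (pure (q j) (b j))"
    using b j by (intro B.finsum_single) (auto simp: fin coord_pure q_closed co_q B.smult_l_null)
  finally show ?thesis using b j by (simp add: coord_pure q_closed co_q)
qed

text \<open>Additivity in \<open>z\<close> leaves the case of a pure tensor \<open>pure a b\<close>,
  where the coordinates of \<open>a\<close> are moved back across the tensor sign and
  \<open>a\<close> is reassembled from its basis expansion.\<close>

lemma sum_coord:
  assumes "z \<in> carrier T"
  shows "(\<Oplus>\<^bsub>T\<^esub>i\<in>J. pure (q i) (coord i z)) = z"
proof (rule T_homs_eq[OF _ _ _ assms])
  show "abelian_group_hom T T (\<lambda>z. \<Oplus>\<^bsub>T\<^esub>i\<in>J. pure (q i) (coord i z))"
  proof (rule add_homI)
    fix x y assume xy: "x \<in> carrier T" "y \<in> carrier T"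
    have "(\<Oplus>\<^bsub>T\<^esub>i\<in>J. pure (q i) (coord i (x \<oplus>\<^bsub>T\<^esub> y)))
        = (\<Oplus>\<^bsub>T\<^esub>i\<in>J. pure (q i) (coord i x) \<oplus>\<^bsub>T\<^esub> pure (q i) (coord i y))"
      using xy pure_bilin abelian_group_hom.hom_add[OF coord_hom]
      by (intro T.finsum_cong') (auto simp: coord_closed q_closed bilin_def)
    also have "\<dots> = (\<Oplus>\<^bsub>T\<^esub>i\<in>J. pure (q i) (coord i x)) \<oplus>\<^bsub>T\<^esub> (\<Oplus>\<^bsub>T\<^esub>i\<in>J. pure (q i) (coord i y))"
      using xy by (intro T.finsum_addf) (auto simp: coord_closed q_closed)
    finally show "(\<Oplus>\<^bsub>T\<^esub>i\<in>J. pure (q i) (coord i (x \<oplus>\<^bsub>T\<^esub> y)))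
        = (\<Oplus>\<^bsub>T\<^esub>i\<in>J. pure (q i) (coord i x)) \<oplus>\<^bsub>T\<^esub> (\<Oplus>\<^bsub>T\<^esub>i\<in>J. pure (q i) (coord i y))" .
  qed (auto simp: T_abelian_group coord_closed q_closed intro!: T.finsum_closed)
  show "abelian_group_hom T T (\<lambda>z. z)" by (rule add_homI) (auto simp: T_abelian_group)
  fix a b assume ab: "a \<in> carrier A" "b \<in> carrier B"
  have "(\<Oplus>\<^bsub>T\<^esub>i\<in>J. pure (q i) (coord i (pure a b))) = (\<Oplus>\<^bsub>T\<^esub>i\<in>J. pure (co a i \<odot>\<^bsub>A\<^esub> q i) b)"
    using ab pure_bilin by (intro T.finsum_cong') (auto simp: coord_pure q_closed co_closed bilin_def)
  also have "\<dots> = pure (\<Oplus>\<^bsub>A\<^esub>i\<in>J. co a i \<odot>\<^bsub>A\<^esub> q i) b"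
    using ab by (intro abelian_group_hom.hom_finsum[OF pure_hom_left, symmetric]) (auto simp: co_closed q_closed)
  finally show "(\<Oplus>\<^bsub>T\<^esub>i\<in>J. pure (q i) (coord i (pure a b))) = pure a b" using ab by (simp add: co_expand)
qed

end

section \<open>Matrix algebras\<close>

lemma mat_alg_simps:
  "carrier (mat_alg m A) = {..<m} \<times> {..<m} \<rightarrow>\<^sub>E carrier A"
  by (simp add: mat_alg_def)

lemma mat_alg_apply:
  assumes "i < m" "j < m"
  shows "\<zero>\<^bsub>mat_alg m A\<^esub> (i, j) = \<zero>\<^bsub>A\<^esub>"
    and "(f \<oplus>\<^bsub>mat_alg m A\<^esub> g) (i, j) = f (i, j) \<oplus>\<^bsub>A\<^esub> g (i, j)"
    and "(c \<odot>\<^bsub>mat_alg m A\<^esub> f) (i, j) = c \<odot>\<^bsub>A\<^esub> f (i, j)"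
    and "(f \<otimes>\<^bsub>mat_alg m A\<^esub> g) (i, j) = (\<Oplus>\<^bsub>A\<^esub>l\<in>{..<m}. f (i, l) \<otimes>\<^bsub>A\<^esub> g (l, j))"
    and "\<one>\<^bsub>mat_alg m A\<^esub> (i, j) = (if i = j then \<one>\<^bsub>A\<^esub> else \<zero>\<^bsub>A\<^esub>)"
  using assms by (simp_all add: mat_alg_def)

lemma mat_alg_eqI:
  "\<lbrakk>f \<in> carrier (mat_alg m A); g \<in> carrier (mat_alg m A);
    \<And>i j. \<lbrakk>i < m; j < m\<rbrakk> \<Longrightarrow> f (i, j) = g (i, j)\<rbrakk> \<Longrightarrow> f = g"
  by (rule PiE_ext[of _ "{..<m} \<times> {..<m}" "\<lambda>_. carrier A"]) (auto simp: mat_alg_simps)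

locale mat_context = module K A for K :: "('a, 'c) ring_scheme" and A :: "('a, 'x) module" +
  fixes m :: nat
begin

abbreviation "Mt \<equiv> mat_alg m A"

lemma mat_mem: "\<lbrakk>f \<in> carrier Mt; i < m; j < m\<rbrakk> \<Longrightarrow> f (i, j) \<in> carrier A"
  by (auto simp: mat_alg_simps)

lemma mat_closed:
  "\<zero>\<^bsub>Mt\<^esub> \<in> carrier Mt"
  "\<lbrakk>f \<in> carrier Mt; g \<in> carrier Mt\<rbrakk> \<Longrightarrow> f \<oplus>\<^bsub>Mt\<^esub> g \<in> carrier Mt"
  "\<lbrakk>c \<in> carrier K; f \<in> carrier Mt\<rbrakk> \<Longrightarrow> c \<odot>\<^bsub>Mt\<^esub> f \<in> carrier Mt"
  by (auto simp: mat_alg_def)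

lemma mat_abelian_group: "abelian_group Mt"
proof (rule abelian_groupI)
  fix f assume f: "f \<in> carrier Mt"
  have g: "(\<ominus>\<^bsub>K\<^esub> \<one>\<^bsub>K\<^esub>) \<odot>\<^bsub>Mt\<^esub> f \<in> carrier Mt" using f by (intro mat_closed) auto
  moreover have "(\<ominus>\<^bsub>K\<^esub> \<one>\<^bsub>K\<^esub>) \<odot>\<^bsub>Mt\<^esub> f \<oplus>\<^bsub>Mt\<^esub> f = \<zero>\<^bsub>Mt\<^esub>"
    by (rule mat_alg_eqI[where m=m and A=A])
      (use f g in \<open>auto simp: mat_closed mat_alg_apply mat_mem smult_l_minus M.l_neg\<close>)
  ultimately show "\<exists>g\<in>carrier Mt. g \<oplus>\<^bsub>Mt\<^esub> f = \<zero>\<^bsub>Mt\<^esub>" by blast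
  show "\<zero>\<^bsub>Mt\<^esub> \<oplus>\<^bsub>Mt\<^esub> f = f"
    by (rule mat_alg_eqI[where m=m and A=A]) (use f in \<open>auto simp: mat_closed mat_alg_apply mat_mem\<close>)
next
  fix f g h assume fgh: "f \<in> carrier Mt" "g \<in> carrier Mt" "h \<in> carrier Mt"
  show "f \<oplus>\<^bsub>Mt\<^esub> g \<oplus>\<^bsub>Mt\<^esub> h = f \<oplus>\<^bsub>Mt\<^esub> (g \<oplus>\<^bsub>Mt\<^esub> h)"
    by (rule mat_alg_eqI[where m=m and A=A]) (use fgh in \<open>auto simp: mat_closed mat_alg_apply mat_mem M.a_assoc\<close>)
next
  fix f g assume fg: "f \<in> carrier Mt" "g \<in> carrier Mt"
  show "f \<oplus>\<^bsub>Mt\<^esub> g = g \<oplus>\<^bsub>Mt\<^esub> f"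
    by (rule mat_alg_eqI[where m=m and A=A]) (use fg in \<open>auto simp: mat_closed mat_alg_apply mat_mem M.a_comm\<close>)
qed (auto simp: mat_closed)

lemma mat_module: "module K Mt"
proof (rule moduleI)
  fix c d f g assume x: "c \<in> carrier K" "d \<in> carrier K" "f \<in> carrier Mt" "g \<in> carrier Mt"
  show "(c \<oplus>\<^bsub>K\<^esub> d) \<odot>\<^bsub>Mt\<^esub> f = c \<odot>\<^bsub>Mt\<^esub> f \<oplus>\<^bsub>Mt\<^esub> d \<odot>\<^bsub>Mt\<^esub> f"
    by (rule mat_alg_eqI[where m=m and A=A]) (use x in \<open>auto simp: mat_closed mat_alg_apply mat_mem smult_l_distr\<close>)
  show "c \<odot>\<^bsub>Mt\<^esub> (f \<oplus>\<^bsub>Mt\<^esub> g) = c \<odot>\<^bsub>Mt\<^esub> f \<oplus>\<^bsub>Mt\<^esub> c \<odot>\<^bsub>Mt\<^esub> g"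
    by (rule mat_alg_eqI[where m=m and A=A]) (use x in \<open>auto simp: mat_closed mat_alg_apply mat_mem smult_r_distr\<close>)
  show "(c \<otimes>\<^bsub>K\<^esub> d) \<odot>\<^bsub>Mt\<^esub> f = c \<odot>\<^bsub>Mt\<^esub> (d \<odot>\<^bsub>Mt\<^esub> f)"
    by (rule mat_alg_eqI[where m=m and A=A]) (use x in \<open>auto simp: mat_closed mat_alg_apply mat_mem smult_assoc1\<close>)
next
  fix f assume f: "f \<in> carrier Mt"
  show "\<one>\<^bsub>K\<^esub> \<odot>\<^bsub>Mt\<^esub> f = f"
    by (rule mat_alg_eqI[where m=m and A=A]) (use f in \<open>auto simp: mat_closed mat_alg_apply mat_mem\<close>)
qed (auto simp: mat_closed mat_abelian_group R.is_cring)

sublocale Mt: module K Mt by (rule mat_module)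

definition single :: "nat \<Rightarrow> nat \<Rightarrow> 'x \<Rightarrow> nat \<times> nat \<Rightarrow> 'x" where
  "single i j x = (\<lambda>p\<in>{..<m} \<times> {..<m}. if p = (i, j) then x else \<zero>\<^bsub>A\<^esub>)"

lemma single_closed: "x \<in> carrier A \<Longrightarrow> single i j x \<in> carrier Mt"
  by (auto simp: single_def mat_alg_simps)

lemma single_apply: "\<lbrakk>k < m; l < m\<rbrakk> \<Longrightarrow> single i j x (k, l) = (if k = i \<and> l = j then x else \<zero>\<^bsub>A\<^esub>)"
  by (auto simp: single_def)

lemma single_hom: "abelian_group_hom A Mt (single i j)"
proof (rule add_homI)
  fix x y assume "x \<in> carrier A" "y \<in> carrier A"
  then show "single i j (x \<oplus>\<^bsub>A\<^esub> y) = single i j x \<oplus>\<^bsub>Mt\<^esub> single i j y"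
    by (intro mat_alg_eqI[where m=m and A=A]) (auto simp: mat_closed mat_alg_apply single_closed single_apply)
qed (auto simp: single_closed M.abelian_group_axioms mat_abelian_group)

lemma mat_eval_hom: "\<lbrakk>i < m; j < m\<rbrakk> \<Longrightarrow> abelian_group_hom Mt A (\<lambda>f. f (i, j))"
  by (rule add_homI) (auto simp: mat_mem mat_alg_apply M.abelian_group_axioms mat_abelian_group)

lemma mat_expand:
  assumes f: "f \<in> carrier Mt"
  shows "(\<Oplus>\<^bsub>Mt\<^esub>p\<in>{..<m} \<times> {..<m}. single (fst p) (snd p) (f p)) = f"
proof (rule mat_alg_eqI)
  have c: "single (fst p) (snd p) (f p) \<in> carrier Mt" if "p \<in> {..<m} \<times> {..<m}" for p
    using that f by (intro single_closed) (auto simp: mat_mem)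
  then show "(\<Oplus>\<^bsub>Mt\<^esub>p\<in>{..<m} \<times> {..<m}. single (fst p) (snd p) (f p)) \<in> carrier Mt"
    by (auto intro!: Mt.finsum_closed)
  fix i j assume ij: "i < m" "j < m"
  have "(\<Oplus>\<^bsub>Mt\<^esub>p\<in>{..<m} \<times> {..<m}. single (fst p) (snd p) (f p)) (i, j)
      = (\<Oplus>\<^bsub>A\<^esub>p\<in>{..<m} \<times> {..<m}. single (fst p) (snd p) (f p) (i, j))"
    using c by (intro abelian_group_hom.hom_finsum[OF mat_eval_hom]) (auto simp: ij)
  also have "\<dots> = single (fst (i, j)) (snd (i, j)) (f (i, j)) (i, j)"
    using ij f by (intro M.finsum_single) (auto simp: single_apply mat_mem)
  finally show "(\<Oplus>\<^bsub>Mt\<^esub>p\<in>{..<m} \<times> {..<m}. single (fst p) (snd p) (f p)) (i, j) = f (i, j)"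
    using ij by (simp add: single_apply)
qed (rule f)

text \<open>Allows products of matrices to be tested on single entries taken from an additive
  generating set of the coefficients, such as scalar multiples of diagrams.\<close>

lemma mat_add_span:
  assumes G: "\<And>x. x \<in> carrier A \<Longrightarrow> x \<in> add_span A G" "G \<subseteq> carrier A" and f: "f \<in> carrier Mt"
  shows "f \<in> add_span Mt {single i j x | i j x. i < m \<and> j < m \<and> x \<in> G}" (is "_ \<in> add_span Mt ?G")
proof -
  have "single i j x \<in> add_span Mt ?G" if "i < m" "j < m" "x \<in> add_span A G" for i j x
    using that(3)
  proof (induction rule: add_span.induct)
    case add_span_zero
    then show ?case
      using abelian_group_hom.hom_zero[OF single_hom, of i j] add_span.add_span_zero[of Mt] by simp
  next
    case (add_span_gen s)
    then show ?case using that by (auto intro!: add_span.add_span_gen)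
  next
    case (add_span_add x y)
    then show ?case using abelian_group_hom.hom_add[OF single_hom, of x y i j] M.add_span_carrier[OF G(2)]
      by (auto intro: add_span.add_span_add)
  qed
  then have "(\<Oplus>\<^bsub>Mt\<^esub>p\<in>{..<m} \<times> {..<m}. single (fst p) (snd p) (f p)) \<in> add_span Mt ?G"
    using f by (intro Mt.add_span_finsum) (auto simp: G mat_mem single_closed)
  then show ?thesis using f by (simp add: mat_expand)
qed

end

locale mat_alg_context = bilinear_alg K A + mat_context K A m
  for K :: "('a, 'c) ring_scheme" and A :: "('a, 'x) module" and m :: nat
begin

lemma mat_mult_closed:
  assumes "f \<in> carrier Mt" "g \<in> carrier Mt" shows "f \<otimes>\<^bsub>Mt\<^esub> g \<in> carrier Mt"
  using assms by (auto simp: mat_alg_def alg_mult_closed PiE_iff intro!: M.finsum_closed)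

lemma mat_bilinear_alg: "bilinear_alg K Mt"
proof (intro bilinear_alg.intro bilinear_alg_axioms.intro mat_module)
  fix f g h assume fgh: "f \<in> carrier Mt" "g \<in> carrier Mt" "h \<in> carrier Mt"
  show "(f \<oplus>\<^bsub>Mt\<^esub> g) \<otimes>\<^bsub>Mt\<^esub> h = f \<otimes>\<^bsub>Mt\<^esub> h \<oplus>\<^bsub>Mt\<^esub> g \<otimes>\<^bsub>Mt\<^esub> h"
  proof (rule mat_alg_eqI[where m=m and A=A])
    fix i j assume ij: "i < m" "j < m"
    have "((f \<oplus>\<^bsub>Mt\<^esub> g) \<otimes>\<^bsub>Mt\<^esub> h) (i, j) = (\<Oplus>\<^bsub>A\<^esub>l\<in>{..<m}. f (i, l) \<otimes>\<^bsub>A\<^esub> h (l, j) \<oplus>\<^bsub>A\<^esub> g (i, l) \<otimes>\<^bsub>A\<^esub> h (l, j))"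
      unfolding mat_alg_apply(4)[OF ij] using fgh ij
      by (intro M.finsum_cong') (auto simp: mat_alg_apply mat_mem alg_l_distr alg_mult_closed)
    also have "\<dots> = (f \<otimes>\<^bsub>Mt\<^esub> h \<oplus>\<^bsub>Mt\<^esub> g \<otimes>\<^bsub>Mt\<^esub> h) (i, j)"
      unfolding mat_alg_apply(2,4)[OF ij] using fgh ij
      by (intro M.finsum_addf) (auto simp: mat_mem alg_mult_closed)
    finally show "((f \<oplus>\<^bsub>Mt\<^esub> g) \<otimes>\<^bsub>Mt\<^esub> h) (i, j) = (f \<otimes>\<^bsub>Mt\<^esub> h \<oplus>\<^bsub>Mt\<^esub> g \<otimes>\<^bsub>Mt\<^esub> h) (i, j)" .
  qed (use fgh in \<open>auto simp: mat_closed mat_mult_closed\<close>)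
  show "h \<otimes>\<^bsub>Mt\<^esub> (f \<oplus>\<^bsub>Mt\<^esub> g) = h \<otimes>\<^bsub>Mt\<^esub> f \<oplus>\<^bsub>Mt\<^esub> h \<otimes>\<^bsub>Mt\<^esub> g"
  proof (rule mat_alg_eqI[where m=m and A=A])
    fix i j assume ij: "i < m" "j < m"
    have "(h \<otimes>\<^bsub>Mt\<^esub> (f \<oplus>\<^bsub>Mt\<^esub> g)) (i, j) = (\<Oplus>\<^bsub>A\<^esub>l\<in>{..<m}. h (i, l) \<otimes>\<^bsub>A\<^esub> f (l, j) \<oplus>\<^bsub>A\<^esub> h (i, l) \<otimes>\<^bsub>A\<^esub> g (l, j))"
      unfolding mat_alg_apply(4)[OF ij] using fgh ij
      by (intro M.finsum_cong') (auto simp: mat_alg_apply mat_mem alg_r_distr alg_mult_closed)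
    also have "\<dots> = (h \<otimes>\<^bsub>Mt\<^esub> f \<oplus>\<^bsub>Mt\<^esub> h \<otimes>\<^bsub>Mt\<^esub> g) (i, j)"
      unfolding mat_alg_apply(2,4)[OF ij] using fgh ij
      by (intro M.finsum_addf) (auto simp: mat_mem alg_mult_closed)
    finally show "(h \<otimes>\<^bsub>Mt\<^esub> (f \<oplus>\<^bsub>Mt\<^esub> g)) (i, j) = (h \<otimes>\<^bsub>Mt\<^esub> f \<oplus>\<^bsub>Mt\<^esub> h \<otimes>\<^bsub>Mt\<^esub> g) (i, j)" .
  qed (use fgh in \<open>auto simp: mat_closed mat_mult_closed\<close>)
next
  fix c f g assume c: "c \<in> carrier K" and fg: "f \<in> carrier Mt" "g \<in> carrier Mt"
  show "(c \<odot>\<^bsub>Mt\<^esub> f) \<otimes>\<^bsub>Mt\<^esub> g = c \<odot>\<^bsub>Mt\<^esub> (f \<otimes>\<^bsub>Mt\<^esub> g)"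
  proof (rule mat_alg_eqI[where m=m and A=A])
    fix i j assume ij: "i < m" "j < m"
    have "((c \<odot>\<^bsub>Mt\<^esub> f) \<otimes>\<^bsub>Mt\<^esub> g) (i, j) = (\<Oplus>\<^bsub>A\<^esub>l\<in>{..<m}. c \<odot>\<^bsub>A\<^esub> (f (i, l) \<otimes>\<^bsub>A\<^esub> g (l, j)))"
      unfolding mat_alg_apply(4)[OF ij] using fg c ij
      by (intro M.finsum_cong') (auto simp: mat_alg_apply mat_mem alg_smult_left alg_mult_closed)
    also have "\<dots> = (c \<odot>\<^bsub>Mt\<^esub> (f \<otimes>\<^bsub>Mt\<^esub> g)) (i, j)"
      unfolding mat_alg_apply(3,4)[OF ij] using fg c ij
      by (intro finsum_smult_ldistr[symmetric]) (auto simp: mat_mem alg_mult_closed)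
    finally show "((c \<odot>\<^bsub>Mt\<^esub> f) \<otimes>\<^bsub>Mt\<^esub> g) (i, j) = (c \<odot>\<^bsub>Mt\<^esub> (f \<otimes>\<^bsub>Mt\<^esub> g)) (i, j)" .
  qed (use fg c in \<open>auto simp: mat_closed mat_mult_closed\<close>)
  show "f \<otimes>\<^bsub>Mt\<^esub> (c \<odot>\<^bsub>Mt\<^esub> g) = c \<odot>\<^bsub>Mt\<^esub> (f \<otimes>\<^bsub>Mt\<^esub> g)"
  proof (rule mat_alg_eqI[where m=m and A=A])
    fix i j assume ij: "i < m" "j < m"
    have "(f \<otimes>\<^bsub>Mt\<^esub> (c \<odot>\<^bsub>Mt\<^esub> g)) (i, j) = (\<Oplus>\<^bsub>A\<^esub>l\<in>{..<m}. c \<odot>\<^bsub>A\<^esub> (f (i, l) \<otimes>\<^bsub>A\<^esub> g (l, j)))"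
      unfolding mat_alg_apply(4)[OF ij] using fg c ij
      by (intro M.finsum_cong') (auto simp: mat_alg_apply mat_mem alg_smult_right alg_mult_closed)
    also have "\<dots> = (c \<odot>\<^bsub>Mt\<^esub> (f \<otimes>\<^bsub>Mt\<^esub> g)) (i, j)"
      unfolding mat_alg_apply(3,4)[OF ij] using fg c ij
      by (intro finsum_smult_ldistr[symmetric]) (auto simp: mat_mem alg_mult_closed)
    finally show "(f \<otimes>\<^bsub>Mt\<^esub> (c \<odot>\<^bsub>Mt\<^esub> g)) (i, j) = (c \<odot>\<^bsub>Mt\<^esub> (f \<otimes>\<^bsub>Mt\<^esub> g)) (i, j)" .
  qed (use fg c in \<open>auto simp: mat_closed mat_mult_closed\<close>)
qed (rule mat_mult_closed)

lemma single_mult: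
  assumes x: "x \<in> carrier A" "y \<in> carrier A" and ij: "i < m" "j < m" "k < m" "l < m"
  shows "single i j x \<otimes>\<^bsub>Mt\<^esub> single k l y = (if j = k then single i l (x \<otimes>\<^bsub>A\<^esub> y) else \<zero>\<^bsub>Mt\<^esub>)"
proof (rule mat_alg_eqI[where m=m and A=A])
  interpret biadditive_ring A by (rule biadditive_ring)
  fix a b assume ab: "a < m" "b < m"
  have "(single i j x \<otimes>\<^bsub>Mt\<^esub> single k l y) (a, b)
     = (\<Oplus>\<^bsub>A\<^esub>c\<in>{..<m}. single i j x (a, c) \<otimes>\<^bsub>A\<^esub> single k l y (c, b))"
    using ab by (rule mat_alg_apply)
  also have "\<dots> = single i j x (a, j) \<otimes>\<^bsub>A\<^esub> single k l y (j, b)"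
    using x ij ab by (intro M.finsum_single) (auto simp: single_apply alg_mult_closed mult_zero_left)
  also have "\<dots> = (if j = k then single i l (x \<otimes>\<^bsub>A\<^esub> y) else \<zero>\<^bsub>Mt\<^esub>) (a, b)"
    using x ij ab by (auto simp: single_apply mat_alg_apply mult_zero_left mult_zero_right)
  finally show "(single i j x \<otimes>\<^bsub>Mt\<^esub> single k l y) (a, b)
     = (if j = k then single i l (x \<otimes>\<^bsub>A\<^esub> y) else \<zero>\<^bsub>Mt\<^esub>) (a, b)" .
qed (use x in \<open>auto simp: single_closed mat_closed mat_mult_closed alg_mult_closed\<close>)

lemma mat_unital_alg:
  assumes "unital_alg K A" shows "unital_alg K Mt"
proof -
  interpret A: unital_alg K A by fact
  interpret biadditive_ring A by (rule biadditive_ring)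
  have one: "\<one>\<^bsub>Mt\<^esub> \<in> carrier Mt" by (auto simp: mat_alg_def A.alg_one_closed)
  show ?thesis
  proof (intro unital_alg.intro unital_alg_axioms.intro mat_bilinear_alg one)
    fix f assume f: "f \<in> carrier Mt"
    show "\<one>\<^bsub>Mt\<^esub> \<otimes>\<^bsub>Mt\<^esub> f = f"
    proof (rule mat_alg_eqI[where m=m and A=A])
      fix i j assume ij: "i < m" "j < m"
      have "(\<one>\<^bsub>Mt\<^esub> \<otimes>\<^bsub>Mt\<^esub> f) (i, j) = \<one>\<^bsub>Mt\<^esub> (i, i) \<otimes>\<^bsub>A\<^esub> f (i, j)"
        unfolding mat_alg_apply(4)[OF ij] using f ij
        by (intro M.finsum_single) (auto simp: mat_alg_apply mat_mem A.alg_one_closed alg_mult_closed mult_zero_left)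
      then show "(\<one>\<^bsub>Mt\<^esub> \<otimes>\<^bsub>Mt\<^esub> f) (i, j) = f (i, j)"
        using f ij by (simp add: mat_alg_apply mat_mem A.alg_l_one)
    qed (use f one in \<open>auto simp: mat_mult_closed\<close>)
    show "f \<otimes>\<^bsub>Mt\<^esub> \<one>\<^bsub>Mt\<^esub> = f"
    proof (rule mat_alg_eqI[where m=m and A=A])
      fix i j assume ij: "i < m" "j < m"
      have "(f \<otimes>\<^bsub>Mt\<^esub> \<one>\<^bsub>Mt\<^esub>) (i, j) = f (i, j) \<otimes>\<^bsub>A\<^esub> \<one>\<^bsub>Mt\<^esub> (j, j)"
        unfolding mat_alg_apply(4)[OF ij] using f ij
        by (intro M.finsum_single) (auto simp: mat_alg_apply mat_mem A.alg_one_closed alg_mult_closed mult_zero_right)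
      then show "(f \<otimes>\<^bsub>Mt\<^esub> \<one>\<^bsub>Mt\<^esub>) (i, j) = f (i, j)"
        using f ij by (simp add: mat_alg_apply mat_mem A.alg_r_one)
    qed (use f one in \<open>auto simp: mat_mult_closed\<close>)
  qed
qed

end

lemma abelian_group_cong:
  assumes "abelian_group G" "carrier H = carrier G" "add H = add G" "\<zero>\<^bsub>H\<^esub> = \<zero>\<^bsub>G\<^esub>"
  shows "abelian_group H"
proof -
  interpret G: abelian_group G by fact
  show ?thesis
    by (rule abelian_groupI) (use assms G.a_assoc G.a_comm G.l_neg in auto)
qed

lemma module_cong:
  assumes "module K M" "carrier N = carrier M" "add N = add M" "\<zero>\<^bsub>N\<^esub> = \<zero>\<^bsub>M\<^esub>" "smult N = smult M"
  shows "module K N"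
proof -
  interpret M: module K M by fact
  show ?thesis
    by (rule moduleI)
      (simp_all add: assms M.R.is_cring M.smult_l_distr M.smult_r_distr M.smult_assoc1
        abelian_group_cong[OF M.abelian_group_axioms])
qed

section \<open>Tensor products of two algebras\<close>

lemma tensor_alg_simps:
  "carrier (tensor_alg K A B) = carrier (tensor_module K A B)"
  "add (tensor_alg K A B) = add (tensor_module K A B)"
  "\<zero>\<^bsub>tensor_alg K A B\<^esub> = \<zero>\<^bsub>tensor_module K A B\<^esub>"
  "smult (tensor_alg K A B) = smult (tensor_module K A B)"
  "\<one>\<^bsub>tensor_alg K A B\<^esub> = pure_tensor K A B \<one>\<^bsub>A\<^esub> \<one>\<^bsub>B\<^esub>"
  by (simp_all add: tensor_alg_def Let_def)

locale tensor_algs = A: bilinear_alg K A + B: bilinear_alg K B + tensor_context K A B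
  for K :: "('a, 'c) ring_scheme" and A :: "('a, 'x) module" and B :: "('a, 'y) module"
begin

abbreviation "TA \<equiv> tensor_alg K A B"

lemma tensor_mult_multilinear: "multilinear4 K A B A B T (\<lambda>a b a' b'. pure (a \<otimes>\<^bsub>A\<^esub> a') (b \<otimes>\<^bsub>B\<^esub> b'))"
proof (intro multilinear4.intro multilinear4_axioms.intro tensor_context_axioms T_module)
  note p = pure_bilin[unfolded bilin_def]
  fix c d assume "c \<in> carrier A" "d \<in> carrier B"
  then show "bilin K A B T (\<lambda>a b. pure (a \<otimes>\<^bsub>A\<^esub> c) (b \<otimes>\<^bsub>B\<^esub> d))"
    "bilin K A B T (\<lambda>a b. pure (c \<otimes>\<^bsub>A\<^esub> a) (d \<otimes>\<^bsub>B\<^esub> b))"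
    by (auto simp: bilin_def p A.alg_mult_closed B.alg_mult_closed A.alg_l_distr B.alg_l_distr
        A.alg_r_distr B.alg_r_distr A.alg_smult_left B.alg_smult_left A.alg_smult_right B.alg_smult_right)
qed

lemma TA_mult: "z \<otimes>\<^bsub>TA\<^esub> w = multilinear4.double_lift K A B A B T (\<lambda>a b a' b'. pure (a \<otimes>\<^bsub>A\<^esub> a') (b \<otimes>\<^bsub>B\<^esub> b')) z w"
  unfolding multilinear4.double_lift_def[OF tensor_mult_multilinear]
    multilinear4.inner_def[OF tensor_mult_multilinear, abs_def]
  by (simp add: tensor_alg_def Let_def)

lemma TA_mult_pure: "\<lbrakk>a \<in> carrier A; b \<in> carrier B; a' \<in> carrier A; b' \<in> carrier B\<rbrakk> \<Longrightarrow>
    pure a b \<otimes>\<^bsub>TA\<^esub> pure a' b' = pure (a \<otimes>\<^bsub>A\<^esub> a') (b \<otimes>\<^bsub>B\<^esub> b')"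
  unfolding TA_mult by (rule multilinear4.double_lift_pure[OF tensor_mult_multilinear])

lemma TA_abelian_group: "abelian_group TA"
  by (rule abelian_group_cong[OF T_abelian_group]) (simp_all add: tensor_alg_simps)

lemma TA_biadditive: "biadditive_ring TA"
proof (intro biadditive_ring.intro biadditive_ring_axioms.intro TA_abelian_group)
  note m = tensor_mult_multilinear
  fix x y z assume "x \<in> carrier TA" "y \<in> carrier TA" "z \<in> carrier TA"
  then have xyz: "x \<in> carrier T" "y \<in> carrier T" "z \<in> carrier T" by (auto simp: tensor_alg_simps)
  show "(x \<oplus>\<^bsub>TA\<^esub> y) \<otimes>\<^bsub>TA\<^esub> z = x \<otimes>\<^bsub>TA\<^esub> z \<oplus>\<^bsub>TA\<^esub> y \<otimes>\<^bsub>TA\<^esub> z"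
    "z \<otimes>\<^bsub>TA\<^esub> (x \<oplus>\<^bsub>TA\<^esub> y) = z \<otimes>\<^bsub>TA\<^esub> x \<oplus>\<^bsub>TA\<^esub> z \<otimes>\<^bsub>TA\<^esub> y"
    unfolding TA_mult tensor_alg_simps
    using multilinear4.double_lift_add_left[OF m xyz] multilinear4.double_lift_add_right[OF m xyz(3,1,2)] .
next
  fix x y assume "x \<in> carrier TA" "y \<in> carrier TA"
  then show "x \<otimes>\<^bsub>TA\<^esub> y \<in> carrier TA"
    unfolding TA_mult tensor_alg_simps using multilinear4.double_lift_closed[OF tensor_mult_multilinear] by auto
qed

end

text \<open>A basis multiplying like matrix units. Both scalar matrices and the endomorphisms of a
  module with a finite basis are instances, so one proof gives both tensor decompositions of the
  matrix algebra.\<close>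

locale mat_units = bilinear_alg K A + fin_basis K A "{..<m} \<times> {..<m}" E co
  for K :: "('a, 'c) ring_scheme" and A :: "('a, 'x) module" and m :: nat
    and E :: "nat \<times> nat \<Rightarrow> 'x" and co +
  assumes E_mult: "\<lbrakk>i < m; j < m; k < m; l < m\<rbrakk> \<Longrightarrow>
      E (i, j) \<otimes>\<^bsub>A\<^esub> E (k, l) = (if j = k then E (i, l) else \<zero>\<^bsub>A\<^esub>)"
    and E_one: "(\<Oplus>\<^bsub>A\<^esub>i\<in>{..<m}. E (i, i)) = \<one>\<^bsub>A\<^esub>"

locale mat_units_tensor = mat_units K A m E co + U: unital_alg K B
  for K :: "('a, 'c) ring_scheme" and A :: "('a, 'x) module" and m :: nat
    and E :: "nat \<times> nat \<Rightarrow> 'x" and co and B :: "('a, 'y) module"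
begin

sublocale tensor_algs K A B
  by unfold_locales

sublocale fin_basis_tensor K A "{..<m} \<times> {..<m}" E co B
  by unfold_locales

sublocale MB: mat_alg_context K B m
  by unfold_locales

abbreviation "JJ \<equiv> {..<m} \<times> {..<m}"

text \<open>The matrix with the single entry \<open>x\<close> in position \<open>p\<close> goes to
  the pure tensor of \<open>E p\<close> and \<open>x\<close>; the coordinates along the basis
  \<open>E\<close> recover the entries.\<close>

definition mat_to_tensor where "mat_to_tensor f = (\<Oplus>\<^bsub>T\<^esub>p\<in>JJ. pure (E p) (f p))"

lemma mat_mem': "\<lbrakk>f \<in> carrier MB.Mt; p \<in> JJ\<rbrakk> \<Longrightarrow> f p \<in> carrier B"
  by (auto simp: MB.mat_mem)

lemma terms_closed: "f \<in> carrier MB.Mt \<Longrightarrow> (\<lambda>p. pure (E p) (f p)) \<in> JJ \<rightarrow> carrier T"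
  by (auto simp del: mem_Sigma_iff simp: q_closed mat_mem')

lemma mat_to_tensor_hom: "abelian_group_hom MB.Mt TA mat_to_tensor"
proof (rule add_homI)
  note p = pure_bilin[unfolded bilin_def]
  fix f g assume fg: "f \<in> carrier MB.Mt" "g \<in> carrier MB.Mt"
  have "mat_to_tensor (f \<oplus>\<^bsub>MB.Mt\<^esub> g) = (\<Oplus>\<^bsub>T\<^esub>p\<in>JJ. pure (E p) (f p) \<oplus>\<^bsub>T\<^esub> pure (E p) (g p))"
    unfolding mat_to_tensor_def using fg p
    by (intro T.finsum_cong') (auto simp: q_closed MB.mat_mem mat_alg_apply)
  also have "\<dots> = mat_to_tensor f \<oplus>\<^bsub>T\<^esub> mat_to_tensor g"
    unfolding mat_to_tensor_def using fg by (intro T.finsum_addf terms_closed)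
  finally show "mat_to_tensor (f \<oplus>\<^bsub>MB.Mt\<^esub> g) = mat_to_tensor f \<oplus>\<^bsub>TA\<^esub> mat_to_tensor g"
    by (simp add: tensor_alg_simps)
next
  fix f assume "f \<in> carrier MB.Mt"
  then show "mat_to_tensor f \<in> carrier TA"
    unfolding mat_to_tensor_def tensor_alg_simps by (intro T.finsum_closed terms_closed)
qed (rule MB.mat_abelian_group TA_abelian_group)+

lemma mat_to_tensor_smult:
  assumes "c \<in> carrier K" "f \<in> carrier MB.Mt"
  shows "mat_to_tensor (c \<odot>\<^bsub>MB.Mt\<^esub> f) = c \<odot>\<^bsub>TA\<^esub> mat_to_tensor f"
proof -
  note p = pure_bilin[unfolded bilin_def]
  have "mat_to_tensor (c \<odot>\<^bsub>MB.Mt\<^esub> f) = (\<Oplus>\<^bsub>T\<^esub>p\<in>JJ. c \<odot>\<^bsub>T\<^esub> pure (E p) (f p))"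
    unfolding mat_to_tensor_def using assms p
    by (intro T.finsum_cong') (auto simp: q_closed MB.mat_mem mat_alg_apply)
  also have "\<dots> = c \<odot>\<^bsub>T\<^esub> mat_to_tensor f"
    unfolding mat_to_tensor_def using assms by (intro T.finsum_smult_ldistr[symmetric] terms_closed) auto
  finally show ?thesis by (simp add: tensor_alg_simps)
qed

lemma mat_to_tensor_single:
  assumes "i < m" "j < m" "x \<in> carrier B"
  shows "mat_to_tensor (MB.single i j x) = pure (E (i, j)) x"
proof -
  have pz: "pure (E p) \<zero>\<^bsub>B\<^esub> = \<zero>\<^bsub>T\<^esub>" if "p \<in> JJ" for p
    using abelian_group_hom.hom_zero[OF pure_hom_right[OF q_closed[OF that]]] .
  have "mat_to_tensor (MB.single i j x) = pure (E (i, j)) (MB.single i j x (i, j))"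
    unfolding mat_to_tensor_def
  proof (rule T.finsum_single)
    fix p assume "p \<in> JJ" "p \<noteq> (i, j)"
    then show "pure (E p) (MB.single i j x p) = \<zero>\<^bsub>T\<^esub>"
      using pz by (cases p) (auto simp: MB.single_apply)
  qed (use assms in \<open>auto simp: q_closed MB.single_apply\<close>)
  then show ?thesis using assms by (simp add: MB.single_apply)
qed

text \<open>Single-entry matrices generate additively. On them both products follow the rule of
  matrix units, and both vanish when the inner indices differ.\<close>

lemma mat_to_tensor_mult:
  assumes "f \<in> carrier MB.Mt" "g \<in> carrier MB.Mt"
  shows "mat_to_tensor (f \<otimes>\<^bsub>MB.Mt\<^esub> g) = mat_to_tensor f \<otimes>\<^bsub>TA\<^esub> mat_to_tensor g"
proof -
  let ?S = "{MB.single i j x | i j x. i < m \<and> j < m \<and> x \<in> carrier B}"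
  interpret h: abelian_group_hom MB.Mt TA mat_to_tensor by (rule mat_to_tensor_hom)
  have gens: "f \<in> add_span MB.Mt ?S" if "f \<in> carrier MB.Mt" for f
    by (rule MB.mat_add_span) (use that in \<open>auto intro: add_span_gen\<close>)
  have E: "E p \<in> carrier A" if "p \<in> JJ" for p using that by (rule q_closed)
  have z: "pure \<zero>\<^bsub>A\<^esub> y = \<zero>\<^bsub>T\<^esub>" if "y \<in> carrier B" for y
    using abelian_group_hom.hom_zero[OF pure_hom_left[OF that]] .
  show ?thesis
  proof (rule mult_hom_on_gens[OF _ TA_biadditive mat_to_tensor_hom, of ?S])
    show "biadditive_ring MB.Mt" by (rule bilinear_alg.biadditive_ring[OF MB.mat_bilinear_alg])
    fix s t assume "s \<in> ?S" "t \<in> ?S"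
    then obtain i j x k l y where st: "s = MB.single i j x" "t = MB.single k l y"
      and ij: "i < m" "j < m" "k < m" "l < m" and xy: "x \<in> carrier B" "y \<in> carrier B" by blast
    then show "mat_to_tensor (s \<otimes>\<^bsub>MB.Mt\<^esub> t) = mat_to_tensor s \<otimes>\<^bsub>TA\<^esub> mat_to_tensor t"
      using E z h.hom_zero
      by (auto simp: MB.single_mult mat_to_tensor_single TA_mult_pure E_mult U.alg_mult_closed tensor_alg_simps)
  qed (use assms gens MB.single_closed in auto)
qed

lemma mat_to_tensor_coord: "\<lbrakk>f \<in> carrier MB.Mt; p \<in> JJ\<rbrakk> \<Longrightarrow> coord p (mat_to_tensor f) = f p"
  unfolding mat_to_tensor_def by (rule coord_sum) (auto simp: MB.mat_mem)

lemma mat_to_tensor_one: "mat_to_tensor \<one>\<^bsub>MB.Mt\<^esub> = \<one>\<^bsub>TA\<^esub>"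
proof -
  have pz: "pure (E p) \<zero>\<^bsub>B\<^esub> = \<zero>\<^bsub>T\<^esub>" if "p \<in> JJ" for p
    using abelian_group_hom.hom_zero[OF pure_hom_right[OF q_closed[OF that]]] .
  have "\<one>\<^bsub>MB.Mt\<^esub> \<in> carrier MB.Mt" by (auto simp: mat_alg_def U.alg_one_closed)
  note o = terms_closed[OF this]
  have "mat_to_tensor \<one>\<^bsub>MB.Mt\<^esub> = (\<Oplus>\<^bsub>T\<^esub>i\<in>{..<m}. \<Oplus>\<^bsub>T\<^esub>j\<in>{..<m}. pure (E (i, j)) (\<one>\<^bsub>MB.Mt\<^esub> (i, j)))"
    unfolding mat_to_tensor_def using o by (intro T.finsum_times) auto
  also have "\<dots> = (\<Oplus>\<^bsub>T\<^esub>i\<in>{..<m}. pure (E (i, i)) \<one>\<^bsub>B\<^esub>)"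
  proof (rule T.finsum_cong')
    fix i assume i: "i \<in> {..<m}"
    have "(\<Oplus>\<^bsub>T\<^esub>j\<in>{..<m}. pure (E (i, j)) (\<one>\<^bsub>MB.Mt\<^esub> (i, j))) = pure (E (i, i)) (\<one>\<^bsub>MB.Mt\<^esub> (i, i))"
      using i pz by (intro T.finsum_single) (auto simp: mat_alg_apply q_closed U.alg_one_closed)
    then show "(\<Oplus>\<^bsub>T\<^esub>j\<in>{..<m}. pure (E (i, j)) (\<one>\<^bsub>MB.Mt\<^esub> (i, j))) = pure (E (i, i)) \<one>\<^bsub>B\<^esub>"
      using i by (simp add: mat_alg_apply)
  qed (auto simp: q_closed U.alg_one_closed)
  also have "\<dots> = pure (\<Oplus>\<^bsub>A\<^esub>i\<in>{..<m}. E (i, i)) \<one>\<^bsub>B\<^esub>"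
    by (intro abelian_group_hom.hom_finsum[OF pure_hom_left, symmetric]) (auto simp: q_closed U.alg_one_closed)
  finally show ?thesis by (simp add: E_one tensor_alg_simps)
qed

theorem mat_to_tensor_iso: "mat_to_tensor \<in> alg_iso K (mat_alg m B) (tensor_alg K A B)"
proof -
  interpret h: abelian_group_hom MB.Mt TA mat_to_tensor by (rule mat_to_tensor_hom)
  have "bij_betw mat_to_tensor (carrier MB.Mt) (carrier TA)"
  proof (rule bij_betw_byWitness[where f' = "\<lambda>z. \<lambda>p\<in>JJ. coord p z"])
    show "\<forall>f\<in>carrier MB.Mt. (\<lambda>p\<in>JJ. coord p (mat_to_tensor f)) = f"
    proof
      fix f assume f: "f \<in> carrier MB.Mt"
      have "(\<lambda>p\<in>JJ. coord p (mat_to_tensor f)) = restrict f JJ"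
        by (rule restrict_ext) (use f in \<open>simp add: mat_to_tensor_coord\<close>)
      then show "(\<lambda>p\<in>JJ. coord p (mat_to_tensor f)) = f"
        using f by (simp add: mat_alg_simps PiE_restrict)
    qed
    show "\<forall>z\<in>carrier TA. mat_to_tensor (\<lambda>p\<in>JJ. coord p z) = z"
    proof
      fix z assume z: "z \<in> carrier TA"
      then have "mat_to_tensor (\<lambda>p\<in>JJ. coord p z) = (\<Oplus>\<^bsub>T\<^esub>p\<in>JJ. pure (E p) (coord p z))"
        unfolding mat_to_tensor_def
        by (intro T.finsum_cong') (auto simp: q_closed coord_closed tensor_alg_simps)
      then show "mat_to_tensor (\<lambda>p\<in>JJ. coord p z) = z"
        using z by (simp add: sum_coord tensor_alg_simps)
    qed
    show "(\<lambda>z. \<lambda>p\<in>JJ. coord p z) ` carrier TA \<subseteq> carrier MB.Mt"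
      by (auto simp: mat_alg_simps tensor_alg_simps coord_closed simp del: restrict_apply intro!: restrict_PiE_iff[THEN iffD2])
  qed auto
  then show ?thesis
    by (auto simp: alg_iso_def ring_iso_def ring_hom_def mat_to_tensor_mult mat_to_tensor_one mat_to_tensor_smult)
qed

end

section \<open>Composites and inverses of algebra isomorphisms\<close>

lemma alg_iso_trans:
  assumes "f \<in> alg_iso K A B" "g \<in> alg_iso K B C"
  shows "g \<circ> f \<in> alg_iso K A C"
proof -
  have "g \<circ> f \<in> ring_iso A C" using assms by (auto simp: alg_iso_def intro: ring_iso_set_trans)
  moreover have "f a \<in> carrier B" if "a \<in> carrier A" for a
    using assms(1) that by (auto simp: alg_iso_def ring_iso_def ring_hom_def)
  ultimately show ?thesis using assms by (auto simp: alg_iso_def)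
qed

text \<open>A candidate for an inverse value is confirmed by applying \<open>f\<close> to it. For
  this the source has to be closed under its operations, which is what the further hypotheses
  provide.\<close>

lemma alg_iso_inv:
  assumes f: "f \<in> alg_iso K A B"
    and "\<And>x y. \<lbrakk>x \<in> carrier A; y \<in> carrier A\<rbrakk> \<Longrightarrow> x \<otimes>\<^bsub>A\<^esub> y \<in> carrier A"
    and "\<And>x y. \<lbrakk>x \<in> carrier A; y \<in> carrier A\<rbrakk> \<Longrightarrow> x \<oplus>\<^bsub>A\<^esub> y \<in> carrier A"
    and "\<And>c x. \<lbrakk>c \<in> carrier K; x \<in> carrier A\<rbrakk> \<Longrightarrow> c \<odot>\<^bsub>A\<^esub> x \<in> carrier A"
    and "\<one>\<^bsub>A\<^esub> \<in> carrier A"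
  shows "inv_into (carrier A) f \<in> alg_iso K B A"
proof -
  let ?g = "inv_into (carrier A) f"
  have b: "bij_betw f (carrier A) (carrier B)" using f by (auto simp: alg_iso_def ring_iso_def)
  note bij_betw_inv_into_right[OF b, simp] bij_betw_inv_into_left[OF b, simp]
  have g: "?g y \<in> carrier A" if "y \<in> carrier B" for y using b that by (auto simp: bij_betw_def inv_into_into)
  have e: "?g y = x" if "y = f x" "x \<in> carrier A" for x y using that by simp
  have "?g (x \<otimes>\<^bsub>B\<^esub> y) = ?g x \<otimes>\<^bsub>A\<^esub> ?g y \<and> ?g (x \<oplus>\<^bsub>B\<^esub> y) = ?g x \<oplus>\<^bsub>A\<^esub> ?g y"
    if "x \<in> carrier B" "y \<in> carrier B" for x y
    using that f g assms by (auto intro!: e simp: alg_iso_def ring_iso_def ring_hom_def)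
  moreover have "?g (c \<odot>\<^bsub>B\<^esub> x) = c \<odot>\<^bsub>A\<^esub> ?g x" if "c \<in> carrier K" "x \<in> carrier B" for c x
    using that f g assms by (auto intro!: e simp: alg_iso_def)
  moreover have "?g \<one>\<^bsub>B\<^esub> = \<one>\<^bsub>A\<^esub>" using f assms by (auto intro!: e simp: alg_iso_def ring_iso_def ring_hom_def)
  ultimately show ?thesis
    using bij_betw_inv_into[OF b] g by (auto simp: alg_iso_def ring_iso_def ring_hom_def)
qed

section \<open>Scalar matrices and endomorphisms\<close>

lemma (in cring) self_alg_unital: "unital_alg R (self_alg R)"
proof -
  have "abelian_group (self_alg R)"
    by (rule abelian_group_cong[OF abelian_group_axioms]) (simp_all add: self_alg_def)
  then have "module R (self_alg R)"
    by (rule moduleI[OF is_cring]) (simp_all add: self_alg_def l_distr r_distr m_assoc)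
  then show ?thesis
    by (intro unital_alg.intro bilinear_alg.intro bilinear_alg_axioms.intro unital_alg_axioms.intro)
      (simp_all add: self_alg_def l_distr r_distr m_ac)
qed

lemma (in cring) scalar_mat_units:
  "mat_units R (mat_alg m (self_alg R)) m
     (\<lambda>p. mat_context.single (self_alg R) m (fst p) (snd p) \<one>) (\<lambda>f p. f p)"
proof -
  interpret S: unital_alg R "self_alg R" by (rule self_alg_unital)
  interpret MS: mat_alg_context R "self_alg R" m by unfold_locales
  have s: "carrier (self_alg R) = carrier R" "add (self_alg R) = add R" "\<zero>\<^bsub>self_alg R\<^esub> = \<zero>"
    "monoid.mult (self_alg R) = monoid.mult R" "smult (self_alg R) = monoid.mult R" "\<one>\<^bsub>self_alg R\<^esub> = \<one>"
    by (simp_all add: self_alg_def)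
  have smul: "c \<odot>\<^bsub>MS.Mt\<^esub> MS.single i j \<one> = MS.single i j c" if "c \<in> carrier R" "i < m" "j < m" for c i j
    by (rule mat_alg_eqI[where m=m and A="self_alg R"])
      (use that in \<open>auto simp: mat_alg_apply MS.single_apply MS.single_closed s MS.mat_closed\<close>)
  show ?thesis
  proof (intro mat_units.intro fin_basis.intro mat_units_axioms.intro fin_basis_axioms.intro
      MS.mat_bilinear_alg MS.mat_module)
    fix f assume f: "f \<in> carrier MS.Mt"
    have "(\<Oplus>\<^bsub>MS.Mt\<^esub>p\<in>{..<m} \<times> {..<m}. f p \<odot>\<^bsub>MS.Mt\<^esub> MS.single (fst p) (snd p) \<one>)
        = (\<Oplus>\<^bsub>MS.Mt\<^esub>p\<in>{..<m} \<times> {..<m}. MS.single (fst p) (snd p) (f p))"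
      using MS.mat_mem[OF f] by (intro MS.Mt.finsum_cong') (auto simp: smul s MS.single_closed)
    then show "(\<Oplus>\<^bsub>MS.Mt\<^esub>p\<in>{..<m} \<times> {..<m}. f p \<odot>\<^bsub>MS.Mt\<^esub> MS.single (fst p) (snd p) \<one>) = f"
      using MS.mat_expand[OF f] by simp
  next
    show "(\<Oplus>\<^bsub>MS.Mt\<^esub>i\<in>{..<m}. MS.single (fst (i, i)) (snd (i, i)) \<one>) = \<one>\<^bsub>MS.Mt\<^esub>"
    proof (rule mat_alg_eqI[where m=m and A="self_alg R"])
      fix i j assume ij: "i < m" "j < m"
      have "(\<Oplus>\<^bsub>MS.Mt\<^esub>l\<in>{..<m}. MS.single (fst (l, l)) (snd (l, l)) \<one>) (i, j)
          = (\<Oplus>\<^bsub>self_alg R\<^esub>l\<in>{..<m}. MS.single l l \<one> (i, j))"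
        using ij by (subst abelian_group_hom.hom_finsum[OF MS.mat_eval_hom]) (auto simp: MS.single_closed s)
      also have "\<dots> = MS.single i i \<one> (i, j)"
        using ij by (intro S.M.finsum_single) (auto simp: MS.single_apply s)
      finally show "(\<Oplus>\<^bsub>MS.Mt\<^esub>l\<in>{..<m}. MS.single (fst (l, l)) (snd (l, l)) \<one>) (i, j) = \<one>\<^bsub>MS.Mt\<^esub> (i, j)"
        using ij by (auto simp: MS.single_apply mat_alg_apply s)
    next
      show "\<one>\<^bsub>MS.Mt\<^esub> \<in> carrier MS.Mt" by (auto simp: mat_alg_def s)
    qed (auto simp: MS.single_closed s intro!: MS.Mt.finsum_closed)
  qed (use MS.mat_mem in \<open>auto simp: s MS.single_closed MS.single_apply mat_alg_apply MS.single_mult split: if_splits\<close>)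
qed


section \<open>Endomorphism algebras and bases of the underlying module\<close>

locale end_context = module K Q for K :: "('a, 'c) ring_scheme" and Q :: "('a, 'q) module"
begin

abbreviation "EQ \<equiv> end_alg K Q"

lemma end_carrier_iff:
  "f \<in> carrier EQ \<longleftrightarrow> f \<in> extensional (carrier Q) \<and> (\<forall>x\<in>carrier Q. f x \<in> carrier Q) \<and>
     (\<forall>x\<in>carrier Q. \<forall>y\<in>carrier Q. f (x \<oplus>\<^bsub>Q\<^esub> y) = f x \<oplus>\<^bsub>Q\<^esub> f y) \<and>
     (\<forall>c\<in>carrier K. \<forall>x\<in>carrier Q. f (c \<odot>\<^bsub>Q\<^esub> x) = c \<odot>\<^bsub>Q\<^esub> f x)"
  by (auto simp: end_alg_def PiE_iff)

lemma end_apply: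
  assumes "x \<in> carrier Q"
  shows "\<zero>\<^bsub>EQ\<^esub> x = \<zero>\<^bsub>Q\<^esub>" "(f \<oplus>\<^bsub>EQ\<^esub> g) x = f x \<oplus>\<^bsub>Q\<^esub> g x" "(c \<odot>\<^bsub>EQ\<^esub> f) x = c \<odot>\<^bsub>Q\<^esub> f x"
    "(f \<otimes>\<^bsub>EQ\<^esub> g) x = f (g x)" "\<one>\<^bsub>EQ\<^esub> x = x"
  using assms by (simp_all add: end_alg_def compose_def)

lemma end_extensional:
  "\<zero>\<^bsub>EQ\<^esub> \<in> extensional (carrier Q)" "f \<oplus>\<^bsub>EQ\<^esub> g \<in> extensional (carrier Q)"
  "c \<odot>\<^bsub>EQ\<^esub> f \<in> extensional (carrier Q)" "f \<otimes>\<^bsub>EQ\<^esub> g \<in> extensional (carrier Q)"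
  "\<one>\<^bsub>EQ\<^esub> \<in> extensional (carrier Q)"
  by (simp_all add: end_alg_def)

lemma end_eqI: "\<lbrakk>f \<in> carrier EQ; g \<in> carrier EQ; \<And>x. x \<in> carrier Q \<Longrightarrow> f x = g x\<rbrakk> \<Longrightarrow> f = g"
  by (rule extensionalityI[of _ "carrier Q"]) (auto simp: end_carrier_iff)

text \<open>Commutativity of \<open>K\<close> is what makes a scalar multiple of a linear map linear
  again.\<close>

lemma smult_swap: "\<lbrakk>c \<in> carrier K; d \<in> carrier K; x \<in> carrier Q\<rbrakk> \<Longrightarrow>
    c \<odot>\<^bsub>Q\<^esub> (d \<odot>\<^bsub>Q\<^esub> x) = d \<odot>\<^bsub>Q\<^esub> (c \<odot>\<^bsub>Q\<^esub> x)"
  by (metis R.m_comm smult_assoc1)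

lemma end_closed:
  "\<zero>\<^bsub>EQ\<^esub> \<in> carrier EQ" "\<one>\<^bsub>EQ\<^esub> \<in> carrier EQ"
  "\<lbrakk>f \<in> carrier EQ; g \<in> carrier EQ\<rbrakk> \<Longrightarrow> f \<oplus>\<^bsub>EQ\<^esub> g \<in> carrier EQ"
  "\<lbrakk>f \<in> carrier EQ; g \<in> carrier EQ\<rbrakk> \<Longrightarrow> f \<otimes>\<^bsub>EQ\<^esub> g \<in> carrier EQ"
  "\<lbrakk>c \<in> carrier K; f \<in> carrier EQ\<rbrakk> \<Longrightarrow> c \<odot>\<^bsub>EQ\<^esub> f \<in> carrier EQ"
proof -
  show "\<zero>\<^bsub>EQ\<^esub> \<in> carrier EQ" "\<one>\<^bsub>EQ\<^esub> \<in> carrier EQ"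
    by (simp_all add: end_carrier_iff end_apply end_extensional)
  show "f \<otimes>\<^bsub>EQ\<^esub> g \<in> carrier EQ" if "f \<in> carrier EQ" "g \<in> carrier EQ"
    using that by (simp add: end_carrier_iff end_apply end_extensional)
  show "f \<oplus>\<^bsub>EQ\<^esub> g \<in> carrier EQ" if "f \<in> carrier EQ" "g \<in> carrier EQ"
    using that by (simp add: end_carrier_iff end_apply end_extensional M.a_ac smult_r_distr)
  show "c \<odot>\<^bsub>EQ\<^esub> f \<in> carrier EQ" if "c \<in> carrier K" "f \<in> carrier EQ"
    using that by (simp add: end_carrier_iff end_apply end_extensional smult_r_distr) (metis smult_swap)
qed

lemma end_mem: "\<lbrakk>f \<in> carrier EQ; x \<in> carrier Q\<rbrakk> \<Longrightarrow> f x \<in> carrier Q"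
  by (auto simp: end_carrier_iff)

lemma end_linear:
  "\<lbrakk>f \<in> carrier EQ; x \<in> carrier Q; y \<in> carrier Q\<rbrakk> \<Longrightarrow> f (x \<oplus>\<^bsub>Q\<^esub> y) = f x \<oplus>\<^bsub>Q\<^esub> f y"
  "\<lbrakk>f \<in> carrier EQ; c \<in> carrier K; x \<in> carrier Q\<rbrakk> \<Longrightarrow> f (c \<odot>\<^bsub>Q\<^esub> x) = c \<odot>\<^bsub>Q\<^esub> f x"
  by (auto simp: end_carrier_iff)

lemma end_hom: "f \<in> carrier EQ \<Longrightarrow> abelian_group_hom Q Q f"
  by (rule add_homI) (auto simp: end_mem end_linear M.abelian_group_axioms)

lemma end_abelian_group: "abelian_group EQ"
proof (rule abelian_groupI)
  fix f assume f: "f \<in> carrier EQ"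
  have g: "(\<ominus>\<^bsub>K\<^esub> \<one>\<^bsub>K\<^esub>) \<odot>\<^bsub>EQ\<^esub> f \<in> carrier EQ" using f by (intro end_closed) auto
  moreover have "(\<ominus>\<^bsub>K\<^esub> \<one>\<^bsub>K\<^esub>) \<odot>\<^bsub>EQ\<^esub> f \<oplus>\<^bsub>EQ\<^esub> f = \<zero>\<^bsub>EQ\<^esub>"
    by (rule end_eqI) (use f g in \<open>auto simp: end_closed end_apply end_mem smult_l_minus M.l_neg\<close>)
  ultimately show "\<exists>g\<in>carrier EQ. g \<oplus>\<^bsub>EQ\<^esub> f = \<zero>\<^bsub>EQ\<^esub>" by blast
  show "\<zero>\<^bsub>EQ\<^esub> \<oplus>\<^bsub>EQ\<^esub> f = f"
    by (rule end_eqI) (use f in \<open>auto simp: end_closed end_apply end_mem\<close>)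
next
  fix f g h assume fgh: "f \<in> carrier EQ" "g \<in> carrier EQ" "h \<in> carrier EQ"
  show "f \<oplus>\<^bsub>EQ\<^esub> g \<oplus>\<^bsub>EQ\<^esub> h = f \<oplus>\<^bsub>EQ\<^esub> (g \<oplus>\<^bsub>EQ\<^esub> h)"
    by (rule end_eqI) (use fgh in \<open>auto simp: end_closed end_apply end_mem M.a_assoc\<close>)
next
  fix f g assume fg: "f \<in> carrier EQ" "g \<in> carrier EQ"
  show "f \<oplus>\<^bsub>EQ\<^esub> g = g \<oplus>\<^bsub>EQ\<^esub> f"
    by (rule end_eqI) (use fg in \<open>auto simp: end_closed end_apply end_mem M.a_comm\<close>)
qed (auto simp: end_closed)

lemma end_module: "module K EQ"
proof (rule moduleI)
  fix c d f g assume x: "c \<in> carrier K" "d \<in> carrier K" "f \<in> carrier EQ" "g \<in> carrier EQ"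
  show "(c \<oplus>\<^bsub>K\<^esub> d) \<odot>\<^bsub>EQ\<^esub> f = c \<odot>\<^bsub>EQ\<^esub> f \<oplus>\<^bsub>EQ\<^esub> d \<odot>\<^bsub>EQ\<^esub> f"
    by (rule end_eqI) (use x in \<open>auto simp: end_closed end_apply end_mem smult_l_distr\<close>)
  show "c \<odot>\<^bsub>EQ\<^esub> (f \<oplus>\<^bsub>EQ\<^esub> g) = c \<odot>\<^bsub>EQ\<^esub> f \<oplus>\<^bsub>EQ\<^esub> c \<odot>\<^bsub>EQ\<^esub> g"
    by (rule end_eqI) (use x in \<open>auto simp: end_closed end_apply end_mem smult_r_distr\<close>)
  show "(c \<otimes>\<^bsub>K\<^esub> d) \<odot>\<^bsub>EQ\<^esub> f = c \<odot>\<^bsub>EQ\<^esub> (d \<odot>\<^bsub>EQ\<^esub> f)"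
    by (rule end_eqI) (use x in \<open>auto simp: end_closed end_apply end_mem smult_assoc1\<close>)
next
  fix f assume f: "f \<in> carrier EQ"
  show "\<one>\<^bsub>K\<^esub> \<odot>\<^bsub>EQ\<^esub> f = f"
    by (rule end_eqI) (use f in \<open>auto simp: end_closed end_apply end_mem\<close>)
qed (auto simp: end_closed end_abelian_group R.is_cring)

lemma end_bilinear_alg: "bilinear_alg K EQ"
proof (intro bilinear_alg.intro bilinear_alg_axioms.intro end_module)
  fix f g h assume x: "f \<in> carrier EQ" "g \<in> carrier EQ" "h \<in> carrier EQ"
  show "(f \<oplus>\<^bsub>EQ\<^esub> g) \<otimes>\<^bsub>EQ\<^esub> h = f \<otimes>\<^bsub>EQ\<^esub> h \<oplus>\<^bsub>EQ\<^esub> g \<otimes>\<^bsub>EQ\<^esub> h"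
    by (rule end_eqI) (use x in \<open>auto simp: end_closed end_apply end_mem\<close>)
  show "h \<otimes>\<^bsub>EQ\<^esub> (f \<oplus>\<^bsub>EQ\<^esub> g) = h \<otimes>\<^bsub>EQ\<^esub> f \<oplus>\<^bsub>EQ\<^esub> h \<otimes>\<^bsub>EQ\<^esub> g"
    by (rule end_eqI) (use x in \<open>auto simp: end_closed end_apply end_mem end_linear\<close>)
next
  fix c f g assume x: "c \<in> carrier K" "f \<in> carrier EQ" "g \<in> carrier EQ"
  show "(c \<odot>\<^bsub>EQ\<^esub> f) \<otimes>\<^bsub>EQ\<^esub> g = c \<odot>\<^bsub>EQ\<^esub> (f \<otimes>\<^bsub>EQ\<^esub> g)"
    by (rule end_eqI) (use x in \<open>auto simp: end_closed end_apply end_mem\<close>)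
  show "f \<otimes>\<^bsub>EQ\<^esub> (c \<odot>\<^bsub>EQ\<^esub> g) = c \<odot>\<^bsub>EQ\<^esub> (f \<otimes>\<^bsub>EQ\<^esub> g)"
    by (rule end_eqI) (use x in \<open>auto simp: end_closed end_apply end_mem end_linear\<close>)
qed (rule end_closed)

end

locale end_basis = fin_basis K Q "{..<m}" q cq + end_context K Q
  for K :: "('a, 'c) ring_scheme" and Q :: "('a, 'q) module" and m :: nat and q cq
begin

text \<open>Takes the basis vector with index \<open>snd p\<close> to the one with index
  \<open>fst p\<close> and kills the other ones. With this order of indices, and that of
  \<open>entry\<close>, composition of maps is the product of matrices.\<close>

definition unit where "unit p = (\<lambda>x\<in>carrier Q. cq x (snd p) \<odot>\<^bsub>Q\<^esub> q (fst p))"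

definition entry where "entry f p = cq (f (q (snd p))) (fst p)"

lemma unit_apply: "x \<in> carrier Q \<Longrightarrow> unit (i, j) x = cq x j \<odot>\<^bsub>Q\<^esub> q i"
  by (simp add: unit_def)

lemma unit_closed: "\<lbrakk>i < m; j < m\<rbrakk> \<Longrightarrow> unit (i, j) \<in> carrier EQ"
  by (auto simp: end_carrier_iff unit_def q_closed co_closed co_add co_smult smult_l_distr smult_assoc1)

lemma unit_q: "\<lbrakk>i < m; j < m; k < m\<rbrakk> \<Longrightarrow> unit (i, j) (q k) = (if j = k then q i else \<zero>\<^bsub>Q\<^esub>)"
  by (auto simp: unit_apply q_closed co_q smult_l_null)

text \<open>Reduces the relations between matrix units, their sum and the expansion of an
  endomorphism to basis vectors, on which \<open>unit_q\<close> gives the values.\<close>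

lemma end_eq_on_q:
  assumes f: "f \<in> carrier EQ" and g: "g \<in> carrier EQ" and e: "\<And>k. k < m \<Longrightarrow> f (q k) = g (q k)"
  shows "f = g"
proof (rule end_eqI[OF f g])
  fix x assume x: "x \<in> carrier Q"
  have "h x = (\<Oplus>\<^bsub>Q\<^esub>i\<in>{..<m}. cq x i \<odot>\<^bsub>Q\<^esub> h (q i))" if h: "h \<in> carrier EQ" for h
  proof -
    have "h (\<Oplus>\<^bsub>Q\<^esub>i\<in>{..<m}. cq x i \<odot>\<^bsub>Q\<^esub> q i) = (\<Oplus>\<^bsub>Q\<^esub>i\<in>{..<m}. h (cq x i \<odot>\<^bsub>Q\<^esub> q i))"
      using x by (intro abelian_group_hom.hom_finsum[OF end_hom[OF h]]) (auto simp: q_closed co_closed)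
    also have "\<dots> = (\<Oplus>\<^bsub>Q\<^esub>i\<in>{..<m}. cq x i \<odot>\<^bsub>Q\<^esub> h (q i))"
      using x h by (intro M.finsum_cong') (auto simp: q_closed co_closed end_linear end_mem)
    finally show ?thesis using co_expand[OF x] by simp
  qed
  from this[OF f] this[OF g] show "f x = g x"
    using e x f g by (auto intro!: M.finsum_cong' simp: q_closed co_closed end_mem)
qed

lemma end_eval_hom: "x \<in> carrier Q \<Longrightarrow> abelian_group_hom EQ Q (\<lambda>f. f x)"
  by (rule add_homI) (auto simp: end_mem end_apply end_abelian_group M.abelian_group_axioms)

lemma end_mat_units: "mat_units K EQ m unit entry"
proof (intro mat_units.intro fin_basis.intro mat_units_axioms.intro fin_basis_axioms.intro
    end_bilinear_alg end_module)
  interpret EQ: module K EQ by (rule end_module)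
  fix f assume f: "f \<in> carrier EQ"
  let ?t = "\<lambda>p. entry f p \<odot>\<^bsub>EQ\<^esub> unit p"
  have ec: "entry f (i, j) \<in> carrier K" if "i < m" "j < m" for i j
    using that f by (auto simp: entry_def end_mem q_closed co_closed)
  have tc: "?t (i, j) \<in> carrier EQ" if "i < m" "j < m" for i j
    using that by (intro end_closed(5) unit_closed ec)
  show "(\<Oplus>\<^bsub>EQ\<^esub>p\<in>{..<m} \<times> {..<m}. ?t p) = f"
  proof (rule end_eq_on_q[OF _ f])
    show "(\<Oplus>\<^bsub>EQ\<^esub>p\<in>{..<m} \<times> {..<m}. ?t p) \<in> carrier EQ"
      using tc by (auto intro!: EQ.finsum_closed)
    fix k assume k: "k < m"
    have "(\<Oplus>\<^bsub>EQ\<^esub>p\<in>{..<m} \<times> {..<m}. ?t p) (q k) = (\<Oplus>\<^bsub>Q\<^esub>p\<in>{..<m} \<times> {..<m}. ?t p (q k))"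
      using tc k by (intro abelian_group_hom.hom_finsum[OF end_eval_hom]) (auto simp: q_closed)
    also have "\<dots> = (\<Oplus>\<^bsub>Q\<^esub>i\<in>{..<m}. \<Oplus>\<^bsub>Q\<^esub>j\<in>{..<m}. ?t (i, j) (q k))"
      by (rule M.finsum_times) (use k in \<open>auto intro: end_mem[OF tc] simp: q_closed\<close>)
    also have "\<dots> = (\<Oplus>\<^bsub>Q\<^esub>i\<in>{..<m}. cq (f (q k)) i \<odot>\<^bsub>Q\<^esub> q i)"
    proof (rule M.finsum_cong')
      fix i assume i: "i \<in> {..<m}"
      have "(\<Oplus>\<^bsub>Q\<^esub>j\<in>{..<m}. ?t (i, j) (q k)) = ?t (i, k) (q k)"
        using i k ec by (intro M.finsum_single) (auto simp: end_apply q_closed unit_q)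
      then show "(\<Oplus>\<^bsub>Q\<^esub>j\<in>{..<m}. ?t (i, j) (q k)) = cq (f (q k)) i \<odot>\<^bsub>Q\<^esub> q i"
        using i k by (simp add: end_apply q_closed unit_q entry_def)
    qed (use f k in \<open>auto simp: q_closed co_closed end_mem\<close>)
    also have "\<dots> = f (q k)" using f k by (intro co_expand) (simp add: end_mem q_closed)
    finally show "(\<Oplus>\<^bsub>EQ\<^esub>p\<in>{..<m} \<times> {..<m}. ?t p) (q k) = f (q k)" .
  qed
next
  interpret EQ: module K EQ by (rule end_module)
  have s: "(\<Oplus>\<^bsub>EQ\<^esub>i\<in>{..<m}. unit (i, i)) \<in> carrier EQ"
    by (auto intro!: EQ.finsum_closed simp: unit_closed)
  show "(\<Oplus>\<^bsub>EQ\<^esub>i\<in>{..<m}. unit (i, i)) = \<one>\<^bsub>EQ\<^esub>"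
  proof (rule end_eq_on_q[OF s end_closed(2)])
    fix k assume k: "k < m"
    have "(\<Oplus>\<^bsub>EQ\<^esub>i\<in>{..<m}. unit (i, i)) (q k) = (\<Oplus>\<^bsub>Q\<^esub>i\<in>{..<m}. unit (i, i) (q k))"
      using k by (intro abelian_group_hom.hom_finsum[OF end_eval_hom]) (auto simp: q_closed unit_closed)
    also have "\<dots> = unit (k, k) (q k)"
      using k by (intro M.finsum_single) (auto simp: q_closed unit_q)
    finally show "(\<Oplus>\<^bsub>EQ\<^esub>i\<in>{..<m}. unit (i, i)) (q k) = \<one>\<^bsub>EQ\<^esub> (q k)"
      using k by (simp add: unit_q end_apply q_closed)
  qed
next
  fix i j k l assume ij: "i < m" "j < m" "k < m" "l < m"
  show "unit (i, j) \<otimes>\<^bsub>EQ\<^esub> unit (k, l) = (if j = k then unit (i, l) else \<zero>\<^bsub>EQ\<^esub>)"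
  proof (rule end_eq_on_q)
    fix r assume r: "r < m"
    have "unit (i, j) \<zero>\<^bsub>Q\<^esub> = \<zero>\<^bsub>Q\<^esub>"
      using abelian_group_hom.hom_zero[OF end_hom[OF unit_closed[OF ij(1,2)]]] .
    then show "(unit (i, j) \<otimes>\<^bsub>EQ\<^esub> unit (k, l)) (q r) = (if j = k then unit (i, l) else \<zero>\<^bsub>EQ\<^esub>) (q r)"
      using ij r by (auto simp: end_apply q_closed unit_q)
  qed (use ij in \<open>auto simp: unit_closed end_closed\<close>)
qed (auto simp: unit_closed entry_def end_mem q_closed co_closed end_apply co_add co_smult unit_q co_q
    co_zero split: if_splits)

end

section \<open>Modules over endomorphism algebras tensored with an algebra\<close>

lemma tensor_action_eq_double_lift:
  assumes "multilinear4 K (end_alg K Q) B Q (restrict_scalars B N) (tensor_module K Q (restrict_scalars B N))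
     (\<lambda>f t q v. pure_tensor K Q (restrict_scalars B N) (f q) (t \<odot>\<^bsub>N\<^esub> v))"
  shows "tensor_action K Q B N z w =
     multilinear4.double_lift K (end_alg K Q) B Q (restrict_scalars B N) (tensor_module K Q (restrict_scalars B N))
     (\<lambda>f t q v. pure_tensor K Q (restrict_scalars B N) (f q) (t \<odot>\<^bsub>N\<^esub> v)) z w"
  unfolding multilinear4.double_lift_def[OF assms] multilinear4.inner_def[OF assms, abs_def]
  by (simp add: tensor_action_def Let_def)

lemma restrict_scalars_simps:
  "carrier (restrict_scalars B N) = carrier N" "add (restrict_scalars B N) = add N"
  "\<zero>\<^bsub>restrict_scalars B N\<^esub> = \<zero>\<^bsub>N\<^esub>" "c \<odot>\<^bsub>restrict_scalars B N\<^esub> v = (c \<odot>\<^bsub>B\<^esub> \<one>\<^bsub>B\<^esub>) \<odot>\<^bsub>N\<^esub> v"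
  by (simp_all add: restrict_scalars_def)

text \<open>The ring \<open>X\<close> is known only through \<open>\<phi>\<close> and its
  distributive laws. The closure assumptions on \<open>X\<close> permit inverting
  \<open>\<phi>\<close>, and \<open>m_pos\<close> provides the index 0 of the corner in which the
  Morita partner lives.\<close>

locale module_over_tensor = end_basis K Q m q cq + U: unital_alg K B + X: biadditive_ring X + V: left_module X V
  for K :: "('a, 'c) ring_scheme" and Q :: "('a, 'q) module" and m :: nat and q cq
    and B :: "('a, 'y) module" and X :: "('a, 'x) module" and V :: "('x, 'm) module" +
  fixes \<phi>
  assumes m_pos: "0 < m"
    and \<phi>: "\<phi> \<in> alg_iso K X (tensor_alg K (end_alg K Q) B)"
    and X_one: "\<one>\<^bsub>X\<^esub> \<in> carrier X"
    and X_smult: "\<lbrakk>c \<in> carrier K; x \<in> carrier X\<rbrakk> \<Longrightarrow> c \<odot>\<^bsub>X\<^esub> x \<in> carrier X"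
begin

sublocale EU: mat_units K EQ m unit entry by (rule end_mat_units)

sublocale ET: mat_units_tensor K EQ m unit entry B by unfold_locales

definition \<psi> where "\<psi> = inv_into (carrier X) \<phi>"

lemma \<psi>_iso: "\<psi> \<in> alg_iso K ET.TA X"
  unfolding \<psi>_def by (rule alg_iso_inv[OF \<phi>]) (auto simp: X.mult_closed X_one X_smult)

lemma \<psi>_hom:
  "z \<in> carrier ET.T \<Longrightarrow> \<psi> z \<in> carrier X"
  "\<lbrakk>z \<in> carrier ET.T; w \<in> carrier ET.T\<rbrakk> \<Longrightarrow> \<psi> (z \<oplus>\<^bsub>ET.T\<^esub> w) = \<psi> z \<oplus>\<^bsub>X\<^esub> \<psi> w"
  "\<lbrakk>z \<in> carrier ET.T; w \<in> carrier ET.T\<rbrakk> \<Longrightarrow> \<psi> (z \<otimes>\<^bsub>ET.TA\<^esub> w) = \<psi> z \<otimes>\<^bsub>X\<^esub> \<psi> w"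
  "\<psi> (ET.pure \<one>\<^bsub>EQ\<^esub> \<one>\<^bsub>B\<^esub>) = \<one>\<^bsub>X\<^esub>"
  using \<psi>_iso by (auto simp: alg_iso_def ring_iso_def ring_hom_def tensor_alg_simps)

lemma \<psi>_add_hom: "abelian_group_hom ET.T X \<psi>"
  by (rule add_homI) (auto simp: \<psi>_hom ET.T_abelian_group X.abelian_group_axioms)

text \<open>The element of \<open>X\<close> corresponding to the tensor of a matrix unit with
  \<open>t\<close>. By \<open>munit_mult\<close> these are matrix units with coefficients in
  \<open>B\<close>, and the structure of \<open>V\<close> is read off from their action.\<close>

definition munit where "munit i j t = \<psi> (ET.pure (unit (i, j)) t)"

lemma pure_unit_closed: "\<lbrakk>i < m; j < m; t \<in> carrier B\<rbrakk> \<Longrightarrow> ET.pure (unit (i, j)) t \<in> carrier ET.T"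
  by (simp add: unit_closed)

lemma munit_closed: "\<lbrakk>i < m; j < m; t \<in> carrier B\<rbrakk> \<Longrightarrow> munit i j t \<in> carrier X"
  unfolding munit_def by (intro \<psi>_hom pure_unit_closed)

lemma munit_add: "\<lbrakk>i < m; j < m; t \<in> carrier B; s \<in> carrier B\<rbrakk> \<Longrightarrow>
    munit i j (t \<oplus>\<^bsub>B\<^esub> s) = munit i j t \<oplus>\<^bsub>X\<^esub> munit i j s"
  using ET.pure_bilin by (simp add: munit_def \<psi>_hom(2)[symmetric] bilin_def unit_closed)

lemma munit_mult:
  assumes "i < m" "j < m" "k < m" "l < m" "t \<in> carrier B" "s \<in> carrier B"
  shows "munit i j t \<otimes>\<^bsub>X\<^esub> munit k l s = (if j = k then munit i l (t \<otimes>\<^bsub>B\<^esub> s) else \<zero>\<^bsub>X\<^esub>)"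
proof -
  have "munit i j t \<otimes>\<^bsub>X\<^esub> munit k l s = \<psi> (ET.pure (unit (i, j) \<otimes>\<^bsub>EQ\<^esub> unit (k, l)) (t \<otimes>\<^bsub>B\<^esub> s))"
    using assms by (simp add: munit_def \<psi>_hom(3)[symmetric] ET.TA_mult_pure unit_closed)
  moreover have "\<psi> (ET.pure \<zero>\<^bsub>EQ\<^esub> (t \<otimes>\<^bsub>B\<^esub> s)) = \<zero>\<^bsub>X\<^esub>"
    using abelian_group_hom.hom_zero[OF ET.pure_hom_left] abelian_group_hom.hom_zero[OF \<psi>_add_hom] assms
    by (simp add: U.alg_mult_closed)
  ultimately show ?thesis using assms by (simp add: EU.E_mult munit_def)
qed

text \<open>Splits the identity of \<open>X\<close> into orthogonal idempotents, one for each index.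
  Since \<open>V\<close> is unital, each of its vectors is the sum of its components.\<close>

lemma munit_sum_one: "(\<Oplus>\<^bsub>X\<^esub>i\<in>{..<m}. munit i i \<one>\<^bsub>B\<^esub>) = \<one>\<^bsub>X\<^esub>"
proof -
  have "(\<Oplus>\<^bsub>X\<^esub>i\<in>{..<m}. munit i i \<one>\<^bsub>B\<^esub>) = \<psi> (\<Oplus>\<^bsub>ET.T\<^esub>i\<in>{..<m}. ET.pure (unit (i, i)) \<one>\<^bsub>B\<^esub>)"
    unfolding munit_def using pure_unit_closed U.alg_one_closed
    by (intro abelian_group_hom.hom_finsum[OF \<psi>_add_hom, symmetric]) auto
  also have "(\<Oplus>\<^bsub>ET.T\<^esub>i\<in>{..<m}. ET.pure (unit (i, i)) \<one>\<^bsub>B\<^esub>) = ET.pure (\<Oplus>\<^bsub>EQ\<^esub>i\<in>{..<m}. unit (i, i)) \<one>\<^bsub>B\<^esub>"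
    by (intro abelian_group_hom.hom_finsum[OF ET.pure_hom_left, symmetric])
      (auto simp: unit_closed U.alg_one_closed)
  finally show ?thesis by (simp add: EU.E_one \<psi>_hom)
qed

section \<open>The action on a module and its corner\<close>

abbreviation act (infixr "\<bullet>" 75) where "x \<bullet> v \<equiv> x \<odot>\<^bsub>V\<^esub> v"

lemma act_hom: "x \<in> carrier X \<Longrightarrow> abelian_group_hom V V (\<lambda>v. x \<bullet> v)"
  by (rule add_homI) (auto simp: V.smult_closed V.smult_r_distr V.abelian_group_axioms)

lemma act_hom_left: "v \<in> carrier V \<Longrightarrow> abelian_group_hom X V (\<lambda>x. x \<bullet> v)"
  by (rule add_homI) (auto simp: V.smult_closed V.smult_l_distr V.abelian_group_axioms X.abelian_group_axioms)

lemma act_zero: "v \<in> carrier V \<Longrightarrow> \<zero>\<^bsub>X\<^esub> \<bullet> v = \<zero>\<^bsub>V\<^esub>" "x \<in> carrier X \<Longrightarrow> x \<bullet> \<zero>\<^bsub>V\<^esub> = \<zero>\<^bsub>V\<^esub>"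
  using abelian_group_hom.hom_zero[OF act_hom_left] abelian_group_hom.hom_zero[OF act_hom] by auto

lemma munit_act:
  "\<lbrakk>i < m; j < m; k < m; l < m; t \<in> carrier B; s \<in> carrier B; v \<in> carrier V\<rbrakk> \<Longrightarrow>
    munit i j t \<bullet> munit k l s \<bullet> v = (if j = k then munit i l (t \<otimes>\<^bsub>B\<^esub> s) \<bullet> v else \<zero>\<^bsub>V\<^esub>)"
  by (simp add: V.smult_assoc[symmetric] munit_closed munit_mult act_zero)

lemma munit_act_closed: "\<lbrakk>i < m; j < m; t \<in> carrier B; v \<in> carrier V\<rbrakk> \<Longrightarrow> munit i j t \<bullet> v \<in> carrier V"
  by (intro V.smult_closed munit_closed)

text \<open>The Morita partner of \<open>V\<close>: the image of the idempotent \<open>E\<^sub>0\<^sub>0 \<otimes> 1\<close>.\<close>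

definition N :: "('y, 'm) module" where "N = \<lparr>carrier = {v \<in> carrier V. munit 0 0 \<one>\<^bsub>B\<^esub> \<bullet> v = v}, monoid.mult = undefined,
    one = undefined, zero = \<zero>\<^bsub>V\<^esub>, add = add V, smult = (\<lambda>t v. munit 0 0 t \<bullet> v)\<rparr>"

lemma N_simps:
  "carrier N = {v \<in> carrier V. munit 0 0 \<one>\<^bsub>B\<^esub> \<bullet> v = v}" "\<zero>\<^bsub>N\<^esub> = \<zero>\<^bsub>V\<^esub>" "add N = add V"
  "t \<odot>\<^bsub>N\<^esub> v = munit 0 0 t \<bullet> v"
  by (simp_all add: N_def)

text \<open>Left multiplication by the idempotent with indices 0, 0 fixes every matrix unit in row
  0, so such units map all of \<open>V\<close> into the corner.\<close>

lemma N_mem: "\<lbrakk>j < m; t \<in> carrier B; v \<in> carrier V\<rbrakk> \<Longrightarrow> munit 0 j t \<bullet> v \<in> carrier N"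
  using m_pos by (simp add: N_simps munit_act_closed munit_act U.alg_one_closed U.alg_l_one)

lemma N_abelian_group: "abelian_group N"
proof (rule abelian_groupI)
  interpret h: abelian_group_hom V V "\<lambda>v. munit 0 0 \<one>\<^bsub>B\<^esub> \<bullet> v"
    using m_pos by (intro act_hom munit_closed U.alg_one_closed)
  fix x y z assume "x \<in> carrier N" "y \<in> carrier N" "z \<in> carrier N"
  note x = this[unfolded N_simps]
  show "x \<oplus>\<^bsub>N\<^esub> y \<in> carrier N" using x by (simp add: N_simps)
  show "x \<oplus>\<^bsub>N\<^esub> y \<oplus>\<^bsub>N\<^esub> z = x \<oplus>\<^bsub>N\<^esub> (y \<oplus>\<^bsub>N\<^esub> z)" using x by (simp add: N_simps V.a_assoc)
  show "x \<oplus>\<^bsub>N\<^esub> y = y \<oplus>\<^bsub>N\<^esub> x" using x by (simp add: N_simps V.a_comm)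
  show "\<zero>\<^bsub>N\<^esub> \<oplus>\<^bsub>N\<^esub> x = x" using x by (simp add: N_simps)
  show "\<exists>y\<in>carrier N. y \<oplus>\<^bsub>N\<^esub> x = \<zero>\<^bsub>N\<^esub>"
    by (rule bexI[of _ "\<ominus>\<^bsub>V\<^esub> x"]) (use x in \<open>simp_all add: N_simps V.l_neg\<close>)
next
  show "\<zero>\<^bsub>N\<^esub> \<in> carrier N" using m_pos by (simp add: N_simps act_zero munit_closed U.alg_one_closed)
qed

text \<open>The laws are the relations between matrix units with both indices 0, together with
  associativity of the action of \<open>X\<close> on \<open>V\<close>; unitality is the condition
  that cuts out the carrier of \<open>N\<close>.\<close>

lemma N_left_module: "left_module B N"
proof (intro left_module.intro left_module_axioms.intro N_abelian_group)
  fix t s x y assume t: "t \<in> carrier B" "s \<in> carrier B" and "x \<in> carrier N" "y \<in> carrier N"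
  then have x: "x \<in> carrier V" "y \<in> carrier V" by (auto simp: N_simps)
  show "(t \<oplus>\<^bsub>B\<^esub> s) \<odot>\<^bsub>N\<^esub> x = t \<odot>\<^bsub>N\<^esub> x \<oplus>\<^bsub>N\<^esub> s \<odot>\<^bsub>N\<^esub> x"
    using m_pos t x by (simp add: N_simps munit_add munit_closed V.smult_l_distr)
  show "t \<odot>\<^bsub>N\<^esub> (x \<oplus>\<^bsub>N\<^esub> y) = t \<odot>\<^bsub>N\<^esub> x \<oplus>\<^bsub>N\<^esub> t \<odot>\<^bsub>N\<^esub> y"
    using m_pos t x by (simp add: N_simps munit_closed V.smult_r_distr)
  show "(t \<otimes>\<^bsub>B\<^esub> s) \<odot>\<^bsub>N\<^esub> x = t \<odot>\<^bsub>N\<^esub> (s \<odot>\<^bsub>N\<^esub> x)"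
    using m_pos t x by (simp add: N_simps munit_act)
next
  fix t x assume "t \<in> carrier B" "x \<in> carrier N"
  then show "t \<odot>\<^bsub>N\<^esub> x \<in> carrier N" using N_mem[OF m_pos] by (simp add: N_simps(4)) (simp add: N_simps(1))
next
  fix x assume "x \<in> carrier N"
  then show "\<one>\<^bsub>B\<^esub> \<odot>\<^bsub>N\<^esub> x = x" by (simp add: N_simps)
qed

sublocale N: left_module B N by (rule N_left_module)

abbreviation "N' \<equiv> restrict_scalars B N"

text \<open>Multiples of the identity are central in \<open>B\<close>. As \<open>K\<close> acts on
  \<open>N\<close> through them, the action of \<open>t\<close> on \<open>N\<close> commutes with
  scalars.\<close>

lemma scalar_swap: "\<lbrakk>c \<in> carrier K; t \<in> carrier B\<rbrakk> \<Longrightarrow>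
    (c \<odot>\<^bsub>B\<^esub> \<one>\<^bsub>B\<^esub>) \<otimes>\<^bsub>B\<^esub> t = c \<odot>\<^bsub>B\<^esub> t" "\<lbrakk>c \<in> carrier K; t \<in> carrier B\<rbrakk> \<Longrightarrow> t \<otimes>\<^bsub>B\<^esub> (c \<odot>\<^bsub>B\<^esub> \<one>\<^bsub>B\<^esub>) = c \<odot>\<^bsub>B\<^esub> t"
  by (simp_all add: U.alg_smult_left U.alg_smult_right U.alg_one_closed U.alg_l_one U.alg_r_one)

lemma scalar_mult: "\<lbrakk>c \<in> carrier K; d \<in> carrier K\<rbrakk> \<Longrightarrow>
    (c \<otimes>\<^bsub>K\<^esub> d) \<odot>\<^bsub>B\<^esub> \<one>\<^bsub>B\<^esub> = (c \<odot>\<^bsub>B\<^esub> \<one>\<^bsub>B\<^esub>) \<otimes>\<^bsub>B\<^esub> (d \<odot>\<^bsub>B\<^esub> \<one>\<^bsub>B\<^esub>)"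
  by (simp add: scalar_swap(1) U.alg_one_closed U.smult_assoc1)

lemma N'_module: "module K N'"
proof (rule moduleI)
  show "abelian_group N'"
    by (rule abelian_group_cong[OF N_abelian_group]) (simp_all add: restrict_scalars_simps)
qed (simp_all add: restrict_scalars_simps U.alg_one_closed R.is_cring N.smult_closed U.smult_l_distr
    N.smult_l_distr N.smult_r_distr scalar_mult N.smult_assoc N.smult_one)

sublocale QN: fin_basis_tensor K Q "{..<m}" q cq "N'"
  by (intro fin_basis_tensor.intro tensor_context.intro fin_basis_axioms module_axioms N'_module)

lemma action_multilinear: "multilinear4 K EQ B Q N' QN.T (\<lambda>f t x v. QN.pure (f x) (t \<odot>\<^bsub>N\<^esub> v))"
proof (intro multilinear4.intro multilinear4_axioms.intro QN.T_module)
  show "tensor_context K EQ B" by (rule ET.tensor_context_axioms)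
  show "tensor_context K Q N'" by (rule QN.tensor_context_axioms)
  note p = QN.pure_bilin[unfolded bilin_def restrict_scalars_simps]
  fix x v assume x: "x \<in> carrier Q" and v: "v \<in> carrier N'"
  have v': "v \<in> carrier N" using v by (simp add: restrict_scalars_simps)
  have c: "(c \<odot>\<^bsub>B\<^esub> t) \<odot>\<^bsub>N\<^esub> v = (c \<odot>\<^bsub>B\<^esub> \<one>\<^bsub>B\<^esub>) \<odot>\<^bsub>N\<^esub> (t \<odot>\<^bsub>N\<^esub> v)" if "c \<in> carrier K" "t \<in> carrier B" for c t
    using that v' by (simp add: N.smult_assoc[symmetric] scalar_swap U.alg_one_closed)
  show "bilin K EQ B QN.T (\<lambda>f t. QN.pure (f x) (t \<odot>\<^bsub>N\<^esub> v))"
    by (simp add: bilin_def p x v' c end_mem end_apply N.smult_closed N.smult_l_distr)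
next
  note p = QN.pure_bilin[unfolded bilin_def restrict_scalars_simps]
  fix f t assume f: "f \<in> carrier EQ" and t: "t \<in> carrier B"
  have c: "t \<odot>\<^bsub>N\<^esub> ((c \<odot>\<^bsub>B\<^esub> \<one>\<^bsub>B\<^esub>) \<odot>\<^bsub>N\<^esub> v) = (c \<odot>\<^bsub>B\<^esub> \<one>\<^bsub>B\<^esub>) \<odot>\<^bsub>N\<^esub> (t \<odot>\<^bsub>N\<^esub> v)"
    if "c \<in> carrier K" "v \<in> carrier N" for c v
    using that t by (simp add: N.smult_assoc[symmetric] scalar_swap U.alg_one_closed)
  show "bilin K Q N' QN.T (\<lambda>x v. QN.pure (f x) (t \<odot>\<^bsub>N\<^esub> v))"
    by (simp add: bilin_def restrict_scalars_simps p f t c end_mem end_linear N.smult_closed N.smult_r_distr)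
qed

sublocale DL: multilinear4 K EQ B Q "N'" QN.T "\<lambda>f t x v. QN.pure (f x) (t \<odot>\<^bsub>N\<^esub> v)"
  by (rule action_multilinear)

text \<open>The component of \<open>v\<close> with index \<open>i\<close> is moved into the corner
  by the unit with indices 0, \<open>i\<close>, and the index is remembered as the basis vector
  \<open>q i\<close>. The map \<open>g\<close> moves it back by the unit with indices
  \<open>i\<close>, 0.\<close>

definition h where "h v = (\<Oplus>\<^bsub>QN.T\<^esub>i\<in>{..<m}. QN.pure (q i) (munit 0 i \<one>\<^bsub>B\<^esub> \<bullet> v))"

lemma h_terms: "v \<in> carrier V \<Longrightarrow> i < m \<Longrightarrow> QN.pure (q i) (munit 0 i \<one>\<^bsub>B\<^esub> \<bullet> v) \<in> carrier QN.T"
  by (intro QN.pure_closed) (simp_all add: q_closed restrict_scalars_simps N_mem U.alg_one_closed)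

lemma h_hom: "abelian_group_hom V QN.T h"
proof (rule add_homI)
  note p = QN.pure_bilin[unfolded bilin_def restrict_scalars_simps]
  fix v w assume vw: "v \<in> carrier V" "w \<in> carrier V"
  have "h (v \<oplus>\<^bsub>V\<^esub> w) = (\<Oplus>\<^bsub>QN.T\<^esub>i\<in>{..<m}. QN.pure (q i) (munit 0 i \<one>\<^bsub>B\<^esub> \<bullet> v) \<oplus>\<^bsub>QN.T\<^esub> QN.pure (q i) (munit 0 i \<one>\<^bsub>B\<^esub> \<bullet> w))"
    unfolding h_def
  proof (rule QN.T.finsum_cong')
    fix i assume i: "i \<in> {..<m}"
    then have "munit 0 i \<one>\<^bsub>B\<^esub> \<bullet> (v \<oplus>\<^bsub>V\<^esub> w) = munit 0 i \<one>\<^bsub>B\<^esub> \<bullet> v \<oplus>\<^bsub>N\<^esub> munit 0 i \<one>\<^bsub>B\<^esub> \<bullet> w"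
      using m_pos vw by (simp add: V.smult_r_distr munit_closed U.alg_one_closed N_simps)
    then show "QN.pure (q i) (munit 0 i \<one>\<^bsub>B\<^esub> \<bullet> (v \<oplus>\<^bsub>V\<^esub> w)) = QN.pure (q i) (munit 0 i \<one>\<^bsub>B\<^esub> \<bullet> v) \<oplus>\<^bsub>QN.T\<^esub> QN.pure (q i) (munit 0 i \<one>\<^bsub>B\<^esub> \<bullet> w)"
      using i vw by (simp add: p q_closed N_mem U.alg_one_closed)
  qed (use vw h_terms in auto)
  also have "\<dots> = h v \<oplus>\<^bsub>QN.T\<^esub> h w"
    unfolding h_def using vw h_terms by (intro QN.T.finsum_addf) auto
  finally show "h (v \<oplus>\<^bsub>V\<^esub> w) = h v \<oplus>\<^bsub>QN.T\<^esub> h w" .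
next
  fix v assume "v \<in> carrier V" then show "h v \<in> carrier QN.T"
    unfolding h_def using h_terms by (auto intro!: QN.T.finsum_closed)
qed (rule V.abelian_group_axioms QN.T_abelian_group)+

lemma h_coord: "\<lbrakk>v \<in> carrier V; j < m\<rbrakk> \<Longrightarrow> QN.coord j (h v) = munit 0 j \<one>\<^bsub>B\<^esub> \<bullet> v"
  unfolding h_def by (rule QN.coord_sum) (auto simp: restrict_scalars_simps N_mem U.alg_one_closed)

definition g where "g w = (\<Oplus>\<^bsub>V\<^esub>i\<in>{..<m}. munit i 0 \<one>\<^bsub>B\<^esub> \<bullet> QN.coord i w)"

lemma coord_V: "\<lbrakk>w \<in> carrier QN.T; j < m\<rbrakk> \<Longrightarrow> QN.coord j w \<in> carrier V \<and> munit 0 0 \<one>\<^bsub>B\<^esub> \<bullet> QN.coord j w = QN.coord j w"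
  using QN.coord_closed[of j w] by (simp add: restrict_scalars_simps N_simps)

lemma g_terms: "w \<in> carrier QN.T \<Longrightarrow> i < m \<Longrightarrow> munit i 0 \<one>\<^bsub>B\<^esub> \<bullet> QN.coord i w \<in> carrier V"
  using m_pos by (auto intro!: munit_act_closed simp: coord_V U.alg_one_closed)

lemma g_closed: "w \<in> carrier QN.T \<Longrightarrow> g w \<in> carrier V"
  unfolding g_def using g_terms by (auto intro!: V.finsum_closed)

lemma g_h: assumes v: "v \<in> carrier V" shows "g (h v) = v"
proof -
  have "g (h v) = (\<Oplus>\<^bsub>V\<^esub>i\<in>{..<m}. munit i i \<one>\<^bsub>B\<^esub> \<bullet> v)"
    unfolding g_def using v m_pos
    by (intro V.finsum_cong') (auto simp: h_coord munit_act munit_act_closed U.alg_one_closed U.alg_l_one)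
  also have "\<dots> = (\<Oplus>\<^bsub>X\<^esub>i\<in>{..<m}. munit i i \<one>\<^bsub>B\<^esub>) \<bullet> v"
    using v by (intro abelian_group_hom.hom_finsum[OF act_hom_left, symmetric]) (auto simp: munit_closed U.alg_one_closed)
  finally show ?thesis using v by (simp add: munit_sum_one V.smult_one)
qed

lemma h_g: assumes w: "w \<in> carrier QN.T" shows "h (g w) = w"
proof -
  \<comment> \<open>Only the summand with \<open>i = j\<close> survives, and there the product of
    the two units is the corner idempotent, which fixes coordinates because they lie in
    \<open>N\<close>.\<close>
  have "munit 0 j \<one>\<^bsub>B\<^esub> \<bullet> g w = QN.coord j w" if j: "j < m" for j
  proof -
    have "munit 0 j \<one>\<^bsub>B\<^esub> \<bullet> g w = (\<Oplus>\<^bsub>V\<^esub>i\<in>{..<m}. munit 0 j \<one>\<^bsub>B\<^esub> \<bullet> munit i 0 \<one>\<^bsub>B\<^esub> \<bullet> QN.coord i w)"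
      unfolding g_def using w j m_pos g_terms
      by (intro abelian_group_hom.hom_finsum[OF act_hom]) (auto simp: munit_closed U.alg_one_closed)
    also have "\<dots> = munit 0 j \<one>\<^bsub>B\<^esub> \<bullet> munit j 0 \<one>\<^bsub>B\<^esub> \<bullet> QN.coord j w"
      using w j m_pos coord_V
      by (intro V.finsum_single) (auto simp: munit_act munit_act_closed U.alg_one_closed U.alg_l_one)
    also have "\<dots> = QN.coord j w"
      using w j m_pos coord_V by (simp add: munit_act U.alg_one_closed U.alg_l_one)
    finally show ?thesis .
  qed
  then have "h (g w) = (\<Oplus>\<^bsub>QN.T\<^esub>i\<in>{..<m}. QN.pure (q i) (QN.coord i w))"
    unfolding h_def using w by (intro QN.T.finsum_cong') (auto simp: q_closed QN.coord_closed)
  then show ?thesis using QN.sum_coord[OF w] by simp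
qed

lemma pure_N_zero: "x \<in> carrier Q \<Longrightarrow> QN.pure x \<zero>\<^bsub>V\<^esub> = \<zero>\<^bsub>QN.T\<^esub>" "v \<in> carrier N \<Longrightarrow> QN.pure \<zero>\<^bsub>Q\<^esub> v = \<zero>\<^bsub>QN.T\<^esub>"
  using abelian_group_hom.hom_zero[OF QN.pure_hom_right] abelian_group_hom.hom_zero[OF QN.pure_hom_left]
  by (simp_all add: restrict_scalars_simps N_simps(2))

text \<open>Both sides equal the tensor of \<open>q i\<close> with
  \<open>munit 0 j t \<bullet> v\<close>. On the left the summand with index \<open>l\<close>
  vanishes unless \<open>l = i\<close>, by the relations in \<open>X\<close>; on the right the
  endomorphism kills \<open>q l\<close> unless \<open>l = j\<close>.\<close>

lemma h_unit:
  assumes "i < m" "j < m" "t \<in> carrier B" "v \<in> carrier V"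
  shows "h (munit i j t \<bullet> v) = DL.double_lift (ET.pure (unit (i, j)) t) (h v)"
proof -
  have "h (munit i j t \<bullet> v) = QN.pure (q i) (munit 0 i \<one>\<^bsub>B\<^esub> \<bullet> munit i j t \<bullet> v)"
    unfolding h_def
  proof (rule QN.T.finsum_single)
    fix l assume "l \<in> {..<m}" "l \<noteq> i"
    then show "QN.pure (q l) (munit 0 l \<one>\<^bsub>B\<^esub> \<bullet> munit i j t \<bullet> v) = \<zero>\<^bsub>QN.T\<^esub>"
      using assms m_pos by (simp add: munit_act U.alg_one_closed pure_N_zero q_closed)
  qed (use assms in \<open>auto intro!: h_terms munit_act_closed\<close>)
  then have 1: "h (munit i j t \<bullet> v) = QN.pure (q i) (munit 0 j t \<bullet> v)"
    using assms m_pos by (simp add: munit_act U.alg_one_closed U.alg_l_one)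
  have p: "ET.pure (unit (i, j)) t \<in> carrier ET.T" using assms by (intro pure_unit_closed)
  \<comment> \<open>The element \<open>t\<close> acts on \<open>N\<close> as
    \<open>munit 0 0 t\<close>, which moves \<open>t\<close> into the unit with indices 0,
    \<open>l\<close>; the endomorphism sends \<open>q l\<close> to \<open>q i\<close> or to
    zero.\<close>
  have d: "DL.double_lift (ET.pure (unit (i, j)) t) (QN.pure (q l) (munit 0 l \<one>\<^bsub>B\<^esub> \<bullet> v))
      = QN.pure (if j = l then q i else \<zero>\<^bsub>Q\<^esub>) (munit 0 l t \<bullet> v)" if "l < m" for l
    using assms that m_pos
    by (subst DL.double_lift_pure)
      (auto simp: unit_closed q_closed restrict_scalars_simps N_mem U.alg_one_closed unit_q N_simps(4) munit_act U.alg_r_one)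
  have "DL.double_lift (ET.pure (unit (i, j)) t) (h v)
      = (\<Oplus>\<^bsub>QN.T\<^esub>l\<in>{..<m}. DL.double_lift (ET.pure (unit (i, j)) t) (QN.pure (q l) (munit 0 l \<one>\<^bsub>B\<^esub> \<bullet> v)))"
    unfolding h_def using assms h_terms
    by (intro abelian_group_hom.hom_finsum[OF DL.double_lift_hom_right[OF p]]) auto
  also have "\<dots> = DL.double_lift (ET.pure (unit (i, j)) t) (QN.pure (q j) (munit 0 j \<one>\<^bsub>B\<^esub> \<bullet> v))"
  proof (rule QN.T.finsum_single)
    fix l assume "l \<in> {..<m}" "l \<noteq> j"
    then show "DL.double_lift (ET.pure (unit (i, j)) t) (QN.pure (q l) (munit 0 l \<one>\<^bsub>B\<^esub> \<bullet> v)) = \<zero>\<^bsub>QN.T\<^esub>"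
      using assms m_pos by (simp add: d pure_N_zero N_mem)
  qed (use assms p in \<open>auto intro!: DL.double_lift_closed h_terms\<close>)
  also have "\<dots> = QN.pure (q i) (munit 0 j t \<bullet> v)" using assms by (simp add: d)
  finally show ?thesis using 1 by simp
qed

text \<open>The basis expansion writes \<open>\<phi> x\<close> as a sum of pure tensors with a
  matrix unit on the left. Both sides are additive in \<open>\<phi> x\<close>, so
  \<open>h_unit\<close> suffices.\<close>

lemma h_equivariant:
  assumes x: "x \<in> carrier X" and v: "v \<in> carrier V"
  shows "h (x \<bullet> v) = DL.double_lift (\<phi> x) (h v)"
proof -
  have hv: "h v \<in> carrier QN.T" using v abelian_group_hom.hom_closed[OF h_hom] by auto
  have z: "\<phi> x \<in> carrier ET.T" using x \<phi> by (auto simp: alg_iso_def ring_iso_def ring_hom_def tensor_alg_simps)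
  let ?S = "{ET.pure (unit (i, j)) t | i j t. i < m \<and> j < m \<and> t \<in> carrier B}"
  have "(\<Oplus>\<^bsub>ET.T\<^esub>p\<in>{..<m} \<times> {..<m}. ET.pure (unit p) (ET.coord p (\<phi> x))) \<in> add_span ET.T ?S"
  proof (intro ET.T.add_span_finsum add_span_gen)
    fix p assume "p \<in> {..<m} \<times> {..<m}"
    then show "ET.pure (unit p) (ET.coord p (\<phi> x)) \<in> ?S" using ET.coord_closed[OF _ z, of p] by (cases p) blast
  qed (use ET.coord_closed[OF _ z] in \<open>auto intro!: pure_unit_closed\<close>)
  then have sp: "\<phi> x \<in> add_span ET.T ?S" by (simp add: ET.sum_coord[OF z])
  interpret hh: abelian_group_hom V QN.T h by (rule h_hom)
  interpret p: abelian_group_hom ET.T X \<psi> by (rule \<psi>_add_hom)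
  have "h (\<psi> (\<phi> x) \<bullet> v) = DL.double_lift (\<phi> x) (h v)"
  proof (rule add_homs_eq[OF _ DL.double_lift_hom_left[OF hv] _ _ sp])
    show "abelian_group_hom ET.T QN.T (\<lambda>z. h (\<psi> z \<bullet> v))"
      by (rule add_homI) (auto simp: v V.smult_closed V.smult_l_distr ET.T_abelian_group QN.T_abelian_group)
    show "?S \<subseteq> carrier ET.T" using pure_unit_closed by auto
    fix s assume "s \<in> ?S"
    then show "h (\<psi> s \<bullet> v) = DL.double_lift s (h v)"
      using h_unit[OF _ _ _ v, unfolded munit_def] by auto
  qed
  moreover have "\<psi> (\<phi> x) = x"
    using \<phi> x unfolding \<psi>_def by (intro bij_betw_inv_into_left) (auto simp: alg_iso_def ring_iso_def)
  ultimately show ?thesis by simp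
qed

theorem V_iso_tensor: "left_module_isomorphic X V (tensor_left_module K Q B N \<phi>)"
proof -
  interpret hh: abelian_group_hom V QN.T h by (rule h_hom)
  have "bij_betw h (carrier V) (carrier QN.T)"
    by (rule bij_betw_byWitness[where f'=g]) (auto simp: g_h h_g g_closed)
  then have "h \<in> left_module_iso X V (tensor_left_module K Q B N \<phi>)"
    by (auto simp: left_module_iso_def tensor_left_module_def Let_def h_equivariant
        tensor_action_eq_double_lift[OF action_multilinear])
  then show ?thesis by (auto simp: left_module_isomorphic_def)
qed

end

section \<open>Components of a set system\<close>

text \<open>The construction of \<open>components\<close> for an arbitrary set system, so that it
  can be transported along injective maps of vertices and applied to stacks with the layers
  interchanged.\<close>

definition comps :: "'v set set \<Rightarrow> 'v set set" where
  "comps S = \<Union>S // (\<Union>b\<in>S. b \<times> b)\<^sup>+"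

lemma components_eq: "components d\<^sub>1 d\<^sub>2 = comps (stacked d\<^sub>1 d\<^sub>2)"
  by (simp add: components_def comps_def)

definition block_closed :: "'v set set \<Rightarrow> 'v set \<Rightarrow> bool" where
  "block_closed S D \<longleftrightarrow> (\<forall>b\<in>S. b \<inter> D \<noteq> {} \<longrightarrow> b \<subseteq> D)"

text \<open>Connectedness expressed without paths: no nonempty proper part of \<open>C\<close> is
  closed under the blocks that meet it.\<close>

definition linked :: "'v set set \<Rightarrow> 'v set \<Rightarrow> bool" where
  "linked S C \<longleftrightarrow> (\<forall>D\<subseteq>C. D \<noteq> {} \<longrightarrow> block_closed S D \<longrightarrow> D = C)"

lemma block_closedD: "\<lbrakk>block_closed S D; b \<in> S; x \<in> b; x \<in> D\<rbrakk> \<Longrightarrow> b \<subseteq> D"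
  by (auto simp: block_closed_def)

lemma block_closed_Int: "\<lbrakk>block_closed S C; block_closed S D\<rbrakk> \<Longrightarrow> block_closed S (C \<inter> D)"
  by (auto simp: block_closed_def)

lemma linkedD: "\<lbrakk>linked S C; D \<subseteq> C; D \<noteq> {}; block_closed S D\<rbrakk> \<Longrightarrow> D = C"
  by (auto simp: linked_def)

lemma block_closed_trancl:
  assumes "block_closed S D" "(x, y) \<in> (\<Union>b\<in>S. b \<times> b)\<^sup>+" "x \<in> D"
  shows "y \<in> D"
  using assms(2,3) by (induction rule: trancl_induct) (use assms(1) in \<open>auto simp: block_closed_def\<close>)

lemma block_closed_class: "block_closed S ((\<Union>b\<in>S. b \<times> b)\<^sup>+ `` {x})"
  by (auto simp: block_closed_def intro: trancl_into_trancl)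

lemma trancl_blocks_sym: "(x, y) \<in> (\<Union>b\<in>S. b \<times> b)\<^sup>+ \<Longrightarrow> (y, x) \<in> (\<Union>b\<in>S. b \<times> b)\<^sup>+"
  by (rule symD[OF sym_trancl]) (auto simp: sym_def)

text \<open>The class of a vertex under the transitive closure is the least closed set containing
  it, which makes classes minimal among nonempty closed sets. Later arguments identify components by
  this property instead of by chains of blocks.\<close>

lemma in_comps_iff:
  "C \<in> comps S \<longleftrightarrow> C \<noteq> {} \<and> C \<subseteq> \<Union>S \<and> block_closed S C \<and> linked S C"
proof
  let ?R = "(\<Union>b\<in>S. b \<times> b)\<^sup>+"
  assume "C \<in> comps S"
  then obtain x where x: "x \<in> \<Union>S" "C = ?R `` {x}" by (auto simp: comps_def quotient_def)
  have "x \<in> C" using x by (auto intro: r_into_trancl)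
  moreover have "C \<subseteq> \<Union>S"
  proof
    fix y assume "y \<in> C"
    then have "(x, y) \<in> ?R" using x by simp
    then show "y \<in> \<Union>S" by (induction rule: trancl_induct) auto
  qed
  moreover have "D = C" if D: "D \<subseteq> C" "D \<noteq> {}" "block_closed S D" for D
  proof -
    obtain y where y: "y \<in> D" using D by auto
    then have "(x, y) \<in> ?R" using D x by auto
    then have "(y, z) \<in> ?R" if "(x, z) \<in> ?R" for z
      by (rule trancl_trans[OF trancl_blocks_sym that])
    then show ?thesis using D x block_closed_trancl[OF D(3) _ y] by auto
  qed
  ultimately show "C \<noteq> {} \<and> C \<subseteq> \<Union>S \<and> block_closed S C \<and> linked S C"
    using block_closed_class[of S x] x(2) unfolding linked_def by blast
next
  let ?R = "(\<Union>b\<in>S. b \<times> b)\<^sup>+"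
  assume C: "C \<noteq> {} \<and> C \<subseteq> \<Union>S \<and> block_closed S C \<and> linked S C"
  then obtain x where x: "x \<in> C" "x \<in> \<Union>S" by blast
  have "?R `` {x} \<subseteq> C" using C x by (auto dest: block_closed_trancl)
  moreover have "x \<in> ?R `` {x}" using x by (auto intro: r_into_trancl)
  ultimately have "?R `` {x} = C"
    using C block_closed_class[of S x] linkedD[of S C "?R `` {x}"] by blast
  then show "C \<in> comps S" using x by (auto simp: comps_def quotient_def)
qed

lemma comps_disjoint:
  assumes "C \<in> comps S" "D \<in> comps S" "x \<in> C" "x \<in> D" shows "C = D"
proof -
  have c: "block_closed S (C \<inter> D)" "C \<inter> D \<noteq> {}" "linked S C" "linked S D"
    using assms by (auto simp: in_comps_iff intro: block_closed_Int)
  show ?thesis using linkedD[OF c(3) _ c(2,1)] linkedD[OF c(4) _ c(2,1)] by auto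
qed

lemma comps_cover: "x \<in> \<Union>S \<Longrightarrow> \<exists>C\<in>comps S. x \<in> C"
  unfolding comps_def by (auto simp: quotient_def intro: r_into_trancl)

text \<open>Covering all vertices by components already forces the list to be complete, because two
  components that share a vertex coincide.\<close>

lemma comps_eqI:
  assumes "\<And>C. C \<in> P \<Longrightarrow> C \<noteq> {} \<and> C \<subseteq> \<Union>S \<and> block_closed S C \<and> linked S C" "\<Union>S \<subseteq> \<Union>P"
  shows "comps S = P"
proof
  show "P \<subseteq> comps S" using assms by (auto simp: in_comps_iff)
  show "comps S \<subseteq> P"
  proof
    fix C assume C: "C \<in> comps S"
    then obtain x where "x \<in> C" "x \<in> \<Union>S" unfolding in_comps_iff by blast
    then obtain D where "D \<in> P" "x \<in> D" using assms by blast
    then have "C = D" using comps_disjoint[OF C, of D x] \<open>P \<subseteq> comps S\<close> \<open>x \<in> C\<close> by blast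
    then show "C \<in> P" using \<open>D \<in> P\<close> by simp
  qed
qed

lemma comps_image:
  assumes inj: "inj_on f (\<Union>S)"
  shows "comps ((`) f ` S) = (`) f ` comps S"
proof (rule comps_eqI)
  have U: "\<Union>((`) f ` S) = f ` \<Union>S" by auto
  show "\<Union>((`) f ` S) \<subseteq> \<Union>((`) f ` comps S)"
    unfolding U using comps_cover[of _ S] by fast
  fix C' assume "C' \<in> (`) f ` comps S"
  then obtain C where C: "C' = f ` C" "C \<noteq> {}" "C \<subseteq> \<Union>S" "block_closed S C" "linked S C"
    by (auto simp: in_comps_iff)
  have "block_closed ((`) f ` S) C'"
    unfolding block_closed_def
  proof (intro ballI impI)
    fix b' assume "b' \<in> (`) f ` S" "b' \<inter> C' \<noteq> {}"
    then obtain b x y where b: "b' = f ` b" "b \<in> S" "x \<in> b" "y \<in> C" "f x = f y" using C(1) by auto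
    then have "x = y" using inj C(3) by (auto dest: inj_onD)
    then show "b' \<subseteq> C'" using b C block_closedD[OF C(4)] by blast
  qed
  have "D' = C'" if D': "D' \<subseteq> C'" "D' \<noteq> {}" "block_closed ((`) f ` S) D'" for D'
  proof -
    let ?D = "{x \<in> C. f x \<in> D'}"
    have e: "D' = f ` ?D" using D'(1) C(1) by auto
    have "block_closed S ?D"
      unfolding block_closed_def
    proof (intro ballI impI)
      fix b assume b: "b \<in> S" "b \<inter> ?D \<noteq> {}"
      then have "b \<subseteq> C" using C(4) by (auto simp: block_closed_def)
      moreover have "f ` b \<subseteq> D'" using b D'(3) by (auto simp: block_closed_def)
      ultimately show "b \<subseteq> ?D" by auto
    qed
    then have "?D = C" using e D'(2) by (intro linkedD[OF C(5)]) auto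
    then show ?thesis using e C(1) by simp
  qed
  then have "linked ((`) f ` S) C'" by (simp add: linked_def)
  moreover have "C' \<noteq> {}" "C' \<subseteq> \<Union>((`) f ` S)" using C(1-3) U by auto
  ultimately show "C' \<noteq> {} \<and> C' \<subseteq> \<Union>((`) f ` S) \<and> block_closed ((`) f ` S) C' \<and> linked ((`) f ` S) C'"
    using \<open>block_closed ((`) f ` S) C'\<close> by blast
qed

lemma comps_add_singletons:
  assumes "X \<inter> \<Union>S = {}"
  shows "comps (S \<union> (\<lambda>v. {v}) ` X) = comps S \<union> (\<lambda>v. {v}) ` X"
proof (rule comps_eqI)
  show "\<Union>(S \<union> (\<lambda>v. {v}) ` X) \<subseteq> \<Union>(comps S \<union> (\<lambda>v. {v}) ` X)"
    using comps_cover[of _ S] by fastforce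
  fix C assume "C \<in> comps S \<union> (\<lambda>v. {v}) ` X"
  then show "C \<noteq> {} \<and> C \<subseteq> \<Union>(S \<union> (\<lambda>v. {v}) ` X) \<and> block_closed (S \<union> (\<lambda>v. {v}) ` X) C
    \<and> linked (S \<union> (\<lambda>v. {v}) ` X) C"
  proof
    assume "C \<in> comps S"
    then have C: "C \<noteq> {}" "C \<subseteq> \<Union>S" "block_closed S C" "linked S C" by (auto simp: in_comps_iff)
    have "block_closed (S \<union> (\<lambda>v. {v}) ` X) D \<longleftrightarrow> block_closed S D" if "D \<subseteq> C" for D
      using that C(2) assms by (auto simp: block_closed_def)
    then show ?thesis using C by (auto simp: linked_def)
  next
    assume "C \<in> (\<lambda>v. {v}) ` X"
    then obtain v where "C = {v}" "v \<in> X" by auto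
    moreover have "block_closed (S \<union> (\<lambda>v. {v}) ` X) {v}"
      using assms \<open>v \<in> X\<close> by (auto simp: block_closed_def)
    ultimately show ?thesis by (auto simp: linked_def subset_singleton_iff)
  qed
qed

text \<open>A tree is grown inside \<open>C\<close>. As long as its vertex set \<open>D\<close> is
  proper it is not closed, so some block leaves it; that block has one vertex in \<open>D\<close>
  and one outside, and contributes one new edge and one new vertex.\<close>

lemma linked_edge_count:
  assumes fin: "finite C" "finite S" and ne: "C \<noteq> {}" and cl: "block_closed S C" and li: "linked S C"
    and sz: "\<And>b. b \<in> S \<Longrightarrow> card b \<le> 2"
  shows "card C \<le> card {b \<in> S. b \<subseteq> C \<and> card b = 2} + 1"
proof -
  have "\<exists>D E. D \<subseteq> C \<and> card D = Suc n \<and> E \<subseteq> {b \<in> S. b \<subseteq> D \<and> card b = 2} \<and> card E = n" if "n < card C" for n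
    using that
  proof (induction n)
    case 0
    obtain x where "x \<in> C" using ne by auto
    then show ?case by (intro exI[of _ "{x}"] exI[of _ "{}"]) auto
  next
    case (Suc n)
    then obtain D E where D: "D \<subseteq> C" "card D = Suc n" "E \<subseteq> {b \<in> S. b \<subseteq> D \<and> card b = 2}" "card E = n"
      by auto
    have "D \<noteq> C" "D \<noteq> {}" using D Suc by auto
    then obtain b where b: "b \<in> S" "b \<inter> D \<noteq> {}" "\<not> b \<subseteq> D"
      using linkedD[OF li D(1)] by (auto simp: block_closed_def)
    then obtain u v where uv: "u \<in> b" "u \<in> D" "v \<in> b" "v \<notin> D" by auto
    have bC: "b \<subseteq> C" using block_closedD[OF cl b(1) uv(1)] uv D by auto
    have fb: "finite b" using bC fin finite_subset by auto
    have "{u, v} \<subseteq> b" "card {u, v} = 2" using uv by (auto simp: card_2_iff)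
    then have buv: "b = {u, v}" using card_seteq[OF fb, of "{u, v}"] sz[OF b(1)] by auto
    have fD: "finite D" using D fin finite_subset by auto
    have "finite E" using D fin finite_subset[of E S] by auto
    moreover have "b \<notin> E" using D uv by auto
    ultimately have "card (insert b E) = Suc n" using D by simp
    moreover have "card (insert v D) = Suc (Suc n)" using uv D fD by simp
    moreover have "insert b E \<subseteq> {b \<in> S. b \<subseteq> insert v D \<and> card b = 2}"
      using D b uv buv by (auto simp: card_2_iff)
    moreover have "insert v D \<subseteq> C" using D uv bC by auto
    ultimately show ?case by blast
  qed
  from this[of "card C - 1"] obtain D E
    where D: "D \<subseteq> C" "E \<subseteq> {b \<in> S. b \<subseteq> D \<and> card b = 2}" "card E = card C - 1"
    using ne fin by (auto simp: card_gt_0_iff)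
  have "card E \<le> card {b \<in> S. b \<subseteq> C \<and> card b = 2}"
    using D fin by (intro card_mono) auto
  then show ?thesis using D by simp
qed

section \<open>Stacks of two matchings\<close>

text \<open>The operation behind \<open>below\<close>, with the set of removed edges as an argument.
  The expansions of products are sums over these sets.\<close>

definition isolate :: "'v set set \<Rightarrow> 'v set set \<Rightarrow> 'v set set" where
  "isolate E P = (P - E) \<union> (\<lambda>v. {v}) ` \<Union>E"

lemma below_isolate: "below d' d \<longleftrightarrow> (\<exists>E\<subseteq>edges d. d' = isolate E d)"
  by (simp add: below_def isolate_def)

lemma isolate_empty [simp]: "isolate {} P = P"
  by (simp add: isolate_def)

text \<open>Members of \<open>E'\<close> have two elements and therefore are not among the
  singletons created by the first step.\<close>

lemma isolate_isolate:
  assumes "E \<inter> E' = {}" "\<And>b. b \<in> E' \<Longrightarrow> card b = 2"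
  shows "isolate E' (isolate E P) = isolate (E \<union> E') P"
proof -
  have "(\<lambda>v. {v}) ` A \<inter> E' = {}" for A using assms(2) by force
  then have "(\<lambda>v. {v}) ` \<Union>E - E' = (\<lambda>v. {v}) ` \<Union>E" by blast
  then show ?thesis by (auto simp: isolate_def Un_Diff)
qed

lemma partition_on_isolate:
  assumes "partition_on A P" "E \<subseteq> P" shows "partition_on A (isolate E P)"
proof (rule partition_onI)
  show "\<Union>(isolate E P) = A" using assms by (auto simp: isolate_def partition_on_def)
  show "{} \<notin> isolate E P" using assms by (auto simp: isolate_def partition_on_def)
  have d: "b = b'" if "b \<in> P" "b' \<in> P" "x \<in> b" "x \<in> b'" for b b' x
    using assms(1) that by (auto simp: partition_on_def disjoint_def)
  show "disjnt p p'" if "p \<in> isolate E P" "p' \<in> isolate E P" "p \<noteq> p'" for p p'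
    using that assms(2) unfolding isolate_def disjnt_def by (auto dest: d)
qed

lemma partition_on_unique:
  "\<lbrakk>partition_on A P; b \<in> P; b' \<in> P; x \<in> b; x \<in> b'\<rbrakk> \<Longrightarrow> b = b'"
  by (auto simp: partition_on_def disjoint_def)

lemma partition_count:
  assumes P: "partition_on A P" and fin: "finite A" and sz: "\<And>b. b \<in> P \<Longrightarrow> card b \<le> 2"
    and cl: "block_closed P C"
  shows "card (C \<inter> A) = 2 * card {b \<in> P. b \<subseteq> C \<and> card b = 2} + card {b \<in> P. b \<subseteq> C \<and> card b = 1}"
proof -
  let ?P2 = "{b \<in> P. b \<subseteq> C \<and> card b = 2}" and ?P1 = "{b \<in> P. b \<subseteq> C \<and> card b = 1}"
  have fP: "finite P" using P fin finite_elements by blast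
  have bf: "finite b" if "b \<in> P" for b
    using that P fin finite_subset[of b A] by (auto simp: partition_on_def)
  have b12: "card b = 1 \<or> card b = 2" if "b \<in> P" for b
  proof -
    have "b \<noteq> {}" using that P by (auto simp: partition_on_def)
    then have "card b \<noteq> 0" using bf[OF that] by simp
    then show ?thesis using sz[OF that] by linarith
  qed
  have un: "C \<inter> A = \<Union>(?P2 \<union> ?P1)"
  proof
    show "\<Union>(?P2 \<union> ?P1) \<subseteq> C \<inter> A" using P by (auto simp: partition_on_def)
    show "C \<inter> A \<subseteq> \<Union>(?P2 \<union> ?P1)"
    proof
      fix x assume x: "x \<in> C \<inter> A"
      then obtain b where b: "b \<in> P" "x \<in> b" using P by (auto simp: partition_on_def)
      then have "b \<subseteq> C" using x block_closedD[OF cl] by blast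
      then show "x \<in> \<Union>(?P2 \<union> ?P1)" using b b12[OF b(1)] by blast
    qed
  qed
  have "card (\<Union>(?P2 \<union> ?P1)) = sum card (?P2 \<union> ?P1)"
    by (rule card_Union_disjoint) (use P bf in \<open>auto simp: partition_on_def disjoint_def pairwise_def disjnt_def\<close>)
  also have "\<dots> = sum card ?P2 + sum card ?P1"
    using fP by (intro sum.union_disjoint) auto
  also have "\<dots> = 2 * card ?P2 + card ?P1" by (simp add: mult.commute)
  finally show ?thesis using un by simp
qed

text \<open>The abstract form of \<open>diag_comp\<close>, with \<open>M\<close> in the role of the
  middle row; \<open>loops\<close> corresponds to the set counted by
  \<open>num_loops\<close>.\<close>

definition outs :: "'v set \<Rightarrow> 'v set set \<Rightarrow> 'v set set" where
  "outs M S = (\<lambda>C. C - M) ` comps S - {{}}"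

definition loops :: "'v set \<Rightarrow> 'v set set \<Rightarrow> 'v set set" where
  "loops M S = {C \<in> comps S. C \<subseteq> M \<and> (\<forall>b\<in>S. b \<subseteq> C \<longrightarrow> card b = 2)}"

text \<open>Three arbitrary disjoint rows instead of the fixed ones: the assumptions are symmetric
  in the two layers, and by \<open>stack_swap\<close> a fact about the upper layer yields the one
  about the lower layer.\<close>

locale stack =
  fixes U M L :: "'v set" and P Q :: "'v set set"
  assumes fin: "finite U" "finite M" "finite L"
    and disj: "U \<inter> M = {}" "M \<inter> L = {}" "U \<inter> L = {}"
    and P: "partition_on (U \<union> M) P" and Q: "partition_on (M \<union> L) Q"
    and P2: "b \<in> P \<Longrightarrow> card b \<le> 2" and Q2: "b \<in> Q \<Longrightarrow> card b \<le> 2"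
begin

lemma stack_swap: "stack L M U Q P"
  by unfold_locales (use fin disj P Q P2 Q2 in \<open>auto simp: Un_commute\<close>)

lemma Union_eq: "\<Union>(P \<union> Q) = U \<union> M \<union> L"
  using P Q by (auto simp: partition_on_def)

lemma comps_finite: "C \<in> comps (P \<union> Q) \<Longrightarrow> finite C"
  using fin Union_eq finite_subset[of C "U \<union> M \<union> L"] by (auto simp: in_comps_iff)

lemma finite_PQ: "finite P" "finite Q"
  using P Q fin finite_elements[of "U \<union> M" P] finite_elements[of "M \<union> L" Q] by auto

text \<open>In the last equation every vertex of \<open>C\<close> is counted twice: a middle vertex
  because it belongs to both layers, an outer one because it belongs to one layer and to
  \<open>C - M\<close>.\<close>

lemma comps_blocks:
  assumes C: "C \<in> comps (P \<union> Q)"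
  shows "card (C \<inter> (U \<union> M)) = 2 * card {b \<in> P. b \<subseteq> C \<and> card b = 2} + card {b \<in> P. b \<subseteq> C \<and> card b = 1}"
    and "card (C \<inter> (M \<union> L)) = 2 * card {b \<in> Q. b \<subseteq> C \<and> card b = 2} + card {b \<in> Q. b \<subseteq> C \<and> card b = 1}"
    and "card (C \<inter> (U \<union> M)) + card (C \<inter> (M \<union> L)) + card (C - M) = 2 * card C"
proof -
  have cl: "block_closed P C" "block_closed Q C" using C by (auto simp: in_comps_iff block_closed_def)
  show "card (C \<inter> (U \<union> M)) = 2 * card {b \<in> P. b \<subseteq> C \<and> card b = 2} + card {b \<in> P. b \<subseteq> C \<and> card b = 1}"
    by (rule partition_count[OF P _ P2 cl(1)]) (use fin in auto)
  show "card (C \<inter> (M \<union> L)) = 2 * card {b \<in> Q. b \<subseteq> C \<and> card b = 2} + card {b \<in> Q. b \<subseteq> C \<and> card b = 1}"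
    by (rule partition_count[OF Q _ Q2 cl(2)]) (use fin in auto)
  have fC: "finite C" by (rule comps_finite[OF C])
  have CS: "C \<subseteq> U \<union> M \<union> L" using C Union_eq by (auto simp: in_comps_iff)
  have "card (C \<inter> (U \<union> M)) = card (C \<inter> U) + card (C \<inter> M)"
    using disj fC by (subst card_Un_disjoint[symmetric]) (auto simp: Int_Un_distrib)
  moreover have "card (C \<inter> (M \<union> L)) = card (C \<inter> M) + card (C \<inter> L)"
    using disj fC by (subst card_Un_disjoint[symmetric]) (auto simp: Int_Un_distrib)
  moreover have "card (C - M) = card (C \<inter> U) + card (C \<inter> L)"
    using disj fC CS by (subst card_Un_disjoint[symmetric]) (auto intro!: arg_cong[where f=card])
  moreover have "card C = card (C \<inter> U) + card (C \<inter> L) + card (C \<inter> M)"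
  proof -
    have "C = (C \<inter> U \<union> C \<inter> L) \<union> C \<inter> M" using CS by auto
    then have "card C = card (C \<inter> U \<union> C \<inter> L) + card (C \<inter> M)"
      using disj fC card_Un_disjoint[of "C \<inter> U \<union> C \<inter> L" "C \<inter> M"] by auto
    also have "card (C \<inter> U \<union> C \<inter> L) = card (C \<inter> U) + card (C \<inter> L)"
      using disj fC by (intro card_Un_disjoint) auto
    finally show ?thesis .
  qed
  ultimately show "card (C \<inter> (U \<union> M)) + card (C \<inter> (M \<union> L)) + card (C - M) = 2 * card C" by simp
qed

text \<open>A connected graph has at least as many edges as vertices minus one, whereas every outer
  vertex and every isolated vertex of one of the two layers costs half an edge.\<close>

lemma comps_degree:
  assumes C: "C \<in> comps (P \<union> Q)"
  shows "card (C - M) + card {b \<in> P. b \<subseteq> C \<and> card b = 1} + card {b \<in> Q. b \<subseteq> C \<and> card b = 1} \<le> 2"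
proof -
  have "card C \<le> card {b \<in> P \<union> Q. b \<subseteq> C \<and> card b = 2} + 1"
    by (rule linked_edge_count) (use C comps_finite[OF C] finite_PQ P2 Q2 in \<open>auto simp: in_comps_iff\<close>)
  also have "{b \<in> P \<union> Q. b \<subseteq> C \<and> card b = 2} = {b \<in> P. b \<subseteq> C \<and> card b = 2} \<union> {b \<in> Q. b \<subseteq> C \<and> card b = 2}"
    by auto
  \<comment> \<open>Only an inequality, since the layers can share a block inside \<open>M\<close>:
    a cap of the upper diagram and a cup of the lower one on the same two vertices are one set in
    the union.\<close>
  also have "card \<dots> \<le> card {b \<in> P. b \<subseteq> C \<and> card b = 2} + card {b \<in> Q. b \<subseteq> C \<and> card b = 2}"
    by (rule card_Un_le)
  finally show ?thesis using comps_blocks[OF C] by linarith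
qed

text \<open>The block \<open>{v}\<close> uses up one of the two units in
  \<open>comps_degree\<close>, which leaves at most one for the outer vertices.\<close>

lemma isolated_degree:
  assumes C: "C \<in> comps (P \<union> Q)" and v: "v \<in> C" "{v} \<in> P \<or> {v} \<in> Q"
  shows "card (C - M) \<le> 1"
proof -
  let ?p = "{b \<in> P. b \<subseteq> C \<and> card b = 1}" and ?q = "{b \<in> Q. b \<subseteq> C \<and> card b = 1}"
  have "?p \<noteq> {} \<or> ?q \<noteq> {}" using v by auto
  then have "card ?p \<noteq> 0 \<or> card ?q \<noteq> 0" using finite_PQ by simp
  then show ?thesis using comps_degree[OF C] by linarith
qed

lemma stack_isolate:
  assumes "E \<subseteq> P" "F \<subseteq> Q" shows "stack U M L (isolate E P) (isolate F Q)"
proof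
  show "card b \<le> 2" if "b \<in> isolate E P" for b using that P2 assms by (auto simp: isolate_def)
  show "card b \<le> 2" if "b \<in> isolate F Q" for b using that Q2 assms by (auto simp: isolate_def)
qed (use fin disj partition_on_isolate P Q assms in auto)

section \<open>Removing edges from a stack\<close>

context
  fixes E F assumes E: "E \<subseteq> {b \<in> P. card b = 2}" and F: "F \<subseteq> {b \<in> Q. card b = 2}"
begin

interpretation S': stack U M L "isolate E P" "isolate F Q"
  by (rule stack_isolate) (use E F in auto)

abbreviation "S \<equiv> P \<union> Q"
abbreviation "S' \<equiv> isolate E P \<union> isolate F Q"
abbreviation "hit C \<equiv> (\<exists>b\<in>E \<union> F. b \<subseteq> C)"

lemma Union_S': "\<Union>S' = \<Union>S"
  using Union_eq S'.Union_eq by simp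

lemma S'_cases: "b \<in> S' \<Longrightarrow> b \<in> S \<or> (\<exists>v. b = {v})"
  by (auto simp: isolate_def)

lemma closed_S': "block_closed S D \<Longrightarrow> block_closed S' D"
  unfolding block_closed_def using S'_cases by fastforce

lemma S_cases: "b \<in> S \<Longrightarrow> b \<in> S' \<or> (b \<in> E \<and> (\<forall>v\<in>b. {v} \<in> isolate E P)) \<or> (b \<in> F \<and> (\<forall>v\<in>b. {v} \<in> isolate F Q))"
  by (auto simp: isolate_def)

text \<open>All blocks inside \<open>C\<close> are untouched, so a part of \<open>C\<close> that is
  closed for the new blocks is closed for the old ones, and linkedness carries over.\<close>

lemma unhit_comps:
  assumes C: "C \<in> comps S" and h: "\<not> hit C" shows "C \<in> comps S'"
  unfolding in_comps_iff
proof (intro conjI)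
  have c: "C \<noteq> {}" "C \<subseteq> \<Union>S" "block_closed S C" "linked S C" using C by (auto simp: in_comps_iff)
  show "C \<noteq> {}" by fact
  show "C \<subseteq> \<Union>S'" using c(2) Union_eq S'.Union_eq by simp
  show "block_closed S' C" by (rule closed_S') fact
  show "linked S' C"
    unfolding linked_def
  proof (intro allI impI)
    fix D assume D: "D \<subseteq> C" "D \<noteq> {}" "block_closed S' D"
    have "block_closed S D"
      unfolding block_closed_def
    proof (intro ballI impI)
      fix b assume b: "b \<in> S" "b \<inter> D \<noteq> {}"
      then have "b \<subseteq> C" using c(3) D(1) unfolding block_closed_def by blast
      then have "b \<in> S'" using b S_cases h by blast
      then show "b \<subseteq> D" using D(3) b unfolding block_closed_def by blast
    qed
    then show "D = C" using linkedD[OF c(4)] D by blast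
  qed
qed

lemma comps_S'_inside:
  assumes C': "C' \<in> comps S'" and C: "C \<in> comps S" and x: "x \<in> C'" "x \<in> C"
  shows "C' \<subseteq> C"
proof -
  have "block_closed S' (C' \<inter> C)"
    using C' C closed_S' by (intro block_closed_Int) (auto simp: in_comps_iff)
  then have "C' \<inter> C = C'" using C' x by (intro linkedD[of S' C']) (auto simp: in_comps_iff)
  then show ?thesis by auto
qed

text \<open>A piece without isolated vertices touches no removed edge, since the endpoints of such
  an edge have become isolated. It would then be closed for the old blocks and hence be all of
  \<open>C\<close>, which does contain a removed edge.\<close>

lemma hit_isolated:
  assumes C': "C' \<in> comps S'" and C: "C \<in> comps S" and x: "x \<in> C'" "x \<in> C" and h: "hit C"
  shows "\<exists>v\<in>C'. {v} \<in> isolate E P \<or> {v} \<in> isolate F Q"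
proof (rule ccontr)
  assume n: "\<not> ?thesis"
  have "block_closed S C'"
    unfolding block_closed_def
  proof (intro ballI impI)
    fix b assume b: "b \<in> S" "b \<inter> C' \<noteq> {}"
    then have "b \<in> S'" using S_cases n by blast
    then show "b \<subseteq> C'" using C' b unfolding in_comps_iff block_closed_def by blast
  qed
  \<comment> \<open>This is not yet absurd, as a cycle stays connected after the loss of one edge.
    The contradiction comes from the endpoints of the removed edge.\<close>
  then have "C' = C"
    using C' C comps_S'_inside[OF C' C x] by (intro linkedD[of S C]) (auto simp: in_comps_iff)
  then obtain b where b: "b \<in> E \<union> F" "b \<subseteq> C'" using h by auto
  then have "b \<noteq> {}" using E F by auto
  then obtain v where v: "v \<in> b" by auto
  then have "{v} \<in> isolate E P \<or> {v} \<in> isolate F Q" using b by (auto simp: isolate_def)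
  then show False using n b v by blast
qed

text \<open>No new loops arise: a piece of a component that has lost an edge contains an isolated
  vertex. Even a cycle that remains connected ceases to be a loop for this reason.\<close>

lemma loops_isolate: "loops M S' = {C \<in> loops M S. \<not> hit C}"
proof (intro equalityI subsetI)
  fix C' assume "C' \<in> loops M S'"
  then have C': "C' \<in> comps S'" "C' \<subseteq> M" "\<And>b. b \<in> S' \<Longrightarrow> b \<subseteq> C' \<Longrightarrow> card b = 2" by (auto simp: loops_def)
  obtain x where x: "x \<in> C'" "x \<in> \<Union>S'" using C' unfolding in_comps_iff by blast
  then obtain C where C: "C \<in> comps S" "x \<in> C" using comps_cover[of x S] Union_S' by blast
  have nh: "\<not> hit C"
  proof
    assume "hit C"
    then obtain v where "v \<in> C'" "{v} \<in> S'" using hit_isolated[OF C'(1) C(1) x(1) C(2)] by auto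
    then show False using C'(3)[of "{v}"] by simp
  qed
  have "C' = C" using comps_disjoint[OF C'(1) unhit_comps[OF C(1) nh] x(1) C(2)] .
  moreover have "card b = 2" if b: "b \<in> S" "b \<subseteq> C" for b
    using S_cases[OF b(1)] b nh C'(3) \<open>C' = C\<close> by blast
  ultimately show "C' \<in> {C \<in> loops M S. \<not> hit C}" using C nh C' by (auto simp: loops_def)
next
  fix C assume "C \<in> {C \<in> loops M S. \<not> hit C}"
  then have C: "C \<in> comps S" "C \<subseteq> M" "\<And>b. b \<in> S \<Longrightarrow> b \<subseteq> C \<Longrightarrow> card b = 2" "\<not> hit C" by (auto simp: loops_def)
  have "card b = 2" if b: "b \<in> S'" "b \<subseteq> C" for b
  proof (rule ccontr)
    assume n: "card b \<noteq> 2"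
    then have "b \<notin> S" using C(3) b by blast
    then obtain c v where c: "b = {v}" "v \<in> c" "c \<in> E \<union> F" using b by (auto simp: isolate_def)
    then have "c \<in> S" using E F by auto
    then have "c \<subseteq> C" using C(1) c b unfolding in_comps_iff block_closed_def by blast
    then show False using C(4) c by blast
  qed
  then show "C \<in> loops M S'" using unhit_comps[OF C(1,4)] C(2) by (auto simp: loops_def)
qed

text \<open>Each piece of a hit component contains a vertex isolated in one of the layers and thus
  at most one outer vertex, by \<open>isolated_degree\<close>. All outer vertices of the component
  end up as singletons.\<close>

lemma outs_isolate:
  "outs M S' = ({C - M | C. C \<in> comps S \<and> \<not> hit C} - {{}}) \<union> {{x} | x C. C \<in> comps S \<and> hit C \<and> x \<in> C - M}"
proof (intro equalityI subsetI)
  fix o' assume "o' \<in> outs M S'"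
  then obtain C' where C': "C' \<in> comps S'" "o' = C' - M" "o' \<noteq> {}" by (auto simp: outs_def)
  obtain x where x: "x \<in> C'" "x \<notin> M" using C' by auto
  then have "x \<in> \<Union>S'" using C' unfolding in_comps_iff by blast
  then obtain C where C: "C \<in> comps S" "x \<in> C" using comps_cover[of x S] Union_S' by blast
  show "o' \<in> ({C - M | C. C \<in> comps S \<and> \<not> hit C} - {{}}) \<union> {{x} | x C. C \<in> comps S \<and> hit C \<and> x \<in> C - M}"
  proof (cases "hit C")
    case True
    then obtain v where v: "v \<in> C'" "{v} \<in> isolate E P \<or> {v} \<in> isolate F Q" using hit_isolated[OF C'(1) C(1) x(1) C(2)] by auto
    have "card (C' - M) \<le> 1" using S'.isolated_degree[OF C'(1) v] .
    moreover have "finite (C' - M)" using S'.comps_finite[OF C'(1)] by simp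
    ultimately have "o' = {x}" using x C' card_le_Suc0_iff_eq[of "C' - M"] by auto
    then show ?thesis using True C x by blast
  next
    case False
    then have "C' = C" using comps_disjoint[OF C'(1) unhit_comps[OF C(1)] x(1) C(2)] by simp
    then show ?thesis using False C C' by auto
  qed
next
  fix o' assume "o' \<in> ({C - M | C. C \<in> comps S \<and> \<not> hit C} - {{}}) \<union> {{x} | x C. C \<in> comps S \<and> hit C \<and> x \<in> C - M}"
  then show "o' \<in> outs M S'"
  proof
    assume "o' \<in> {C - M | C. C \<in> comps S \<and> \<not> hit C} - {{}}"
    then show ?thesis using unhit_comps by (auto simp: outs_def)
  next
    assume "o' \<in> {{x} | x C. C \<in> comps S \<and> hit C \<and> x \<in> C - M}"
    then obtain x C where C: "o' = {x}" "C \<in> comps S" "hit C" "x \<in> C" "x \<notin> M" by auto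
    then have "x \<in> \<Union>S" unfolding in_comps_iff by blast
    then obtain C' where C': "C' \<in> comps S'" "x \<in> C'" using comps_cover[of x S'] Union_S' by blast
    obtain v where v: "v \<in> C'" "{v} \<in> isolate E P \<or> {v} \<in> isolate F Q" using hit_isolated[OF C'(1) C(2) C'(2) C(4,3)] by auto
    have "card (C' - M) \<le> 1" using S'.isolated_degree[OF C'(1) v] .
    moreover have "finite (C' - M)" using S'.comps_finite[OF C'(1)] by simp
    ultimately have "C' - M = {x}" using C C' card_le_Suc0_iff_eq[of "C' - M"] by auto
    then show ?thesis using C C' by (auto simp: outs_def image_iff)
  qed
qed

end

text \<open>The component of \<open>e\<close> contains \<open>v\<close>, which is isolated in the
  other layer. It therefore has at most one outer vertex and is no loop even before \<open>e\<close>
  is removed, and breaking it changes neither the outer blocks nor the loops.\<close>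

lemma toggle_P:
  assumes e: "e \<in> P" "card e = 2" and v: "v \<in> e" "{v} \<in> Q"
  shows "outs M (isolate {e} P \<union> Q) = outs M (P \<union> Q)" "loops M (isolate {e} P \<union> Q) = loops M (P \<union> Q)"
proof -
  have E: "{e} \<subseteq> {b \<in> P. card b = 2}" "{} \<subseteq> {b \<in> Q. card b = 2}" using e by auto
  have vC: "v \<in> C" if "e \<subseteq> C" for C using that v by auto
  have x: "C - M = {x}" if "C \<in> comps (P \<union> Q)" "e \<subseteq> C" "x \<in> C - M" for C x
    using isolated_degree[OF that(1) vC[OF that(2)]] v that comps_finite[OF that(1)]
      card_le_Suc0_iff_eq[of "C - M"] by auto
  have "outs M (isolate {e} P \<union> Q) = ({C - M | C. C \<in> comps (P \<union> Q) \<and> \<not> e \<subseteq> C} - {{}})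
      \<union> {{x} | x C. C \<in> comps (P \<union> Q) \<and> e \<subseteq> C \<and> x \<in> C - M}"
    using outs_isolate[OF E] by simp
  also have "{{x} | x C. C \<in> comps (P \<union> Q) \<and> e \<subseteq> C \<and> x \<in> C - M}
      = {C - M | C. C \<in> comps (P \<union> Q) \<and> e \<subseteq> C} - {{}}"
  proof (intro equalityI subsetI)
    fix z assume "z \<in> {{x} | x C. C \<in> comps (P \<union> Q) \<and> e \<subseteq> C \<and> x \<in> C - M}"
    then obtain x' C where c: "z = {x'}" "C \<in> comps (P \<union> Q)" "e \<subseteq> C" "x' \<in> C - M" by blast
    have "z = C - M" using x[OF c(2-4)] c(1) by simp
    then show "z \<in> {C - M | C. C \<in> comps (P \<union> Q) \<and> e \<subseteq> C} - {{}}" using c by blast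
  next
    fix z assume "z \<in> {C - M | C. C \<in> comps (P \<union> Q) \<and> e \<subseteq> C} - {{}}"
    then obtain C x' where c: "z = C - M" "C \<in> comps (P \<union> Q)" "e \<subseteq> C" "x' \<in> C - M" by blast
    have "z = {x'}" using x[OF c(2-4)] c(1) by simp
    then show "z \<in> {{x} | x C. C \<in> comps (P \<union> Q) \<and> e \<subseteq> C \<and> x \<in> C - M}" using c by blast
  qed
  also have "({C - M | C. C \<in> comps (P \<union> Q) \<and> \<not> e \<subseteq> C} - {{}}) \<union> ({C - M | C. C \<in> comps (P \<union> Q) \<and> e \<subseteq> C} - {{}})
      = ({C - M | C. C \<in> comps (P \<union> Q) \<and> \<not> e \<subseteq> C} \<union> {C - M | C. C \<in> comps (P \<union> Q) \<and> e \<subseteq> C}) - {{}}"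
    by (rule Un_Diff[symmetric])
  also have "{C - M | C. C \<in> comps (P \<union> Q) \<and> \<not> e \<subseteq> C} \<union> {C - M | C. C \<in> comps (P \<union> Q) \<and> e \<subseteq> C}
      = (\<lambda>C. C - M) ` comps (P \<union> Q)" by blast
  finally show "outs M (isolate {e} P \<union> Q) = outs M (P \<union> Q)" unfolding outs_def .
  have "\<not> e \<subseteq> C" if "C \<in> loops M (P \<union> Q)" for C
  proof
    assume "e \<subseteq> C"
    then have "{v} \<subseteq> C" using v by auto
    then have "card {v} = 2" using that v(2) unfolding loops_def by blast
    then show False by simp
  qed
  then show "loops M (isolate {e} P \<union> Q) = loops M (P \<union> Q)"
    using loops_isolate[OF E] by auto
qed

end

text \<open>The case complementary to cancellation: a middle vertex is isolated in both layers or in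
  neither.\<close>

locale matched_stack = stack +
  assumes matched: "v \<in> M \<Longrightarrow> {v} \<in> P \<longleftrightarrow> {v} \<in> Q"
begin

text \<open>The components that removing edges can break. A component without an edge is a single
  vertex.\<close>

definition live where "live = {C \<in> comps (P \<union> Q). \<exists>b\<in>P \<union> Q. b \<subseteq> C \<and> card b = 2}"

definition paths where "paths = {C \<in> comps (P \<union> Q). card (C - M) = 2}"

text \<open>A vertex isolated in one layer is isolated in every layer containing it, by
  \<open>matched\<close> if it lies in the middle row. It then is a component by itself, and that
  component has no edge.\<close>

lemma live_no_isolated:
  assumes C: "C \<in> live" shows "b \<in> P \<union> Q \<Longrightarrow> b \<subseteq> C \<Longrightarrow> card b = 2"
proof (rule ccontr)
  assume b: "b \<in> P \<union> Q" "b \<subseteq> C" "card b \<noteq> 2"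
  have CS: "C \<in> comps (P \<union> Q)" using C by (simp add: live_def)
  have "b \<noteq> {}" using b P Q by (auto simp: partition_on_def)
  moreover have "finite b" using b(2) comps_finite[OF CS] finite_subset by auto
  ultimately have "card b = 1" using b P2[of b] Q2[of b] by (cases "card b") auto
  then obtain v where v: "b = {v}" by (auto simp: card_1_singleton_iff)
  have "block_closed (P \<union> Q) {v}"
    unfolding block_closed_def
  proof (intro ballI impI)
    fix c assume c: "c \<in> P \<union> Q" "c \<inter> {v} \<noteq> {}"
    have vP: "{v} \<in> P" if "v \<in> U \<union> M"
      using that b(1) matched disj Q v by (auto simp: partition_on_def)
    have vQ: "{v} \<in> Q" if "v \<in> M \<union> L"
      using that b(1) matched disj P v by (auto simp: partition_on_def)
    show "c \<subseteq> {v}"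
    proof (cases "c \<in> P")
      case True
      then have "v \<in> U \<union> M" using c P by (auto simp: partition_on_def)
      then show ?thesis using vP partition_on_unique[OF P True, of "{v}" v] c by auto
    next
      case False
      then have "c \<in> Q" "v \<in> M \<union> L" using c Q by (auto simp: partition_on_def)
      then show ?thesis using vQ partition_on_unique[OF Q, of c "{v}" v] c by auto
    qed
  qed
  then have "{v} = C" using CS b v by (intro linkedD[of "P \<union> Q" C]) (auto simp: in_comps_iff)
  moreover obtain c where "c \<in> P \<union> Q" "c \<subseteq> C" "card c = 2" using C by (auto simp: live_def)
  ultimately show False using card_mono[of "{v}" c] by auto
qed

text \<open>Without isolated vertices \<open>comps_blocks\<close> makes the number of outer vertices
  even, and \<open>comps_degree\<close> bounds it by 2. Two outer vertices give a path, none a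
  loop.\<close>

lemma live_cases: "C \<in> live \<Longrightarrow> C \<in> paths \<or> C \<in> loops M (P \<union> Q)"
proof -
  assume C: "C \<in> live"
  then have CS: "C \<in> comps (P \<union> Q)" by (simp add: live_def)
  have "{b \<in> P. b \<subseteq> C \<and> card b = 1} = {}" "{b \<in> Q. b \<subseteq> C \<and> card b = 1} = {}"
    using live_no_isolated[OF C] by force+
  then have e: "card (C - M) = 2 * (card C - card {b \<in> P. b \<subseteq> C \<and> card b = 2} - card {b \<in> Q. b \<subseteq> C \<and> card b = 2})"
    using comps_blocks[OF CS] by (simp only: card.empty)
  have "card (C - M) \<le> 2" using comps_degree[OF CS] by linarith
  then have "card (C - M) = 2 \<or> card (C - M) = 0" using e by presburger
  then show ?thesis
  proof
    assume "card (C - M) = 0"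
    then have "C \<subseteq> M" using comps_finite[OF CS] by auto
    then show ?thesis using CS live_no_isolated[OF C] by (auto simp: loops_def)
  qed (use CS in \<open>auto simp: paths_def\<close>)
qed

text \<open>A component without edges consists of one vertex and cannot have two outer ones.\<close>

lemma paths_live: "C \<in> paths \<Longrightarrow> C \<in> live"
proof -
  assume "C \<in> paths"
  then have C: "C \<in> comps (P \<union> Q)" "card (C - M) = 2" by (auto simp: paths_def)
  show "C \<in> live"
  proof (rule ccontr)
    assume n: "C \<notin> live"
    have "C - M \<noteq> {}" using C(2) by (metis card.empty zero_neq_numeral)
    then obtain x where x: "x \<in> C - M" by blast
    have "block_closed (P \<union> Q) {x}"
      unfolding block_closed_def
    proof (intro ballI impI)
      fix b assume b: "b \<in> P \<union> Q" "b \<inter> {x} \<noteq> {}"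
      then have bC: "b \<subseteq> C" using C(1) x by (auto simp: in_comps_iff block_closed_def)
      then have "card b \<noteq> 2" using n b C by (auto simp: live_def)
      then have "card b \<le> 1" using b P2[of b] Q2[of b] by auto
      moreover have "finite b" using bC comps_finite[OF C(1)] finite_subset by auto
      ultimately show "b \<subseteq> {x}" using b card_le_Suc0_iff_eq[of b] by auto
    qed
    then have "{x} = C" using C x by (intro linkedD[of "P \<union> Q" C]) (auto simp: in_comps_iff)
    then show False using C(2) card_Diff_subset_Int[of "{x}" M] card_mono[of "{x}" "C - M"] by auto
  qed
qed

lemma loops_live: "C \<in> loops M (P \<union> Q) \<Longrightarrow> C \<in> live"
proof -
  assume "C \<in> loops M (P \<union> Q)"
  then have C: "C \<in> comps (P \<union> Q)" "\<forall>b\<in>P \<union> Q. b \<subseteq> C \<longrightarrow> card b = 2" by (auto simp: loops_def)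
  then obtain x b where "x \<in> C" "x \<in> b" "b \<in> P \<union> Q" unfolding in_comps_iff by blast
  then have "b \<subseteq> C" "b \<in> P \<union> Q" using C(1) by (auto simp: in_comps_iff block_closed_def)
  then show "C \<in> live" using C by (auto simp: live_def)
qed

lemma live_eq: "live = paths \<union> loops M (P \<union> Q)" "paths \<inter> loops M (P \<union> Q) = {}"
proof -
  show "live = paths \<union> loops M (P \<union> Q)" using live_cases paths_live loops_live by blast
  have "C - M = {}" if "C \<in> loops M (P \<union> Q)" for C using that by (auto simp: loops_def)
  then show "paths \<inter> loops M (P \<union> Q) = {}" by (fastforce simp: paths_def)
qed

text \<open>A broken path leaves its two ends isolated, exactly as if the corresponding edge of the
  composite had been removed; a broken loop disappears. The outcome depends on the removed edges
  only through the set \<open>H\<close> of broken components, which allows the sums to be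
  regrouped.\<close>

lemma outs_isolate_matched:
  assumes E: "E \<subseteq> {b \<in> P. card b = 2}" and F: "F \<subseteq> {b \<in> Q. card b = 2}"
    and H: "H = {C \<in> live. \<exists>b\<in>E \<union> F. b \<subseteq> C}"
  shows "outs M (isolate E P \<union> isolate F Q) = isolate ((\<lambda>C. C - M) ` (H \<inter> paths)) (outs M (P \<union> Q))"
    and "loops M (isolate E P \<union> isolate F Q) = loops M (P \<union> Q) - H"
proof -
  have hit: "(\<exists>b\<in>E \<union> F. b \<subseteq> C) \<longleftrightarrow> C \<in> H" if "C \<in> comps (P \<union> Q)" for C
    using that E F H by (auto simp: live_def)
  show "loops M (isolate E P \<union> isolate F Q) = loops M (P \<union> Q) - H"
    unfolding loops_isolate[OF E F] using hit unfolding loops_def by blast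
  have d: "C = D" if "C \<in> comps (P \<union> Q)" "D \<in> comps (P \<union> Q)" "C - M = D - M" "C - M \<noteq> {}" for C D
    using that comps_disjoint[of C "P \<union> Q" D] by blast
  have HL: "C \<in> paths \<or> C \<subseteq> M" "C \<in> comps (P \<union> Q)" if "C \<in> H" for C
    using that live_cases[of C] H by (auto simp: loops_def live_def)
  have ne: "C - M \<noteq> {}" if "C \<in> paths" for C
    using that by (metis (mono_tags, lifting) card.empty mem_Collect_eq paths_def zero_neq_numeral)
  have "outs M (isolate E P \<union> isolate F Q) = ({C - M | C. C \<in> comps (P \<union> Q) \<and> C \<notin> H} - {{}})
      \<union> {{x} | x C. C \<in> comps (P \<union> Q) \<and> C \<in> H \<and> x \<in> C - M}"
  proof -
    have "{C - M | C. C \<in> comps (P \<union> Q) \<and> \<not> (\<exists>b\<in>E \<union> F. b \<subseteq> C)} = {C - M | C. C \<in> comps (P \<union> Q) \<and> C \<notin> H}"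
      using hit by blast
    moreover have "{{x} | x C. C \<in> comps (P \<union> Q) \<and> (\<exists>b\<in>E \<union> F. b \<subseteq> C) \<and> x \<in> C - M}
        = {{x} | x C. C \<in> comps (P \<union> Q) \<and> C \<in> H \<and> x \<in> C - M}"
      using hit by blast
    ultimately show ?thesis unfolding outs_isolate[OF E F] by simp
  qed
  also have "{C - M | C. C \<in> comps (P \<union> Q) \<and> C \<notin> H} - {{}} = outs M (P \<union> Q) - (\<lambda>C. C - M) ` (H \<inter> paths)"
  proof (intro equalityI subsetI)
    fix z assume "z \<in> {C - M | C. C \<in> comps (P \<union> Q) \<and> C \<notin> H} - {{}}"
    then obtain C where C: "z = C - M" "C \<in> comps (P \<union> Q)" "C \<notin> H" "z \<noteq> {}" by auto
    have "z \<notin> (\<lambda>C. C - M) ` (H \<inter> paths)"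
    proof
      assume "z \<in> (\<lambda>C. C - M) ` (H \<inter> paths)"
      then obtain D where D: "z = D - M" "D \<in> H" by blast
      have "C - M = D - M" "C - M \<noteq> {}" using C(1,4) D(1) by simp_all
      then have "C = D" by (rule d[OF C(2) HL(2)[OF D(2)]])
      then show False using C D by simp
    qed
    then show "z \<in> outs M (P \<union> Q) - (\<lambda>C. C - M) ` (H \<inter> paths)" using C(1,2,4) unfolding outs_def by blast
  next
    fix z assume z: "z \<in> outs M (P \<union> Q) - (\<lambda>C. C - M) ` (H \<inter> paths)"
    then obtain C where C: "z = C - M" "C \<in> comps (P \<union> Q)" "z \<noteq> {}" unfolding outs_def by blast
    have "C \<notin> H"
    proof
      assume "C \<in> H"
      then have "C \<in> H \<inter> paths" using HL(1) C(1,3) by blast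
      then show False using z C(1) by blast
    qed
    then show "z \<in> {C - M | C. C \<in> comps (P \<union> Q) \<and> C \<notin> H} - {{}}" using C by blast
  qed
  also have "{{x} | x C. C \<in> comps (P \<union> Q) \<and> C \<in> H \<and> x \<in> C - M} = (\<lambda>v. {v}) ` \<Union>((\<lambda>C. C - M) ` (H \<inter> paths))"
    (is "?A = ?B")
  proof (intro equalityI subsetI)
    fix z assume "z \<in> ?A"
    then obtain x C where z: "z = {x}" "C \<in> H" "x \<in> C - M" by blast
    then have "C \<in> H \<inter> paths" using HL(1)[of C] by blast
    then have "x \<in> \<Union>((\<lambda>C. C - M) ` (H \<inter> paths))" using z(3) by (rule UN_I)
    then show "z \<in> ?B" unfolding z(1) by (rule imageI)
  next
    fix z assume "z \<in> ?B"
    then obtain x C where z: "z = {x}" "C \<in> H" "x \<in> C - M" by auto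
    then show "z \<in> ?A" using HL(2)[OF z(2)] by blast
  qed
  finally show "outs M (isolate E P \<union> isolate F Q) = isolate ((\<lambda>C. C - M) ` (H \<inter> paths)) (outs M (P \<union> Q))"
    by (simp add: isolate_def)
qed

lemma outs_edges: "{z \<in> outs M (P \<union> Q). card z = 2} = (\<lambda>C. C - M) ` paths"
  by (auto simp: outs_def paths_def image_iff)

lemma paths_inj: "inj_on (\<lambda>C. C - M) paths"
proof (rule inj_onI)
  fix C D assume CD: "C \<in> paths" "D \<in> paths" "C - M = D - M"
  then have "C - M \<noteq> {}"
    by (metis (mono_tags, lifting) card.empty mem_Collect_eq paths_def zero_neq_numeral)
  then show "C = D" using CD comps_disjoint[of C "P \<union> Q" D] by (auto simp: paths_def)
qed

end

section \<open>Stacked diagrams\<close>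

lemma comps_block: "C \<in> comps S \<Longrightarrow> \<exists>b\<in>S. b \<subseteq> C \<and> b \<noteq> {}"
proof -
  assume "C \<in> comps S"
  then have C: "C \<noteq> {}" "C \<subseteq> \<Union>S" "block_closed S C" by (simp_all add: in_comps_iff)
  then obtain x b where x: "x \<in> C" "x \<in> b" "b \<in> S" by blast
  then show ?thesis using block_closedD[OF C(3) x(3,2,1)] by blast
qed

abbreviation verts :: "nat \<Rightarrow> vertex set" where "verts k \<equiv> {Upper, Lower} \<times> {1..k}"

lemma partition_on_image:
  assumes "partition_on A P" "inj_on f A" shows "partition_on (f ` A) ((`) f ` P)"
proof -
  have "(`) f ` P - {{}} = (`) f ` P" using assms(1) by (auto simp: partition_on_def)
  then show ?thesis using partition_on_inj_image[OF assms] by simp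
qed

lemma image_isolate:
  assumes "inj_on f (\<Union>d)" "E \<subseteq> d"
  shows "(`) f ` isolate E d = isolate ((`) f ` E) ((`) f ` d)"
proof -
  have "inj_on ((`) f) (Pow (\<Union>d))" using assms(1) by (rule inj_on_image_Pow)
  then have "(`) f ` (d - E) = (`) f ` d - (`) f ` E"
    by (rule inj_on_image_set_diff) (use assms in auto)
  moreover have "\<Union>((`) f ` E) = f ` \<Union>E" by blast
  ultimately show ?thesis by (simp add: isolate_def image_Un image_image)
qed

lemma edges_image: "inj_on f (\<Union>d) \<Longrightarrow> edges ((`) f ` d) = (`) f ` edges d"
  by (auto simp: edges_def card_image inj_on_subset[of f "\<Union>d"] Union_upper)

definition fU :: "vertex \<Rightarrow> vertex" where "fU = map_prod (id(Lower := Middle)) id"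
definition fL :: "vertex \<Rightarrow> vertex" where "fL = map_prod (id(Upper := Middle)) id"

lemma fU_simps [simp]: "fU (Upper, i) = (Upper, i)" "fU (Lower, i) = (Middle, i)"
  by (auto simp: fU_def)

lemma fL_simps [simp]: "fL (Lower, i) = (Lower, i)" "fL (Upper, i) = (Middle, i)"
  by (auto simp: fL_def)

lemma fU_inj: "inj_on fU (verts k)" and fL_inj: "inj_on fL (verts k)"
  by (auto simp: inj_on_def)

lemma fU_verts: "fU ` verts k = {Upper} \<times> {1..k} \<union> {Middle} \<times> {1..k}"
  and fL_verts: "fL ` verts k = {Middle} \<times> {1..k} \<union> {Lower} \<times> {1..k}"
  by (force simp: image_iff)+

lemma stacked_eq: "stacked d\<^sub>1 d\<^sub>2 = (`) fU ` d\<^sub>1 \<union> (`) fL ` d\<^sub>2"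
  by (simp add: stacked_def relabel_rows_def fU_def fL_def)

lemma partial_brauerD:
  assumes "d \<in> partial_brauer k"
  shows "partition_on (verts k) d" "b \<in> d \<Longrightarrow> card b \<le> 2" "\<Union>d = verts k" "finite d"
    "b \<in> d \<Longrightarrow> finite b" "b \<in> d \<Longrightarrow> b \<noteq> {}" "b \<in> d \<Longrightarrow> b \<subseteq> verts k"
proof -
  show p: "partition_on (verts k) d" and "b \<in> d \<Longrightarrow> card b \<le> 2"
    using assms by (auto simp: partial_brauer_def)
  show "\<Union>d = verts k" using p by (auto simp: partition_on_def)
  then show "b \<in> d \<Longrightarrow> b \<subseteq> verts k" "b \<in> d \<Longrightarrow> finite b" using finite_subset[of b "verts k"] by auto
  show "b \<in> d \<Longrightarrow> b \<noteq> {}" using p by (auto simp: partition_on_def)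
  show "finite d" using finite_elements[OF _ p] by auto
qed

lemma isolate_partial_brauer:
  assumes "d \<in> partial_brauer k" "E \<subseteq> edges d"
  shows "isolate E d \<in> partial_brauer k"
proof -
  have "E \<subseteq> d" using assms by (auto simp: edges_def)
  then show ?thesis using assms partition_on_isolate by (auto simp: partial_brauer_def) (auto simp: isolate_def)
qed

text \<open>A block taking part in a crossing has two vertices at different boundary positions, so
  none of the new singletons is involved.\<close>

lemma isolate_motzkin:
  assumes "d \<in> motzkin k" "E \<subseteq> edges d"
  shows "isolate E d \<in> motzkin k"
proof -
  have "noncrossing k (isolate E d)"
    unfolding noncrossing_def
  proof (intro ballI notI)
    fix b b' assume b: "b \<in> isolate E d" "b' \<in> isolate E d"
    assume "\<exists>x\<in>b. \<exists>y\<in>b'. \<exists>z\<in>b. \<exists>w\<in>b'. boundary_pos k x < boundary_pos k y \<and>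
      boundary_pos k y < boundary_pos k z \<and> boundary_pos k z < boundary_pos k w"
    then obtain x y z w where xyzw: "x \<in> b" "y \<in> b'" "z \<in> b" "w \<in> b'"
      "boundary_pos k x < boundary_pos k y" "boundary_pos k y < boundary_pos k z" "boundary_pos k z < boundary_pos k w" by blast
    then have "b \<noteq> {v}" "b' \<noteq> {v}" for v by auto
    then have "b \<in> d" "b' \<in> d" using b by (auto simp: isolate_def)
    moreover have "noncrossing k d" using assms(1) by (simp add: motzkin_def)
    ultimately show False using xyzw unfolding noncrossing_def by blast
  qed
  then show ?thesis using assms isolate_partial_brauer by (auto simp: motzkin_def)
qed

lemma edges_isolate: "d \<in> partial_brauer k \<Longrightarrow> E \<subseteq> edges d \<Longrightarrow> edges (isolate E d) = edges d - E"
  by (auto simp: edges_def isolate_def)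

lemma stack_diagrams:
  assumes "d\<^sub>1 \<in> partial_brauer k" "d\<^sub>2 \<in> partial_brauer k"
  shows "stack ({Upper} \<times> {1..k}) ({Middle} \<times> {1..k}) ({Lower} \<times> {1..k}) ((`) fU ` d\<^sub>1) ((`) fL ` d\<^sub>2)"
proof
  note d = partial_brauerD[OF assms(1)] partial_brauerD[OF assms(2)]
  show "partition_on ({Upper} \<times> {1..k} \<union> {Middle} \<times> {1..k}) ((`) fU ` d\<^sub>1)"
    using partition_on_image[OF d(1) fU_inj] by (simp only: fU_verts)
  show "partition_on ({Middle} \<times> {1..k} \<union> {Lower} \<times> {1..k}) ((`) fL ` d\<^sub>2)"
    using partition_on_image[OF d(8) fL_inj] by (simp only: fL_verts)
  show "card b \<le> 2" if "b \<in> (`) fU ` d\<^sub>1" for b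
    using that d(2,5) card_image_le le_trans by (metis (no_types, lifting) imageE)
  show "card b \<le> 2" if "b \<in> (`) fL ` d\<^sub>2" for b
    using that d(9,12) card_image_le le_trans by (metis (no_types, lifting) imageE)
qed auto

lemma comps_stacked_subset:
  assumes "d\<^sub>1 \<in> partial_brauer k" "d\<^sub>2 \<in> partial_brauer k" "C \<in> comps (stacked d\<^sub>1 d\<^sub>2)"
  shows "C \<subseteq> {Upper, Middle, Lower} \<times> {1..k}"
proof -
  interpret stack "{Upper} \<times> {1..k}" "{Middle} \<times> {1..k}" "{Lower} \<times> {1..k}" "(`) fU ` d\<^sub>1" "(`) fL ` d\<^sub>2"
    by (rule stack_diagrams[OF assms(1,2)])
  have "C \<subseteq> \<Union>((`) fU ` d\<^sub>1 \<union> (`) fL ` d\<^sub>2)" using assms(3) unfolding in_comps_iff stacked_eq by blast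
  then show ?thesis unfolding Union_eq by auto
qed

text \<open>Components lie over the positions \<open>{1..k}\<close>, so the infinite middle row in
  the definition can be replaced by the finite one that \<open>stack\<close> requires.\<close>

lemma diag_comp_eq:
  assumes "d\<^sub>1 \<in> partial_brauer k" "d\<^sub>2 \<in> partial_brauer k"
  shows "diag_comp d\<^sub>1 d\<^sub>2 = outs ({Middle} \<times> {1..k}) (stacked d\<^sub>1 d\<^sub>2)"
proof -
  have "C - {Middle} \<times> UNIV = C - {Middle} \<times> {1..k}" if "C \<in> comps (stacked d\<^sub>1 d\<^sub>2)" for C
    using comps_stacked_subset[OF assms that] by auto
  then show ?thesis unfolding diag_comp_def outs_def components_eq by (metis (no_types, lifting) image_cong)
qed

lemma num_loops_eq:
  assumes "d\<^sub>1 \<in> partial_brauer k" "d\<^sub>2 \<in> partial_brauer k"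
  shows "num_loops d\<^sub>1 d\<^sub>2 = card (loops ({Middle} \<times> {1..k}) (stacked d\<^sub>1 d\<^sub>2))"
proof -
  have "C \<subseteq> {Middle} \<times> UNIV \<longleftrightarrow> C \<subseteq> {Middle} \<times> {1..k}" if "C \<in> comps (stacked d\<^sub>1 d\<^sub>2)" for C
    using comps_stacked_subset[OF assms that] by auto
  then show ?thesis unfolding num_loops_def loops_def components_eq by (metis (no_types, lifting))
qed

lemma stacked_isolate:
  assumes "d\<^sub>1 \<in> partial_brauer k" "d\<^sub>2 \<in> partial_brauer k" "E \<subseteq> edges d\<^sub>1" "F \<subseteq> edges d\<^sub>2"
  shows "stacked (isolate E d\<^sub>1) (isolate F d\<^sub>2)
    = isolate ((`) fU ` E) ((`) fU ` d\<^sub>1) \<union> isolate ((`) fL ` F) ((`) fL ` d\<^sub>2)"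
proof -
  have "inj_on fU (\<Union>d\<^sub>1)" "inj_on fL (\<Union>d\<^sub>2)" "E \<subseteq> d\<^sub>1" "F \<subseteq> d\<^sub>2"
    using assms fU_inj[of k] fL_inj[of k] by (auto simp only: partial_brauerD(3) edges_def)
  then show ?thesis unfolding stacked_eq by (simp only: image_isolate)
qed

lemma edges_fU: "d \<in> partial_brauer k \<Longrightarrow> b \<in> edges d \<Longrightarrow> fU ` b \<in> (`) fU ` d \<and> card (fU ` b) = 2"
  and edges_fL: "d \<in> partial_brauer k \<Longrightarrow> b \<in> edges d \<Longrightarrow> fL ` b \<in> (`) fL ` d \<and> card (fL ` b) = 2"
proof -
  assume d: "d \<in> partial_brauer k" "b \<in> edges d"
  then have b: "b \<subseteq> verts k" "card b = 2" "b \<in> d" using partial_brauerD(7) by (auto simp: edges_def)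
  show "fU ` b \<in> (`) fU ` d \<and> card (fU ` b) = 2" "fL ` b \<in> (`) fL ` d \<and> card (fL ` b) = 2"
    using b inj_on_subset[OF fU_inj b(1)] inj_on_subset[OF fL_inj b(1)] by (auto simp: card_image)
qed

lemma toggle_upper:
  assumes d: "d\<^sub>1 \<in> partial_brauer k" "d\<^sub>2 \<in> partial_brauer k"
    and e: "e \<in> edges d\<^sub>1" "(Lower, i) \<in> e" and v: "{(Upper, i)} \<in> d\<^sub>2"
  shows "diag_comp (isolate {e} d\<^sub>1) d\<^sub>2 = diag_comp d\<^sub>1 d\<^sub>2" "num_loops (isolate {e} d\<^sub>1) d\<^sub>2 = num_loops d\<^sub>1 d\<^sub>2"
proof -
  interpret stack "{Upper} \<times> {1..k}" "{Middle} \<times> {1..k}" "{Lower} \<times> {1..k}" "(`) fU ` d\<^sub>1" "(`) fL ` d\<^sub>2"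
    by (rule stack_diagrams[OF d])
  have i: "isolate {e} d\<^sub>1 \<in> partial_brauer k" using e d by (intro isolate_partial_brauer) auto
  have s: "stacked (isolate {e} d\<^sub>1) d\<^sub>2 = isolate {fU ` e} ((`) fU ` d\<^sub>1) \<union> (`) fL ` d\<^sub>2"
    using stacked_isolate[OF d, of "{e}" "{}"] e by simp
  have m: "(Middle, i) \<in> fU ` e" "{(Middle, i)} \<in> (`) fL ` d\<^sub>2"
    using imageI[OF e(2), of fU] imageI[OF v, of "(`) fL"] by auto
  note t = toggle_P[OF _ _ m]
  show "diag_comp (isolate {e} d\<^sub>1) d\<^sub>2 = diag_comp d\<^sub>1 d\<^sub>2"
    using t(1) edges_fU[OF d(1) e(1)] by (simp add: diag_comp_eq[OF i d(2)] diag_comp_eq[OF d] s) (simp add: stacked_eq)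
  show "num_loops (isolate {e} d\<^sub>1) d\<^sub>2 = num_loops d\<^sub>1 d\<^sub>2"
    using t(2) edges_fU[OF d(1) e(1)] by (simp add: num_loops_eq[OF i d(2)] num_loops_eq[OF d] s) (simp add: stacked_eq)
qed

text \<open>The stack is read upside down: after \<open>stack_swap\<close> the lower diagram is the
  first layer and \<open>toggle_P\<close> applies.\<close>

lemma toggle_lower:
  assumes d: "d\<^sub>1 \<in> partial_brauer k" "d\<^sub>2 \<in> partial_brauer k"
    and e: "e \<in> edges d\<^sub>2" "(Upper, i) \<in> e" and v: "{(Lower, i)} \<in> d\<^sub>1"
  shows "diag_comp d\<^sub>1 (isolate {e} d\<^sub>2) = diag_comp d\<^sub>1 d\<^sub>2" "num_loops d\<^sub>1 (isolate {e} d\<^sub>2) = num_loops d\<^sub>1 d\<^sub>2"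
proof -
  interpret stack "{Lower} \<times> {1..k}" "{Middle} \<times> {1..k}" "{Upper} \<times> {1..k}" "(`) fL ` d\<^sub>2" "(`) fU ` d\<^sub>1"
    by (rule stack.stack_swap[OF stack_diagrams[OF d]])
  have i: "isolate {e} d\<^sub>2 \<in> partial_brauer k" using e d by (intro isolate_partial_brauer) auto
  have s: "stacked d\<^sub>1 (isolate {e} d\<^sub>2) = isolate {fL ` e} ((`) fL ` d\<^sub>2) \<union> (`) fU ` d\<^sub>1"
    using stacked_isolate[OF d, of "{}" "{e}"] e by auto
  have m: "(Middle, i) \<in> fL ` e" "{(Middle, i)} \<in> (`) fU ` d\<^sub>1"
    using imageI[OF e(2), of fL] imageI[OF v, of "(`) fU"] by auto
  note t = toggle_P[OF _ _ m]
  show "diag_comp d\<^sub>1 (isolate {e} d\<^sub>2) = diag_comp d\<^sub>1 d\<^sub>2"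
    using t(1) edges_fL[OF d(2) e(1)]
    by (simp add: diag_comp_eq[OF d(1) i] diag_comp_eq[OF d] s) (simp add: stacked_eq Un_commute)
  show "num_loops d\<^sub>1 (isolate {e} d\<^sub>2) = num_loops d\<^sub>1 d\<^sub>2"
    using t(2) edges_fL[OF d(2) e(1)]
    by (simp add: num_loops_eq[OF d(1) i] num_loops_eq[OF d] s) (simp add: stacked_eq Un_commute)
qed

text \<open>The upper positions that are matched; \<open>bots\<close> collects those of the lower
  row. Equality of \<open>bots\<close> of the first and \<open>tops\<close> of the second factor is
  the condition of a matched stack.\<close>

definition tops :: "diagram \<Rightarrow> nat set" where "tops d = {i. (Upper, i) \<in> \<Union>(edges d)}"
definition bots :: "diagram \<Rightarrow> nat set" where "bots d = {i. (Lower, i) \<in> \<Union>(edges d)}"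

lemma singleton_iff_not_edge:
  assumes d: "d \<in> partial_brauer k" and v: "v \<in> verts k"
  shows "{v} \<in> d \<longleftrightarrow> v \<notin> \<Union>(edges d)"
proof
  assume s: "{v} \<in> d"
  show "v \<notin> \<Union>(edges d)"
  proof
    assume "v \<in> \<Union>(edges d)"
    then obtain b where "b \<in> d" "card b = 2" "v \<in> b" by (auto simp: edges_def)
    then have "b = {v}" using s partition_on_unique[OF partial_brauerD(1)[OF d], of b "{v}" v] by simp
    then show False using \<open>card b = 2\<close> by simp
  qed
next
  assume n: "v \<notin> \<Union>(edges d)"
  obtain b where b: "b \<in> d" "v \<in> b" using v partial_brauerD(3)[OF d] by blast
  then have "card b \<noteq> 2" using n by (auto simp: edges_def)
  then have "card b \<le> Suc 0" using partial_brauerD(2)[OF d b(1)] by simp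
  then have "b = {v}" using b partial_brauerD(5)[OF d b(1)] card_le_Suc0_iff_eq[of b] by blast
  then show "{v} \<in> d" using b by simp
qed

lemma fU_singleton: "{(Middle, i)} \<in> (`) fU ` d \<longleftrightarrow> {(Lower, i)} \<in> d" if "d \<in> partial_brauer k" for d i
proof
  assume "{(Middle, i)} \<in> (`) fU ` d"
  then obtain b where b: "b \<in> d" "fU ` b = {(Middle, i)}" by auto
  have "v = (Lower, i)" if "v \<in> b" for v
  proof -
    have "v \<in> verts k" "fU v = (Middle, i)" using that b partial_brauerD(7)[OF \<open>d \<in> partial_brauer k\<close> b(1)] by blast+
    then show ?thesis by (cases v) auto
  qed
  then have "b = {(Lower, i)}" using b by blast
  then show "{(Lower, i)} \<in> d" using b by simp
qed (force simp: image_iff)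

lemma fL_singleton: "{(Middle, i)} \<in> (`) fL ` d \<longleftrightarrow> {(Upper, i)} \<in> d" if "d \<in> partial_brauer k" for d i
proof
  assume "{(Middle, i)} \<in> (`) fL ` d"
  then obtain b where b: "b \<in> d" "fL ` b = {(Middle, i)}" by auto
  have "v = (Upper, i)" if "v \<in> b" for v
  proof -
    have "v \<in> verts k" "fL v = (Middle, i)" using that b partial_brauerD(7)[OF \<open>d \<in> partial_brauer k\<close> b(1)] by blast+
    then show ?thesis by (cases v) auto
  qed
  then have "b = {(Upper, i)}" using b by blast
  then show "{(Upper, i)} \<in> d" using b by simp
qed (force simp: image_iff)

lemma matched_stack_diagrams:
  assumes "d\<^sub>1 \<in> partial_brauer k" "d\<^sub>2 \<in> partial_brauer k" "bots d\<^sub>1 = tops d\<^sub>2"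
  shows "matched_stack ({Upper} \<times> {1..k}) ({Middle} \<times> {1..k}) ({Lower} \<times> {1..k}) ((`) fU ` d\<^sub>1) ((`) fL ` d\<^sub>2)"
proof (intro matched_stack.intro matched_stack_axioms.intro stack_diagrams assms(1,2))
  fix v :: vertex assume "v \<in> {Middle} \<times> {1..k}"
  then obtain i where i: "v = (Middle, i)" "i \<in> {1..k}" by auto
  have "i \<in> bots d\<^sub>1 \<longleftrightarrow> i \<in> tops d\<^sub>2" using assms(3) by simp
  then show "{v} \<in> (`) fU ` d\<^sub>1 \<longleftrightarrow> {v} \<in> (`) fL ` d\<^sub>2"
    using i assms by (simp add: fU_singleton fL_singleton singleton_iff_not_edge bots_def tops_def)
qed

lemma diag_comp_partial_brauer:
  assumes d: "d\<^sub>1 \<in> partial_brauer k" "d\<^sub>2 \<in> partial_brauer k"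
  shows "diag_comp d\<^sub>1 d\<^sub>2 \<in> partial_brauer k"
proof -
  let ?M = "{Middle} \<times> {1..k} :: vertex set"
  interpret stack "{Upper} \<times> {1..k}" ?M "{Lower} \<times> {1..k}" "(`) fU ` d\<^sub>1" "(`) fL ` d\<^sub>2"
    by (rule stack_diagrams[OF d])
  let ?S = "(`) fU ` d\<^sub>1 \<union> (`) fL ` d\<^sub>2"
  have "partition_on (verts k) (outs ?M ?S)"
  proof (rule partition_onI)
    show "{} \<notin> outs ?M ?S" by (simp add: outs_def)
    show "\<Union>(outs ?M ?S) = verts k"
    proof (intro equalityI subsetI)
      fix v assume "v \<in> \<Union>(outs ?M ?S)"
      then obtain C where "C \<in> comps ?S" "v \<in> C" "v \<notin> ?M" by (auto simp: outs_def)
      then show "v \<in> verts k" using Union_eq by (auto simp: in_comps_iff)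
    next
      fix v assume v: "v \<in> verts k"
      then have "v \<in> \<Union>?S" unfolding Union_eq by auto
      then obtain C where "C \<in> comps ?S" "v \<in> C" using comps_cover[of v ?S] by blast
      moreover have "v \<notin> ?M" using v by auto
      ultimately show "v \<in> \<Union>(outs ?M ?S)" unfolding outs_def by blast
    qed
    show "disjnt p q" if "p \<in> outs ?M ?S" "q \<in> outs ?M ?S" "p \<noteq> q" for p q
      using that comps_disjoint[of _ ?S] unfolding outs_def disjnt_def by blast
  qed
  moreover have "card b \<le> 2" if b: "b \<in> outs ?M ?S" for b
  proof -
    obtain C where C: "C \<in> comps ?S" "b = C - ?M" using b unfolding outs_def by blast
    show ?thesis unfolding C(2) using comps_degree[OF C(1)] by linarith
  qed
  ultimately show ?thesis unfolding diag_comp_eq[OF d] stacked_eq by (auto simp: partial_brauer_def)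
qed

section \<open>Composition preserves planarity\<close>

text \<open>A substitute for crossing numbers: its parity detects whether two chords cross, and
  unlike the relation of crossing it is additive in both arguments, so it can be computed for unions
  of chords.\<close>

definition pairs_below :: "nat \<Rightarrow> vertex set \<Rightarrow> vertex set \<Rightarrow> nat" where
  "pairs_below k A B = (\<Sum>u\<in>A. \<Sum>v\<in>B. if boundary_pos k u < boundary_pos k v then 1 else 0)"

lemma tl_partial_brauer: "d \<in> tl_diagrams n \<Longrightarrow> d \<in> partial_brauer n"
  by (auto simp: tl_diagrams_def motzkin_def)

lemma tl_card: "\<lbrakk>d \<in> tl_diagrams n; b \<in> d\<rbrakk> \<Longrightarrow> card b = 2"
  by (auto simp: tl_diagrams_def)

lemma boundary_pos_inj: "inj_on (boundary_pos n) (verts n)"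
  by (auto simp: inj_on_def boundary_pos_def)

text \<open>The eight excluded patterns are the ways in which the endpoints of the chords
  \<open>{x, z}\<close> and \<open>{y, w}\<close> can alternate. In all remaining orders
  \<open>x\<close> lies between \<open>y\<close> and \<open>w\<close> exactly when \<open>z\<close>
  does.\<close>

lemma chords_order:
  fixes x y z w :: nat
  assumes "x \<noteq> z" "y \<noteq> w" "x \<noteq> y" "x \<noteq> w" "z \<noteq> y" "z \<noteq> w"
    and "\<not> (x < y \<and> y < z \<and> z < w)" "\<not> (y < x \<and> x < w \<and> w < z)"
    and "\<not> (x < w \<and> w < z \<and> z < y)" "\<not> (w < x \<and> x < y \<and> y < z)"
    and "\<not> (z < y \<and> y < x \<and> x < w)" "\<not> (y < z \<and> z < w \<and> w < x)"
    and "\<not> (z < w \<and> w < x \<and> x < y)" "\<not> (w < z \<and> z < y \<and> y < x)"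
  shows "((x < y) = (x < w)) = ((z < y) = (z < w))"
  using assms by presburger

text \<open>Two chords cross iff an odd number of pairs of their endpoints is in increasing order.\<close>

lemma pairs_below_blocks:
  assumes d: "d \<in> tl_diagrams n" and b: "b \<in> d" "b' \<in> d" "b \<noteq> b'"
  shows "even (pairs_below n b b')"
proof -
  note pb = tl_partial_brauer[OF d]
  obtain x z where xz: "b = {x, z}" "x \<noteq> z" using tl_card[OF d b(1)] by (auto simp: card_2_iff)
  obtain y w where yw: "b' = {y, w}" "y \<noteq> w" using tl_card[OF d b(2)] by (auto simp: card_2_iff)
  have dj: "b \<inter> b' = {}" using partition_on_unique[OF partial_brauerD(1)[OF pb] b(1,2)] b(3) by blast
  have sub: "b \<subseteq> verts n" "b' \<subseteq> verts n" using partial_brauerD(7)[OF pb] b by auto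
  have ne: "boundary_pos n x \<noteq> boundary_pos n z" "boundary_pos n y \<noteq> boundary_pos n w"
    "boundary_pos n x \<noteq> boundary_pos n y" "boundary_pos n x \<noteq> boundary_pos n w"
    "boundary_pos n z \<noteq> boundary_pos n y" "boundary_pos n z \<noteq> boundary_pos n w"
  proof -
    have bp: "boundary_pos n u \<noteq> boundary_pos n v" if "u \<in> verts n" "v \<in> verts n" "u \<noteq> v" for u v
      using inj_onD[OF boundary_pos_inj[of n] _ that(1,2)] that(3) by blast
    have "x \<in> verts n" "z \<in> verts n" "y \<in> verts n" "w \<in> verts n" "x \<noteq> y" "x \<noteq> w" "z \<noteq> y" "z \<noteq> w"
      using sub dj unfolding xz(1) yw(1) by auto
    then show "boundary_pos n x \<noteq> boundary_pos n z" "boundary_pos n y \<noteq> boundary_pos n w"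
      "boundary_pos n x \<noteq> boundary_pos n y" "boundary_pos n x \<noteq> boundary_pos n w"
      "boundary_pos n z \<noteq> boundary_pos n y" "boundary_pos n z \<noteq> boundary_pos n w"
      using xz(2) yw(2) by (simp_all only: bp not_False_eq_True)
  qed
  have nc: "\<not> (boundary_pos n s < boundary_pos n t \<and> boundary_pos n t < boundary_pos n u \<and> boundary_pos n u < boundary_pos n v)"
    if "s \<in> c" "t \<in> c'" "u \<in> c" "v \<in> c'" "c \<in> d" "c' \<in> d" for s t u v c c'
    using d that unfolding tl_diagrams_def motzkin_def noncrossing_def by blast
  have "\<not> (boundary_pos n s < boundary_pos n t \<and> boundary_pos n t < boundary_pos n u \<and> boundary_pos n u < boundary_pos n v)"
    "\<not> (boundary_pos n t < boundary_pos n s \<and> boundary_pos n s < boundary_pos n v \<and> boundary_pos n v < boundary_pos n u)"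
    if "s \<in> {x, z}" "u \<in> {x, z}" "t \<in> {y, w}" "v \<in> {y, w}" for s u t v
    using nc[of s b t b' u v] nc[of t b' s b v u] that xz yw b by auto
  \<comment> \<open>The instances follow the order in which \<open>chords_order\<close> excludes the
    alternating patterns.\<close>
  note n1 = this(1)[of x z y w] this(2)[of x z y w] this(1)[of x z w y] this(2)[of x z w y]
    this(1)[of z x y w] this(2)[of z x y w] this(1)[of z x w y] this(2)[of z x w y]
  note n1 = n1[simplified insert_iff simp_thms]
  have "pairs_below n b b' =
     (if boundary_pos n x < boundary_pos n y then 1 else 0) + (if boundary_pos n x < boundary_pos n w then 1 else 0)
   + ((if boundary_pos n z < boundary_pos n y then 1 else 0) + (if boundary_pos n z < boundary_pos n w then 1 else 0))"
    using xz yw by (simp add: pairs_below_def)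
  then show ?thesis
    using chords_order[OF ne n1] by (simp split: if_splits)
qed

text \<open>Both sets are unions of chords, and disjointness ensures that the two chords of each
  pair are different. By additivity the count is a sum of even numbers.\<close>

lemma pairs_below_closed:
  assumes d: "d \<in> tl_diagrams n" and A: "A \<subseteq> verts n" "block_closed d A" and B: "B \<subseteq> verts n" "block_closed d B"
    and AB: "A \<inter> B = {}"
  shows "even (pairs_below n A B)"
proof -
  note pb = tl_partial_brauer[OF d]
  have part: "partition_on A {b \<in> d. b \<subseteq> A}" if "A \<subseteq> verts n" "block_closed d A" for A
  proof (rule partition_onI)
    show "\<Union>{b \<in> d. b \<subseteq> A} = A"
    proof (intro equalityI subsetI)
      fix x assume x: "x \<in> A"
      have "x \<in> \<Union>d" unfolding partial_brauerD(3)[OF pb] using that(1) x by (rule subsetD)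
      then obtain b where b: "b \<in> d" "x \<in> b" by blast
      then show "x \<in> \<Union>{b \<in> d. b \<subseteq> A}" using block_closedD[OF that(2) b x] by blast
    qed blast
    show "disjnt p q" if "p \<in> {b \<in> d. b \<subseteq> A}" "q \<in> {b \<in> d. b \<subseteq> A}" "p \<noteq> q" for p q
      using that partition_on_unique[OF partial_brauerD(1)[OF pb]] unfolding disjnt_def by blast
    show "{} \<notin> {b \<in> d. b \<subseteq> A}" using partial_brauerD(6)[OF pb] by blast
  qed
  have fin: "finite A" "finite B" using A B finite_subset[of _ "verts n"] by auto
  have "pairs_below n A B = (\<Sum>b\<in>{b \<in> d. b \<subseteq> A}. \<Sum>u\<in>b. \<Sum>v\<in>B. if boundary_pos n u < boundary_pos n v then 1 else 0)"
    unfolding pairs_below_def by (rule sum.partition[OF fin(1) part[OF A]])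
  also have "\<dots> = (\<Sum>b\<in>{b \<in> d. b \<subseteq> A}. \<Sum>u\<in>b. \<Sum>b'\<in>{b \<in> d. b \<subseteq> B}. \<Sum>v\<in>b'. if boundary_pos n u < boundary_pos n v then 1 else 0)"
    by (intro sum.cong refl sum.partition[OF fin(2) part[OF B]])
  also have "\<dots> = (\<Sum>b\<in>{b \<in> d. b \<subseteq> A}. \<Sum>b'\<in>{b \<in> d. b \<subseteq> B}. pairs_below n b b')"
    unfolding pairs_below_def by (rule sum.cong[OF refl]) (rule sum.swap)
  finally have e: "pairs_below n A B = (\<Sum>b\<in>{b \<in> d. b \<subseteq> A}. \<Sum>b'\<in>{b \<in> d. b \<subseteq> B}. pairs_below n b b')" .
  show ?thesis unfolding e
  proof (intro dvd_sum)
    fix b b' assume bb: "b \<in> {b \<in> d. b \<subseteq> A}" "b' \<in> {b \<in> d. b \<subseteq> B}"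
    then have "b \<noteq> b'" using AB partial_brauerD(6)[OF pb] by blast
    then show "even (pairs_below n b b')" using bb by (intro pairs_below_blocks[OF d]) auto
  qed
qed

definition less_count :: "nat set \<Rightarrow> nat set \<Rightarrow> nat" where
  "less_count A B = (\<Sum>i\<in>A. \<Sum>j\<in>B. if i < j then 1 else 0)"

lemma less_count_swap:
  assumes "finite A" "finite B" "A \<inter> B = {}"
  shows "less_count A B + less_count B A = card A * card B"
proof -
  have "less_count B A = (\<Sum>i\<in>A. \<Sum>j\<in>B. if j < i then 1 else 0)"
    unfolding less_count_def by (rule sum.swap)
  then have "less_count A B + less_count B A = (\<Sum>i\<in>A. \<Sum>j\<in>B. (if i < j then 1 else 0) + (if j < i then 1 else 0))"
    by (simp add: less_count_def sum.distrib)
  also have "\<dots> = (\<Sum>i\<in>A. \<Sum>j\<in>B. 1)"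
    using assms(3) by (intro sum.cong refl) auto
  finally show ?thesis by simp
qed

lemma sum_row: "(\<Sum>v\<in>{r} \<times> A. f v) = (\<Sum>i\<in>A. f (r, i))"
proof -
  have "{r} \<times> A = Pair r ` A" by auto
  then show ?thesis by (simp add: sum.reindex inj_on_def)
qed

text \<open>On the boundary every upper vertex precedes every lower one, which gives the product of
  cardinalities. The lower row is traversed backwards, which interchanges the arguments in the last
  term.\<close>

lemma pairs_below_rows:
  assumes A: "A \<subseteq> {1..n}" "A' \<subseteq> {1..n}" and B: "B \<subseteq> {1..n}" "B' \<subseteq> {1..n}"
  shows "pairs_below n ({Upper} \<times> A \<union> {Lower} \<times> A') ({Upper} \<times> B \<union> {Lower} \<times> B')
    = less_count A B + card A * card B' + less_count B' A'"
proof -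
  have fin: "finite A" "finite A'" "finite B" "finite B'" using A B finite_subset[OF _ finite_atLeastAtMost] by auto
  let ?f = "\<lambda>u v. if boundary_pos n u < boundary_pos n v then 1 else 0 :: nat"
  have sp: "(\<Sum>v\<in>{Upper} \<times> X \<union> {Lower} \<times> X'. g v) = (\<Sum>i\<in>X. g (Upper, i)) + (\<Sum>i\<in>X'. g (Lower, i))"
    if "finite X" "finite X'" for X X' and g :: "vertex \<Rightarrow> nat"
    using that by (subst sum.union_disjoint) (auto simp: sum_row)
  have 1: "?f (Upper, i) (Upper, j) = (if i < j then 1 else 0)" for i j by (simp add: boundary_pos_def)
  have le: "1 \<le> i \<and> i \<le> n" if "i \<in> A \<or> i \<in> A' \<or> i \<in> B \<or> i \<in> B'" for i
    using that A B by auto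
  have 2: "?f (Upper, i) (Lower, j) = 1" if "i \<in> A" "j \<in> B'" for i j
    using le[of i] le[of j] that by (simp add: boundary_pos_def) linarith
  have 3: "?f (Lower, i) (Upper, j) = 0" if "i \<in> A'" "j \<in> B" for i j
    using le[of i] le[of j] that by (simp add: boundary_pos_def) linarith
  have 4: "?f (Lower, i) (Lower, j) = (if j < i then 1 else 0)" if "i \<in> A'" "j \<in> B'" for i j
    using le[of i] le[of j] that by (auto simp: boundary_pos_def)
  have "pairs_below n ({Upper} \<times> A \<union> {Lower} \<times> A') ({Upper} \<times> B \<union> {Lower} \<times> B')
    = (\<Sum>i\<in>A. (\<Sum>j\<in>B. ?f (Upper, i) (Upper, j)) + (\<Sum>j\<in>B'. ?f (Upper, i) (Lower, j)))
    + (\<Sum>i\<in>A'. (\<Sum>j\<in>B. ?f (Lower, i) (Upper, j)) + (\<Sum>j\<in>B'. ?f (Lower, i) (Lower, j)))"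
    unfolding pairs_below_def using fin by (simp only: sp)
  also have "\<dots> = (\<Sum>i\<in>A. (\<Sum>j\<in>B. if i < j then 1 else 0) + (\<Sum>j\<in>B'. 1))
    + (\<Sum>i\<in>A'. (\<Sum>j\<in>B. 0) + (\<Sum>j\<in>B'. if j < i then 1 else 0))"
    by (intro arg_cong2[where f="(+)"] sum.cong refl 1 2 3 4)
  also have "\<dots> = less_count A B + card A * card B' + (\<Sum>i\<in>A'. \<Sum>j\<in>B'. if j < i then 1 else 0)"
    by (simp add: less_count_def sum.distrib)
  also have "(\<Sum>i\<in>A'. \<Sum>j\<in>B'. if j < i then 1 else 0) = less_count B' A'"
    unfolding less_count_def by (rule sum.swap)
  finally show ?thesis .
qed

lemma tl_bots: "d \<in> tl_diagrams n \<Longrightarrow> bots d = {1..n}"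
  and tl_tops: "d \<in> tl_diagrams n \<Longrightarrow> tops d = {1..n}"
proof -
  assume d: "d \<in> tl_diagrams n"
  have "edges d = d" using tl_card[OF d] by (auto simp: edges_def)
  then show "bots d = {1..n}" "tops d = {1..n}"
    using partial_brauerD(3)[OF tl_partial_brauer[OF d]] by (auto simp: bots_def tops_def)
qed

text \<open>Modulo 2 the two hypotheses and the conclusion add up to \<open>(a + b) * (y + z)\<close>.\<close>

lemma even_linear_combination:
  fixes a b c x y z p q r s t :: nat
  assumes "even (p + a * y + s)" "even (t + b * z + q)" "s + t = b * y" "even (a + b)" "even (b + c)" "even (x + y)" "even (y + z)"
  shows "even (p + a * z + q)"
proof -
  have "even (s + t) \<longleftrightarrow> even (b * y)" using assms(3) by simp
  then show ?thesis
    using assms(1,2,4-7) by (cases "even a"; cases "even y"; cases "even p"; cases "even s"; simp)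
qed

text \<open>The parts of two components in either diagram are unions of chords and have even counts.
  The middle row enters the two counts in opposite directions, so modulo 2 it cancels up to a
  product of cardinalities, and the outer parts have an even count as well. Two crossing chords
  would have the odd count 3.\<close>

theorem tl_diag_comp:
  assumes d: "d\<^sub>1 \<in> tl_diagrams n" "d\<^sub>2 \<in> tl_diagrams n"
  shows "diag_comp d\<^sub>1 d\<^sub>2 \<in> tl_diagrams n"
proof -
  let ?U = "{Upper} \<times> {1..n} :: vertex set" and ?M = "{Middle} \<times> {1..n} :: vertex set" and ?L = "{Lower} \<times> {1..n} :: vertex set"
  note pb = tl_partial_brauer[OF d(1)] tl_partial_brauer[OF d(2)]
  interpret matched_stack ?U ?M ?L "(`) fU ` d\<^sub>1" "(`) fL ` d\<^sub>2"
    by (rule matched_stack_diagrams[OF pb]) (simp add: tl_bots[OF d(1)] tl_tops[OF d(2)])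
  let ?S = "(`) fU ` d\<^sub>1 \<union> (`) fL ` d\<^sub>2"
  have ed: "edges d\<^sub>1 = d\<^sub>1" "edges d\<^sub>2 = d\<^sub>2" using tl_card[OF d(1)] tl_card[OF d(2)] by (auto simp: edges_def)
  have c2: "card b = 2" if "b \<in> ?S" for b
    using that edges_fU[OF pb(1)] edges_fL[OF pb(2)] ed by auto
  have live: "C \<in> live" if C: "C \<in> comps ?S" for C
  proof -
    obtain b where "b \<in> ?S" "b \<subseteq> C" using comps_block[OF C] by blast
    then show ?thesis using C c2 unfolding live_def by blast
  qed
  have out2: "card b = 2" if b: "b \<in> outs ?M ?S" for b
  proof -
    obtain C where C: "C \<in> comps ?S" "b = C - ?M" "b \<noteq> {}" using b unfolding outs_def by blast
    then have "C \<notin> loops ?M ?S" unfolding loops_def by blast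
    then show ?thesis using live_cases[OF live[OF C(1)]] C(2) unfolding paths_def by blast
  qed
  define ix where "ix r C = {i. (r, i) \<in> C}" for r :: row and C :: "vertex set"
  have rows: "ix Upper C \<subseteq> {1..n}" "ix Middle C \<subseteq> {1..n}" "ix Lower C \<subseteq> {1..n}"
    "C \<inter> (?U \<union> ?M) = {Upper} \<times> ix Upper C \<union> {Middle} \<times> ix Middle C"
    "C \<inter> (?M \<union> ?L) = {Middle} \<times> ix Middle C \<union> {Lower} \<times> ix Lower C"
    "C - ?M = {Upper} \<times> ix Upper C \<union> {Lower} \<times> ix Lower C" if "C \<in> comps ?S" for C
    using comps_stacked_subset[OF pb, of C] that unfolding stacked_eq ix_def by auto
  \<comment> \<open>No block is a singleton, so the part of a component in either layer is a union
    of edges.\<close>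
  have even: "even (card (ix Upper C) + card (ix Middle C))" "even (card (ix Middle C) + card (ix Lower C))"
    if C: "C \<in> comps ?S" for C
  proof -
    have fin: "finite (ix r C)" if "r \<in> {Upper, Middle, Lower}" for r
      using rows(1-3)[OF C] that finite_subset[OF _ finite_atLeastAtMost] by auto
    have z: "{b \<in> (`) fU ` d\<^sub>1. b \<subseteq> C \<and> card b = 1} = {}" "{b \<in> (`) fL ` d\<^sub>2. b \<subseteq> C \<and> card b = 1} = {}"
      using c2 by force+
    have "card (C \<inter> (?U \<union> ?M)) = card (ix Upper C) + card (ix Middle C)"
      unfolding rows(4)[OF C] using fin by (subst card_Un_disjoint) (auto simp: card_cartesian_product)
    then show "even (card (ix Upper C) + card (ix Middle C))" using comps_blocks(1)[OF C] unfolding z by simp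
    have "card (C \<inter> (?M \<union> ?L)) = card (ix Middle C) + card (ix Lower C)"
      unfolding rows(5)[OF C] using fin by (subst card_Un_disjoint) (auto simp: card_cartesian_product)
    then show "even (card (ix Middle C) + card (ix Lower C))" using comps_blocks(2)[OF C] unfolding z by simp
  qed
  have cl1: "block_closed d\<^sub>1 ({Upper} \<times> ix Upper C \<union> {Lower} \<times> ix Middle C)" if C: "C \<in> comps ?S" for C
    unfolding block_closed_def
  proof (intro ballI impI)
    fix b assume b: "b \<in> d\<^sub>1" "b \<inter> ({Upper} \<times> ix Upper C \<union> {Lower} \<times> ix Middle C) \<noteq> {}"
    then have "fU ` b \<inter> C \<noteq> {}" by (force simp: ix_def)
    then have f: "fU ` b \<subseteq> C" using C b(1) unfolding in_comps_iff block_closed_def by blast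
    show "b \<subseteq> {Upper} \<times> ix Upper C \<union> {Lower} \<times> ix Middle C"
    proof
      fix v assume v: "v \<in> b"
      then have "v \<in> verts n" "fU v \<in> C" using f partial_brauerD(7)[OF pb(1) b(1)] by auto
      then show "v \<in> {Upper} \<times> ix Upper C \<union> {Lower} \<times> ix Middle C" by (cases v) (auto simp: ix_def)
    qed
  qed
  have cl2: "block_closed d\<^sub>2 ({Upper} \<times> ix Middle C \<union> {Lower} \<times> ix Lower C)" if C: "C \<in> comps ?S" for C
    unfolding block_closed_def
  proof (intro ballI impI)
    fix b assume b: "b \<in> d\<^sub>2" "b \<inter> ({Upper} \<times> ix Middle C \<union> {Lower} \<times> ix Lower C) \<noteq> {}"
    then have "fL ` b \<inter> C \<noteq> {}" by (force simp: ix_def)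
    then have f: "fL ` b \<subseteq> C" using C b(1) unfolding in_comps_iff block_closed_def by blast
    show "b \<subseteq> {Upper} \<times> ix Middle C \<union> {Lower} \<times> ix Lower C"
    proof
      fix v assume v: "v \<in> b"
      then have "v \<in> verts n" "fL v \<in> C" using f partial_brauerD(7)[OF pb(2) b(1)] by auto
      then show "v \<in> {Upper} \<times> ix Middle C \<union> {Lower} \<times> ix Lower C" by (cases v) (auto simp: ix_def)
    qed
  qed
  have par: "even (pairs_below n (C - ?M) (C' - ?M))"
    if C: "C \<in> comps ?S" and C': "C' \<in> comps ?S" and ne: "C \<noteq> C'" for C C'
  proof -
    note r = rows[OF C] and r' = rows[OF C']
    have dj: "i \<notin> ix r C'" if "i \<in> ix r C" for r i
      using that comps_disjoint[OF C C'] ne unfolding ix_def by blast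
    have "even (pairs_below n ({Upper} \<times> ix Upper C \<union> {Lower} \<times> ix Middle C) ({Upper} \<times> ix Upper C' \<union> {Lower} \<times> ix Middle C'))"
      by (rule pairs_below_closed[OF d(1) _ cl1[OF C] _ cl1[OF C']]) (use r(1-3) r'(1-3) dj in blast)+
    then have 1: "even (less_count (ix Upper C) (ix Upper C') + card (ix Upper C) * card (ix Middle C') + less_count (ix Middle C') (ix Middle C))"
      by (simp only: pairs_below_rows[OF r(1,2) r'(1,2)])
    have "even (pairs_below n ({Upper} \<times> ix Middle C \<union> {Lower} \<times> ix Lower C) ({Upper} \<times> ix Middle C' \<union> {Lower} \<times> ix Lower C'))"
      by (rule pairs_below_closed[OF d(2) _ cl2[OF C] _ cl2[OF C']]) (use r(1-3) r'(1-3) dj in blast)+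
    then have 2: "even (less_count (ix Middle C) (ix Middle C') + card (ix Middle C) * card (ix Lower C') + less_count (ix Lower C') (ix Lower C))"
      by (simp only: pairs_below_rows[OF r(2,3) r'(2,3)])
    \<comment> \<open>The middle row is the lower row of one diagram and the upper row of the other,
      so it is read in both directions and every pair of its vertices is counted exactly
      once.\<close>
    have 3: "less_count (ix Middle C') (ix Middle C) + less_count (ix Middle C) (ix Middle C') = card (ix Middle C) * card (ix Middle C')"
      using less_count_swap[of "ix Middle C'" "ix Middle C"] dj[of _ Middle]
        finite_subset[OF r(2) finite_atLeastAtMost] finite_subset[OF r'(2) finite_atLeastAtMost]
      by (auto simp: mult.commute disjoint_iff)
    show ?thesis
      unfolding r(6) r'(6) pairs_below_rows[OF r(1,3) r'(1,3)]
      by (rule even_linear_combination[OF 1 2 3 even[OF C] even[OF C']])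
  qed
  have "noncrossing n (outs ?M ?S)"
    unfolding noncrossing_def
  proof (intro ballI notI)
    fix b b' assume b: "b \<in> outs ?M ?S" "b' \<in> outs ?M ?S"
    assume "\<exists>x\<in>b. \<exists>y\<in>b'. \<exists>z\<in>b. \<exists>w\<in>b'. boundary_pos n x < boundary_pos n y \<and>
      boundary_pos n y < boundary_pos n z \<and> boundary_pos n z < boundary_pos n w"
    then obtain x y z w where xyzw: "x \<in> b" "y \<in> b'" "z \<in> b" "w \<in> b'"
      "boundary_pos n x < boundary_pos n y" "boundary_pos n y < boundary_pos n z" "boundary_pos n z < boundary_pos n w" by blast
    have "x \<noteq> z" "y \<noteq> w" using xyzw by auto
    have fb: "finite b" "finite b'" using out2[OF b(1)] out2[OF b(2)] by (auto intro: card_ge_0_finite)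
    have eb: "b = {x, z}" using out2[OF b(1)] xyzw \<open>x \<noteq> z\<close> fb card_seteq[of b "{x, z}"] by auto
    have eb': "b' = {y, w}" using out2[OF b(2)] xyzw \<open>y \<noteq> w\<close> fb card_seteq[of b' "{y, w}"] by auto
    have "b \<noteq> b'" using eb eb' xyzw by auto
    moreover obtain C C' where "C \<in> comps ?S" "C' \<in> comps ?S" "b = C - ?M" "b' = C' - ?M"
      using b by (auto simp: outs_def)
    ultimately have "even (pairs_below n b b')" using par[of C C'] by auto
    \<comment> \<open>The increasing pairs are \<open>(x, y)\<close>, \<open>(x, w)\<close> and
      \<open>(z, w)\<close>.\<close>
    moreover have "pairs_below n b b' = 3" using xyzw \<open>x \<noteq> z\<close> \<open>y \<noteq> w\<close> by (simp add: pairs_below_def eb eb')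
    ultimately show False by simp
  qed
  then show ?thesis
    using diag_comp_partial_brauer[OF pb] out2
    unfolding diag_comp_eq[OF pb] stacked_eq tl_diagrams_def motzkin_def by blast
qed

lemma noncrossingD:
  "\<lbrakk>noncrossing k d; b \<in> d; b' \<in> d; x \<in> b; y \<in> b'; z \<in> b; w \<in> b';
    boundary_pos k x < boundary_pos k y; boundary_pos k y < boundary_pos k z; boundary_pos k z < boundary_pos k w\<rbrakk> \<Longrightarrow> False"
  unfolding noncrossing_def by blast

section \<open>Identity diagrams\<close>

lemma id_diagram_tl: "id_diagram n \<in> tl_diagrams n"
proof -
  have "partition_on (verts n) (id_diagram n)"
    by (rule partition_onI) (auto simp: id_diagram_def disjnt_def)
  moreover have "card b = 2" if "b \<in> id_diagram n" for b using that by (auto simp: id_diagram_def)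
  moreover have "noncrossing n (id_diagram n)"
    by (auto simp: noncrossing_def id_diagram_def boundary_pos_def)
  ultimately show ?thesis by (auto simp: tl_diagrams_def motzkin_def partial_brauer_def)
qed

lemma fL_image_iff:
  assumes "b \<subseteq> verts n"
  shows "(Middle, i) \<in> fL ` b \<longleftrightarrow> (Upper, i) \<in> b" "(Lower, i) \<in> fL ` b \<longleftrightarrow> (Lower, i) \<in> b" "(Upper, i) \<notin> fL ` b"
proof -
  have m: "v = (Upper, i)" if "v \<in> verts n" "fL v = (Middle, i)" for v using that by (cases v) auto
  have l: "v = (Lower, i)" if "v \<in> verts n" "fL v = (Lower, i)" for v using that by (cases v) auto
  have u: "fL v \<noteq> (Upper, i)" if "v \<in> verts n" for v using that by (cases v) auto
  show "(Middle, i) \<in> fL ` b \<longleftrightarrow> (Upper, i) \<in> b"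
    using m assms imageI[of "(Upper, i)" b fL] by (metis fL_simps(2) imageE subsetD)
  show "(Lower, i) \<in> fL ` b \<longleftrightarrow> (Lower, i) \<in> b"
    using l assms imageI[of "(Lower, i)" b fL] by (metis fL_simps(1) imageE subsetD)
  show "(Upper, i) \<notin> fL ` b" using u assms by (metis imageE subsetD)
qed

text \<open>The identity diagram ties each upper vertex to the middle vertex below it and does
  nothing else. A component is thus a block of \<open>d\<close>, relabelled as part of the lower
  layer, with its upper vertices repeated in the outer row.\<close>

lemma comps_id_left:
  assumes d: "d \<in> partial_brauer n"
  shows "comps (stacked (id_diagram n) d) = (\<lambda>b. fL ` b \<union> {v \<in> b. fst v = Upper}) ` d" (is "comps ?S = ?K ` d")
proof (rule comps_eqI)
  have U: "\<Union>?S = {Upper, Middle, Lower} \<times> {1..n}"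
  proof -
    interpret stack "{Upper} \<times> {1..n}" "{Middle} \<times> {1..n}" "{Lower} \<times> {1..n}" "(`) fU ` id_diagram n" "(`) fL ` d"
      by (rule stack_diagrams[OF tl_partial_brauer[OF id_diagram_tl] d])
    show ?thesis unfolding stacked_eq Union_eq by auto
  qed
  have vb: "\<exists>b\<in>d. v \<in> b" if "v \<in> verts n" for v using that partial_brauerD(3)[OF d] by blast
  show "\<Union>?S \<subseteq> \<Union>(?K ` d)"
  proof
    fix v assume "v \<in> \<Union>?S"
    then obtain r i where v: "v = (r, i)" "i \<in> {1..n}" unfolding U by auto
    obtain b b' where b: "b \<in> d" "(Upper, i) \<in> b" "b' \<in> d" "(Lower, i) \<in> b'" using vb[of "(Upper, i)"] vb[of "(Lower, i)"] v(2) by auto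
    have "(Middle, i) \<in> fL ` b" "(Lower, i) \<in> fL ` b'" using imageI[OF b(2), of fL] imageI[OF b(4), of fL] by auto
    then show "v \<in> \<Union>(?K ` d)" using v b by (cases r) auto
  qed
  fix C assume "C \<in> ?K ` d"
  then obtain b where b: "b \<in> d" "C = ?K b" by auto
  note bv = partial_brauerD(7)[OF d b(1)]
  have uni: "b' = b" if "b' \<in> d" "v \<in> b" "v \<in> b'" for b' v
    using partition_on_unique[OF partial_brauerD(1)[OF d] that(1) b(1)] that by blast
  have mem: "(Middle, i) \<in> fL ` b' \<longleftrightarrow> (Upper, i) \<in> b'" "(Lower, i) \<in> fL ` b' \<longleftrightarrow> (Lower, i) \<in> b'"
    "(Upper, i) \<notin> fL ` b'" if "b' \<in> d" for b' i
    using fL_image_iff[OF partial_brauerD(7)[OF d that]] .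
  have inC: "(Middle, i) \<in> C \<longleftrightarrow> (Upper, i) \<in> b" "(Lower, i) \<in> C \<longleftrightarrow> (Lower, i) \<in> b" "(Upper, i) \<in> C \<longleftrightarrow> (Upper, i) \<in> b" for i
    unfolding b(2) using mem[OF b(1)] by auto
  have idb: "(`) fU ` id_diagram n = (\<lambda>i. {(Upper, i), (Middle, i)}) ` {1..n}"
    by (auto simp: id_diagram_def image_image)
  have ne: "fL ` b \<noteq> {}" using partial_brauerD(6)[OF d b(1)] by simp
  have cl: "block_closed ?S C"
    unfolding block_closed_def stacked_eq
  proof (intro ballI impI)
    fix c assume c: "c \<in> (`) fU ` id_diagram n \<union> (`) fL ` d" "c \<inter> C \<noteq> {}"
    from c(1) show "c \<subseteq> C"
    proof
      assume "c \<in> (`) fU ` id_diagram n"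
      then show ?thesis using c(2) inC unfolding idb by auto
    next
      assume "c \<in> (`) fL ` d"
      then obtain b' where b': "b' \<in> d" "c = fL ` b'" by auto
      obtain v where v: "v \<in> fL ` b'" "v \<in> C" using c(2) b' by auto
      obtain r i where ri: "v = (r, i)" by (cases v)
      have "b' = b"
        using v ri mem[OF b'(1)] inC uni[OF b'(1)] by (cases r) auto
      then show ?thesis using b' b by auto
    qed
  qed
  moreover have "C \<subseteq> \<Union>?S"
    unfolding U b(2) using bv by (auto simp: fL_def)
  moreover have "linked ?S C"
    unfolding linked_def
  proof (intro allI impI)
    fix D assume D: "D \<subseteq> C" "D \<noteq> {}" "block_closed ?S D"
    have um: "(Upper, i) \<in> D \<longleftrightarrow> (Middle, i) \<in> D" if "i \<in> {1..n}" for i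
    proof -
      have "{(Upper, i), (Middle, i)} \<in> ?S" unfolding stacked_eq idb using that by blast
      then show ?thesis using D(3) block_closedD[of ?S D "{(Upper, i), (Middle, i)}"] by blast
    qed
    obtain v where v: "v \<in> D" using D(2) by auto
    have "fL ` b \<inter> D \<noteq> {}"
    proof (cases "fst v = Upper")
      case True
      then obtain i where i: "v = (Upper, i)" by (cases v) auto
      then have "(Upper, i) \<in> b" using v D(1) inC by auto
      then have "(Middle, i) \<in> D" "(Middle, i) \<in> fL ` b" using um[of i] v i bv mem[OF b(1)] by auto
      then show ?thesis by auto
    next
      case False
      then show ?thesis using v D(1) b(2) by auto
    qed
    moreover have "fL ` b \<in> ?S" unfolding stacked_eq using b(1) by blast
    ultimately have f: "fL ` b \<subseteq> D" using D(3) unfolding block_closed_def by blast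
    have "(Upper, i) \<in> D" if "(Upper, i) \<in> b" for i
    proof -
      have "(Middle, i) \<in> fL ` b" using that mem(1)[OF b(1), of i] by (rule_tac iffD2)
      then have "(Middle, i) \<in> D" using f by (rule_tac subsetD)
      then show ?thesis using um[of i] that bv by auto
    qed
    then have "C \<subseteq> D" unfolding b(2) using f by auto
    then show "D = C" using D(1) by blast
  qed
  ultimately show "C \<noteq> {} \<and> C \<subseteq> \<Union>?S \<and> block_closed ?S C \<and> linked ?S C" using ne b(2) by blast
qed

lemma outer_part_id_left:
  assumes "b \<subseteq> verts n" shows "(fL ` b \<union> {v \<in> b. fst v = Upper}) - {Middle} \<times> {1..n} = b"
proof -
  have "(r, i) \<in> (fL ` b \<union> {v \<in> b. fst v = Upper}) - {Middle} \<times> {1..n} \<longleftrightarrow> (r, i) \<in> b" for r i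
    using fL_image_iff[OF assms, of i] assms by (cases r) auto
  then show ?thesis by (simp add: set_eq_iff split_paired_all)
qed

lemma id_comp_left:
  assumes d: "d \<in> partial_brauer n"
  shows "diag_comp (id_diagram n) d = d" "num_loops (id_diagram n) d = 0"
proof -
  note i = tl_partial_brauer[OF id_diagram_tl[of n]]
  have o: "(fL ` b \<union> {v \<in> b. fst v = Upper}) - {Middle} \<times> {1..n} = b" if "b \<in> d" for b
    by (rule outer_part_id_left[OF partial_brauerD(7)[OF d that]])
  have "(\<lambda>C. C - {Middle} \<times> {1..n}) ` (\<lambda>b. fL ` b \<union> {v \<in> b. fst v = Upper}) ` d = d"
    unfolding image_image using o by (simp cong: image_cong)
  then show "diag_comp (id_diagram n) d = d"
    unfolding diag_comp_eq[OF i d] outs_def comps_id_left[OF d] using partial_brauerD(6)[OF d] by simp blast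
  have "\<not> C \<subseteq> {Middle} \<times> {1..n}" if C: "C \<in> (\<lambda>b. fL ` b \<union> {v \<in> b. fst v = Upper}) ` d" for C
  proof -
    obtain b where b: "b \<in> d" "C = fL ` b \<union> {v \<in> b. fst v = Upper}" using C by blast
    have "C - {Middle} \<times> {1..n} \<noteq> {}" using o[OF b(1)] partial_brauerD(6)[OF d b(1)] unfolding b(2) by simp
    then show ?thesis by blast
  qed
  then have "loops ({Middle} \<times> {1..n}) (stacked (id_diagram n) d) = {}"
    unfolding loops_def comps_id_left[OF d] by blast
  then show "num_loops (id_diagram n) d = 0" by (simp add: num_loops_eq[OF i d])
qed

text \<open>The reflection exchanging the two rows reduces the right unit law to the left one.\<close>

definition flip :: "vertex \<Rightarrow> vertex" where
  "flip v = (case fst v of Upper \<Rightarrow> Lower | Middle \<Rightarrow> Middle | Lower \<Rightarrow> Upper, snd v)"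

lemma flip_flip [simp]: "flip (flip v) = v"
  by (cases v; cases "fst v") (auto simp: flip_def)

lemma flip_simps [simp]: "flip (Upper, i) = (Lower, i)" "flip (Lower, i) = (Upper, i)" "flip (Middle, i) = (Middle, i)"
  by (auto simp: flip_def)

lemma inj_flip: "inj flip"
  by (rule injI) (metis flip_flip)

lemma flip_verts: "flip ` verts n = verts n" "flip ` ({Middle} \<times> X) = {Middle} \<times> X"
  by (force simp: image_iff)+

lemma flip_partial_brauer: "d \<in> partial_brauer n \<Longrightarrow> (`) flip ` d \<in> partial_brauer n"
proof -
  assume d: "d \<in> partial_brauer n"
  have "partition_on (flip ` verts n) ((`) flip ` d)"
    by (rule partition_on_image[OF partial_brauerD(1)[OF d]]) (rule inj_on_subset[OF inj_flip subset_UNIV])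
  then have "partition_on (verts n) ((`) flip ` d)" by (simp only: flip_verts)
  then show ?thesis
    using partial_brauerD(2)[OF d] card_image[OF inj_on_subset[OF inj_flip subset_UNIV]]
    by (auto simp: partial_brauer_def)
qed

lemma flip_stacked:
  assumes "d\<^sub>1 \<in> partial_brauer n" "d\<^sub>2 \<in> partial_brauer n"
  shows "stacked ((`) flip ` d\<^sub>2) ((`) flip ` d\<^sub>1) = (`) flip ` stacked d\<^sub>1 d\<^sub>2"
proof -
  have e: "fU (flip v) = flip (fL v)" "fL (flip v) = flip (fU v)" if "v \<in> verts n" for v
    using that by (cases v; auto)+
  have "fU ` flip ` b = flip ` fL ` b" if "b \<in> d\<^sub>2" for b
    unfolding image_image using e(1) partial_brauerD(7)[OF assms(2) that] by (intro image_cong) auto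
  moreover have "fL ` flip ` b = flip ` fU ` b" if "b \<in> d\<^sub>1" for b
    unfolding image_image using e(2) partial_brauerD(7)[OF assms(1) that] by (intro image_cong) auto
  ultimately have "(`) fU ` (`) flip ` d\<^sub>2 = (`) flip ` (`) fL ` d\<^sub>2" "(`) fL ` (`) flip ` d\<^sub>1 = (`) flip ` (`) fU ` d\<^sub>1"
    unfolding image_image by (auto intro: image_cong)
  then show ?thesis unfolding stacked_eq image_Un by (simp add: Un_commute)
qed

lemma flip_comp:
  assumes d: "d\<^sub>1 \<in> partial_brauer n" "d\<^sub>2 \<in> partial_brauer n"
  shows "diag_comp ((`) flip ` d\<^sub>2) ((`) flip ` d\<^sub>1) = (`) flip ` diag_comp d\<^sub>1 d\<^sub>2"
    "num_loops ((`) flip ` d\<^sub>2) ((`) flip ` d\<^sub>1) = num_loops d\<^sub>1 d\<^sub>2"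
proof -
  let ?M = "{Middle} \<times> {1..n} :: vertex set"
  note f = flip_partial_brauer[OF d(2)] flip_partial_brauer[OF d(1)]
  have inj: "inj_on flip X" for X by (rule inj_on_subset[OF inj_flip subset_UNIV])
  have c: "comps (stacked ((`) flip ` d\<^sub>2) ((`) flip ` d\<^sub>1)) = (`) flip ` comps (stacked d\<^sub>1 d\<^sub>2)"
    unfolding flip_stacked[OF d] by (rule comps_image[OF inj])
  have m: "flip ` C - ?M = flip ` (C - ?M)" for C
    by (simp add: image_set_diff[OF inj_flip] flip_verts)
  show "diag_comp ((`) flip ` d\<^sub>2) ((`) flip ` d\<^sub>1) = (`) flip ` diag_comp d\<^sub>1 d\<^sub>2"
    unfolding diag_comp_eq[OF f] diag_comp_eq[OF d] outs_def c image_image m by auto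
  have sub: "flip ` C \<subseteq> ?M \<longleftrightarrow> C \<subseteq> ?M" for C
    using inj_image_subset_iff[OF inj_flip, of C ?M] by (simp add: flip_verts)
  have "loops ?M (stacked ((`) flip ` d\<^sub>2) ((`) flip ` d\<^sub>1)) = (`) flip ` loops ?M (stacked d\<^sub>1 d\<^sub>2)"
    unfolding loops_def flip_stacked[OF d] comps_image[OF inj]
    by (auto simp: sub inj_image_subset_iff[OF inj_flip] card_image[OF inj] simp del: One_nat_def)
  moreover have "inj_on ((`) flip) X" for X using inj_flip by (auto simp: inj_on_def inj_image_eq_iff)
  ultimately show "num_loops ((`) flip ` d\<^sub>2) ((`) flip ` d\<^sub>1) = num_loops d\<^sub>1 d\<^sub>2"
    by (simp add: num_loops_eq[OF f] num_loops_eq[OF d] card_image)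
qed

lemma id_comp_right:
  assumes d: "d \<in> partial_brauer n"
  shows "diag_comp d (id_diagram n) = d" "num_loops d (id_diagram n) = 0"
proof -
  have ff: "(`) flip ` (`) flip ` d = d" for d by (simp add: image_image)
  have fid: "(`) flip ` id_diagram n = id_diagram n"
    by (auto simp: id_diagram_def image_image insert_commute)
  note i = tl_partial_brauer[OF id_diagram_tl[of n]]
  note f = flip_comp[OF i flip_partial_brauer[OF d], unfolded ff fid id_comp_left[OF flip_partial_brauer[OF d]]]
  show "diag_comp d (id_diagram n) = d" "num_loops d (id_diagram n) = 0" using f by simp_all
qed

section \<open>Spreading a diagram over subsets of the vertices\<close>

text \<open>An \<open>n\<close>-subset of \<open>{1..k}\<close> presented by its increasing
  enumeration. Monotonicity is what preserves planarity when vertices are moved.\<close>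

definition incr :: "nat \<Rightarrow> nat \<Rightarrow> (nat \<Rightarrow> nat) \<Rightarrow> bool" where
  "incr n k a \<longleftrightarrow> strict_mono_on {1..n} a \<and> a ` {1..n} \<subseteq> {1..k}"

lemma incr_less: "\<lbrakk>incr n k a; i \<in> {1..n}; j \<in> {1..n}\<rbrakk> \<Longrightarrow> a i < a j \<longleftrightarrow> i < j"
  unfolding incr_def by (metis linorder_neqE_nat order_less_asym order_less_irrefl strict_mono_onD)

lemma incr_inj: "incr n k a \<Longrightarrow> inj_on a {1..n}"
  by (rule inj_onI) (metis incr_less linorder_neqE_nat order_less_irrefl)

lemma incr_range: "\<lbrakk>incr n k a; i \<in> {1..n}\<rbrakk> \<Longrightarrow> 1 \<le> a i \<and> a i \<le> k"
  unfolding incr_def by (meson atLeastAtMost_iff image_subset_iff)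

text \<open>One map for each row, so that a stack of two diagrams can be embedded by a single
  function. For a diagram \<open>id\<close> is filled in as the map of the middle row.\<close>

definition emb :: "(nat \<Rightarrow> nat) \<Rightarrow> (nat \<Rightarrow> nat) \<Rightarrow> (nat \<Rightarrow> nat) \<Rightarrow> vertex \<Rightarrow> vertex" where
  "emb a b c v = (fst v, (case fst v of Upper \<Rightarrow> a | Middle \<Rightarrow> b | Lower \<Rightarrow> c) (snd v))"

lemma emb_simps [simp]: "emb a b c (Upper, i) = (Upper, a i)" "emb a b c (Middle, i) = (Middle, b i)"
  "emb a b c (Lower, i) = (Lower, c i)" "fst (emb a b c v) = fst v"
  by (auto simp: emb_def)

lemma emb_inj3:
  assumes "incr n k a" "incr n k b" "incr n k c"
  shows "inj_on (emb a b c) ({Upper, Middle, Lower} \<times> {1..n})"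
proof (rule inj_onI)
  fix u v assume uv: "u \<in> {Upper, Middle, Lower} \<times> {1..n}" "v \<in> {Upper, Middle, Lower} \<times> {1..n}" "emb a b c u = emb a b c v"
  obtain r i s j where x: "u = (r, i)" "v = (s, j)" by (cases u, cases v)
  then have "i \<in> {1..n}" "j \<in> {1..n}" using uv by auto
  then have "a i = a j \<longleftrightarrow> i = j" "b i = b j \<longleftrightarrow> i = j" "c i = c j \<longleftrightarrow> i = j"
    using assms[THEN incr_inj] by (simp_all only: inj_on_eq_iff)
  then show "u = v" using uv(3) x by (cases r) (auto simp: emb_def)
qed

lemma emb_inj:
  assumes "incr n k a" "incr n k c"
  shows "inj_on (emb a b c) (verts n)"
proof -
  have "inj_on (emb a a c) (verts n)" by (rule inj_on_subset[OF emb_inj3[OF assms(1,1,2)]]) auto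
  moreover have "emb a a c v = emb a b c v" if "v \<in> verts n" for v using that by (cases v) auto
  ultimately show ?thesis by (simp only: inj_on_cong[of "verts n" "emb a a c" "emb a b c"])
qed

text \<open>Puts the vertices of \<open>t\<close> at the positions enumerated by \<open>a\<close>
  and \<open>c\<close> and leaves all others isolated. By \<open>spread_surj\<close> every balanced
  diagram with \<open>n\<close> edges arises in this way from a Temperley-Lieb diagram.\<close>

definition spread :: "nat \<Rightarrow> nat \<Rightarrow> (nat \<Rightarrow> nat) \<Rightarrow> (nat \<Rightarrow> nat) \<Rightarrow> diagram \<Rightarrow> diagram" where
  "spread k n a c t = (`) (emb a id c) ` t \<union> (\<lambda>v. {v}) ` (verts k - emb a id c ` verts n)"

lemma partition_on_Un_singletons:
  assumes "partition_on A P" "A \<inter> X = {}"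
  shows "partition_on (A \<union> X) (P \<union> (\<lambda>v. {v}) ` X)"
proof (rule partition_onI)
  show "\<Union>(P \<union> (\<lambda>v. {v}) ` X) = A \<union> X" using assms by (auto simp: partition_on_def)
  show "{} \<notin> P \<union> (\<lambda>v. {v}) ` X" using assms by (auto simp: partition_on_def)
  have d: "disjnt p q" if "p \<in> P" "q \<in> P" "p \<noteq> q" for p q
    using partition_on_unique[OF assms(1) that(1,2)] that(3) by (auto simp: disjnt_def)
  have s: "p \<subseteq> A" if "p \<in> P" for p using that assms(1) by (auto simp: partition_on_def)
  show "disjnt p q" if "p \<in> P \<union> (\<lambda>v. {v}) ` X" "q \<in> P \<union> (\<lambda>v. {v}) ` X" "p \<noteq> q" for p q
    using that assms(2) d s unfolding disjnt_def by blast
qed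

lemma emb_verts: "\<lbrakk>incr n k a; incr n k c\<rbrakk> \<Longrightarrow> emb a b c ` verts n \<subseteq> verts k"
  by (auto simp: incr_def)

text \<open>The rows keep their order on the boundary and each map is increasing; the reversal of
  the lower row occurs on both sides. The equivalence is used in both directions: crossings are
  pulled back in \<open>spread_noncrossing\<close> and pushed forward in
  \<open>spread_surj\<close>.\<close>

lemma emb_boundary_pos:
  assumes "incr n k a" "incr n k c" "u \<in> verts n" "v \<in> verts n"
  shows "boundary_pos k (emb a b c u) < boundary_pos k (emb a b c v) \<longleftrightarrow> boundary_pos n u < boundary_pos n v"
proof -
  obtain r i s j where uv: "u = (r, i)" "v = (s, j)" "i \<in> {1..n}" "j \<in> {1..n}"
    "r = Upper \<or> r = Lower" "s = Upper \<or> s = Lower" using assms(3,4) by auto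
  have e: "a i < a j \<longleftrightarrow> i < j" "c i < c j \<longleftrightarrow> i < j" "c j < c i \<longleftrightarrow> j < i"
    using incr_less[OF assms(1) uv(3,4)] incr_less[OF assms(2) uv(3,4)] incr_less[OF assms(2) uv(4,3)] .
  have r: "1 \<le> a i" "a i \<le> k" "1 \<le> a j" "a j \<le> k" "1 \<le> c i" "c i \<le> k" "1 \<le> c j" "c j \<le> k"
    "1 \<le> i" "i \<le> n" "1 \<le> j" "j \<le> n"
    using incr_range[OF assms(1) uv(3)] incr_range[OF assms(1) uv(4)] incr_range[OF assms(2) uv(3)]
      incr_range[OF assms(2) uv(4)] uv(3,4) by auto
  have ll: "2 * k + 1 - c i < 2 * k + 1 - c j \<longleftrightarrow> c j < c i" "2 * n + 1 - i < 2 * n + 1 - j \<longleftrightarrow> j < i"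
    using r by linarith+
  have ul: "a i < 2 * k + 1 - c j" "i < 2 * n + 1 - j" "\<not> 2 * k + 1 - c i < a j" "\<not> 2 * n + 1 - i < j"
    using r by linarith+
  from uv(5,6) show ?thesis
    unfolding uv(1,2) boundary_pos_def using e ll ul by auto
qed

context
  fixes n k :: nat and a c :: "nat \<Rightarrow> nat"
  assumes a: "incr n k a" and c: "incr n k c"
begin

lemma spread_partial_brauer:
  assumes t: "t \<in> partial_brauer n" shows "spread k n a c t \<in> partial_brauer k"
proof -
  let ?f = "emb a id c"
  have "partition_on (?f ` verts n \<union> (verts k - ?f ` verts n)) (spread k n a c t)"
    unfolding spread_def
    by (rule partition_on_Un_singletons[OF partition_on_image[OF partial_brauerD(1)[OF t] emb_inj[OF a c]]]) auto
  moreover have "?f ` verts n \<union> (verts k - ?f ` verts n) = verts k" using emb_verts[OF a c] by blast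
  moreover have "card b \<le> 2" if "b \<in> spread k n a c t" for b
    using that partial_brauerD(2,5)[OF t] card_image_le order_trans unfolding spread_def by fastforce
  ultimately show ?thesis by (simp add: partial_brauer_def)
qed

lemma edges_spread:
  assumes t: "t \<in> partial_brauer n" shows "edges (spread k n a c t) = (`) (emb a id c) ` edges t"
proof -
  have "edges (spread k n a c t) = edges ((`) (emb a id c) ` t)"
    by (auto simp: edges_def spread_def)
  also have "\<dots> = (`) (emb a id c) ` edges t"
    by (rule edges_image) (simp add: partial_brauerD(3)[OF t] emb_inj[OF a c] del: One_nat_def)
  finally show ?thesis .
qed

lemma spread_noncrossing:
  assumes t: "t \<in> partial_brauer n" "noncrossing n t" shows "noncrossing k (spread k n a c t)"
  unfolding noncrossing_def
proof (intro ballI notI)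
  let ?f = "emb a id c"
  fix b b' assume b: "b \<in> spread k n a c t" "b' \<in> spread k n a c t"
  assume "\<exists>x\<in>b. \<exists>y\<in>b'. \<exists>z\<in>b. \<exists>w\<in>b'. boundary_pos k x < boundary_pos k y \<and>
    boundary_pos k y < boundary_pos k z \<and> boundary_pos k z < boundary_pos k w"
  then obtain x y z w where xyzw: "x \<in> b" "y \<in> b'" "z \<in> b" "w \<in> b'"
    "boundary_pos k x < boundary_pos k y" "boundary_pos k y < boundary_pos k z" "boundary_pos k z < boundary_pos k w" by blast
  then have ne: "b \<noteq> {v}" "b' \<noteq> {v}" for v by auto
  have "b \<in> (`) ?f ` t" "b' \<in> (`) ?f ` t" using b ne unfolding spread_def by blast+
  then obtain e e' where e: "e \<in> t" "b = ?f ` e" "e' \<in> t" "b' = ?f ` e'" by auto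
  then obtain x' y' z' w' where p: "x' \<in> e" "z' \<in> e" "y' \<in> e'" "w' \<in> e'" "x = ?f x'" "y = ?f y'" "z = ?f z'" "w = ?f w'"
    using xyzw(1-4) by auto
  have v: "x' \<in> verts n" "y' \<in> verts n" "z' \<in> verts n" "w' \<in> verts n"
    using p(1-4) partial_brauerD(7)[OF t(1) e(1)] partial_brauerD(7)[OF t(1) e(3)] by auto
  have "boundary_pos n x' < boundary_pos n y'" "boundary_pos n y' < boundary_pos n z'" "boundary_pos n z' < boundary_pos n w'"
    using xyzw(5-7) unfolding p(5-8) using emb_boundary_pos[OF a c] v by blast+
  then show False using t(2) e p unfolding noncrossing_def by blast
qed

lemma tops_spread: "t \<in> tl_diagrams n \<Longrightarrow> tops (spread k n a c t) = a ` {1..n}"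
  and bots_spread: "t \<in> tl_diagrams n \<Longrightarrow> bots (spread k n a c t) = c ` {1..n}"
proof -
  assume t: "t \<in> tl_diagrams n"
  note pb = tl_partial_brauer[OF t]
  have "edges t = t" using tl_card[OF t] by (auto simp: edges_def)
  then have "\<Union>(edges (spread k n a c t)) = emb a id c ` verts n"
    using partial_brauerD(3)[OF pb] by (simp add: edges_spread[OF pb] image_Union[symmetric] del: One_nat_def)
  then show "tops (spread k n a c t) = a ` {1..n}" "bots (spread k n a c t) = c ` {1..n}"
    unfolding tops_def bots_def by (auto simp: image_iff)
qed

lemma spread_inj:
  assumes "t \<in> partial_brauer n" "t' \<in> partial_brauer n" "edges t = t" "edges t' = t'"
    and e: "spread k n a c t = spread k n a c t'"
  shows "t = t'"
proof -
  have "(`) (emb a id c) ` t = edges (spread k n a c t)" by (simp add: edges_spread assms(1,3))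
  also have "\<dots> = (`) (emb a id c) ` t'" by (simp add: e edges_spread assms(2,4))
  finally have "(`) (emb a id c) ` t = (`) (emb a id c) ` t'" .
  moreover have "inj_on ((`) (emb a id c)) (Pow (verts n))" by (rule inj_on_image_Pow[OF emb_inj[OF a c]])
  moreover have "t \<subseteq> Pow (verts n)" "t' \<subseteq> Pow (verts n)" using partial_brauerD(7) assms(1,2) by blast+
  ultimately show ?thesis by (simp add: inj_on_image_eq_iff)
qed

end

text \<open>An edge has one upper endpoint, one more if it is a cup and one less if it is a cap; for
  lower endpoints the roles are interchanged. The totals over all edges are stated without
  subtraction to stay within the natural numbers.\<close>

lemma edge_count:
  assumes d: "d \<in> partial_brauer k"
  shows "card (tops d) + card (caps d) = card (edges d) + card (cups d)"
    and "card (bots d) + card (cups d) = card (edges d) + card (caps d)"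
proof -
  have fe: "finite (edges d)" using partial_brauerD(4)[OF d] by (simp add: edges_def)
  have part: "partition_on (\<Union>(edges d)) (edges d)"
    using partial_brauerD(1)[OF d] by (auto simp: partition_on_def edges_def disjoint_def)
  have fU: "finite (\<Union>(edges d))" using fe partial_brauerD(5)[OF d] by (auto simp: edges_def)
  have row: "card {i. (r, i) \<in> \<Union>(edges d)} = (\<Sum>b\<in>edges d. card (b \<inter> {r} \<times> UNIV))" for r
  proof -
    have "(\<Sum>b\<in>edges d. card (b \<inter> {r} \<times> UNIV)) = (\<Sum>b\<in>edges d. \<Sum>v\<in>b. if fst v = r then 1 else 0)"
    proof (rule sum.cong[OF refl])
      fix b assume "b \<in> edges d"
      then have "finite b" using partial_brauerD(5)[OF d] by (auto simp: edges_def)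
      then have "(\<Sum>v\<in>b. if fst v = r then 1 else 0) = card {v \<in> b. fst v = r}" by (simp add: sum.If_cases Int_def)
      moreover have "{v \<in> b. fst v = r} = b \<inter> {r} \<times> UNIV" by auto
      ultimately show "card (b \<inter> {r} \<times> UNIV) = (\<Sum>v\<in>b. if fst v = r then 1 else 0)" by simp
    qed
    also have "\<dots> = (\<Sum>v\<in>\<Union>(edges d). if fst v = r then 1 else 0)"
      by (rule sum.partition[OF fU part, symmetric])
    also have "\<dots> = card {v \<in> \<Union>(edges d). fst v = r}" using fU by (simp add: sum.If_cases Int_def)
    also have "{v \<in> \<Union>(edges d). fst v = r} = Pair r ` {i. (r, i) \<in> \<Union>(edges d)}" by force
    also have "card \<dots> = card {i. (r, i) \<in> \<Union>(edges d)}" by (simp add: card_image inj_on_def)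
    finally show ?thesis ..
  qed
  have blk: "card (b \<inter> {Upper} \<times> UNIV) + (if b \<in> caps d then 1 else 0) = 1 + (if b \<in> cups d then 1 else 0)"
    "card (b \<inter> {Lower} \<times> UNIV) + (if b \<in> cups d then 1 else 0) = 1 + (if b \<in> caps d then 1 else 0)"
    if b: "b \<in> edges d" for b
  proof -
    have "card b = 2" "b \<subseteq> verts k" using b partial_brauerD(7)[OF d] by (auto simp: edges_def)
    then obtain r i s j where x: "b = {(r, i), (s, j)}" "(r, i) \<noteq> (s, j)" "r = Upper \<or> r = Lower" "s = Upper \<or> s = Lower"
      by (auto simp: card_2_iff)
    have i: "{(Upper, i), (Upper, j)} \<inter> {Upper} \<times> UNIV = {(Upper, i), (Upper, j)}"
      "{(Lower, i), (Lower, j)} \<inter> {Upper} \<times> UNIV = {}" "{(Upper, i), (Lower, j)} \<inter> {Upper} \<times> UNIV = {(Upper, i)}"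
      "{(Lower, i), (Upper, j)} \<inter> {Upper} \<times> UNIV = {(Upper, j)}"
      "{(Lower, i), (Lower, j)} \<inter> {Lower} \<times> UNIV = {(Lower, i), (Lower, j)}"
      "{(Upper, i), (Upper, j)} \<inter> {Lower} \<times> UNIV = {}" "{(Upper, i), (Lower, j)} \<inter> {Lower} \<times> UNIV = {(Lower, j)}"
      "{(Lower, i), (Upper, j)} \<inter> {Lower} \<times> UNIV = {(Lower, i)}" by auto
    have m: "b \<in> cups d \<longleftrightarrow> r = Upper \<and> s = Upper" "b \<in> caps d \<longleftrightarrow> r = Lower \<and> s = Lower"
      using b x by (auto simp: cups_def caps_def)
    show "card (b \<inter> {Upper} \<times> UNIV) + (if b \<in> caps d then 1 else 0) = 1 + (if b \<in> cups d then 1 else 0)"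
      "card (b \<inter> {Lower} \<times> UNIV) + (if b \<in> cups d then 1 else 0) = 1 + (if b \<in> caps d then 1 else 0)"
      unfolding m using x by (auto simp: i)
  qed
  have c: "(\<Sum>b\<in>edges d. if b \<in> cups d then 1 else 0) = card (cups d)"
    "(\<Sum>b\<in>edges d. if b \<in> caps d then 1 else 0) = card (caps d)"
  proof -
    have "edges d \<inter> {b. b \<in> cups d} = cups d" "edges d \<inter> {b. b \<in> caps d} = caps d" by (auto simp: cups_def caps_def)
    then show "(\<Sum>b\<in>edges d. if b \<in> cups d then 1 else 0) = card (cups d)"
      "(\<Sum>b\<in>edges d. if b \<in> caps d then 1 else 0) = card (caps d)"
      using fe by (simp_all add: sum.If_cases)
  qed
  have "(\<Sum>b\<in>edges d. card (b \<inter> {Upper} \<times> UNIV) + (if b \<in> caps d then 1 else 0)) = (\<Sum>b\<in>edges d. 1 + (if b \<in> cups d then 1 else 0))"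
    by (rule sum.cong[OF refl blk(1)])
  then show "card (tops d) + card (caps d) = card (edges d) + card (cups d)"
    unfolding sum.distrib c row[of Upper, folded tops_def, symmetric] by simp
  have "(\<Sum>b\<in>edges d. card (b \<inter> {Lower} \<times> UNIV) + (if b \<in> cups d then 1 else 0)) = (\<Sum>b\<in>edges d. 1 + (if b \<in> caps d then 1 else 0))"
    by (rule sum.cong[OF refl blk(2)])
  then show "card (bots d) + card (cups d) = card (edges d) + card (caps d)"
    unfolding sum.distrib c row[of Lower, folded bots_def, symmetric] by simp
qed

text \<open>Adding the two equations of \<open>edge_count\<close> determines the number of edges,
  and either of them then compares cups with caps. This is why balanced diagrams fit into square
  matrices: the two matched subsets have the same size.\<close>

lemma balanced_edges_iff:
  "d \<in> balanced_edges k n \<longleftrightarrow> d \<in> motzkin k \<and> card (tops d) = n \<and> card (bots d) = n"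
proof (cases "d \<in> motzkin k")
  case True
  then have "d \<in> partial_brauer k" by (simp add: motzkin_def)
  from edge_count[OF this] True show ?thesis by (auto simp: balanced_edges_def balanced_def)
qed (simp add: balanced_edges_def balanced_def)

lemma spread_balanced_edges:
  assumes "incr n k a" "incr n k c" "t \<in> tl_diagrams n"
  shows "spread k n a c t \<in> balanced_edges k n"
  using assms spread_partial_brauer[OF assms(1,2) tl_partial_brauer] spread_noncrossing[OF assms(1,2) tl_partial_brauer]
    card_image[OF incr_inj[OF assms(1)]] card_image[OF incr_inj[OF assms(2)]]
  by (simp add: balanced_edges_iff motzkin_def tops_spread bots_spread tl_diagrams_def)

text \<open>The edges of \<open>d\<close> are pulled back along the injection
  \<open>emb a id c\<close>. Its image is the set of matched vertices, so the pulled back edges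
  cover both rows completely, and what \<open>spread\<close> adds are the isolated vertices of
  \<open>d\<close>.\<close>

lemma spread_surj:
  assumes a: "incr n k a" and c: "incr n k c" and d: "d \<in> balanced_edges k n"
    and td: "tops d = a ` {1..n}" "bots d = c ` {1..n}"
  shows "\<exists>t\<in>tl_diagrams n. spread k n a c t = d"
proof -
  let ?f = "emb a id c"
  have m: "d \<in> motzkin k" using d by (simp add: balanced_edges_def balanced_def)
  then have pb: "d \<in> partial_brauer k" by (simp add: motzkin_def)
  have inj: "inj_on ?f (verts n)" by (rule emb_inj[OF a c])
  have U: "\<Union>(edges d) = ?f ` verts n"
  proof -
    have "\<Union>(edges d) \<subseteq> verts k" using partial_brauerD(7)[OF pb] by (auto simp: edges_def)
    then have "\<Union>(edges d) = {Upper} \<times> tops d \<union> {Lower} \<times> bots d" by (auto simp: tops_def bots_def)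
    also have "\<dots> = ?f ` verts n" unfolding td by (force simp: image_iff)
    finally show ?thesis .
  qed
  define g where "g = inv_into (verts n) ?f"
  have ginj: "inj_on g (?f ` verts n)" unfolding g_def by (rule inj_on_inv_into) simp
  have fg: "?f (g v) = v" if "v \<in> ?f ` verts n" for v unfolding g_def using that by (rule f_inv_into_f)
  have gim: "g ` ?f ` verts n = verts n" unfolding g_def using inj by (simp add: inv_into_image_cancel del: One_nat_def)
  have fgb: "?f ` g ` b = b" if "b \<in> edges d" for b
  proof -
    have "b \<subseteq> ?f ` verts n" using that U by blast
    then have "(\<lambda>x. ?f (g x)) ` b = (\<lambda>x. x) ` b" by (intro image_cong fg) auto
    then show ?thesis unfolding image_image by simp
  qed
  let ?t = "(`) g ` edges d"
  have ft: "(`) ?f ` ?t = edges d" using fgb by (simp add: image_image[where f="(`) ?f"] cong: image_cong)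
  have "partition_on (\<Union>(edges d)) (edges d)"
    using partial_brauerD(1)[OF pb] by (auto simp: partition_on_def edges_def disjoint_def)
  then have part: "partition_on (verts n) ?t"
    using partition_on_image[of "\<Union>(edges d)" "edges d" g] ginj gim unfolding U by simp
  have c2: "card b = 2" if "b \<in> ?t" for b
  proof -
    obtain e where e: "e \<in> edges d" "b = g ` e" using \<open>b \<in> ?t\<close> by auto
    have "inj_on g e" using ginj e(1) U by (intro inj_on_subset[OF ginj]) blast
    then show ?thesis using e by (simp add: card_image edges_def)
  qed
  have tpb: "?t \<in> partial_brauer n" using part c2 by (simp add: partial_brauer_def)
  have "noncrossing n ?t"
    unfolding noncrossing_def
  proof (intro ballI notI)
    fix b b' assume b: "b \<in> ?t" "b' \<in> ?t"
    assume "\<exists>x\<in>b. \<exists>y\<in>b'. \<exists>z\<in>b. \<exists>w\<in>b'. boundary_pos n x < boundary_pos n y \<and>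
      boundary_pos n y < boundary_pos n z \<and> boundary_pos n z < boundary_pos n w"
    then obtain x y z w where xyzw: "x \<in> b" "y \<in> b'" "z \<in> b" "w \<in> b'"
      "boundary_pos n x < boundary_pos n y" "boundary_pos n y < boundary_pos n z" "boundary_pos n z < boundary_pos n w" by blast
    have v: "x \<in> verts n" "y \<in> verts n" "z \<in> verts n" "w \<in> verts n"
      using xyzw(1-4) partial_brauerD(7)[OF tpb b(1)] partial_brauerD(7)[OF tpb b(2)] by auto
    have pos: "boundary_pos k (?f x) < boundary_pos k (?f y)" "boundary_pos k (?f y) < boundary_pos k (?f z)"
      "boundary_pos k (?f z) < boundary_pos k (?f w)"
      using xyzw(5-7) emb_boundary_pos[OF a c] v by blast+
    have "?f ` b \<in> edges d" "?f ` b' \<in> edges d"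
      using imageI[OF b(1), of "(`) ?f"] imageI[OF b(2), of "(`) ?f"] unfolding ft .
    then have bd: "?f ` b \<in> d" "?f ` b' \<in> d" by (auto simp only: edges_def)
    have "noncrossing k d" using m by (simp add: motzkin_def)
    then show False by (rule noncrossingD[OF _ bd xyzw(1-4)[THEN imageI] pos])
  qed
  then have t: "?t \<in> tl_diagrams n" using tpb c2 by (simp add: tl_diagrams_def motzkin_def)
  have "(\<lambda>v. {v}) ` (verts k - ?f ` verts n) = d - edges d"
  proof (intro equalityI subsetI)
    fix b assume "b \<in> (\<lambda>v. {v}) ` (verts k - ?f ` verts n)"
    then obtain v where v: "b = {v}" "v \<in> verts k" "v \<notin> \<Union>(edges d)" unfolding U by blast
    then show "b \<in> d - edges d" using singleton_iff_not_edge[OF pb v(2)] by (auto simp: edges_def)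
  next
    fix b assume b: "b \<in> d - edges d"
    then have "card b \<noteq> 2" "b \<in> d" by (auto simp: edges_def)
    then have "card b \<le> Suc 0" using partial_brauerD(2)[OF pb, of b] by simp
    moreover obtain v where v: "v \<in> b" using partial_brauerD(6)[OF pb \<open>b \<in> d\<close>] by blast
    ultimately have "b = {v}" using partial_brauerD(5)[OF pb \<open>b \<in> d\<close>] card_le_Suc0_iff_eq[of b] by blast
    moreover have vk: "v \<in> verts k" using v partial_brauerD(7)[OF pb \<open>b \<in> d\<close>] by blast
    ultimately have "v \<notin> \<Union>(edges d)" using singleton_iff_not_edge[OF pb vk] \<open>b \<in> d\<close> by simp
    then show "b \<in> (\<lambda>v. {v}) ` (verts k - ?f ` verts n)" using \<open>b = {v}\<close> vk unfolding U by blast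
  qed
  then have "spread k n a c ?t = d" unfolding spread_def ft by (auto simp: edges_def)
  then show ?thesis using t by blast
qed

lemma emb_complement:
  "verts k - emb a b c ` verts n = {Upper} \<times> ({1..k} - a ` {1..n}) \<union> {Lower} \<times> ({1..k} - c ` {1..n})"
proof -
  have "{Upper, Lower} \<times> A = {Upper} \<times> A \<union> {Lower} \<times> A" for A :: "nat set" by blast
  moreover have "emb a b c ` ({Upper} \<times> A) = {Upper} \<times> a ` A" "emb a b c ` ({Lower} \<times> A) = {Lower} \<times> c ` A" for A
    by (force simp: image_iff)+
  ultimately have "emb a b c ` verts n = {Upper} \<times> a ` {1..n} \<union> {Lower} \<times> c ` {1..n}"
    by (simp only: image_Un)
  then show ?thesis by auto
qed

text \<open>The stack of the spread diagrams is the image of the stack of \<open>t\<close> and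
  \<open>s\<close> under one injection, with isolated vertices added. Components, outer blocks and
  loops are carried along.\<close>

lemma spread_comp:
  assumes a: "incr n k a" and b: "incr n k b" and c: "incr n k c"
    and t: "t \<in> partial_brauer n" and s: "s \<in> partial_brauer n"
  shows "diag_comp (spread k n a b t) (spread k n b c s) = spread k n a c (diag_comp t s)"
    and "num_loops (spread k n a b t) (spread k n b c s) = num_loops t s"
proof -
  let ?f = "emb a b c"
  let ?V = "{Upper, Middle, Lower} \<times> {1..n} :: vertex set"
  let ?Mk = "{Middle} \<times> {1..k} :: vertex set" and ?Mn = "{Middle} \<times> {1..n} :: vertex set"
  define X :: "vertex set" where
    "X = {Upper} \<times> ({1..k} - a ` {1..n}) \<union> {Middle} \<times> ({1..k} - b ` {1..n}) \<union> {Lower} \<times> ({1..k} - c ` {1..n})"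
  note pb = spread_partial_brauer[OF a b t] spread_partial_brauer[OF b c s]
  have inj: "inj_on ?f ?V" by (rule emb_inj3[OF a b c])
  have U: "\<Union>(stacked t s) = ?V"
  proof -
    interpret stack "{Upper} \<times> {1..n}" "{Middle} \<times> {1..n}" "{Lower} \<times> {1..n}" "(`) fU ` t" "(`) fL ` s"
      by (rule stack_diagrams[OF t s])
    show ?thesis unfolding stacked_eq Union_eq by auto
  qed
  have 1: "(`) fU ` (`) (emb a id b) ` t = (`) ?f ` (`) fU ` t"
  proof -
    have "fU ` emb a id b ` e = ?f ` fU ` e" if "e \<in> t" for e
      unfolding image_image
    proof (rule image_cong[OF refl])
      fix v assume "v \<in> e"
      then have "v \<in> verts n" using partial_brauerD(7)[OF t that] by blast
      then show "fU (emb a id b v) = ?f (fU v)" by (cases v) auto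
    qed
    then show ?thesis by (simp only: image_image cong: image_cong)
  qed
  have 2: "(`) fL ` (`) (emb b id c) ` s = (`) ?f ` (`) fL ` s"
  proof -
    have "fL ` emb b id c ` e = ?f ` fL ` e" if "e \<in> s" for e
      unfolding image_image
    proof (rule image_cong[OF refl])
      fix v assume "v \<in> e"
      then have "v \<in> verts n" using partial_brauerD(7)[OF s that] by blast
      then show "fL (emb b id c v) = ?f (fL v)" by (cases v) auto
    qed
    then show ?thesis by (simp only: image_image cong: image_cong)
  qed
  have fi: "fU ` ({Upper} \<times> A) = {Upper} \<times> A" "fU ` ({Lower} \<times> A) = {Middle} \<times> A"
    "fL ` ({Upper} \<times> A) = {Middle} \<times> A" "fL ` ({Lower} \<times> A) = {Lower} \<times> A" for A
    by (force simp: image_iff)+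
  have 3: "fU ` (verts k - emb a id b ` verts n) \<union> fL ` (verts k - emb b id c ` verts n) = X"
    unfolding X_def emb_complement image_Un fi by blast
  have "stacked (spread k n a b t) (spread k n b c s)
    = ((`) fU ` (`) (emb a id b) ` t \<union> (`) fL ` (`) (emb b id c) ` s)
    \<union> (\<lambda>v. {v}) ` (fU ` (verts k - emb a id b ` verts n) \<union> fL ` (verts k - emb b id c ` verts n))"
    unfolding stacked_eq spread_def image_Un by (simp add: image_image Un_ac)
  \<comment> \<open>Both layers use \<open>b\<close> on the middle row, which is why the single map
    \<open>emb a b c\<close> describes their union.\<close>
  then have st: "stacked (spread k n a b t) (spread k n b c s) = (`) ?f ` stacked t s \<union> (\<lambda>v. {v}) ` X"
    unfolding 1 2 3 stacked_eq image_Un .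
  have XV: "X \<inter> ?f ` ?V = {}" unfolding X_def by auto
  have co: "comps (stacked (spread k n a b t) (spread k n b c s)) = (`) ?f ` comps (stacked t s) \<union> (\<lambda>v. {v}) ` X"
    unfolding st
  proof (subst comps_add_singletons)
    show "X \<inter> \<Union>((`) ?f ` stacked t s) = {}" using XV U by (simp add: image_Union[symmetric] del: One_nat_def)
    show "comps ((`) ?f ` stacked t s) \<union> (\<lambda>v. {v}) ` X = (`) ?f ` comps (stacked t s) \<union> (\<lambda>v. {v}) ` X"
      using comps_image[of ?f "stacked t s"] inj U by simp
  qed
  have CV: "C \<subseteq> ?V" if "C \<in> comps (stacked t s)" for C using that U unfolding in_comps_iff by simp
  have bM: "b i \<in> {1..k}" if "i \<in> {1..n}" for i using incr_range[OF b that] by simp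
  have mid: "?f ` C - ?Mk = emb a id c ` (C - ?Mn)" "?f ` C \<subseteq> ?Mk \<longleftrightarrow> C \<subseteq> ?Mn" if C: "C \<subseteq> ?V" for C
  proof -
    have fv: "?f v \<in> ?Mk \<longleftrightarrow> v \<in> ?Mn" if "v \<in> ?V" for v
      using that bM by (cases v) auto
    have fe: "?f v = emb a id c v" if "v \<in> ?V" "v \<notin> ?Mn" for v using that by (cases v) auto
    show "?f ` C \<subseteq> ?Mk \<longleftrightarrow> C \<subseteq> ?Mn" using fv C by blast
    show "?f ` C - ?Mk = emb a id c ` (C - ?Mn)"
    proof (intro equalityI subsetI)
      fix w assume "w \<in> ?f ` C - ?Mk"
      then obtain v where v: "w = ?f v" "v \<in> C" "?f v \<notin> ?Mk" by blast
      then have "v \<notin> ?Mn" "v \<in> ?V" using fv C by blast+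
      then show "w \<in> emb a id c ` (C - ?Mn)" using v fe by blast
    next
      fix w assume "w \<in> emb a id c ` (C - ?Mn)"
      then obtain v where v: "w = emb a id c v" "v \<in> C" "v \<notin> ?Mn" by blast
      then have "v \<in> ?V" using C by blast
      then show "w \<in> ?f ` C - ?Mk" using v fe fv by (metis DiffI imageI)
    qed
  qed
  have XM: "X - ?Mk = verts k - emb a id c ` verts n" unfolding X_def emb_complement by auto
  have "outs ?Mk (stacked (spread k n a b t) (spread k n b c s))
    = (`) (emb a id c) ` outs ?Mn (stacked t s) \<union> (\<lambda>v. {v}) ` (X - ?Mk)"
  proof -
    have "(\<lambda>C. C - ?Mk) ` (`) ?f ` comps (stacked t s) = (`) (emb a id c) ` (\<lambda>C. C - ?Mn) ` comps (stacked t s)"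
      unfolding image_image by (rule image_cong[OF refl mid(1)[OF CV]])
    moreover have "(\<lambda>C. C - ?Mk) ` (\<lambda>v. {v}) ` X - {{}} = (\<lambda>v. {v}) ` (X - ?Mk)" by auto
    moreover have "(`) (emb a id c) ` Y - {{}} = (`) (emb a id c) ` (Y - {{}})" for Y by auto
    ultimately show ?thesis unfolding outs_def co image_Un Un_Diff by simp
  qed
  then show "diag_comp (spread k n a b t) (spread k n b c s) = spread k n a c (diag_comp t s)"
    unfolding diag_comp_eq[OF pb] diag_comp_eq[OF t s] XM spread_def[of k n a c] .
  have fp: "inj_on ((`) ?f) (Pow ?V)" by (rule inj_on_image_Pow[OF inj])
  have "loops ?Mk (stacked (spread k n a b t) (spread k n b c s)) = (`) ?f ` loops ?Mn (stacked t s)"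
  proof (intro equalityI subsetI)
    fix C assume "C \<in> loops ?Mk (stacked (spread k n a b t) (spread k n b c s))"
    then have "C \<in> comps (stacked (spread k n a b t) (spread k n b c s)) \<and> C \<subseteq> ?Mk \<and>
      (\<forall>e\<in>stacked (spread k n a b t) (spread k n b c s). e \<subseteq> C \<longrightarrow> card e = 2)"
      unfolding loops_def by (rule CollectD)
    then have C: "C \<in> (`) ?f ` comps (stacked t s) \<union> (\<lambda>v. {v}) ` X" "C \<subseteq> ?Mk"
      "\<And>e. e \<in> (`) ?f ` stacked t s \<union> (\<lambda>v. {v}) ` X \<Longrightarrow> e \<subseteq> C \<Longrightarrow> card e = 2"
      unfolding co unfolding st by simp_all
    \<comment> \<open>A middle vertex outside the image is a component within the middle row, but
      its block has one element, so it is no loop.\<close>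
    have "C \<notin> (\<lambda>v. {v}) ` X" using C(3)[of C] by auto
    then obtain D where D: "C = ?f ` D" "D \<in> comps (stacked t s)" using C(1) by blast
    have "card e = 2" if e: "e \<in> stacked t s" "e \<subseteq> D" for e
    proof -
      have "inj_on ?f e" using inj_on_subset[OF inj] e(2) CV[OF D(2)] by blast
      then show ?thesis using C(3)[of "?f ` e"] e D(1) by (auto simp: card_image)
    qed
    moreover have "D \<subseteq> ?Mn" using C(2) unfolding D(1) mid(2)[OF CV[OF D(2)]] .
    ultimately have "D \<in> loops ?Mn (stacked t s)" using D(2) by (simp add: loops_def)
    then show "C \<in> (`) ?f ` loops ?Mn (stacked t s)" unfolding D(1) by (rule imageI)
  next
    fix C assume "C \<in> (`) ?f ` loops ?Mn (stacked t s)"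
    then obtain D where D: "C = ?f ` D" "D \<in> comps (stacked t s)" "D \<subseteq> ?Mn"
      "\<And>e. e \<in> stacked t s \<Longrightarrow> e \<subseteq> D \<Longrightarrow> card e = 2" unfolding loops_def by blast
    have "card e = 2" if e: "e \<in> (`) ?f ` stacked t s \<union> (\<lambda>v. {v}) ` X" "e \<subseteq> C" for e
      using e(1)
    proof
      assume "e \<in> (`) ?f ` stacked t s"
      then obtain e' where e': "e = ?f ` e'" "e' \<in> stacked t s" by blast
      have "e' \<subseteq> ?V" using e'(2) U by blast
      have "e' \<subseteq> D"
      proof
        fix v assume v: "v \<in> e'"
        then have "?f v \<in> ?f ` D" using e(2) unfolding e'(1) D(1) by blast
        then show "v \<in> D" using inj_on_image_mem_iff[OF inj _ CV[OF D(2)]] v \<open>e' \<subseteq> ?V\<close> by blast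
      qed
      then have "card e' = 2" using D(4) e'(2) by blast
      moreover have "inj_on ?f e'" using inj_on_subset[OF inj \<open>e' \<subseteq> ?V\<close>] .
      ultimately show ?thesis by (simp add: e'(1) card_image)
    next
      assume "e \<in> (\<lambda>v. {v}) ` X"
      then show ?thesis using e(2) D(1) CV[OF D(2)] XV by blast
    qed
    moreover have "C \<subseteq> ?Mk" unfolding D(1) mid(2)[OF CV[OF D(2)]] by (rule D(3))
    moreover have "C \<in> comps (stacked (spread k n a b t) (spread k n b c s))"
      unfolding co D(1) by (rule UnI1[OF imageI[OF D(2)]])
    ultimately show "C \<in> loops ?Mk (stacked (spread k n a b t) (spread k n b c s))"
      unfolding loops_def st by (simp del: One_nat_def)
  qed
  moreover have "loops ?Mn (stacked t s) \<subseteq> Pow ?V" using CV unfolding loops_def by blast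
  ultimately show "num_loops (spread k n a b t) (spread k n b c s) = num_loops t s"
    unfolding num_loops_eq[OF pb] num_loops_eq[OF t s] using card_image[OF inj_on_subset[OF fp]] by simp
qed

lemma ex_incr:
  assumes "A \<subseteq> {1..k}" "card A = n"
  shows "\<exists>a. incr n k a \<and> a ` {1..n} = A"
proof -
  have "finite A" using assms finite_subset by blast
  then obtain h where h: "bij_betw h {..<card A} A" "strict_mono_on {..<card A} h"
    by (rule ex_bij_betw_strict_mono_card)
  \<comment> \<open>The enumeration \<open>h\<close> counts from 0, positions in a diagram count
    from 1.\<close>
  have "{1..n} = Suc ` {0..<n}" by (simp add: image_Suc_atLeastLessThan atLeastLessThanSuc_atLeastAtMost)
  then have im: "(\<lambda>i. i - 1) ` {1..n} = {..<n}" by (simp add: image_image atLeast0LessThan)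
  have "(\<lambda>i. h (i - 1)) ` {1..n} = h ` (\<lambda>i. i - 1) ` {1..n}" by (simp only: image_image)
  also have "\<dots> = A" unfolding im using h(1) assms by (simp add: bij_betw_def)
  finally have i: "(\<lambda>i. h (i - 1)) ` {1..n} = A" .
  have "strict_mono_on {1..n} (\<lambda>i. h (i - 1))"
  proof (rule strict_mono_onI)
    fix r s assume "r \<in> {1..n}" "s \<in> {1..n}" "r < s"
    then show "h (r - 1) < h (s - 1)" using assms(2) by (intro strict_mono_onD[OF h(2)]) auto
  qed
  then show ?thesis using i assms by (intro exI[of _ "\<lambda>i. h (i - 1)"]) (simp add: incr_def)
qed

section \<open>Alternating sums over subsets\<close>

context cring
begin

abbreviation sgn_pow :: "nat \<Rightarrow> 'a" where "sgn_pow n \<equiv> (\<ominus> \<one>) [^] n"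

lemma finsum_Pow_insert:
  assumes "finite X" "x \<notin> X" "\<And>W. W \<subseteq> insert x X \<Longrightarrow> f W \<in> carrier R"
  shows "(\<Oplus>W\<in>Pow (insert x X). f W) = (\<Oplus>W\<in>Pow X. f W) \<oplus> (\<Oplus>W\<in>Pow X. f (insert x W))"
proof -
  have "(\<Oplus>W\<in>Pow (insert x X). f W) = (\<Oplus>W\<in>Pow X. f W) \<oplus> (\<Oplus>W\<in>insert x ` Pow X. f W)"
    unfolding Pow_insert by (rule finsum_Un_disjoint) (use assms(1,2) in \<open>auto intro!: assms(3)\<close>)
  also have "(\<Oplus>W\<in>insert x ` Pow X. f W) = (\<Oplus>W\<in>Pow X. f (insert x W))"
  proof (rule finsum_reindex)
    show "inj_on (insert x) (Pow X)" using assms(2) by (auto simp: inj_on_def)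
    show "f \<in> insert x ` Pow X \<rightarrow> carrier R" by (auto intro!: assms(3))
  qed
  finally show ?thesis .
qed

lemma finsum_neg: "f \<in> A \<rightarrow> carrier R \<Longrightarrow> (\<Oplus>i\<in>A. \<ominus> f i) = \<ominus> (\<Oplus>i\<in>A. f i)"
proof (induction A rule: infinite_finite_induct)
  case (insert x A)
  then have "(\<Oplus>i\<in>insert x A. \<ominus> f i) = \<ominus> f x \<oplus> (\<Oplus>i\<in>A. \<ominus> f i)" by (intro finsum_insert) auto
  moreover have "(\<Oplus>i\<in>insert x A. f i) = f x \<oplus> (\<Oplus>i\<in>A. f i)" using insert by (intro finsum_insert) auto
  moreover have "f x \<in> carrier R" "(\<Oplus>i\<in>A. f i) \<in> carrier R" using insert.prems by (auto intro!: finsum_closed)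
  ultimately show ?case using insert by (simp add: minus_add)
qed auto

lemma sgn_Suc: "sgn_pow (Suc n) = \<ominus> sgn_pow n"
  by (simp add: r_minus)

text \<open>The sets \<open>W\<close> and \<open>insert x W\<close> have opposite signs and the same
  value, so the terms cancel in pairs.\<close>

lemma alternating_toggle:
  assumes X: "finite X" "x \<in> X" and F: "\<And>W. W \<subseteq> X \<Longrightarrow> F W \<in> carrier R"
    and t: "\<And>W. W \<subseteq> X - {x} \<Longrightarrow> F (insert x W) = F W"
  shows "(\<Oplus>W\<in>Pow X. sgn_pow (card W) \<otimes> F W) = \<zero>"
proof -
  have Xe: "X = insert x (X - {x})" using X by auto
  have fX: "finite (X - {x})" using X by simp
  have "(\<Oplus>W\<in>Pow X. sgn_pow (card W) \<otimes> F W) = (\<Oplus>W\<in>Pow (X - {x}). sgn_pow (card W) \<otimes> F W)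
      \<oplus> (\<Oplus>W\<in>Pow (X - {x}). sgn_pow (card (insert x W)) \<otimes> F (insert x W))"
    by (subst Xe, rule finsum_Pow_insert) (use X F in auto)
  also have "(\<Oplus>W\<in>Pow (X - {x}). sgn_pow (card (insert x W)) \<otimes> F (insert x W))
      = (\<Oplus>W\<in>Pow (X - {x}). \<ominus> (sgn_pow (card W) \<otimes> F W))"
  proof (rule finsum_cong')
    fix W assume W: "W \<in> Pow (X - {x})"
    then have "card (insert x W) = Suc (card W)" using finite_subset[OF _ fX] by (subst card_insert_disjoint) auto
    moreover have "F W \<in> carrier R" using W F by auto
    ultimately show "sgn_pow (card (insert x W)) \<otimes> F (insert x W) = \<ominus> (sgn_pow (card W) \<otimes> F W)"
      using t[of W] W by (simp only: sgn_Suc) (simp add: l_minus)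
  qed (use F in \<open>auto intro!: a_inv_closed\<close>)
  also have "\<dots> = \<ominus> (\<Oplus>W\<in>Pow (X - {x}). sgn_pow (card W) \<otimes> F W)"
    by (rule finsum_neg) (use F in auto)
  also have "(\<Oplus>W\<in>Pow (X - {x}). sgn_pow (card W) \<otimes> F W) \<oplus> \<ominus> (\<Oplus>W\<in>Pow (X - {x}). sgn_pow (card W) \<otimes> F W) = \<zero>"
    by (rule r_neg) (use F in \<open>auto intro!: finsum_closed\<close>)
  finally show ?thesis .
qed

text \<open>The sets \<open>W\<close> with image \<open>S\<close> choose a nonempty subset of each
  fibre over \<open>S\<close>, and the signs of the nonempty subsets of one fibre add up to -1. With
  \<open>c\<close> sending an edge to its component, this replaces sets of removed edges by sets of
  broken components.\<close>

lemma alternating_image: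
  assumes "finite X" "\<And>S. F S \<in> carrier R"
  shows "(\<Oplus>W\<in>Pow X. sgn_pow (card W) \<otimes> F (c ` W)) = (\<Oplus>S\<in>Pow (c ` X). sgn_pow (card S) \<otimes> F S)"
  using assms
proof (induction X arbitrary: F rule: finite_induct)
  case empty
  then show ?case by simp
next
  case (insert x X)
  note F = insert.prems
  let ?G = "\<lambda>S. F (insert (c x) S)"
  have "(\<Oplus>W\<in>Pow (insert x X). sgn_pow (card W) \<otimes> F (c ` W))
      = (\<Oplus>W\<in>Pow X. sgn_pow (card W) \<otimes> F (c ` W)) \<oplus> (\<Oplus>W\<in>Pow X. sgn_pow (card (insert x W)) \<otimes> F (c ` insert x W))"
    by (rule finsum_Pow_insert) (use insert.hyps F in auto)
  also have "(\<Oplus>W\<in>Pow X. sgn_pow (card (insert x W)) \<otimes> F (c ` insert x W)) = (\<Oplus>W\<in>Pow X. \<ominus> (sgn_pow (card W) \<otimes> ?G (c ` W)))"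
  proof (rule finsum_cong')
    fix W assume W: "W \<in> Pow X"
    then have "card (insert x W) = Suc (card W)" using finite_subset[OF _ insert.hyps(1)] insert.hyps(2)
      by (subst card_insert_disjoint) auto
    then show "sgn_pow (card (insert x W)) \<otimes> F (c ` insert x W) = \<ominus> (sgn_pow (card W) \<otimes> ?G (c ` W))"
      using F by (simp only: sgn_Suc) (simp add: l_minus)
  qed (use F in \<open>auto intro!: a_inv_closed\<close>)
  also have "\<dots> = \<ominus> (\<Oplus>W\<in>Pow X. sgn_pow (card W) \<otimes> ?G (c ` W))"
    by (rule finsum_neg) (use F in auto)
  also have "(\<Oplus>W\<in>Pow X. sgn_pow (card W) \<otimes> ?G (c ` W)) = (\<Oplus>S\<in>Pow (c ` X). sgn_pow (card S) \<otimes> ?G S)"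
    by (rule insert.IH) (rule F)
  also have "(\<Oplus>W\<in>Pow X. sgn_pow (card W) \<otimes> F (c ` W)) = (\<Oplus>S\<in>Pow (c ` X). sgn_pow (card S) \<otimes> F S)"
    by (rule insert.IH) (rule F)
  finally have e: "(\<Oplus>W\<in>Pow (insert x X). sgn_pow (card W) \<otimes> F (c ` W))
      = (\<Oplus>S\<in>Pow (c ` X). sgn_pow (card S) \<otimes> F S) \<oplus> \<ominus> (\<Oplus>S\<in>Pow (c ` X). sgn_pow (card S) \<otimes> ?G S)" .
  have fX: "finite (c ` X)" using insert.hyps by simp
  have cl: "(\<Oplus>S\<in>Pow (c ` X). sgn_pow (card S) \<otimes> F S) \<in> carrier R" using F by (auto intro!: finsum_closed)
  show ?case
  proof (cases "c x \<in> c ` X")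
    case True
    \<comment> \<open>The function \<open>?G\<close> inserts \<open>c x\<close> anyway, so it does
      not notice whether \<open>c x\<close> is present. A further edge in a component that already
      has one contributes nothing new.\<close>
    have "(\<Oplus>S\<in>Pow (c ` X). sgn_pow (card S) \<otimes> ?G S) = \<zero>"
      by (rule alternating_toggle[OF fX True]) (use F in auto)
    then show ?thesis unfolding e using True cl by (simp add: insert_absorb)
  next
    case False
    have "(\<Oplus>S\<in>Pow (insert (c x) (c ` X)). sgn_pow (card S) \<otimes> F S)
      = (\<Oplus>S\<in>Pow (c ` X). sgn_pow (card S) \<otimes> F S) \<oplus> (\<Oplus>S\<in>Pow (c ` X). sgn_pow (card (insert (c x) S)) \<otimes> ?G S)"
      by (rule finsum_Pow_insert) (use fX False F in auto)
    also have "(\<Oplus>S\<in>Pow (c ` X). sgn_pow (card (insert (c x) S)) \<otimes> ?G S) = (\<Oplus>S\<in>Pow (c ` X). \<ominus> (sgn_pow (card S) \<otimes> ?G S))"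
    proof (rule finsum_cong')
      fix W assume W: "W \<in> Pow (c ` X)"
      then have "card (insert (c x) W) = Suc (card W)" using finite_subset[OF _ fX] False
        by (subst card_insert_disjoint) auto
      then show "sgn_pow (card (insert (c x) W)) \<otimes> ?G W = \<ominus> (sgn_pow (card W) \<otimes> ?G W)"
        using F by (simp only: sgn_Suc) (simp add: l_minus)
    qed (use F in \<open>auto intro!: a_inv_closed\<close>)
    also have "\<dots> = \<ominus> (\<Oplus>S\<in>Pow (c ` X). sgn_pow (card S) \<otimes> ?G S)"
      by (rule finsum_neg) (use F in auto)
    finally show ?thesis unfolding e by simp
  qed
qed

text \<open>Each member of \<open>L\<close> is either kept, with factor \<open>\<delta>\<close>, or
  put into \<open>W\<close>, with factor -1. This is the expansion of a power of
  \<open>\<delta> \<ominus> \<one>\<close> and the origin of the shifted parameter.\<close>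

lemma alternating_binomial:
  assumes "finite L" "\<delta> \<in> carrier R"
  shows "(\<Oplus>W\<in>Pow L. sgn_pow (card W) \<otimes> \<delta> [^] card (L - W)) = (\<delta> \<ominus> \<one>) [^] card L"
  using assms(1)
proof (induction L rule: finite_induct)
  case empty
  then show ?case by simp
next
  case (insert x L)
  let ?f = "\<lambda>W. sgn_pow (card W) \<otimes> \<delta> [^] card (L - W)"
  have cl: "?f \<in> Pow L \<rightarrow> carrier R" using assms(2) by auto
  have "(\<Oplus>W\<in>Pow (insert x L). sgn_pow (card W) \<otimes> \<delta> [^] card (insert x L - W))
    = (\<Oplus>W\<in>Pow L. sgn_pow (card W) \<otimes> \<delta> [^] card (insert x L - W))
    \<oplus> (\<Oplus>W\<in>Pow L. sgn_pow (card (insert x W)) \<otimes> \<delta> [^] card (insert x L - insert x W))"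
    by (rule finsum_Pow_insert) (use insert.hyps assms(2) in auto)
  also have "(\<Oplus>W\<in>Pow L. sgn_pow (card W) \<otimes> \<delta> [^] card (insert x L - W)) = (\<Oplus>W\<in>Pow L. \<delta> \<otimes> ?f W)"
  proof (rule finsum_cong')
    fix W assume "W \<in> Pow L"
    then have "card (insert x L - W) = Suc (card (L - W))"
      using insert.hyps by (subst insert_Diff_if) (auto intro!: card_insert_disjoint)
    then show "sgn_pow (card W) \<otimes> \<delta> [^] card (insert x L - W) = \<delta> \<otimes> ?f W"
      using assms(2) by (simp add: m_ac)
  qed (use assms(2) in auto)
  also have "\<dots> = \<delta> \<otimes> (\<Oplus>W\<in>Pow L. ?f W)"
    using insert.hyps(1) assms(2) by (intro finsum_rdistr[symmetric]) auto
  also have "(\<Oplus>W\<in>Pow L. sgn_pow (card (insert x W)) \<otimes> \<delta> [^] card (insert x L - insert x W)) = (\<Oplus>W\<in>Pow L. \<ominus> ?f W)"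
  proof (rule finsum_cong')
    fix W assume W: "W \<in> Pow L"
    then have "card (insert x W) = Suc (card W)" using finite_subset[OF _ insert.hyps(1)] insert.hyps(2)
      by (subst card_insert_disjoint) auto
    moreover have "insert x L - insert x W = L - W" using insert.hyps W by auto
    ultimately show "sgn_pow (card (insert x W)) \<otimes> \<delta> [^] card (insert x L - insert x W) = \<ominus> ?f W"
      using assms(2) by (simp only: sgn_Suc) (simp add: l_minus)
  qed (use assms(2) in \<open>auto intro!: a_inv_closed\<close>)
  also have "\<dots> = \<ominus> (\<Oplus>W\<in>Pow L. ?f W)" by (rule finsum_neg) (rule cl)
  also have "\<delta> \<otimes> (\<Oplus>W\<in>Pow L. ?f W) \<oplus> \<ominus> (\<Oplus>W\<in>Pow L. ?f W) = (\<delta> \<ominus> \<one>) [^] card L \<otimes> (\<delta> \<ominus> \<one>)"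
    using assms(2) unfolding insert.IH by (simp add: minus_eq r_distr l_distr r_minus l_minus m_comm)
  finally show ?case using insert.hyps by simp
qed

lemma finsum_Pow_disjoint:
  assumes "finite P" "finite L" "P \<inter> L = {}" "\<And>H. f H \<in> carrier R"
  shows "(\<Oplus>H\<in>Pow (P \<union> L). f H) = (\<Oplus>A\<in>Pow P. \<Oplus>B\<in>Pow L. f (A \<union> B))"
proof -
  have im: "Pow (P \<union> L) = (\<lambda>(A, B). A \<union> B) ` (Pow P \<times> Pow L)"
  proof (intro equalityI subsetI)
    fix H assume "H \<in> Pow (P \<union> L)"
    then have "H = (\<lambda>(A, B). A \<union> B) (H \<inter> P, H \<inter> L)" by auto
    then show "H \<in> (\<lambda>(A, B). A \<union> B) ` (Pow P \<times> Pow L)" by (rule image_eqI) auto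
  qed auto
  have inj: "inj_on (\<lambda>(A, B). A \<union> B) (Pow P \<times> Pow L)"
    by (rule inj_on_inverseI[where g="\<lambda>H. (H \<inter> P, H \<inter> L)"]) (use assms(3) in auto)
  have "(\<Oplus>H\<in>Pow (P \<union> L). f H) = (\<Oplus>p\<in>Pow P \<times> Pow L. f ((\<lambda>(A, B). A \<union> B) p))"
    unfolding im by (rule finsum_reindex[OF _ inj]) (use assms(4) in auto)
  also have "\<dots> = (\<Oplus>A\<in>Pow P. \<Oplus>B\<in>Pow L. f (A \<union> B))"
    using finsum_times[of "Pow P" "Pow L" "\<lambda>p. f ((\<lambda>(A, B). A \<union> B) p)"] assms by simp
  finally show ?thesis .
qed

end

section \<open>Products of barred diagrams\<close>

lemma finite_motzkin: "finite (motzkin k)"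
proof (rule finite_subset)
  show "motzkin k \<subseteq> Pow (Pow (verts k))" using partial_brauerD(7) by (auto simp: motzkin_def)
qed auto

lemma finite_tl_diagrams: "finite (tl_diagrams n)"
  by (rule finite_subset[OF _ finite_motzkin[of n]]) (auto simp: tl_diagrams_def)

text \<open>Each removed edge is replaced by two singletons, so the number of blocks grows by one
  per edge. The exponent in \<open>bar_elt\<close> therefore is the number of removed edges.\<close>

lemma card_isolate:
  assumes d: "d \<in> partial_brauer k" and E: "E \<subseteq> edges d"
  shows "card (isolate E d) = card d + card E"
proof -
  have fd: "finite d" by (rule partial_brauerD(4)[OF d])
  have Ed: "E \<subseteq> d" using E by (auto simp: edges_def)
  have fE: "finite E" using Ed fd finite_subset by blast
  have fb: "finite b" "card b = 2" if "b \<in> E" for b using that E partial_brauerD(5)[OF d] by (auto simp: edges_def)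
  have "disjoint E" using pairwise_subset[OF _ Ed] partial_brauerD(1)[OF d] by (auto simp: partition_on_def)
  then have "card (\<Union>E) = sum card E" using fb by (intro card_Union_disjoint) auto
  also have "\<dots> = 2 * card E" using fb by simp
  finally have u: "card (\<Union>E) = 2 * card E" .
  have "card ((\<lambda>v. {v}) ` \<Union>E) = 2 * card E" unfolding u[symmetric] by (rule card_image) simp
  moreover have "(d - E) \<inter> (\<lambda>v. {v}) ` \<Union>E = {}"
  proof -
    have "{v} \<notin> d" if "v \<in> \<Union>E" for v
    proof -
      have "v \<in> \<Union>(edges d)" "v \<in> verts k" using that E Ed partial_brauerD(3)[OF d] by blast+
      then show ?thesis using singleton_iff_not_edge[OF d] by blast
    qed
    then show ?thesis by auto
  qed
  moreover have "finite (\<Union>E)" using fE fb by blast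
  ultimately have "card (isolate E d) = card (d - E) + 2 * card E"
    unfolding isolate_def using fd by (subst card_Un_disjoint) auto
  then show ?thesis using card_Diff_subset[OF fE Ed] card_mono[OF fd Ed] by simp
qed

text \<open>The removed edges are those missing among the edges of the result.\<close>

lemma isolate_inj:
  assumes "d \<in> partial_brauer k" "E \<subseteq> edges d" "E' \<subseteq> edges d" "isolate E d = isolate E' d"
  shows "E = E'"
  using edges_isolate[OF assms(1,2)] edges_isolate[OF assms(1,3)] assms(2-4) by auto

context cring
begin

lemma bar_elt_isolate:
  assumes "d \<in> motzkin k" "E \<subseteq> edges d"
  shows "bar_elt R k d (isolate E d) = sgn_pow (card E)"
proof -
  have "isolate E d \<in> motzkin k" "below (isolate E d) d" using assms isolate_motzkin by (auto simp: below_isolate)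
  then show ?thesis using card_isolate[of d k E] assms by (simp add: bar_elt_def motzkin_def)
qed

lemma bar_elt_not_below: "\<not> below d' d \<Longrightarrow> d' \<in> motzkin k \<Longrightarrow> bar_elt R k d d' = \<zero>"
  by (simp add: bar_elt_def)

lemma bar_elt_mem: "d' \<in> motzkin k \<Longrightarrow> bar_elt R k d d' \<in> carrier R"
  by (simp add: bar_elt_def)

lemma bar_elt_carrier: "bar_elt R k d \<in> carrier (free_module R (motzkin k))"
  using finite_motzkin[of k] by (auto simp: free_module_simps bar_elt_def)

text \<open>At most one summand is nonzero, since the removed edges can be recovered from the
  result. The indexing of the edges by \<open>f\<close> makes it possible to let \<open>X\<close> be
  the set of paths in a stack.\<close>

lemma bar_elt_expand:
  assumes d: "d \<in> motzkin k" and d': "d' \<in> motzkin k" and X: "finite X" "inj_on f X" "f ` X = edges d"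
  shows "bar_elt R k d d' = (\<Oplus>A\<in>Pow X. if isolate (f ` A) d = d' then sgn_pow (card A) else \<zero>)"
proof (cases "below d' d")
  case True
  then obtain E where E: "E \<subseteq> edges d" "d' = isolate E d" by (auto simp: below_isolate)
  then obtain A where A: "A \<subseteq> X" "E = f ` A" using X(3) by (metis subset_image_iff)
  have "(\<Oplus>A\<in>Pow X. if isolate (f ` A) d = d' then sgn_pow (card A) else \<zero>)
      = (if isolate (f ` A) d = d' then sgn_pow (card A) else \<zero>)"
  proof (rule finsum_single)
    fix B assume B: "B \<in> Pow X" "B \<noteq> A"
    then have "f ` B \<noteq> f ` A" using inj_on_image_eq_iff[OF X(2)] A by auto
    moreover have "f ` B \<subseteq> edges d" using B X(3) by blast
    ultimately show "(if isolate (f ` B) d = d' then sgn_pow (card B) else \<zero>) = \<zero>"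
      using isolate_inj[of d k "f ` B" E] E A B X(3) d by (auto simp: motzkin_def)
  qed (use X A in auto)
  moreover have "card E = card A" unfolding A(2) using inj_on_subset[OF X(2) A(1)] by (rule card_image)
  ultimately show ?thesis using bar_elt_isolate[OF d E(1)] E(2) A(2) by simp
next
  case False
  then have "isolate (f ` A) d \<noteq> d'" if "A \<in> Pow X" for A
    using image_mono[of A X f] that X(3) False unfolding below_isolate by (metis PowD)
  then have "(\<Oplus>A\<in>Pow X. if isolate (f ` A) d = d' then sgn_pow (card A) else \<zero>) = (\<Oplus>A\<in>Pow X. \<zero>)"
    by (intro finsum_cong') auto
  then show ?thesis using bar_elt_not_below[OF False d'] by (simp add: finsum_zero)
qed

end

section \<open>Algebras with a finite basis of diagrams\<close>

lemma diagram_alg_simps: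
  "carrier (diagram_alg K \<delta> D u) = carrier (free_module K D)"
  "add (diagram_alg K \<delta> D u) = add (free_module K D)"
  "\<zero>\<^bsub>diagram_alg K \<delta> D u\<^esub> = \<zero>\<^bsub>free_module K D\<^esub>"
  "smult (diagram_alg K \<delta> D u) = smult (free_module K D)"
  "\<one>\<^bsub>diagram_alg K \<delta> D u\<^esub> = basis_elt K D u"
  by (simp_all add: diagram_alg_def free_module_def)

lemma diagram_alg_mult:
  "d \<in> D \<Longrightarrow> (f \<otimes>\<^bsub>diagram_alg K \<delta> D u\<^esub> g) d = (\<Oplus>\<^bsub>K\<^esub>p\<in>{p \<in> D \<times> D. diag_comp (fst p) (snd p) = d}.
     (\<delta> [^]\<^bsub>K\<^esub> num_loops (fst p) (snd p)) \<otimes>\<^bsub>K\<^esub> (f (fst p) \<otimes>\<^bsub>K\<^esub> g (snd p)))"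
  by (simp add: diagram_alg_def)

context cring
begin

context
  fixes \<delta> :: 'a and D :: "diagram set" and u :: diagram assumes \<delta>: "\<delta> \<in> carrier R" and D: "finite D"
begin

abbreviation "DA \<equiv> diagram_alg R \<delta> D u"

lemma diagram_alg_mult_closed:
  assumes "f \<in> carrier DA" "g \<in> carrier DA" shows "f \<otimes>\<^bsub>DA\<^esub> g \<in> carrier DA"
proof -
  have m: "f d \<in> carrier R" "g d \<in> carrier R" if "d \<in> D" for d
    using assms that by (auto simp: diagram_alg_simps free_module_mem)
  have "(f \<otimes>\<^bsub>DA\<^esub> g) d \<in> carrier R" if "d \<in> D" for d
    unfolding diagram_alg_mult[OF that] by (rule finsum_closed) (use m \<delta> in auto)
  moreover have "(f \<otimes>\<^bsub>DA\<^esub> g) d = undefined" if "d \<notin> D" for d using that by (simp add: diagram_alg_def)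
  ultimately show ?thesis using D unfolding diagram_alg_simps free_module_simps by auto
qed

lemma diagram_alg_bilinear: "bilinear_alg R DA"
proof (intro bilinear_alg.intro bilinear_alg_axioms.intro)
  show "module R DA"
    by (rule module_cong[OF free_module_module[of D]]) (simp_all add: diagram_alg_simps)
  interpret FM: module R "free_module R D" by (rule free_module_module)
  have fin: "finite {p \<in> D \<times> D. diag_comp (fst p) (snd p) = d}" for d using D by simp
  note ext = free_module_eqI[of _ R D, folded diagram_alg_simps(1)[of R \<delta> D u]]
  note mc = diagram_alg_mult_closed
  have ac: "f \<oplus>\<^bsub>DA\<^esub> g \<in> carrier DA" if "f \<in> carrier DA" "g \<in> carrier DA" for f g
    using that by (simp add: diagram_alg_simps)
  have sc: "c \<odot>\<^bsub>DA\<^esub> g \<in> carrier DA" if "c \<in> carrier R" "g \<in> carrier DA" for c g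
    using that by (simp add: diagram_alg_simps)
  have ap: "(f \<oplus>\<^bsub>DA\<^esub> g) d = f d \<oplus> g d" "(c \<odot>\<^bsub>DA\<^esub> f) d = c \<otimes> f d" if "d \<in> D" for f g d c
    using that by (simp_all add: diagram_alg_simps free_module_apply)
  have m: "f d \<in> carrier R" if "f \<in> carrier DA" "d \<in> D" for f d
    using that by (auto simp: diagram_alg_simps free_module_mem)
  {
    fix f g h assume fgh: "f \<in> carrier DA" "g \<in> carrier DA" "h \<in> carrier DA"
    show "(f \<oplus>\<^bsub>DA\<^esub> g) \<otimes>\<^bsub>DA\<^esub> h = f \<otimes>\<^bsub>DA\<^esub> h \<oplus>\<^bsub>DA\<^esub> g \<otimes>\<^bsub>DA\<^esub> h"
    proof (rule ext)
      fix d assume d: "d \<in> D"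
      show "((f \<oplus>\<^bsub>DA\<^esub> g) \<otimes>\<^bsub>DA\<^esub> h) d = (f \<otimes>\<^bsub>DA\<^esub> h \<oplus>\<^bsub>DA\<^esub> g \<otimes>\<^bsub>DA\<^esub> h) d"
        unfolding ap(1)[OF d] diagram_alg_mult[OF d]
        by (subst finsum_addf[symmetric])
          (use fgh \<delta> m in \<open>auto intro!: finsum_cong' simp: ap l_distr r_distr\<close>)
    qed (use fgh in \<open>auto intro!: mc ac\<close>)
    show "h \<otimes>\<^bsub>DA\<^esub> (f \<oplus>\<^bsub>DA\<^esub> g) = h \<otimes>\<^bsub>DA\<^esub> f \<oplus>\<^bsub>DA\<^esub> h \<otimes>\<^bsub>DA\<^esub> g"
    proof (rule ext)
      fix d assume d: "d \<in> D"
      show "(h \<otimes>\<^bsub>DA\<^esub> (f \<oplus>\<^bsub>DA\<^esub> g)) d = (h \<otimes>\<^bsub>DA\<^esub> f \<oplus>\<^bsub>DA\<^esub> h \<otimes>\<^bsub>DA\<^esub> g) d"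
        unfolding ap(1)[OF d] diagram_alg_mult[OF d]
        by (subst finsum_addf[symmetric])
          (use fgh \<delta> m in \<open>auto intro!: finsum_cong' simp: ap l_distr r_distr\<close>)
    qed (use fgh in \<open>auto intro!: mc ac\<close>)
  }
  fix c f g assume x: "c \<in> carrier R" "f \<in> carrier DA" "g \<in> carrier DA"
  have sw: "x \<otimes> (c \<otimes> y \<otimes> z) = c \<otimes> (x \<otimes> (y \<otimes> z))" "x \<otimes> (y \<otimes> (c \<otimes> z)) = c \<otimes> (x \<otimes> (y \<otimes> z))"
    if "x \<in> carrier R" "y \<in> carrier R" "z \<in> carrier R" for x y z
    using that x(1) by (simp_all add: m_ac)
  show "(c \<odot>\<^bsub>DA\<^esub> f) \<otimes>\<^bsub>DA\<^esub> g = c \<odot>\<^bsub>DA\<^esub> (f \<otimes>\<^bsub>DA\<^esub> g)"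
  proof (rule ext)
    fix d assume d: "d \<in> D"
    show "((c \<odot>\<^bsub>DA\<^esub> f) \<otimes>\<^bsub>DA\<^esub> g) d = (c \<odot>\<^bsub>DA\<^esub> (f \<otimes>\<^bsub>DA\<^esub> g)) d"
      unfolding ap(2)[OF d] diagram_alg_mult[OF d]
      by (subst finsum_rdistr[OF fin])
        (use x \<delta> m in \<open>auto intro!: finsum_cong' simp: ap sw\<close>)
  qed (use x in \<open>auto intro!: mc sc\<close>)
  show "f \<otimes>\<^bsub>DA\<^esub> (c \<odot>\<^bsub>DA\<^esub> g) = c \<odot>\<^bsub>DA\<^esub> (f \<otimes>\<^bsub>DA\<^esub> g)"
  proof (rule ext)
    fix d assume d: "d \<in> D"
    show "(f \<otimes>\<^bsub>DA\<^esub> (c \<odot>\<^bsub>DA\<^esub> g)) d = (c \<odot>\<^bsub>DA\<^esub> (f \<otimes>\<^bsub>DA\<^esub> g)) d"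
      unfolding ap(2)[OF d] diagram_alg_mult[OF d]
      by (subst finsum_rdistr[OF fin])
        (use x \<delta> m in \<open>auto intro!: finsum_cong' simp: ap sw\<close>)
  qed (use x in \<open>auto intro!: mc sc\<close>)
qed (rule diagram_alg_mult_closed)

text \<open>The product records coefficients at members of \<open>D\<close> only, so a composite
  outside \<open>D\<close> would be lost; hence the hypothesis on
  \<open>diag_comp t s\<close>.\<close>

lemma diagram_alg_basis_mult:
  assumes ts: "t \<in> D" "s \<in> D" and c: "diag_comp t s \<in> D"
  shows "basis_elt R D t \<otimes>\<^bsub>DA\<^esub> basis_elt R D s = \<delta> [^] num_loops t s \<odot>\<^bsub>DA\<^esub> basis_elt R D (diag_comp t s)"
proof (rule free_module_eqI[of _ R D])
  fix d assume d: "d \<in> D"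
  let ?P = "{p \<in> D \<times> D. diag_comp (fst p) (snd p) = d}"
  let ?g = "\<lambda>p. \<delta> [^] num_loops (fst p) (snd p) \<otimes> (basis_elt R D t (fst p) \<otimes> basis_elt R D s (snd p))"
  have g: "?g p = (if p = (t, s) then \<delta> [^] num_loops t s else \<zero>)" if "p \<in> D \<times> D" for p
    using that \<delta> by (cases p) (auto simp: free_module_apply)
  have "(basis_elt R D t \<otimes>\<^bsub>DA\<^esub> basis_elt R D s) d = (\<Oplus>p\<in>?P. ?g p)" by (rule diagram_alg_mult[OF d])
  also have "\<dots> = (if diag_comp t s = d then \<delta> [^] num_loops t s else \<zero>)"
  proof (cases "diag_comp t s = d")
    case True
    have "(\<Oplus>p\<in>?P. ?g p) = ?g (t, s)"
      by (rule finsum_single) (use D ts True g \<delta> in auto)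
    then show ?thesis using True g[of "(t, s)"] ts by simp
  next
    case False
    have "(\<Oplus>p\<in>?P. ?g p) = (\<Oplus>p\<in>?P. \<zero>)" by (rule finsum_cong') (use False g in auto)
    then show ?thesis using False by (simp add: finsum_zero)
  qed
  also have "\<dots> = (\<delta> [^] num_loops t s \<odot>\<^bsub>DA\<^esub> basis_elt R D (diag_comp t s)) d"
    using d \<delta> by (auto simp: diagram_alg_simps free_module_apply)
  finally show "(basis_elt R D t \<otimes>\<^bsub>DA\<^esub> basis_elt R D s) d = (\<delta> [^] num_loops t s \<odot>\<^bsub>DA\<^esub> basis_elt R D (diag_comp t s)) d" .
next
  interpret FM: module R "free_module R D" by (rule free_module_module)
  show "basis_elt R D t \<otimes>\<^bsub>DA\<^esub> basis_elt R D s \<in> carrier (free_module R D)"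
    using diagram_alg_mult_closed[unfolded diagram_alg_simps] by (simp add: basis_elt_carrier)
  show "\<delta> [^] num_loops t s \<odot>\<^bsub>DA\<^esub> basis_elt R D (diag_comp t s) \<in> carrier (free_module R D)"
    using \<delta> by (simp add: diagram_alg_simps basis_elt_carrier)
qed

end

lemma add_span_cong:
  assumes "x \<in> add_span G S" "\<zero>\<^bsub>H\<^esub> = \<zero>\<^bsub>G\<^esub>" "add H = add G"
  shows "x \<in> add_span H S"
  using assms(1)
proof (induction rule: add_span.induct)
  case add_span_zero
  show ?case using add_span.add_span_zero[of H S] assms(2) by simp
next
  case (add_span_gen s)
  then show ?case by (rule add_span.add_span_gen)
next
  case (add_span_add x y)
  then show ?case using add_span.add_span_add[of x H S y] assms(3) by simp
qed

lemma TL_unital: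
  assumes \<delta>: "\<delta> \<in> carrier R" shows "unital_alg R (TL_alg R \<delta> n)"
proof -
  let ?D = "tl_diagrams n" and ?u = "id_diagram n"
  interpret B: bilinear_alg R "TL_alg R \<delta> n"
    unfolding TL_alg_def by (rule diagram_alg_bilinear[OF \<delta> finite_tl_diagrams])
  let ?G = "{c \<odot>\<^bsub>free_module R ?D\<^esub> basis_elt R ?D s | c s. c \<in> carrier R \<and> s \<in> ?D}"
  have one: "\<one>\<^bsub>TL_alg R \<delta> n\<^esub> = basis_elt R ?D ?u" by (simp add: TL_alg_def diagram_alg_simps)
  have be: "basis_elt R ?D s \<in> carrier (TL_alg R \<delta> n)" for s
    by (simp add: TL_alg_def diagram_alg_simps basis_elt_carrier)
  have sp: "x \<in> add_span (TL_alg R \<delta> n) ?G" if "x \<in> carrier (TL_alg R \<delta> n)" for x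
  proof -
    have "x \<in> add_span (free_module R ?D) ?G"
      using that by (intro free_module_add_span) (simp add: TL_alg_def diagram_alg_simps)
    then show ?thesis by (rule add_span_cong) (simp_all add: TL_alg_def diagram_alg_simps)
  qed
  have sm: "smult (free_module R ?D) = smult (TL_alg R \<delta> n)" by (simp add: TL_alg_def diagram_alg_simps)
  have id: "abelian_group_hom (TL_alg R \<delta> n) (TL_alg R \<delta> n) (\<lambda>x. x)"
    by (rule add_homI) (auto simp: B.abelian_group_axioms)
  interpret BR: biadditive_ring "TL_alg R \<delta> n" by (rule B.biadditive_ring)
  have G: "?G \<subseteq> carrier (TL_alg R \<delta> n)" unfolding sm using be by auto
  have pb: "s \<in> partial_brauer n" if "s \<in> ?D" for s using that by (rule tl_partial_brauer)
  have bm: "basis_elt R ?D ?u \<otimes>\<^bsub>TL_alg R \<delta> n\<^esub> basis_elt R ?D s = basis_elt R ?D s"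
    "basis_elt R ?D s \<otimes>\<^bsub>TL_alg R \<delta> n\<^esub> basis_elt R ?D ?u = basis_elt R ?D s" if s: "s \<in> ?D" for s
    unfolding TL_alg_def
    using diagram_alg_basis_mult[OF \<delta> finite_tl_diagrams id_diagram_tl s] diagram_alg_basis_mult[OF \<delta> finite_tl_diagrams s id_diagram_tl]
      B.smult_one[OF be] s id_comp_left[OF pb[OF s]] id_comp_right[OF pb[OF s]]
    by (simp_all add: TL_alg_def)
  show ?thesis
  proof (intro unital_alg.intro unital_alg_axioms.intro B.bilinear_alg_axioms)
    show "\<one>\<^bsub>TL_alg R \<delta> n\<^esub> \<in> carrier (TL_alg R \<delta> n)" unfolding one by (rule be)
    fix x assume x: "x \<in> carrier (TL_alg R \<delta> n)"
    show "\<one>\<^bsub>TL_alg R \<delta> n\<^esub> \<otimes>\<^bsub>TL_alg R \<delta> n\<^esub> x = x"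
      unfolding one
      by (rule add_homs_eq[OF BR.hom_mult_right[OF be] id G _ sp[OF x]])
        (use be in \<open>auto simp: sm B.alg_smult_right bm\<close>)
    show "x \<otimes>\<^bsub>TL_alg R \<delta> n\<^esub> \<one>\<^bsub>TL_alg R \<delta> n\<^esub> = x"
      unfolding one
      by (rule add_homs_eq[OF BR.hom_mult_left[OF be] id G _ sp[OF x]])
        (use be in \<open>auto simp: sm B.alg_smult_left bm\<close>)
  qed
qed

end

section \<open>Products as alternating sums over removed edges\<close>

lemma Plus_vimage: "W = (Inl -` W) <+> (Inr -` W)"
proof (intro equalityI subsetI)
  fix x assume "x \<in> W"
  then show "x \<in> (Inl -` W) <+> (Inr -` W)" by (cases x) auto
qed auto

text \<open>The edges of the two factors are kept apart by a sum type because one set of vertices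
  can be an edge of both. Here each is sent to its block in the stack, where a cap and a cup can
  still become equal.\<close>

fun lifted_block :: "vertex set + vertex set \<Rightarrow> vertex set" where
  "lifted_block (Inl e) = fU ` e"
| "lifted_block (Inr e) = fL ` e"

context cring
begin

definition isolate_pair :: "diagram \<Rightarrow> diagram \<Rightarrow> (vertex set + vertex set) set \<Rightarrow> diagram \<times> diagram" where
  "isolate_pair d\<^sub>1 d\<^sub>2 W = (isolate (Inl -` W) d\<^sub>1, isolate (Inr -` W) d\<^sub>2)"

definition coeff_at :: "'a \<Rightarrow> diagram \<Rightarrow> diagram \<times> diagram \<Rightarrow> 'a" where
  "coeff_at \<delta> d p = (if diag_comp (fst p) (snd p) = d then \<delta> [^] num_loops (fst p) (snd p) else \<zero>)"

text \<open>A pair of diagrams has nonzero coefficients only if both members arise by removing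
  edges, and the removed edges are determined by the pair. The sum in the product is thus reindexed
  by subsets of the disjoint union of the edge sets.\<close>

lemma bar_mult_expand:
  assumes \<delta>: "\<delta> \<in> carrier R" and d: "d\<^sub>1 \<in> motzkin k" "d\<^sub>2 \<in> motzkin k" "d \<in> motzkin k"
  shows "(bar_elt R k d\<^sub>1 \<otimes>\<^bsub>motzkin_alg R \<delta> k\<^esub> bar_elt R k d\<^sub>2) d
    = (\<Oplus>W\<in>Pow (edges d\<^sub>1 <+> edges d\<^sub>2). sgn_pow (card W) \<otimes> coeff_at \<delta> d (isolate_pair d\<^sub>1 d\<^sub>2 W))"
proof -
  let ?D = "motzkin k" and ?X = "edges d\<^sub>1 <+> edges d\<^sub>2" and ?\<phi> = "isolate_pair d\<^sub>1 d\<^sub>2"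
  let ?P = "{p \<in> ?D \<times> ?D. diag_comp (fst p) (snd p) = d}"
  let ?g = "\<lambda>p. \<delta> [^] num_loops (fst p) (snd p) \<otimes> (bar_elt R k d\<^sub>1 (fst p) \<otimes> bar_elt R k d\<^sub>2 (snd p))"
  let ?h = "\<lambda>p. if diag_comp (fst p) (snd p) = d then ?g p else \<zero>"
  have pb: "d\<^sub>1 \<in> partial_brauer k" "d\<^sub>2 \<in> partial_brauer k" using d by (auto simp: motzkin_def)
  have finX: "finite ?X" using partial_brauerD(4)[OF pb(1)] partial_brauerD(4)[OF pb(2)] by (simp add: edges_def)
  have sub: "Inl -` W \<subseteq> edges d\<^sub>1" "Inr -` W \<subseteq> edges d\<^sub>2" if "W \<subseteq> ?X" for W
    using that by auto
  have \<phi>D: "?\<phi> W \<in> ?D \<times> ?D" if "W \<subseteq> ?X" for W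
    unfolding isolate_pair_def using isolate_motzkin[OF d(1) sub(1)[OF that]] isolate_motzkin[OF d(2) sub(2)[OF that]] by simp
  have inj: "inj_on ?\<phi> (Pow ?X)"
  proof (rule inj_onI)
    fix V W assume VW: "V \<in> Pow ?X" "W \<in> Pow ?X" "?\<phi> V = ?\<phi> W"
    then have "Inl -` V = Inl -` W" "Inr -` V = Inr -` W"
      using isolate_inj[OF pb(1) sub(1) sub(1), of V W] isolate_inj[OF pb(2) sub(2) sub(2), of V W]
      by (auto simp: isolate_pair_def)
    then show "V = W" using Plus_vimage[of V] Plus_vimage[of W] by simp
  qed
  have g: "?g p \<in> carrier R" if "p \<in> ?D \<times> ?D" for p
    using that \<delta> by (auto simp: bar_elt_mem)
  have "(bar_elt R k d\<^sub>1 \<otimes>\<^bsub>motzkin_alg R \<delta> k\<^esub> bar_elt R k d\<^sub>2) d = (\<Oplus>p\<in>?P. ?g p)"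
    unfolding motzkin_alg_def by (rule diagram_alg_mult[OF d(3)])
  also have "\<dots> = (\<Oplus>p\<in>?\<phi> ` Pow ?X. ?h p)"
  proof (rule add.finprod_mono_neutral_cong)
    show "finite (?\<phi> ` Pow ?X)" "finite ?P" using finX finite_motzkin by simp_all
    show "?h p = \<zero>" if "p \<in> ?\<phi> ` Pow ?X - ?P" for p using that \<phi>D by auto
    show "?g p = ?h p" if "p \<in> ?P \<inter> ?\<phi> ` Pow ?X" for p using that by simp
    show "?g \<in> ?P \<rightarrow> carrier R" using g by blast
    show "?h \<in> ?\<phi> ` Pow ?X \<rightarrow> carrier R"
    proof
      fix p assume "p \<in> ?\<phi> ` Pow ?X"
      then have "p \<in> ?D \<times> ?D" using \<phi>D by blast
      then show "?h p \<in> carrier R" using g by simp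
    qed
    fix p assume p: "p \<in> ?P - ?\<phi> ` Pow ?X"
    have "\<not> (below (fst p) d\<^sub>1 \<and> below (snd p) d\<^sub>2)"
    proof
      assume "below (fst p) d\<^sub>1 \<and> below (snd p) d\<^sub>2"
      then obtain E F where EF: "E \<subseteq> edges d\<^sub>1" "F \<subseteq> edges d\<^sub>2" "p = (isolate E d\<^sub>1, isolate F d\<^sub>2)"
        by (cases p) (auto simp: below_isolate)
      have "Inl -` (E <+> F) = E" "Inr -` (E <+> F) = F" by auto
      then have "p = ?\<phi> (E <+> F)" by (simp add: isolate_pair_def EF(3))
      moreover have "E <+> F \<in> Pow ?X" using EF by auto
      ultimately show False using p by blast
    qed
    then show "?g p = \<zero>" using p \<delta> bar_elt_mem[of _ k] by (cases p) (auto simp: bar_elt_not_below)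
  qed
  also have "\<dots> = (\<Oplus>W\<in>Pow ?X. ?h (?\<phi> W))"
  proof (rule finsum_reindex[OF _ inj])
    show "?h \<in> ?\<phi> ` Pow ?X \<rightarrow> carrier R"
    proof
      fix p assume "p \<in> ?\<phi> ` Pow ?X"
      then have "p \<in> ?D \<times> ?D" using \<phi>D by blast
      then show "?h p \<in> carrier R" using g by simp
    qed
  qed
  also have "\<dots> = (\<Oplus>W\<in>Pow ?X. sgn_pow (card W) \<otimes> coeff_at \<delta> d (?\<phi> W))"
  proof (rule finsum_cong')
    fix W assume W: "W \<in> Pow ?X"
    have fin: "finite (Inl -` W)" "finite (Inr -` W)"
      using sub[of W] W partial_brauerD(4)[OF pb(1)] partial_brauerD(4)[OF pb(2)]
      by (auto simp: edges_def intro: finite_subset)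
    have "card W = card (Inl -` W) + card (Inr -` W)"
      using card_Plus[OF fin] Plus_vimage[of W] by simp
    then have "sgn_pow (card W) = sgn_pow (card (Inl -` W)) \<otimes> sgn_pow (card (Inr -` W))"
      by (simp add: nat_pow_mult)
    moreover have "bar_elt R k d\<^sub>1 (fst (?\<phi> W)) = sgn_pow (card (Inl -` W))" "bar_elt R k d\<^sub>2 (snd (?\<phi> W)) = sgn_pow (card (Inr -` W))"
      unfolding isolate_pair_def using bar_elt_isolate[OF d(1) sub(1)] bar_elt_isolate[OF d(2) sub(2)] W by auto
    ultimately show "?h (?\<phi> W) = sgn_pow (card W) \<otimes> coeff_at \<delta> d (?\<phi> W)"
      using \<delta> by (simp add: coeff_at_def m_comm)
  qed (use \<delta> in \<open>auto simp: coeff_at_def\<close>)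
  finally show ?thesis .
qed

lemma coeff_at_closed: "\<delta> \<in> carrier R \<Longrightarrow> coeff_at \<delta> d p \<in> carrier R"
  by (simp add: coeff_at_def)

lemma isolate_insert:
  "\<lbrakk>e \<notin> E; card e = 2\<rbrakk> \<Longrightarrow> isolate (insert e E) d = isolate {e} (isolate E d)"
  using isolate_isolate[of E "{e}" d] by simp

text \<open>At a middle position that is matched in one factor only, the edge ending there can be
  removed or kept without affecting the composite or the loops, whatever else is removed. The
  alternating sum cancels by toggling this edge.\<close>

lemma bar_mult_unmatched:
  assumes \<delta>: "\<delta> \<in> carrier R" and d: "d\<^sub>1 \<in> motzkin k" "d\<^sub>2 \<in> motzkin k" and ne: "bots d\<^sub>1 \<noteq> tops d\<^sub>2"
  shows "bar_elt R k d\<^sub>1 \<otimes>\<^bsub>motzkin_alg R \<delta> k\<^esub> bar_elt R k d\<^sub>2 = \<zero>\<^bsub>motzkin_alg R \<delta> k\<^esub>"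
proof (rule free_module_eqI[of _ R "motzkin k"])
  let ?X = "edges d\<^sub>1 <+> edges d\<^sub>2"
  have pb: "d\<^sub>1 \<in> partial_brauer k" "d\<^sub>2 \<in> partial_brauer k" using d by (auto simp: motzkin_def)
  have finX: "finite ?X" using partial_brauerD(4)[OF pb(1)] partial_brauerD(4)[OF pb(2)] by (simp add: edges_def)
  fix d assume dm: "d \<in> motzkin k"
  have mem: "i \<in> {1..k}" if "i \<in> bots d\<^sub>1 \<or> i \<in> tops d\<^sub>2" for i
    using that partial_brauerD(7)[OF pb(1)] partial_brauerD(7)[OF pb(2)] by (fastforce simp: bots_def tops_def edges_def)
  \<comment> \<open>An isolated vertex remains isolated when edges are removed, so one and the same
    edge can be toggled for all \<open>W\<close>.\<close>
  have sing: "{v} \<in> isolate E d" if "{v} \<in> d" "E \<subseteq> edges d" for v E and d :: diagram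
    using that by (auto simp: isolate_def edges_def)
  have "\<exists>x\<in>?X. \<forall>W\<subseteq>?X - {x}. coeff_at \<delta> d (isolate_pair d\<^sub>1 d\<^sub>2 (insert x W)) = coeff_at \<delta> d (isolate_pair d\<^sub>1 d\<^sub>2 W)"
  proof -
    obtain i where i: "i \<in> bots d\<^sub>1 \<and> i \<notin> tops d\<^sub>2 \<or> i \<in> tops d\<^sub>2 \<and> i \<notin> bots d\<^sub>1" using ne by blast
    then show ?thesis
    proof
      assume i: "i \<in> bots d\<^sub>1 \<and> i \<notin> tops d\<^sub>2"
      then obtain e where e: "e \<in> edges d\<^sub>1" "(Lower, i) \<in> e" by (auto simp: bots_def)
      have s: "{(Upper, i)} \<in> d\<^sub>2" using i mem[of i] singleton_iff_not_edge[OF pb(2), of "(Upper, i)"] by (auto simp: tops_def)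
      show ?thesis
      proof (rule bexI[of _ "Inl e"], intro allI impI)
        fix W assume W: "W \<subseteq> ?X - {Inl e}"
        let ?E = "Inl -` W" and ?F = "Inr -` W"
        have EF: "?E \<subseteq> edges d\<^sub>1 - {e}" "?F \<subseteq> edges d\<^sub>2" using W by auto
        then have E: "?E \<subseteq> edges d\<^sub>1" by auto
        have v: "Inl -` insert (Inl e) W = insert e ?E" "Inr -` insert (Inl e) W = ?F" by auto
        have ii: "isolate (insert e ?E) d\<^sub>1 = isolate {e} (isolate ?E d\<^sub>1)"
          using EF e by (intro isolate_insert) (auto simp: edges_def)
        have ee: "e \<in> edges (isolate ?E d\<^sub>1)" using edges_isolate[OF pb(1) E] e EF by auto
        note t = toggle_upper[OF isolate_partial_brauer[OF pb(1) E] isolate_partial_brauer[OF pb(2) EF(2)] ee e(2) sing[OF s EF(2)]]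
        show "coeff_at \<delta> d (isolate_pair d\<^sub>1 d\<^sub>2 (insert (Inl e) W)) = coeff_at \<delta> d (isolate_pair d\<^sub>1 d\<^sub>2 W)"
          unfolding isolate_pair_def coeff_at_def v ii fst_conv snd_conv t ..
      qed (use e in auto)
    next
      assume i: "i \<in> tops d\<^sub>2 \<and> i \<notin> bots d\<^sub>1"
      then obtain e where e: "e \<in> edges d\<^sub>2" "(Upper, i) \<in> e" by (auto simp: tops_def)
      have s: "{(Lower, i)} \<in> d\<^sub>1" using i mem[of i] singleton_iff_not_edge[OF pb(1), of "(Lower, i)"] by (auto simp: bots_def)
      show ?thesis
      proof (rule bexI[of _ "Inr e"], intro allI impI)
        fix W assume W: "W \<subseteq> ?X - {Inr e}"
        let ?E = "Inl -` W" and ?F = "Inr -` W"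
        have EF: "?E \<subseteq> edges d\<^sub>1" "?F \<subseteq> edges d\<^sub>2 - {e}" using W by auto
        then have F: "?F \<subseteq> edges d\<^sub>2" by auto
        have v: "Inl -` insert (Inr e) W = ?E" "Inr -` insert (Inr e) W = insert e ?F" by auto
        have ii: "isolate (insert e ?F) d\<^sub>2 = isolate {e} (isolate ?F d\<^sub>2)"
          using EF e by (intro isolate_insert) (auto simp: edges_def)
        have ee: "e \<in> edges (isolate ?F d\<^sub>2)" using edges_isolate[OF pb(2) F] e EF by auto
        note t = toggle_lower[OF isolate_partial_brauer[OF pb(1) EF(1)] isolate_partial_brauer[OF pb(2) F] ee e(2) sing[OF s EF(1)]]
        show "coeff_at \<delta> d (isolate_pair d\<^sub>1 d\<^sub>2 (insert (Inr e) W)) = coeff_at \<delta> d (isolate_pair d\<^sub>1 d\<^sub>2 W)"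
          unfolding isolate_pair_def coeff_at_def v ii fst_conv snd_conv t ..
      qed (use e in auto)
    qed
  qed
  then obtain x where x: "x \<in> ?X"
    "\<And>W. W \<subseteq> ?X - {x} \<Longrightarrow> coeff_at \<delta> d (isolate_pair d\<^sub>1 d\<^sub>2 (insert x W)) = coeff_at \<delta> d (isolate_pair d\<^sub>1 d\<^sub>2 W)" by blast
  have "(bar_elt R k d\<^sub>1 \<otimes>\<^bsub>motzkin_alg R \<delta> k\<^esub> bar_elt R k d\<^sub>2) d = \<zero>"
    unfolding bar_mult_expand[OF \<delta> d dm]
    by (rule alternating_toggle[where F="\<lambda>W. coeff_at \<delta> d (isolate_pair d\<^sub>1 d\<^sub>2 W)", OF finX x(1) coeff_at_closed[OF \<delta>] x(2)])
  then show "(bar_elt R k d\<^sub>1 \<otimes>\<^bsub>motzkin_alg R \<delta> k\<^esub> bar_elt R k d\<^sub>2) d = \<zero>\<^bsub>motzkin_alg R \<delta> k\<^esub> d"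
    using dm by (simp add: motzkin_alg_def diagram_alg_simps free_module_apply)
next
  show "bar_elt R k d\<^sub>1 \<otimes>\<^bsub>motzkin_alg R \<delta> k\<^esub> bar_elt R k d\<^sub>2 \<in> carrier (free_module R (motzkin k))"
    using diagram_alg_mult_closed[OF \<delta> finite_motzkin[of k]] bar_elt_carrier[of k]
    unfolding motzkin_alg_def diagram_alg_simps by blast
  show "\<zero>\<^bsub>motzkin_alg R \<delta> k\<^esub> \<in> carrier (free_module R (motzkin k))"
    unfolding motzkin_alg_def diagram_alg_simps by (rule free_module_zero_closed)
qed

text \<open>The coefficient belonging to a set of removed edges depends on the broken components
  alone, so \<open>alternating_image\<close> applies. The resulting sum factors: the paths give the
  barred composite, the loops the power of \<open>\<delta> \<ominus> \<one>\<close>.\<close>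

lemma bar_mult_matched:
  assumes \<delta>: "\<delta> \<in> carrier R" and d: "d\<^sub>1 \<in> motzkin k" "d\<^sub>2 \<in> motzkin k" and eq: "bots d\<^sub>1 = tops d\<^sub>2"
    and c: "diag_comp d\<^sub>1 d\<^sub>2 \<in> motzkin k"
  shows "bar_elt R k d\<^sub>1 \<otimes>\<^bsub>motzkin_alg R \<delta> k\<^esub> bar_elt R k d\<^sub>2
    = (\<delta> \<ominus> \<one>) [^] num_loops d\<^sub>1 d\<^sub>2 \<odot>\<^bsub>motzkin_alg R \<delta> k\<^esub> bar_elt R k (diag_comp d\<^sub>1 d\<^sub>2)"
proof (rule free_module_eqI[of _ R "motzkin k"])
  let ?X = "edges d\<^sub>1 <+> edges d\<^sub>2" and ?M = "{Middle} \<times> {1..k} :: vertex set"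
  have pb: "d\<^sub>1 \<in> partial_brauer k" "d\<^sub>2 \<in> partial_brauer k" using d by (auto simp: motzkin_def)
  have finX: "finite ?X" using partial_brauerD(4)[OF pb(1)] partial_brauerD(4)[OF pb(2)] by (simp add: edges_def)
  interpret S: matched_stack "{Upper} \<times> {1..k}" ?M "{Lower} \<times> {1..k}" "(`) fU ` d\<^sub>1" "(`) fL ` d\<^sub>2"
    by (rule matched_stack_diagrams[OF pb eq])
  let ?S = "(`) fU ` d\<^sub>1 \<union> (`) fL ` d\<^sub>2"
  let ?L = "loops ?M ?S"
  let ?o = "\<lambda>C. C - ?M"
  define cmp where "cmp x = (THE C. C \<in> comps ?S \<and> lifted_block x \<subseteq> C)" for x
  have blk: "lifted_block x \<in> ?S" "card (lifted_block x) = 2" if "x \<in> ?X" for x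
    using that edges_fU[OF pb(1)] edges_fL[OF pb(2)] by (cases x; auto)+
  have ex: "\<exists>!C. C \<in> comps ?S \<and> lifted_block x \<subseteq> C" if x: "x \<in> ?X" for x
  proof -
    have "lifted_block x \<noteq> {}" using blk(2)[OF x] by (metis card.empty zero_neq_numeral)
    then obtain v where v: "v \<in> lifted_block x" by blast
    then have "v \<in> \<Union>?S" using blk(1)[OF x] by (rule_tac UnionI)
    then obtain C where C: "C \<in> comps ?S" "v \<in> C" using comps_cover[of v ?S] by blast
    then have "block_closed ?S C" by (simp add: in_comps_iff)
    then have "lifted_block x \<subseteq> C" using blk(1)[OF x] v C(2) by (rule block_closedD)
    then show ?thesis using C v comps_disjoint[OF C(1) _ C(2)] by blast
  qed
  have cmp: "cmp x \<in> comps ?S" "lifted_block x \<subseteq> cmp x" if "x \<in> ?X" for x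
    using theI'[OF ex[OF that]] unfolding cmp_def by blast+
  have cmp_iff: "lifted_block x \<subseteq> C \<longleftrightarrow> cmp x = C" if "x \<in> ?X" "C \<in> comps ?S" for x C
    using ex[OF that(1)] cmp[OF that(1)] that(2) by blast
  have live: "cmp x \<in> S.live" if "x \<in> ?X" for x
    using cmp[OF that] blk[OF that] unfolding S.live_def by blast
  have im: "cmp ` ?X = S.live"
  proof (intro equalityI subsetI)
    fix C assume C: "C \<in> S.live"
    then obtain b where b: "b \<in> ?S" "b \<subseteq> C" "card b = 2" "C \<in> comps ?S" unfolding S.live_def by blast
    from b(1) have "\<exists>x\<in>?X. lifted_block x = b"
    proof
      assume "b \<in> (`) fU ` d\<^sub>1"
      then obtain e where e: "e \<in> d\<^sub>1" "b = fU ` e" by blast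
      have "card e = 2"
        using b(3) e card_image[OF inj_on_subset[OF fU_inj partial_brauerD(7)[OF pb(1) e(1)]]] by simp
      then show ?thesis using e by (intro bexI[of _ "Inl e"]) (auto simp: edges_def)
    next
      assume "b \<in> (`) fL ` d\<^sub>2"
      then obtain e where e: "e \<in> d\<^sub>2" "b = fL ` e" by blast
      have "card e = 2"
        using b(3) e card_image[OF inj_on_subset[OF fL_inj partial_brauerD(7)[OF pb(2) e(1)]]] by simp
      then show ?thesis using e by (intro bexI[of _ "Inr e"]) (auto simp: edges_def)
    qed
    then obtain x where "x \<in> ?X" "lifted_block x = b" by blast
    then show "C \<in> cmp ` ?X" using cmp_iff[of x C] b by blast
  qed (use live in blast)
  have oe: "edges (diag_comp d\<^sub>1 d\<^sub>2) = ?o ` S.paths"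
    unfolding edges_def diag_comp_eq[OF pb] stacked_eq by (rule S.outs_edges)
  have finL: "finite S.live" unfolding im[symmetric] using finX by simp
  then have fin: "finite S.paths" "finite ?L" unfolding S.live_eq by simp_all
  \<comment> \<open>The coefficient as a function of the set \<open>H\<close> of broken components:
    broken paths are edges removed from the composite, and every loop outside \<open>H\<close> still
    gives a factor \<open>\<delta>\<close>.\<close>
  define G where "G d H = (if isolate (?o ` (H \<inter> S.paths)) (diag_comp d\<^sub>1 d\<^sub>2) = d then \<delta> [^] card (?L - H) else \<zero>)" for d H
  have G: "G d H \<in> carrier R" for d H using \<delta> by (simp add: G_def)
  have co: "coeff_at \<delta> d (isolate_pair d\<^sub>1 d\<^sub>2 W) = G d (cmp ` W)" if W: "W \<subseteq> ?X" for d W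
  proof -
    let ?E = "Inl -` W" and ?F = "Inr -` W"
    have EF: "?E \<subseteq> edges d\<^sub>1" "?F \<subseteq> edges d\<^sub>2" using W by auto
    have EF': "(`) fU ` ?E \<subseteq> {b \<in> (`) fU ` d\<^sub>1. card b = 2}" "(`) fL ` ?F \<subseteq> {b \<in> (`) fL ` d\<^sub>2. card b = 2}"
    proof -
      show "(`) fU ` ?E \<subseteq> {b \<in> (`) fU ` d\<^sub>1. card b = 2}"
      proof (rule image_subsetI)
        fix e assume "e \<in> ?E"
        then have "e \<in> edges d\<^sub>1" using EF(1) by (rule_tac subsetD)
        then show "fU ` e \<in> {b \<in> (`) fU ` d\<^sub>1. card b = 2}" unfolding mem_Collect_eq by (rule edges_fU[OF pb(1)])
      qed
      show "(`) fL ` ?F \<subseteq> {b \<in> (`) fL ` d\<^sub>2. card b = 2}"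
      proof (rule image_subsetI)
        fix e assume "e \<in> ?F"
        then have "e \<in> edges d\<^sub>2" using EF(2) by (rule_tac subsetD)
        then show "fL ` e \<in> {b \<in> (`) fL ` d\<^sub>2. card b = 2}" unfolding mem_Collect_eq by (rule edges_fL[OF pb(2)])
      qed
    qed
    have lb: "(`) fU ` ?E \<union> (`) fL ` ?F = lifted_block ` W"
    proof -
      have "lifted_block ` W = lifted_block ` (?E <+> ?F)" using Plus_vimage[of W] by simp
      also have "\<dots> = (`) fU ` ?E \<union> (`) fL ` ?F" by (simp only: Plus_def image_Un image_image lifted_block.simps)
      finally show ?thesis ..
    qed
    have H: "cmp ` W = {C \<in> S.live. \<exists>b\<in>(`) fU ` ?E \<union> (`) fL ` ?F. b \<subseteq> C}"
      unfolding lb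
    proof (intro equalityI subsetI)
      fix C assume "C \<in> cmp ` W"
      then obtain x where "x \<in> W" "C = cmp x" by blast
      then show "C \<in> {C \<in> S.live. \<exists>b\<in>lifted_block ` W. b \<subseteq> C}" using live[of x] cmp(2)[of x] W by blast
    next
      fix C assume "C \<in> {C \<in> S.live. \<exists>b\<in>lifted_block ` W. b \<subseteq> C}"
      then obtain x where "x \<in> W" "lifted_block x \<subseteq> C" "C \<in> comps ?S" unfolding S.live_def by blast
      then show "C \<in> cmp ` W" using cmp_iff[of x C] W by blast
    qed
    note ip = isolate_partial_brauer[OF pb(1) EF(1)] isolate_partial_brauer[OF pb(2) EF(2)]
    have "diag_comp (isolate ?E d\<^sub>1) (isolate ?F d\<^sub>2) = isolate (?o ` (cmp ` W \<inter> S.paths)) (diag_comp d\<^sub>1 d\<^sub>2)"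
      unfolding diag_comp_eq[OF ip] diag_comp_eq[OF pb] stacked_isolate[OF pb EF] stacked_eq[of d\<^sub>1 d\<^sub>2]
      by (rule S.outs_isolate_matched(1)[OF EF' H])
    moreover have "num_loops (isolate ?E d\<^sub>1) (isolate ?F d\<^sub>2) = card (?L - cmp ` W)"
      unfolding num_loops_eq[OF ip] stacked_isolate[OF pb EF] S.outs_isolate_matched(2)[OF EF' H] ..
    ultimately show ?thesis unfolding coeff_at_def isolate_pair_def G_def by simp
  qed
  fix e assume e: "e \<in> motzkin k"
  let ?b = "\<lambda>A. if isolate (?o ` A) (diag_comp d\<^sub>1 d\<^sub>2) = e then sgn_pow (card A) else \<zero>"
  have "(bar_elt R k d\<^sub>1 \<otimes>\<^bsub>motzkin_alg R \<delta> k\<^esub> bar_elt R k d\<^sub>2) e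
      = (\<Oplus>W\<in>Pow ?X. sgn_pow (card W) \<otimes> coeff_at \<delta> e (isolate_pair d\<^sub>1 d\<^sub>2 W))"
    by (rule bar_mult_expand[OF \<delta> d e])
  also have "\<dots> = (\<Oplus>W\<in>Pow ?X. sgn_pow (card W) \<otimes> G e (cmp ` W))"
    by (rule finsum_cong') (use co G in auto)
  also have "\<dots> = (\<Oplus>H\<in>Pow S.live. sgn_pow (card H) \<otimes> G e H)"
    unfolding im[symmetric] by (rule alternating_image[OF finX]) (rule G)
  \<comment> \<open>Broken paths \<open>A\<close> and broken loops \<open>B\<close> vary
    independently; the composite depends on \<open>A\<close> only and the power of
    \<open>\<delta>\<close> on \<open>B\<close> only.\<close>
  also have "\<dots> = (\<Oplus>A\<in>Pow S.paths. \<Oplus>B\<in>Pow ?L. sgn_pow (card (A \<union> B)) \<otimes> G e (A \<union> B))"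
    unfolding S.live_eq(1) by (rule finsum_Pow_disjoint[OF fin S.live_eq(2)]) (use G in auto)
  also have "\<dots> = (\<Oplus>A\<in>Pow S.paths. ?b A \<otimes> (\<delta> \<ominus> \<one>) [^] card ?L)"
  proof (rule finsum_cong')
    fix A assume A: "A \<in> Pow S.paths"
    have "(\<Oplus>B\<in>Pow ?L. sgn_pow (card (A \<union> B)) \<otimes> G e (A \<union> B)) = (\<Oplus>B\<in>Pow ?L. ?b A \<otimes> (sgn_pow (card B) \<otimes> \<delta> [^] card (?L - B)))"
    proof (rule finsum_cong')
      fix B assume B: "B \<in> Pow ?L"
      have dj: "A \<inter> B = {}" using A B S.live_eq(2) by blast
      have "finite A" "finite B" using A B fin finite_subset by blast+
      then have cd: "card (A \<union> B) = card A + card B" using dj by (simp add: card_Un_disjoint)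
      have s: "(A \<union> B) \<inter> S.paths = A" "?L - (A \<union> B) = ?L - B" using A B S.live_eq(2) by blast+
      show "sgn_pow (card (A \<union> B)) \<otimes> G e (A \<union> B) = ?b A \<otimes> (sgn_pow (card B) \<otimes> \<delta> [^] card (?L - B))"
        unfolding G_def s cd using \<delta> by (simp add: nat_pow_mult[symmetric] m_assoc)
    qed (use \<delta> in auto)
    also have "\<dots> = ?b A \<otimes> (\<Oplus>B\<in>Pow ?L. sgn_pow (card B) \<otimes> \<delta> [^] card (?L - B))"
      by (rule finsum_rdistr[symmetric]) (use fin \<delta> in auto)
    finally show "(\<Oplus>B\<in>Pow ?L. sgn_pow (card (A \<union> B)) \<otimes> G e (A \<union> B)) = ?b A \<otimes> (\<delta> \<ominus> \<one>) [^] card ?L"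
      by (simp only: alternating_binomial[OF fin(2) \<delta>])
  qed (use \<delta> in auto)
  also have "\<dots> = (\<Oplus>A\<in>Pow S.paths. ?b A) \<otimes> (\<delta> \<ominus> \<one>) [^] card ?L"
    by (rule finsum_ldistr[symmetric]) (use fin \<delta> in auto)
  also have "(\<Oplus>A\<in>Pow S.paths. ?b A) = bar_elt R k (diag_comp d\<^sub>1 d\<^sub>2) e"
    by (rule bar_elt_expand[OF c e fin(1) S.paths_inj oe[symmetric], symmetric])
  also have "card ?L = num_loops d\<^sub>1 d\<^sub>2" unfolding num_loops_eq[OF pb] stacked_eq ..
  finally show "(bar_elt R k d\<^sub>1 \<otimes>\<^bsub>motzkin_alg R \<delta> k\<^esub> bar_elt R k d\<^sub>2) e
    = ((\<delta> \<ominus> \<one>) [^] num_loops d\<^sub>1 d\<^sub>2 \<odot>\<^bsub>motzkin_alg R \<delta> k\<^esub> bar_elt R k (diag_comp d\<^sub>1 d\<^sub>2)) e"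
    using e \<delta> by (simp add: motzkin_alg_def diagram_alg_simps free_module_apply m_comm bar_elt_mem)
next
  show "bar_elt R k d\<^sub>1 \<otimes>\<^bsub>motzkin_alg R \<delta> k\<^esub> bar_elt R k d\<^sub>2 \<in> carrier (free_module R (motzkin k))"
    using diagram_alg_mult_closed[OF \<delta> finite_motzkin[of k]] bar_elt_carrier[of k]
    unfolding motzkin_alg_def diagram_alg_simps by blast
  show "(\<delta> \<ominus> \<one>) [^] num_loops d\<^sub>1 d\<^sub>2 \<odot>\<^bsub>motzkin_alg R \<delta> k\<^esub> bar_elt R k (diag_comp d\<^sub>1 d\<^sub>2) \<in> carrier (free_module R (motzkin k))"
    unfolding motzkin_alg_def diagram_alg_simps
    by (rule free_module_smult_closed[OF _ bar_elt_carrier]) (use \<delta> in simp)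
qed

end

section \<open>The ideal spanned by the barred diagrams with a fixed number of edges\<close>

locale planar_ideal = cring K for K :: "('a, 'c) ring_scheme" (structure) +
  fixes \<delta> :: 'a and k n :: nat
  assumes delta: "\<delta> \<in> carrier K" and nk: "n \<le> k"
begin

abbreviation "M \<equiv> motzkin_alg K \<delta> k"
abbreviation "B \<equiv> TL_alg K (\<delta> \<ominus> \<one>) n"
abbreviation "X \<equiv> X_alg K \<delta> k n"
abbreviation "m \<equiv> k choose n"
abbreviation "TD \<equiv> tl_diagrams n"

sublocale M: bilinear_alg K M
  unfolding motzkin_alg_def by (rule diagram_alg_bilinear[OF delta finite_motzkin])

sublocale B: unital_alg K B
  by (rule TL_unital) (use delta in simp)

sublocale MB: mat_alg_context K B m
  by unfold_locales

section \<open>Balanced diagrams as matrix units\<close>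

definition subset_family where "subset_family = {A. A \<subseteq> {1..k} \<and> card A = n}"

lemma card_subset_family: "card subset_family = m"
  unfolding subset_family_def using n_subsets[of "{1..k}" n] by simp

lemma finite_subset_family: "finite subset_family"
  unfolding subset_family_def by (rule finite_subset[of _ "Pow {1..k}"]) auto

text \<open>Any numbering of the \<open>n\<close>-subsets will do; a different one permutes the rows
  and columns of all matrices simultaneously.\<close>

definition enum where "enum = (SOME s. bij_betw s {..<m} subset_family)"

lemma enum_bij: "bij_betw enum {..<m} subset_family"
proof -
  have "\<exists>s. bij_betw s {..<m} subset_family"
    using ex_bij_betw_nat_finite[OF finite_subset_family] by (simp add: card_subset_family atLeast0LessThan)
  then show ?thesis unfolding enum_def by (rule someI_ex)
qed

definition enum_map where "enum_map i = (SOME a. incr n k a \<and> a ` {1..n} = enum i)"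

lemma enum_map: "i < m \<Longrightarrow> incr n k (enum_map i)" "i < m \<Longrightarrow> enum_map i ` {1..n} = enum i"
proof -
  assume "i < m"
  then have "enum i \<in> subset_family" using enum_bij by (auto simp: bij_betw_def)
  then have "\<exists>a. incr n k a \<and> a ` {1..n} = enum i" by (intro ex_incr) (auto simp: subset_family_def)
  then have "incr n k (enum_map i) \<and> enum_map i ` {1..n} = enum i" unfolding enum_map_def by (rule someI_ex)
  then show "incr n k (enum_map i)" "enum_map i ` {1..n} = enum i" by auto
qed

lemma enum_eq_iff: "\<lbrakk>i < m; j < m\<rbrakk> \<Longrightarrow> enum i = enum j \<longleftrightarrow> i = j"
  using enum_bij by (auto simp: bij_betw_def inj_on_def)

text \<open>The diagram in row \<open>i\<close> and column \<open>j\<close> with planar matching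
  \<open>t\<close>: the row numbers the matched upper positions, the column the matched lower
  ones.\<close>

definition unit_diagram where "unit_diagram i j t = spread k n (enum_map i) (enum_map j) t"

lemma unit_diagram_balanced: "\<lbrakk>i < m; j < m; t \<in> TD\<rbrakk> \<Longrightarrow> unit_diagram i j t \<in> balanced_edges k n"
  unfolding unit_diagram_def by (intro spread_balanced_edges enum_map)

lemma unit_diagram_motzkin: "\<lbrakk>i < m; j < m; t \<in> TD\<rbrakk> \<Longrightarrow> unit_diagram i j t \<in> motzkin k"
  using unit_diagram_balanced by (auto simp: balanced_edges_def balanced_def)

lemma unit_diagram_tops: "\<lbrakk>i < m; j < m; t \<in> TD\<rbrakk> \<Longrightarrow> tops (unit_diagram i j t) = enum i"
  and unit_diagram_bots: "\<lbrakk>i < m; j < m; t \<in> TD\<rbrakk> \<Longrightarrow> bots (unit_diagram i j t) = enum j"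
  unfolding unit_diagram_def by (simp_all only: tops_spread bots_spread enum_map)

lemma unit_diagram_inj:
  assumes "i < m" "j < m" "t \<in> TD" "i' < m" "j' < m" "t' \<in> TD" "unit_diagram i j t = unit_diagram i' j' t'"
  shows "i = i' \<and> j = j' \<and> t = t'"
proof -
  have "i = i'" using unit_diagram_tops[OF assms(1-3)] unit_diagram_tops[OF assms(4-6)] assms(1,4,7) by (simp add: enum_eq_iff)
  moreover have "j = j'" using unit_diagram_bots[OF assms(1-3)] unit_diagram_bots[OF assms(4-6)] assms(2,5,7) by (simp add: enum_eq_iff)
  moreover have "edges t = t" "edges t' = t'" using tl_card assms(3,6) by (auto simp: edges_def)
  ultimately show ?thesis
    using assms spread_inj[OF enum_map(1)[OF assms(1)] enum_map(1)[OF assms(2)] tl_partial_brauer[OF assms(3)] tl_partial_brauer[OF assms(6)]]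
    by (simp add: unit_diagram_def)
qed

lemma unit_diagram_surj:
  assumes "d \<in> balanced_edges k n"
  shows "\<exists>i<m. \<exists>j<m. \<exists>t\<in>TD. d = unit_diagram i j t"
proof -
  have d: "d \<in> motzkin k" "card (tops d) = n" "card (bots d) = n" using assms by (auto simp: balanced_edges_iff)
  then have pb: "d \<in> partial_brauer k" by (simp add: motzkin_def)
  have "tops d \<subseteq> {1..k}" "bots d \<subseteq> {1..k}"
    using partial_brauerD(7)[OF pb] by (fastforce simp: tops_def bots_def edges_def)+
  then have "tops d \<in> enum ` {..<m}" "bots d \<in> enum ` {..<m}"
    using d enum_bij by (auto simp: bij_betw_def subset_family_def)
  then obtain i j where ij: "i < m" "j < m" "tops d = enum i" "bots d = enum j" by auto
  then have "\<exists>t\<in>TD. spread k n (enum_map i) (enum_map j) t = d"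
    by (intro spread_surj enum_map assms) (simp_all only: enum_map)
  then show ?thesis using ij unfolding unit_diagram_def by blast
qed

lemma unit_diagram_mult:
  assumes "i < m" "j < m" "l < m" "t \<in> TD" "s \<in> TD"
  shows "diag_comp (unit_diagram i j t) (unit_diagram j l s) = unit_diagram i l (diag_comp t s)" "num_loops (unit_diagram i j t) (unit_diagram j l s) = num_loops t s"
  using spread_comp[OF enum_map(1)[OF assms(1)] enum_map(1)[OF assms(2)] enum_map(1)[OF assms(3)] tl_partial_brauer[OF assms(4)] tl_partial_brauer[OF assms(5)]]
  by (simp_all add: unit_diagram_def)

definition unit_bar where "unit_bar i j t = bar_elt K k (unit_diagram i j t)"

lemma unit_bar_carrier: "unit_bar i j t \<in> carrier M"
  unfolding unit_bar_def motzkin_alg_def diagram_alg_simps by (rule bar_elt_carrier)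

lemma unit_bar_mult:
  assumes "i < m" "j < m" "j' < m" "l < m" "t \<in> TD" "s \<in> TD"
  shows "unit_bar i j t \<otimes>\<^bsub>M\<^esub> unit_bar j' l s
    = (if j = j' then (\<delta> \<ominus> \<one>) [^] num_loops t s \<odot>\<^bsub>M\<^esub> unit_bar i l (diag_comp t s) else \<zero>\<^bsub>M\<^esub>)"
proof (cases "j = j'")
  case True
  have "bots (unit_diagram i j t) = tops (unit_diagram j l s)" using assms True by (simp add: unit_diagram_tops unit_diagram_bots)
  moreover have "diag_comp (unit_diagram i j t) (unit_diagram j l s) \<in> motzkin k"
    using assms True unit_diagram_mult(1) unit_diagram_motzkin tl_diag_comp by simp
  ultimately show ?thesis
    using bar_mult_matched[OF delta unit_diagram_motzkin[OF assms(1,2,5)] unit_diagram_motzkin[OF assms(2,4,6)]] True assms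
    by (simp add: unit_bar_def unit_diagram_mult)
next
  case False
  then have "bots (unit_diagram i j t) \<noteq> tops (unit_diagram j' l s)" using assms by (simp add: unit_diagram_tops unit_diagram_bots enum_eq_iff)
  then show ?thesis
    using bar_mult_unmatched[OF delta unit_diagram_motzkin[OF assms(1,2,5)] unit_diagram_motzkin[OF assms(3,4,6)]] False
    by (simp add: unit_bar_def)
qed

text \<open>Removing edges lowers their number, so among the diagrams with exactly \<open>n\<close>
  edges only the leading one occurs in a barred diagram. This triangularity makes the barred
  diagrams linearly independent.\<close>

lemma unit_bar_coeff:
  assumes "i < m" "j < m" "t \<in> TD" "i' < m" "j' < m" "t' \<in> TD"
  shows "unit_bar i j t (unit_diagram i' j' t') = (if i = i' \<and> j = j' \<and> t = t' then \<one> else \<zero>)"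
proof (cases "below (unit_diagram i' j' t') (unit_diagram i j t)")
  case True
  have pb: "unit_diagram i j t \<in> partial_brauer k" using unit_diagram_motzkin[OF assms(1-3)] by (simp add: motzkin_def)
  obtain E where E: "E \<subseteq> edges (unit_diagram i j t)" "unit_diagram i' j' t' = isolate E (unit_diagram i j t)" using True by (auto simp: below_isolate)
  have n: "card (edges (unit_diagram i j t)) = n" "card (edges (isolate E (unit_diagram i j t))) = n"
    using unit_diagram_balanced[OF assms(1-3)] unit_diagram_balanced[OF assms(4-6)] unfolding E(2) by (auto simp: balanced_edges_def)
  have fin: "finite (edges (unit_diagram i j t))" using partial_brauerD(4)[OF pb] by (simp add: edges_def)
  then have fE: "finite E" using E(1) finite_subset by blast
  have "n - card E = n" using n card_Diff_subset[OF fE E(1)] unfolding edges_isolate[OF pb E(1)] by simp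
  moreover have "card E \<le> n" using card_mono[OF fin E(1)] n by simp
  ultimately have "card E = 0" by linarith
  then have "E = {}" using fE by simp
  then have "unit_diagram i' j' t' = unit_diagram i j t" using E(2) by simp
  moreover from this have "i = i' \<and> j = j' \<and> t = t'" using unit_diagram_inj assms by metis
  ultimately show ?thesis
    using bar_elt_isolate[OF unit_diagram_motzkin[OF assms(1-3)], of "{}"] by (simp add: unit_bar_def)
next
  case False
  moreover have "below (unit_diagram i j t) (unit_diagram i j t)" by (auto simp: below_isolate intro: exI[of _ "{}"])
  ultimately have "\<not> (i = i' \<and> j = j' \<and> t = t')" by blast
  then show ?thesis using bar_elt_not_below[OF False unit_diagram_motzkin[OF assms(4-6)]] by (auto simp: unit_bar_def)
qed

section \<open>The isomorphism with matrices over the Temperley-Lieb algebra\<close>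

abbreviation "QQ \<equiv> ({..<m} \<times> {..<m}) \<times> TD"

text \<open>The target is the whole Motzkin algebra, where the module laws and the distributive laws
  are at hand; \<open>X_carrier_eq\<close> identifies the image with the ideal.\<close>

definition mat_to_ideal where "mat_to_ideal f = (\<Oplus>\<^bsub>M\<^esub>q\<in>QQ. f (fst q) (snd q) \<odot>\<^bsub>M\<^esub> unit_bar (fst (fst q)) (snd (fst q)) (snd q))"

lemma finQQ: "finite QQ"
  by (simp add: finite_tl_diagrams)

lemma coeff_mem: "\<lbrakk>f \<in> carrier MB.Mt; q \<in> QQ\<rbrakk> \<Longrightarrow> f (fst q) (snd q) \<in> carrier K"
proof -
  assume "f \<in> carrier MB.Mt" "q \<in> QQ"
  then have "f (fst q) \<in> carrier B" by (auto simp: MB.mat_mem)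
  then show ?thesis using \<open>q \<in> QQ\<close> by (auto simp: TL_alg_def diagram_alg_simps free_module_mem)
qed

lemma mat_to_ideal_terms: "f \<in> carrier MB.Mt \<Longrightarrow>
    (\<lambda>q. f (fst q) (snd q) \<odot>\<^bsub>M\<^esub> unit_bar (fst (fst q)) (snd (fst q)) (snd q)) \<in> QQ \<rightarrow> carrier M"
  using coeff_mem unit_bar_carrier by blast

lemma B_apply: "t \<in> TD \<Longrightarrow> (x \<oplus>\<^bsub>B\<^esub> y) t = x t \<oplus> y t" "t \<in> TD \<Longrightarrow> (c \<odot>\<^bsub>B\<^esub> x) t = c \<otimes> x t"
  "t \<in> TD \<Longrightarrow> \<zero>\<^bsub>B\<^esub> t = \<zero>"
  by (simp_all add: TL_alg_def diagram_alg_simps free_module_apply)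

lemma mat_to_ideal_hom: "abelian_group_hom MB.Mt M mat_to_ideal"
proof (rule add_homI)
  fix f g assume fg: "f \<in> carrier MB.Mt" "g \<in> carrier MB.Mt"
  have "mat_to_ideal (f \<oplus>\<^bsub>MB.Mt\<^esub> g) = (\<Oplus>\<^bsub>M\<^esub>q\<in>QQ. f (fst q) (snd q) \<odot>\<^bsub>M\<^esub> unit_bar (fst (fst q)) (snd (fst q)) (snd q)
      \<oplus>\<^bsub>M\<^esub> g (fst q) (snd q) \<odot>\<^bsub>M\<^esub> unit_bar (fst (fst q)) (snd (fst q)) (snd q))"
    unfolding mat_to_ideal_def
  proof (rule M.M.finsum_cong')
    fix q assume q: "q \<in> QQ"
    have "(f \<oplus>\<^bsub>MB.Mt\<^esub> g) (fst q) (snd q) = f (fst q) (snd q) \<oplus> g (fst q) (snd q)"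
      using q by (auto simp: mat_alg_apply B_apply)
    then show "(f \<oplus>\<^bsub>MB.Mt\<^esub> g) (fst q) (snd q) \<odot>\<^bsub>M\<^esub> unit_bar (fst (fst q)) (snd (fst q)) (snd q)
      = f (fst q) (snd q) \<odot>\<^bsub>M\<^esub> unit_bar (fst (fst q)) (snd (fst q)) (snd q)
      \<oplus>\<^bsub>M\<^esub> g (fst q) (snd q) \<odot>\<^bsub>M\<^esub> unit_bar (fst (fst q)) (snd (fst q)) (snd q)"
      using coeff_mem[OF fg(1) q] coeff_mem[OF fg(2) q] unit_bar_carrier by (simp add: M.smult_l_distr)
  qed (use mat_to_ideal_terms[OF fg(1)] mat_to_ideal_terms[OF fg(2)] in auto)
  also have "\<dots> = mat_to_ideal f \<oplus>\<^bsub>M\<^esub> mat_to_ideal g"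
    unfolding mat_to_ideal_def using mat_to_ideal_terms[OF fg(1)] mat_to_ideal_terms[OF fg(2)] by (rule M.M.finsum_addf)
  finally show "mat_to_ideal (f \<oplus>\<^bsub>MB.Mt\<^esub> g) = mat_to_ideal f \<oplus>\<^bsub>M\<^esub> mat_to_ideal g" .
next
  fix f assume "f \<in> carrier MB.Mt"
  then show "mat_to_ideal f \<in> carrier M" unfolding mat_to_ideal_def by (intro M.M.finsum_closed mat_to_ideal_terms)
qed (rule MB.mat_abelian_group M.M.abelian_group_axioms)+

lemma mat_to_ideal_smult:
  assumes "c \<in> carrier K" "f \<in> carrier MB.Mt"
  shows "mat_to_ideal (c \<odot>\<^bsub>MB.Mt\<^esub> f) = c \<odot>\<^bsub>M\<^esub> mat_to_ideal f"
proof -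
  have "mat_to_ideal (c \<odot>\<^bsub>MB.Mt\<^esub> f) = (\<Oplus>\<^bsub>M\<^esub>q\<in>QQ. c \<odot>\<^bsub>M\<^esub> (f (fst q) (snd q) \<odot>\<^bsub>M\<^esub> unit_bar (fst (fst q)) (snd (fst q)) (snd q)))"
    unfolding mat_to_ideal_def
  proof (rule M.M.finsum_cong')
    fix q assume q: "q \<in> QQ"
    have "(c \<odot>\<^bsub>MB.Mt\<^esub> f) (fst q) (snd q) = c \<otimes> f (fst q) (snd q)"
      using q by (auto simp: mat_alg_apply B_apply)
    then show "(c \<odot>\<^bsub>MB.Mt\<^esub> f) (fst q) (snd q) \<odot>\<^bsub>M\<^esub> unit_bar (fst (fst q)) (snd (fst q)) (snd q)
      = c \<odot>\<^bsub>M\<^esub> (f (fst q) (snd q) \<odot>\<^bsub>M\<^esub> unit_bar (fst (fst q)) (snd (fst q)) (snd q))"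
      using coeff_mem[OF assms(2) q] unit_bar_carrier assms(1) by (simp add: M.smult_assoc1)
  qed (use mat_to_ideal_terms[OF assms(2)] assms(1) in auto)
  also have "\<dots> = c \<odot>\<^bsub>M\<^esub> mat_to_ideal f"
    unfolding mat_to_ideal_def using mat_to_ideal_terms[OF assms(2)] assms(1) by (intro M.finsum_smult_ldistr[symmetric] finQQ)
  finally show ?thesis .
qed

definition gen where "gen i j c t = MB.single i j (c \<odot>\<^bsub>B\<^esub> basis_elt K TD t)"

lemma basis_B: "basis_elt K TD t \<in> carrier B"
  by (simp add: TL_alg_def diagram_alg_simps basis_elt_carrier)

lemma gen_closed: "c \<in> carrier K \<Longrightarrow> gen i j c t \<in> carrier MB.Mt"
  unfolding gen_def by (intro MB.single_closed B.smult_closed basis_B)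

lemma mat_to_ideal_gen:
  assumes "i < m" "j < m" "t \<in> TD" "c \<in> carrier K"
  shows "mat_to_ideal (gen i j c t) = c \<odot>\<^bsub>M\<^esub> unit_bar i j t"
proof -
  let ?f = "gen i j c t"
  let ?g = "\<lambda>q. ?f (fst q) (snd q) \<odot>\<^bsub>M\<^esub> unit_bar (fst (fst q)) (snd (fst q)) (snd q)"
  have v: "?f (fst q) (snd q) = (if q = ((i, j), t) then c else \<zero>)" if q: "q \<in> QQ" for q
  proof -
    obtain i' j' t' where q': "q = ((i', j'), t')" by (metis surj_pair)
    then show ?thesis using q assms
      by (auto simp: gen_def MB.single_apply B_apply free_module_apply)
  qed
  have "mat_to_ideal ?f = ?g ((i, j), t)"
    unfolding mat_to_ideal_def
  proof (rule M.M.finsum_single[OF finQQ])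
    show q: "((i, j), t) \<in> QQ" using assms by simp
    show "?g ((i, j), t) \<in> carrier M" using mat_to_ideal_terms[OF gen_closed[OF assms(4)]] q by blast
    fix q assume "q \<in> QQ" "q \<noteq> ((i, j), t)"
    then show "?g q = \<zero>\<^bsub>M\<^esub>" using v unit_bar_carrier by (simp add: M.smult_l_null)
  qed
  then show ?thesis using v[of "((i, j), t)"] assms by simp
qed

lemma gens: "f \<in> carrier MB.Mt \<Longrightarrow> f \<in> add_span MB.Mt {gen i j c t | i j c t. i < m \<and> j < m \<and> c \<in> carrier K \<and> t \<in> TD}"
proof -
  assume f: "f \<in> carrier MB.Mt"
  let ?G = "{c \<odot>\<^bsub>B\<^esub> basis_elt K TD t | c t. c \<in> carrier K \<and> t \<in> TD}"
  have "x \<in> add_span B ?G" if "x \<in> carrier B" for x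
  proof -
    have "x \<in> carrier (free_module K TD)" using that by (simp add: TL_alg_def diagram_alg_simps)
    from add_span_cong[OF free_module_add_span[OF this], of B] show ?thesis
      by (simp add: TL_alg_def diagram_alg_simps)
  qed
  moreover have "?G \<subseteq> carrier B" using basis_B by auto
  ultimately have "f \<in> add_span MB.Mt {MB.single i j x | i j x. i < m \<and> j < m \<and> x \<in> ?G}"
    by (rule MB.mat_add_span[OF _ _ f])
  moreover have "{MB.single i j x | i j x. i < m \<and> j < m \<and> x \<in> ?G} = {gen i j c t | i j c t. i < m \<and> j < m \<and> c \<in> carrier K \<and> t \<in> TD}"
    unfolding gen_def by blast
  ultimately show ?thesis by simp
qed

text \<open>On generators both sides carry the factor \<open>\<delta> \<ominus> \<one>\<close> once
  for each loop: on the left it is the parameter of the Temperley-Lieb algebra, on the right it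
  comes from the product of barred diagrams.\<close>

lemma mat_to_ideal_mult:
  assumes "f \<in> carrier MB.Mt" "g \<in> carrier MB.Mt"
  shows "mat_to_ideal (f \<otimes>\<^bsub>MB.Mt\<^esub> g) = mat_to_ideal f \<otimes>\<^bsub>M\<^esub> mat_to_ideal g"
proof (rule mult_hom_on_gens[OF _ M.biadditive_ring mat_to_ideal_hom _ _ gens[OF assms(1)] gens[OF assms(2)]])
  show "biadditive_ring MB.Mt" by (rule bilinear_alg.biadditive_ring[OF MB.mat_bilinear_alg])
  show "{gen i j c t | i j c t. i < m \<and> j < m \<and> c \<in> carrier K \<and> t \<in> TD} \<subseteq> carrier MB.Mt" using gen_closed by blast
  fix x y assume "x \<in> {gen i j c t | i j c t. i < m \<and> j < m \<and> c \<in> carrier K \<and> t \<in> TD}"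
    "y \<in> {gen i j c t | i j c t. i < m \<and> j < m \<and> c \<in> carrier K \<and> t \<in> TD}"
  then obtain i j c t j' l c' s where x: "x = gen i j c t" "i < m" "j < m" "c \<in> carrier K" "t \<in> TD"
    and y: "y = gen j' l c' s" "j' < m" "l < m" "c' \<in> carrier K" "s \<in> TD" by blast
  let ?d = "\<delta> \<ominus> \<one>" and ?N = "num_loops t s"
  have d: "?d \<in> carrier K" using delta by simp
  have ts: "diag_comp t s \<in> TD" using tl_diag_comp x(5) y(5) .
  have bm: "basis_elt K TD t \<otimes>\<^bsub>B\<^esub> basis_elt K TD s = ?d [^] ?N \<odot>\<^bsub>B\<^esub> basis_elt K TD (diag_comp t s)"
    unfolding TL_alg_def by (rule diagram_alg_basis_mult[OF d finite_tl_diagrams x(5) y(5) ts])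
  have "(c \<odot>\<^bsub>B\<^esub> basis_elt K TD t) \<otimes>\<^bsub>B\<^esub> (c' \<odot>\<^bsub>B\<^esub> basis_elt K TD s)
      = (c' \<otimes> (c \<otimes> ?d [^] ?N)) \<odot>\<^bsub>B\<^esub> basis_elt K TD (diag_comp t s)"
    using x y d basis_B by (simp add: B.alg_smult_left B.alg_smult_right bm B.smult_assoc1)
  then have "x \<otimes>\<^bsub>MB.Mt\<^esub> y = (if j = j' then gen i l (c' \<otimes> (c \<otimes> ?d [^] ?N)) (diag_comp t s) else \<zero>\<^bsub>MB.Mt\<^esub>)"
    unfolding x(1) y(1) gen_def using x y basis_B by (simp add: MB.single_mult)
  then have "mat_to_ideal (x \<otimes>\<^bsub>MB.Mt\<^esub> y) = (if j = j' then (c' \<otimes> (c \<otimes> ?d [^] ?N)) \<odot>\<^bsub>M\<^esub> unit_bar i l (diag_comp t s) else \<zero>\<^bsub>M\<^esub>)"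
    using x y d ts abelian_group_hom.hom_zero[OF mat_to_ideal_hom] by (simp add: mat_to_ideal_gen)
  also have "\<dots> = (c \<odot>\<^bsub>M\<^esub> unit_bar i j t) \<otimes>\<^bsub>M\<^esub> (c' \<odot>\<^bsub>M\<^esub> unit_bar j' l s)"
    using x y d unit_bar_carrier by (simp add: M.alg_smult_left M.alg_smult_right M.alg_mult_closed unit_bar_mult M.smult_assoc1)
  finally show "mat_to_ideal (x \<otimes>\<^bsub>MB.Mt\<^esub> y) = mat_to_ideal x \<otimes>\<^bsub>M\<^esub> mat_to_ideal y"
    using x y by (simp add: mat_to_ideal_gen)
qed

text \<open>By \<open>unit_bar_coeff\<close> only one summand has a nonzero coefficient at a given
  unit diagram. The entries of the matrix can thus be read off from its image, which gives
  injectivity.\<close>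

lemma mat_to_ideal_coeff:
  assumes f: "f \<in> carrier MB.Mt" and i: "i < m" "j < m" "t \<in> TD"
  shows "mat_to_ideal f (unit_diagram i j t) = f (i, j) t"
proof -
  have q: "((i, j), t) \<in> QQ" using i by simp
  let ?g = "\<lambda>q. f (fst q) (snd q) \<odot>\<^bsub>M\<^esub> unit_bar (fst (fst q)) (snd (fst q)) (snd q)"
  have M: "carrier M = carrier (free_module K (motzkin k))" "finsum M = finsum (free_module K (motzkin k))"
    "smult M = smult (free_module K (motzkin k))"
    by (simp_all add: motzkin_alg_def diagram_alg_simps finsum_def fun_eq_iff)
  have d: "unit_diagram i j t \<in> motzkin k" by (rule unit_diagram_motzkin[OF i])
  have e: "?g q (unit_diagram i j t) = (if q = ((i, j), t) then f (i, j) t else \<zero>)" if "q \<in> QQ" for q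
  proof -
    obtain i' j' t' where q': "q = ((i', j'), t')" by (metis surj_pair)
    then show ?thesis using that coeff_mem[OF f that] d i
      by (auto simp: M free_module_apply unit_bar_coeff)
  qed
  have "mat_to_ideal f (unit_diagram i j t) = (\<Oplus>q\<in>QQ. ?g q (unit_diagram i j t))"
    unfolding mat_to_ideal_def M(2) using mat_to_ideal_terms[OF f] unfolding M(1) by (rule free_module_finsum_apply[OF d])
  also have "\<dots> = ?g ((i, j), t) (unit_diagram i j t)"
    by (rule finsum_single[OF finQQ q]) (use e coeff_mem[OF f q] q in auto)
  finally show ?thesis using e[OF q] by simp
qed

lemma mat_to_ideal_inj: "inj_on mat_to_ideal (carrier MB.Mt)"
proof (rule inj_onI)
  fix f g assume fg: "f \<in> carrier MB.Mt" "g \<in> carrier MB.Mt" "mat_to_ideal f = mat_to_ideal g"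
  show "f = g"
  proof (rule mat_alg_eqI[OF fg(1,2)])
    fix i j assume ij: "i < m" "j < m"
    have "f (i, j) t = g (i, j) t" if "t \<in> TD" for t
      using mat_to_ideal_coeff[OF fg(1) ij that] mat_to_ideal_coeff[OF fg(2) ij that] fg(3) by simp
    moreover have "f (i, j) \<in> carrier (free_module K TD)" "g (i, j) \<in> carrier (free_module K TD)"
      using MB.mat_mem[OF fg(1) ij] MB.mat_mem[OF fg(2) ij] by (simp_all add: TL_alg_def diagram_alg_simps)
    ultimately show "f (i, j) = g (i, j)" by (intro free_module_eqI[of _ K TD])
  qed
qed

lemma mat_to_ideal_image_smult:
  assumes "c \<in> carrier K" "x \<in> mat_to_ideal ` carrier MB.Mt" shows "c \<odot>\<^bsub>M\<^esub> x \<in> mat_to_ideal ` carrier MB.Mt"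
proof -
  obtain f where f: "f \<in> carrier MB.Mt" "x = mat_to_ideal f" using assms(2) by blast
  have "mat_to_ideal (c \<odot>\<^bsub>MB.Mt\<^esub> f) \<in> mat_to_ideal ` carrier MB.Mt" by (rule imageI) (rule MB.mat_closed(3)[OF assms(1) f(1)])
  then show ?thesis unfolding mat_to_ideal_smult[OF assms(1) f(1)] f(2) .
qed

lemma mat_to_ideal_image_mult:
  assumes "x \<in> mat_to_ideal ` carrier MB.Mt" "y \<in> mat_to_ideal ` carrier MB.Mt" shows "x \<otimes>\<^bsub>M\<^esub> y \<in> mat_to_ideal ` carrier MB.Mt"
proof -
  obtain f g where f: "f \<in> carrier MB.Mt" "x = mat_to_ideal f" "g \<in> carrier MB.Mt" "y = mat_to_ideal g" using assms by blast
  have "mat_to_ideal (f \<otimes>\<^bsub>MB.Mt\<^esub> g) \<in> mat_to_ideal ` carrier MB.Mt" by (rule imageI) (rule MB.mat_mult_closed[OF f(1,3)])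
  then show ?thesis unfolding mat_to_ideal_mult[OF f(1,3)] f(2,4) .
qed

lemma mat_to_ideal_image_add:
  assumes "x \<in> mat_to_ideal ` carrier MB.Mt" "y \<in> mat_to_ideal ` carrier MB.Mt" shows "x \<oplus>\<^bsub>M\<^esub> y \<in> mat_to_ideal ` carrier MB.Mt"
proof -
  obtain f g where f: "f \<in> carrier MB.Mt" "x = mat_to_ideal f" "g \<in> carrier MB.Mt" "y = mat_to_ideal g" using assms by blast
  have "mat_to_ideal (f \<oplus>\<^bsub>MB.Mt\<^esub> g) \<in> mat_to_ideal ` carrier MB.Mt" by (rule imageI) (rule MB.mat_closed(2)[OF f(1,3)])
  then show ?thesis unfolding abelian_group_hom.hom_add[OF mat_to_ideal_hom f(1,3)] f(2,4) .
qed

text \<open>The image is a submodule and contains every barred diagram of the spanning set.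
  Conversely, matrices are sums of generators \<open>gen\<close>, and each of these is sent to a
  multiple of such a barred diagram.\<close>

lemma X_carrier_eq: "X_carrier K \<delta> k n = mat_to_ideal ` carrier MB.Mt"
proof
  interpret h: abelian_group_hom MB.Mt M mat_to_ideal by (rule mat_to_ideal_hom)
  have "submodule (mat_to_ideal ` carrier MB.Mt) K M"
  proof (rule M.submoduleI)
    show "mat_to_ideal ` carrier MB.Mt \<subseteq> carrier M" by auto
    show "\<zero>\<^bsub>M\<^esub> \<in> mat_to_ideal ` carrier MB.Mt" using imageI[OF MB.mat_closed(1), of mat_to_ideal] by simp
    show "\<ominus>\<^bsub>M\<^esub> a \<in> mat_to_ideal ` carrier MB.Mt" if a: "a \<in> mat_to_ideal ` carrier MB.Mt" for a
    proof -
      obtain f where f: "f \<in> carrier MB.Mt" "a = mat_to_ideal f" using a by blast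
      have "mat_to_ideal (\<ominus>\<^bsub>MB.Mt\<^esub> f) \<in> mat_to_ideal ` carrier MB.Mt" by (rule imageI) (rule MB.Mt.a_inv_closed[OF f(1)])
      then show ?thesis using f by simp
    qed
    show "a \<oplus>\<^bsub>M\<^esub> b \<in> mat_to_ideal ` carrier MB.Mt" if "a \<in> mat_to_ideal ` carrier MB.Mt" "b \<in> mat_to_ideal ` carrier MB.Mt" for a b
      using that by (rule mat_to_ideal_image_add)
    show "c \<odot>\<^bsub>M\<^esub> x \<in> mat_to_ideal ` carrier MB.Mt" if "c \<in> carrier K" "x \<in> mat_to_ideal ` carrier MB.Mt" for c x
      using that by (rule mat_to_ideal_image_smult)
  qed
  moreover have "bar_elt K k ` balanced_edges k n \<subseteq> mat_to_ideal ` carrier MB.Mt"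
  proof
    fix x assume "x \<in> bar_elt K k ` balanced_edges k n"
    then obtain d where d: "d \<in> balanced_edges k n" "x = bar_elt K k d" by blast
    obtain i j t where ijt: "i < m" "j < m" "t \<in> TD" "d = unit_diagram i j t" using unit_diagram_surj[OF d(1)] by blast
    then have "x = mat_to_ideal (gen i j \<one> t)" using d unit_bar_carrier by (simp add: mat_to_ideal_gen unit_bar_def[symmetric])
    then show "x \<in> mat_to_ideal ` carrier MB.Mt" using gen_closed by blast
  qed
  ultimately show "X_carrier K \<delta> k n \<subseteq> mat_to_ideal ` carrier MB.Mt"
    unfolding X_carrier_def by (rule span_in_least)
  show "mat_to_ideal ` carrier MB.Mt \<subseteq> X_carrier K \<delta> k n"
  proof
    fix x assume "x \<in> mat_to_ideal ` carrier MB.Mt"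
    then obtain f where f: "f \<in> carrier MB.Mt" "x = mat_to_ideal f" by blast
    have sub: "bar_elt K k ` balanced_edges k n \<subseteq> carrier M"
      using bar_elt_carrier by (auto simp: motzkin_alg_def diagram_alg_simps)
    have H: "submodule (X_carrier K \<delta> k n) K M"
      unfolding X_carrier_def by (rule span_in_submodule[OF M.module_axioms sub])
    have bX: "bar_elt K k ` balanced_edges k n \<subseteq> X_carrier K \<delta> k n"
      unfolding X_carrier_def by (rule span_in_subset)
    show "x \<in> X_carrier K \<delta> k n" unfolding f(2)
      using gens[OF f(1)]
    proof (induction rule: add_span.induct)
      case add_span_zero
      show ?case unfolding h.hom_zero
        using subgroup.one_closed[OF submodule.axioms(1)[OF H]] by simp
    next
      case (add_span_gen y)
      then obtain i j c t where y: "y = gen i j c t" "i < m" "j < m" "c \<in> carrier K" "t \<in> TD" by blast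
      have "unit_bar i j t \<in> X_carrier K \<delta> k n" using bX unit_diagram_balanced[OF y(2,3,5)] unfolding unit_bar_def by blast
      then show ?case using y M.submoduleE(4)[OF H] by (simp add: mat_to_ideal_gen)
    next
      case (add_span_add y z)
      have "{gen i j c t | i j c t. i < m \<and> j < m \<and> c \<in> carrier K \<and> t \<in> TD} \<subseteq> carrier MB.Mt" using gen_closed by blast
      note c = MB.Mt.add_span_carrier[OF this]
      show ?case using add_span_add M.submoduleE(5)[OF H] c by simp
    qed
  qed
qed

lemma X_simps: "carrier X = mat_to_ideal ` carrier MB.Mt" "add X = add M" "\<zero>\<^bsub>X\<^esub> = \<zero>\<^bsub>M\<^esub>" "smult X = smult M"
  "monoid.mult X = monoid.mult M"
  by (simp_all add: X_alg_def PTL_alg_def X_carrier_eq)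

sublocale MU: unital_alg K MB.Mt
  by (rule MB.mat_unital_alg) (rule B.unital_alg_axioms)

text \<open>The identity of the ideal is given by a definite description. The image of the identity
  matrix satisfies it, and a two-sided identity is unique.\<close>

lemma X_one: "\<one>\<^bsub>X\<^esub> = mat_to_ideal \<one>\<^bsub>MB.Mt\<^esub>"
proof -
  let ?P = "\<lambda>u. u \<in> mat_to_ideal ` carrier MB.Mt \<and> (\<forall>x\<in>mat_to_ideal ` carrier MB.Mt. u \<otimes>\<^bsub>M\<^esub> x = x \<and> x \<otimes>\<^bsub>M\<^esub> u = x)"
  have P: "?P (mat_to_ideal \<one>\<^bsub>MB.Mt\<^esub>)"
    using MU.alg_one_closed by (auto simp: mat_to_ideal_mult[symmetric] MU.alg_l_one MU.alg_r_one)
  have "\<one>\<^bsub>X\<^esub> = (THE u. ?P u)" by (simp add: X_alg_def PTL_alg_def X_carrier_eq)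
  also have "\<dots> = mat_to_ideal \<one>\<^bsub>MB.Mt\<^esub>"
  proof (rule the_equality[where P="?P", OF P])
    fix u assume u: "?P u"
    have "u = u \<otimes>\<^bsub>M\<^esub> mat_to_ideal \<one>\<^bsub>MB.Mt\<^esub>" using P u by metis
    also have "\<dots> = mat_to_ideal \<one>\<^bsub>MB.Mt\<^esub>" using P u by metis
    finally show "u = mat_to_ideal \<one>\<^bsub>MB.Mt\<^esub>" .
  qed
  finally show ?thesis .
qed

lemma mat_to_ideal_iso: "mat_to_ideal \<in> alg_iso K MB.Mt X"
  using mat_to_ideal_mult abelian_group_hom.hom_add[OF mat_to_ideal_hom] mat_to_ideal_smult mat_to_ideal_inj
  by (auto simp: alg_iso_def ring_iso_def ring_hom_def X_simps X_one bij_betw_def)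

lemma mat_to_ideal_inv_iso: "inv_into (carrier MB.Mt) mat_to_ideal \<in> alg_iso K X MB.Mt"
  by (rule alg_iso_inv[OF mat_to_ideal_iso])
    (auto simp: MB.mat_mult_closed MB.mat_closed MU.alg_one_closed)

lemma X_biadditive: "biadditive_ring X"
proof -
  interpret h: abelian_group_hom MB.Mt M mat_to_ideal by (rule mat_to_ideal_hom)
  have "abelian_group X"
  proof (rule abelian_groupI)
    fix x assume "x \<in> carrier X"
    then obtain f where f: "f \<in> carrier MB.Mt" "x = mat_to_ideal f" by (auto simp: X_simps)
    have "mat_to_ideal (\<ominus>\<^bsub>MB.Mt\<^esub> f) \<in> carrier X"
      unfolding X_simps by (rule imageI) (rule MB.Mt.a_inv_closed[OF f(1)])
    moreover have "mat_to_ideal (\<ominus>\<^bsub>MB.Mt\<^esub> f) \<oplus>\<^bsub>X\<^esub> x = \<zero>\<^bsub>X\<^esub>"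
      using f by (simp add: X_simps M.l_neg)
    ultimately show "\<exists>y\<in>carrier X. y \<oplus>\<^bsub>X\<^esub> x = \<zero>\<^bsub>X\<^esub>" by blast
  next
    show "\<zero>\<^bsub>X\<^esub> \<in> carrier X" unfolding X_simps using imageI[OF MB.mat_closed(1), of mat_to_ideal] by simp
  next
    fix x y assume "x \<in> carrier X" "y \<in> carrier X"
    then show "x \<oplus>\<^bsub>X\<^esub> y \<in> carrier X" unfolding X_simps by (rule mat_to_ideal_image_add)
  qed (auto simp: X_simps M.a_ac)
  moreover have "x \<otimes>\<^bsub>X\<^esub> y \<in> carrier X" if "x \<in> carrier X" "y \<in> carrier X" for x y
    using that unfolding X_simps by (rule mat_to_ideal_image_mult)
  ultimately show ?thesis
    by (intro biadditive_ring.intro biadditive_ring_axioms.intro)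
      (auto simp: X_simps M.alg_l_distr M.alg_r_distr)
qed

lemma X_smult_closed: "\<lbrakk>c \<in> carrier K; x \<in> carrier X\<rbrakk> \<Longrightarrow> c \<odot>\<^bsub>X\<^esub> x \<in> carrier X"
  unfolding X_simps by (rule mat_to_ideal_image_smult)

lemma X_one_closed: "\<one>\<^bsub>X\<^esub> \<in> carrier X"
  unfolding X_one X_simps using MU.alg_one_closed by blast

section \<open>Tensor decompositions and modules\<close>

lemma matrix_tensor_iso: "alg_isomorphic K MB.Mt (tensor_alg K (mat_alg m (self_alg K)) B)"
proof -
  interpret E: mat_units_tensor K "mat_alg m (self_alg K)" m
    "\<lambda>p. mat_context.single (self_alg K) m (fst p) (snd p) \<one>" "\<lambda>f p. f p" B
    by (intro mat_units_tensor.intro scalar_mat_units B.unital_alg_axioms)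
  show ?thesis using E.mat_to_tensor_iso by (auto simp: alg_isomorphic_def)
qed

text \<open>The coordinate of a function on subsets is its value at the subset with the given
  number, so \<open>Q_module\<close> is numbered in the same way as the rows and columns of the
  matrices.\<close>

lemma Q_basis: "end_basis K (Q_module K k n) m (\<lambda>i. basis_elt K subset_family (enum i)) (\<lambda>f i. f (enum i))"
proof -
  have Q: "Q_module K k n = free_module K subset_family" by (simp add: Q_module_def subset_family_def)
  have en: "enum i \<in> subset_family" if "i < m" for i using that enum_bij by (auto simp: bij_betw_def)
  interpret Q: module K "free_module K subset_family" by (rule free_module_module)
  show ?thesis
    unfolding Q
  proof (intro end_basis.intro end_context.intro fin_basis.intro fin_basis_axioms.intro free_module_module)
    fix f assume f: "f \<in> carrier (free_module K subset_family)"
    have "f = (\<Oplus>\<^bsub>free_module K subset_family\<^esub>s\<in>enum ` {..<m}. f s \<odot>\<^bsub>free_module K subset_family\<^esub> basis_elt K subset_family s)"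
      using enum_bij finite_subset_family by (intro free_module_expand[OF f]) (auto simp: bij_betw_def)
    also have "\<dots> = (\<Oplus>\<^bsub>free_module K subset_family\<^esub>i\<in>{..<m}. f (enum i) \<odot>\<^bsub>free_module K subset_family\<^esub> basis_elt K subset_family (enum i))"
      using enum_bij f en
      by (intro Q.M.finsum_reindex) (auto simp: bij_betw_def intro!: Q.smult_closed basis_elt_carrier free_module_mem[OF f])
    finally show "(\<Oplus>\<^bsub>free_module K subset_family\<^esub>i\<in>{..<m}. f (enum i) \<odot>\<^bsub>free_module K subset_family\<^esub> basis_elt K subset_family (enum i)) = f" ..
  qed (use en in \<open>auto simp: basis_elt_carrier free_module_mem free_module_apply enum_eq_iff\<close>)
qed

lemma end_tensor_iso: "\<exists>\<phi>. \<phi> \<in> alg_iso K MB.Mt (tensor_alg K (end_alg K (Q_module K k n)) B)"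
proof -
  interpret Q: end_basis K "Q_module K k n" m "\<lambda>i. basis_elt K subset_family (enum i)" "\<lambda>f i. f (enum i)"
    by (rule Q_basis)
  interpret E: mat_units_tensor K Q.EQ m Q.unit Q.entry B
    by (intro mat_units_tensor.intro Q.end_mat_units B.unital_alg_axioms)
  show ?thesis using E.mat_to_tensor_iso by blast
qed

lemma module_tensor:
  fixes V :: "(diagram \<Rightarrow> 'a, 'm) module"
  assumes \<phi>: "\<phi> \<in> alg_iso K X (tensor_alg K (end_alg K (Q_module K k n)) B)"
    and V: "left_module X V"
  shows "\<exists>N :: (diagram \<Rightarrow> 'a, 'm) module. left_module B N \<and> left_module_isomorphic X V (tensor_left_module K (Q_module K k n) B N \<phi>)"
proof -
  \<comment> \<open>The hypothesis \<open>nk\<close> makes the binomial coefficient positive, so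
    that there is a corner with index 0.\<close>
  interpret W: module_over_tensor K "Q_module K k n" m "\<lambda>i. basis_elt K subset_family (enum i)" "\<lambda>f i. f (enum i)"
    B X V \<phi>
    by (intro module_over_tensor.intro module_over_tensor_axioms.intro Q_basis B.unital_alg_axioms
        X_biadditive V \<phi> X_one_closed X_smult_closed) (use nk in simp)
  show ?thesis using W.N_left_module W.V_iso_tensor by blast
qed

end

theorem theorem4p2:
  fixes K :: "('a, 'c) ring_scheme" and \<delta> :: 'a and k n :: nat
  assumes "cring K" and "\<delta> \<in> carrier K" and "n \<le> k"
  shows
    "alg_isomorphic K (X_alg K \<delta> k n)
       (mat_alg (k choose n) (TL_alg K (\<delta> \<ominus>\<^bsub>K\<^esub> \<one>\<^bsub>K\<^esub>) n)) \<and>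
     alg_isomorphic K (mat_alg (k choose n) (TL_alg K (\<delta> \<ominus>\<^bsub>K\<^esub> \<one>\<^bsub>K\<^esub>) n))
       (tensor_alg K (mat_alg (k choose n) (self_alg K)) (TL_alg K (\<delta> \<ominus>\<^bsub>K\<^esub> \<one>\<^bsub>K\<^esub>) n)) \<and>
     alg_isomorphic K (X_alg K \<delta> k n)
       (tensor_alg K (end_alg K (Q_module K k n)) (TL_alg K (\<delta> \<ominus>\<^bsub>K\<^esub> \<one>\<^bsub>K\<^esub>) n)) \<and>
     (\<forall>\<phi> \<in> alg_iso K (X_alg K \<delta> k n)
             (tensor_alg K (end_alg K (Q_module K k n)) (TL_alg K (\<delta> \<ominus>\<^bsub>K\<^esub> \<one>\<^bsub>K\<^esub>) n)).
       \<forall>V :: (diagram \<Rightarrow> 'a, 'm) module. left_module (X_alg K \<delta> k n) V \<longrightarrow>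
         (\<exists>N :: (diagram \<Rightarrow> 'a, 'm) module.
            left_module (TL_alg K (\<delta> \<ominus>\<^bsub>K\<^esub> \<one>\<^bsub>K\<^esub>) n) N \<and>
            left_module_isomorphic (X_alg K \<delta> k n) V
              (tensor_left_module K (Q_module K k n) (TL_alg K (\<delta> \<ominus>\<^bsub>K\<^esub> \<one>\<^bsub>K\<^esub>) n) N \<phi>)))"
proof -
  interpret P: planar_ideal K \<delta> k n
    by (intro planar_ideal.intro planar_ideal_axioms.intro assms)
  obtain \<phi> where \<phi>: "\<phi> \<in> alg_iso K P.MB.Mt (tensor_alg K (end_alg K (Q_module K k n)) P.B)"
    using P.end_tensor_iso by blast
  have "alg_isomorphic K P.X P.MB.Mt" using P.mat_to_ideal_inv_iso by (auto simp: alg_isomorphic_def)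
  \<comment> \<open>This also shows that the quantification over isomorphisms in the module
    statement is not vacuous.\<close>
  moreover have "alg_isomorphic K P.X (tensor_alg K (end_alg K (Q_module K k n)) P.B)"
    using alg_iso_trans[OF P.mat_to_ideal_inv_iso \<phi>] by (auto simp: alg_isomorphic_def)
  ultimately show ?thesis using P.matrix_tensor_iso P.module_tensor by blast
qed

end
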